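(* For every $\alpha>0$ there is a sequence of split tori $L_i\subset X_\alpha$ which are mutually Hamiltonian isotopic, $L_i\cong L_j$ for all $i,j$, and which converge in the $C^\infty$-topology to a split torus $L\subset X_\alpha$ with $L\not\cong L_i$.
   Context: Let $\omega_{S^2}$ be an area form on $S^2$ of total area $1$. For $\alpha>0$ let $X_\alpha=(S^2\times S^2,\omega_\alpha)$ with $\omega_\alpha=2(\alpha+1)\omega_{S^2}\oplus 2\alpha\,\omega_{S^2}$. In $S^2(a)=(S^2,a\omega_{S^2})$, for $h\in(-\frac a2,\frac a2)$, $S^1_h$ denotes the circle of constant height such that the annulus bounded by the equator and $S^1_h$ has signed symplectic area $h$. A split torus is $T(x,y)=S^1_x\times S^1_y\subset X_\alpha$ with $(x,y)\in(-1-\alpha,1+\alpha)\times(-\alpha,\alpha)$. $L\cong L'$ means that $\phi(L)=L'$ for some $\phi\in\mathrm{Ham}(X_\alpha)$; $L\not\cong L'$ means that no such $\phi$ exists. *)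

theory Defs
  imports "HOL-Analysis.Analysis"
begin

section \<open>Smoothness\<close>

primrec iterated_derivative ::
  "'a list \<Rightarrow> ('a::euclidean_space \<Rightarrow> 'b::real_normed_vector) \<Rightarrow> 'a \<Rightarrow> 'b" where
  "iterated_derivative [] f = f"
| "iterated_derivative (v # vs) f =
     iterated_derivative vs (\<lambda>x. frechet_derivative f (at x) v)"

(* Only meaningful for open U. Differentiability of every iterated partial derivative makes
   all of them continuous, so this is the class C^infinity. *)
definition smooth_on_open ::
  "'a::euclidean_space set \<Rightarrow> ('a \<Rightarrow> 'b::real_normed_vector) \<Rightarrow> bool" where
  "smooth_on_open U f \<longleftrightarrow>
     (\<forall>vs. set vs \<subseteq> Basis \<longrightarrow> (\<forall>x\<in>U. iterated_derivative vs f differentiable (at x)))"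

definition smooth_on_submanifold ::
  "'a::euclidean_space set \<Rightarrow> ('a \<Rightarrow> 'b::real_normed_vector) \<Rightarrow> bool" where
  "smooth_on_submanifold M f \<longleftrightarrow>
     (\<exists>U g. open U \<and> M \<subseteq> U \<and> smooth_on_open U g \<and> (\<forall>x\<in>M. g x = f x))"

section \<open>The sphere and its area forms\<close>

type_synonym 'a two_form = "'a \<Rightarrow> 'a \<Rightarrow> 'a \<Rightarrow> real"

abbreviation S2 :: "(real^3) set" where
  "S2 \<equiv> sphere 0 1"

definition tangent_S2 :: "real^3 \<Rightarrow> (real^3) set" where
  "tangent_S2 p = {v. p \<bullet> v = 0}"

(* A 2-form on the sphere is represented by alternating forms on the ambient 3-space along the
   sphere. Every 2-form on the sphere has such an extension, for instance its pullback under
   orthogonal projection to the tangent planes, and only its restriction to tangent vectors is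
   used below. *)
definition area_form :: "(real^3) two_form \<Rightarrow> bool" where
  "area_form \<omega> \<longleftrightarrow>
     (\<forall>p\<in>S2. bilinear (\<omega> p) \<and> (\<forall>u. \<omega> p u u = 0)) \<and>
     (\<forall>u v. smooth_on_submanifold S2 (\<lambda>p. \<omega> p u v)) \<and>
     (\<forall>p\<in>S2. \<forall>u\<in>tangent_S2 p. u \<noteq> 0 \<longrightarrow> (\<exists>v\<in>tangent_S2 p. \<omega> p u v \<noteq> 0))"

definition scale_form :: "real \<Rightarrow> 'a two_form \<Rightarrow> 'a two_form" where
  "scale_form a \<omega> = (\<lambda>p u v. a * \<omega> p u v)"

definition geographic :: "real \<Rightarrow> real \<Rightarrow> real^3" where
  "geographic lat lon = vector [cos lat * cos lon, cos lat * sin lon, sin lat]"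

(* The integral of the form over the zone between two latitudes. The zone is oriented by
   (longitude, latitude), i.e. by the outward normal, and the interval integral changes sign
   when its bounds are exchanged. *)
definition zone_area :: "(real^3) two_form \<Rightarrow> real \<Rightarrow> real \<Rightarrow> real" where
  "zone_area \<omega> lat0 lat1 =
     (LBINT lat=ereal lat0..ereal lat1. (LBINT lon=ereal 0..ereal (2 * pi).
        \<omega> (geographic lat lon)
          (vector_derivative (\<lambda>s. geographic lat s) (at lon))
          (vector_derivative (\<lambda>s. geographic s lon) (at lat))))"

definition total_area :: "(real^3) two_form \<Rightarrow> real" where
  "total_area \<omega> = zone_area \<omega> (- (pi / 2)) (pi / 2)"

definition northern_area :: "(real^3) two_form \<Rightarrow> real" where
  "northern_area \<omega> = zone_area \<omega> 0 (pi / 2)"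

(* The signed area of the annulus between the equator and a parallel is strictly increasing in
   the latitude (for positive forms), so the set below is a single circle of constant height. *)
definition height_circle :: "(real^3) two_form \<Rightarrow> real \<Rightarrow> (real^3) set" where
  "height_circle \<omega> h = {p \<in> S2. zone_area \<omega> 0 (arcsin (p $ 3)) = h}"

section \<open>The symplectic manifold and its Hamiltonian diffeomorphisms\<close>

type_synonym point = "(real^3) \<times> (real^3)"

abbreviation S2xS2 :: "point set" where
  "S2xS2 \<equiv> S2 \<times> S2"

definition tangent_S2xS2 :: "point \<Rightarrow> point set" where
  "tangent_S2xS2 x = tangent_S2 (fst x) \<times> tangent_S2 (snd x)"

definition sum_form ::
  "'a two_form \<Rightarrow> 'b two_form \<Rightarrow> ('a \<times> 'b) two_form" where
  "sum_form \<sigma> \<tau> =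
     (\<lambda>x u v. \<sigma> (fst x) (fst u) (fst v) + \<tau> (snd x) (snd u) (snd v))"

definition symplectic_form :: "(real^3) two_form \<Rightarrow> real \<Rightarrow> point two_form" where
  "symplectic_form \<omega> \<alpha> =
     sum_form (scale_form (2 * (\<alpha> + 1)) \<omega>) (scale_form (2 * \<alpha>) \<omega>)"

(* X is the Hamiltonian vector of F at x. Replacing dF by -dF (the other sign convention)
   replaces every Hamiltonian by its negative and gives the same diffeomorphisms. *)
definition hamiltonian_vector ::
  "point two_form \<Rightarrow> (point \<Rightarrow> real) \<Rightarrow> point \<Rightarrow> point \<Rightarrow> bool" where
  "hamiltonian_vector \<Omega> F x X \<longleftrightarrow>
     X \<in> tangent_S2xS2 x \<and>
     (\<forall>v\<in>tangent_S2xS2 x. \<Omega> x X v = frechet_derivative F (at x) v)"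

(* Smooth Hamiltonians on [0,1] x S2 x S2 are given by smooth functions on a neighbourhood;
   the Hamiltonian vectors depend only on the restriction. *)
definition hamiltonian_flow ::
  "point two_form \<Rightarrow> (real \<times> point \<Rightarrow> real) \<Rightarrow> (real \<Rightarrow> point \<Rightarrow> point) \<Rightarrow> bool" where
  "hamiltonian_flow \<Omega> H \<Phi> \<longleftrightarrow>
     (\<exists>U. open U \<and> {0..1} \<times> S2xS2 \<subseteq> U \<and> smooth_on_open U H) \<and>
     (\<forall>x\<in>S2xS2. \<Phi> 0 x = x) \<and>
     (\<forall>t\<in>{0..1}. \<forall>x\<in>S2xS2. \<Phi> t x \<in> S2xS2 \<and>
        (\<exists>X. hamiltonian_vector \<Omega> (\<lambda>y. H (t, y)) (\<Phi> t x) X \<and>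
             ((\<lambda>s. \<Phi> s x) has_vector_derivative X) (at t within {0..1})))"

(* Elements of Ham are total functions of which only the values on S2 x S2 matter. *)
definition Ham :: "point two_form \<Rightarrow> (point \<Rightarrow> point) set" where
  "Ham \<Omega> = {\<phi>. \<exists>H \<Phi>. hamiltonian_flow \<Omega> H \<Phi> \<and> (\<forall>x\<in>S2xS2. \<phi> x = \<Phi> 1 x)}"

definition ham_equivalent :: "point two_form \<Rightarrow> point set \<Rightarrow> point set \<Rightarrow> bool" where
  "ham_equivalent \<Omega> L L' \<longleftrightarrow> (\<exists>\<phi>\<in>Ham \<Omega>. \<phi> ` L = L')"

section \<open>Split tori and their convergence\<close>

definition split_torus :: "(real^3) two_form \<Rightarrow> real \<Rightarrow> real \<Rightarrow> real \<Rightarrow> point set" where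
  "split_torus \<omega> \<alpha> x y =
     height_circle (scale_form (2 * (\<alpha> + 1)) \<omega>) x \<times>
     height_circle (scale_form (2 * \<alpha>) \<omega>) y"

definition is_split_torus :: "(real^3) two_form \<Rightarrow> real \<Rightarrow> point set \<Rightarrow> bool" where
  "is_split_torus \<omega> \<alpha> L \<longleftrightarrow>
     (\<exists>x\<in>{- 1 - \<alpha><..<1 + \<alpha>}. \<exists>y\<in>{- \<alpha><..<\<alpha>}. L = split_torus \<omega> \<alpha> x y)"

(* A smooth embedding of the 2-torus R^2/Z^2 with image L, lifted to R^2. The second conjunct
   says both that f is Z^2-periodic and that the induced map on the torus is injective. *)
definition torus_embedding :: "(real \<times> real \<Rightarrow> point) \<Rightarrow> point set \<Rightarrow> bool" where
  "torus_embedding f L \<longleftrightarrow>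
     smooth_on_open UNIV f \<and>
     (\<forall>s t s' t'. f (s, t) = f (s', t') \<longleftrightarrow> s - s' \<in> \<int> \<and> t - t' \<in> \<int>) \<and>
     (\<forall>z. inj (frechet_derivative f (at z))) \<and>
     range f = L"

(* Convergence of embedded tori in the C^infinity-topology: for suitable parametrisations all
   partial derivatives converge uniformly. *)
definition tori_converge_smoothly :: "(nat \<Rightarrow> point set) \<Rightarrow> point set \<Rightarrow> bool" where
  "tori_converge_smoothly Ls L \<longleftrightarrow>
     (\<exists>f g. (\<forall>i. torus_embedding (f i) (Ls i)) \<and> torus_embedding g L \<and>
        (\<forall>vs. set vs \<subseteq> Basis \<longrightarrow>
           uniform_limit UNIV (\<lambda>i. iterated_derivative vs (f i))
             (iterated_derivative vs g) sequentially))"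

end

theory Submission
  imports Defs
begin

text \<open>
  After an area preserving change of coordinates on the sphere, taking circles of constant height
  to circles of latitude, both factors are round. Half rotations of the factors, a shear
  \<open>T(u, w) \<cong> T(u - 2w, -w)\<close> for \<open>\<bar>u - w\<bar> < 1\<close> and a corner move \<open>T(u, w) \<cong> T(1 - w, 1 - u)\<close> for
  \<open>u - w > 1\<close> compose, for \<open>0 < y < \<alpha>\<close>, to the moves \<open>u \<mapsto> -u\<close>, \<open>u \<mapsto> u - 2y\<close> for \<open>\<bar>u - y\<bar> < 1\<close> and
  \<open>u \<mapsto> 2 - u\<close> for \<open>\<bar>u - 1\<bar> < y\<close> on the tori \<open>T(u, y)\<close>. If \<open>y\<close> is irrational, the orbit of \<open>1\<close>
  is dense in \<open>\<bar>u - 1\<bar> < y\<close>, so every \<open>x\<close> in this range is a limit of heights \<open>X\<^sub>i\<close> in \<open>\<int> + \<int>y\<close> with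
  mutually equivalent tori \<open>T(X\<^sub>i, y)\<close>. On the other hand, a Hamiltonian diffeomorphism preserves,
  modulo the areas of the two spheres, the group of areas of discs bounded by loops on the torus; hence
  \<open>T(x, y) \<cong> T(X\<^sub>i, y)\<close> forces \<open>x \<in> \<int> + \<int>\<alpha> + \<int>y\<close>, which excludes only countably many \<open>x\<close>.
\<close>

section \<open>Calculus of smooth functions\<close>

text \<open>Disc areas are never computed as integrals, since the image of a loop under a flow comes
  with no disc. They are read off from inscribed N-gons: the product of the phases of Hermitian
  products of spinors over consecutive vertices is a discrete holonomy, and for a circle of latitude
  it tends to the exponential of half the enclosed solid angle. Along a flow this phase changes by a
  sum over edges in which the Hamiltonian telescopes, up to an error of order 1/N. The areas of the
  two factors have no common unit, so their phases cannot be merged into one point of the circle;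
  real lifts x and y are kept, and only \<open>c1 * x + c2 * y\<close> is small. Bounded integers
  and a limit in N turn this into an exact relation.

  The other obstacle is that the area form is arbitrary while explicit flows need rotational
  symmetry. The change of coordinates is explicit: heights are corrected by area, longitudes by the
  density along each parallel. The work lies in the poles, where both corrections look
  singular.\<close>

primrec ksmooth_on ::
  "nat \<Rightarrow> 'a::euclidean_space set \<Rightarrow> ('a \<Rightarrow> 'b::real_normed_vector) \<Rightarrow> bool" where
  "ksmooth_on 0 U f \<longleftrightarrow> (\<forall>x\<in>U. f differentiable (at x))"
| "ksmooth_on (Suc n) U f \<longleftrightarrow> (\<forall>x\<in>U. f differentiable (at x)) \<and>
     (\<forall>b\<in>Basis. ksmooth_on n U (\<lambda>x. frechet_derivative f (at x) b))"

lemma ksmooth_on_imp_differentiable: "ksmooth_on n U f \<Longrightarrow> x \<in> U \<Longrightarrow> f differentiable (at x)"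
  by (cases n) auto

text \<open>Bounding the order makes smoothness accessible to induction on n: the derivative of a
  product or composite is built from functions smooth to order n, whereas a fixed list of directions
  is not stable under the product rule.\<close>

lemma ksmooth_on_iff_iterated:
  "ksmooth_on n U f \<longleftrightarrow>
     (\<forall>vs. length vs \<le> n \<longrightarrow> set vs \<subseteq> Basis \<longrightarrow> (\<forall>x\<in>U. iterated_derivative vs f differentiable (at x)))"
proof (induction n arbitrary: f)
  case 0
  then show ?case by simp
next
  case (Suc n)
  show ?case (is "?L = ?R")
  proof
    assume L: ?L
    show ?R
    proof (intro allI impI)
      fix vs :: "'a list" assume vs: "length vs \<le> Suc n" "set vs \<subseteq> Basis"
      show "\<forall>x\<in>U. iterated_derivative vs f differentiable (at x)"
        using L vs Suc.IH by (cases vs) auto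
    qed
  next
    assume R: ?R
    have "\<forall>x\<in>U. f differentiable (at x)" using R[rule_format, of "[]"] by simp
    moreover have "ksmooth_on n U (\<lambda>x. frechet_derivative f (at x) b)" if "b \<in> Basis" for b
      unfolding Suc.IH
    proof (intro allI impI)
      fix vs :: "'a list" assume vs: "length vs \<le> n" "set vs \<subseteq> Basis"
      show "\<forall>x\<in>U. iterated_derivative vs (\<lambda>x. frechet_derivative f (at x) b) differentiable (at x)"
        using R[rule_format, of "b # vs"] vs that by simp
    qed
    ultimately show ?L by simp
  qed
qed

lemma smooth_on_open_iff_ksmooth: "smooth_on_open U f \<longleftrightarrow> (\<forall>n. ksmooth_on n U f)"
  unfolding smooth_on_open_def ksmooth_on_iff_iterated by blast

lemma smooth_on_openD: "smooth_on_open U f \<Longrightarrow> ksmooth_on n U f"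
  by (simp add: smooth_on_open_iff_ksmooth)

lemma smooth_on_open_imp_differentiable:
  "smooth_on_open U f \<Longrightarrow> x \<in> U \<Longrightarrow> f differentiable (at x)"
  by (meson ksmooth_on_imp_differentiable smooth_on_openD)

lemma smooth_on_open_imp_continuous_on: "smooth_on_open U f \<Longrightarrow> continuous_on U f"
  by (meson continuous_at_imp_continuous_on differentiable_imp_continuous_within
      smooth_on_open_imp_differentiable)

lemma smooth_on_open_derivative:
  "smooth_on_open U f \<Longrightarrow> b \<in> Basis \<Longrightarrow> smooth_on_open U (\<lambda>x. frechet_derivative f (at x) b)"
  unfolding smooth_on_open_iff_ksmooth by (metis ksmooth_on.simps(2))

lemma smooth_on_open_subset: "smooth_on_open U f \<Longrightarrow> V \<subseteq> U \<Longrightarrow> smooth_on_open V f"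
  unfolding smooth_on_open_def by blast

lemma frechet_derivative_cong_open:
  assumes "open U" "x \<in> U" "\<And>y. y \<in> U \<Longrightarrow> f y = g y"
  shows "frechet_derivative f (at x) = frechet_derivative g (at x)"
proof -
  have "(f has_derivative D) (at x) = (g has_derivative D) (at x)" for D
    using has_derivative_transform_within_open[of f D x UNIV U g]
      has_derivative_transform_within_open[of g D x UNIV U f] assms by auto
  then show ?thesis unfolding frechet_derivative_def by simp
qed

lemma differentiable_cong_open:
  assumes "open U" "x \<in> U" "\<And>y. y \<in> U \<Longrightarrow> f y = g y" "f differentiable (at x)"
  shows "g differentiable (at x)"
  using assms unfolding differentiable_def by (blast intro: has_derivative_transform_within_open)

lemma ksmooth_on_cong:
  assumes "open U" "\<And>x. x \<in> U \<Longrightarrow> f x = g x" "ksmooth_on n U f"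
  shows "ksmooth_on n U g"
  using assms(2,3)
proof (induction n arbitrary: f g)
  case 0
  then show ?case using assms(1) differentiable_cong_open[of U _ f g] by auto
next
  case (Suc n)
  have "ksmooth_on n U (\<lambda>x. frechet_derivative g (at x) b)" if b: "b \<in> Basis" for b
  proof (rule Suc.IH[of "\<lambda>x. frechet_derivative f (at x) b"])
    show "frechet_derivative f (at x) b = frechet_derivative g (at x) b" if "x \<in> U" for x
      using frechet_derivative_cong_open[of U x f g] assms(1) that Suc.prems by simp
    show "ksmooth_on n U (\<lambda>x. frechet_derivative f (at x) b)" using Suc.prems b by simp
  qed
  moreover have "g differentiable (at x)" if "x \<in> U" for x
    using differentiable_cong_open[OF assms(1) that, of f g] Suc.prems that by simp
  ultimately show ?case by simp
qed

lemma smooth_on_open_cong: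
  assumes "open U" "\<And>x. x \<in> U \<Longrightarrow> f x = g x" "smooth_on_open U f"
  shows "smooth_on_open U g"
  using ksmooth_on_cong[OF assms(1), of f g] assms(2,3) unfolding smooth_on_open_iff_ksmooth by blast

lemma smooth_on_open_Un: "smooth_on_open U f \<Longrightarrow> smooth_on_open V f \<Longrightarrow> smooth_on_open (U \<union> V) f"
  unfolding smooth_on_open_def by blast

lemma ksmooth_on_mono: "ksmooth_on n U f \<Longrightarrow> m \<le> n \<Longrightarrow> ksmooth_on m U f"
  unfolding ksmooth_on_iff_iterated using le_trans by blast

text \<open>Lets an explicit formula for the derivative on U stand in for
  \<open>frechet_derivative\<close>; openness of U carries the replacement over to all further
  derivatives.\<close>

lemma ksmooth_on_SucI:
  assumes "open U" "\<And>x. x \<in> U \<Longrightarrow> (f has_derivative f' x) (at x)"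
    and "\<And>b. b \<in> Basis \<Longrightarrow> ksmooth_on n U (\<lambda>x. f' x b)"
  shows "ksmooth_on (Suc n) U f"
proof -
  have "ksmooth_on n U (\<lambda>x. frechet_derivative f (at x) b)" if "b \<in> Basis" for b
  proof (rule ksmooth_on_cong[OF assms(1) _ assms(3)[OF that]])
    fix x assume x: "x \<in> U"
    show "f' x b = frechet_derivative f (at x) b"
      using frechet_derivative_at[OF assms(2)[OF x]] by simp
  qed
  moreover have "f differentiable (at x)" if "x \<in> U" for x
    using assms(2)[OF that] unfolding differentiable_def by blast
  ultimately show ?thesis by simp
qed

lemma ksmooth_on_has_derivative:
  "ksmooth_on n U f \<Longrightarrow> x \<in> U \<Longrightarrow> (f has_derivative frechet_derivative f (at x)) (at x)"
  by (meson frechet_derivative_works ksmooth_on_imp_differentiable)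

lemma smooth_on_open_has_derivative:
  "smooth_on_open U f \<Longrightarrow> x \<in> U \<Longrightarrow> (f has_derivative frechet_derivative f (at x)) (at x)"
  by (meson ksmooth_on_has_derivative smooth_on_openD)

section \<open>Closure properties of smooth functions\<close>

lemma ksmooth_on_const: "ksmooth_on n U (\<lambda>x. c)"
  by (induction n arbitrary: c) auto

lemma ksmooth_on_bounded_linear:
  assumes "bounded_linear L" and "open U" shows "ksmooth_on n U L"
proof (cases n)
  case 0
  then show ?thesis using assms bounded_linear_imp_differentiable by auto
next
  case (Suc m)
  then show ?thesis
    using ksmooth_on_SucI[of U L "\<lambda>_. L"] assms bounded_linear_imp_has_derivative ksmooth_on_const
    by metis
qed

lemma ksmooth_on_linear_compose:
  assumes L: "bounded_linear L" and U: "open U" and f: "ksmooth_on n U f"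
  shows "ksmooth_on n U (\<lambda>x. L (f x))"
  using f
proof (induction n arbitrary: f)
  case 0
  then show ?case
    using L bounded_linear_imp_differentiable differentiable_chain_at[of f _ L]
    by (fastforce simp: o_def)
next
  case (Suc n)
  show ?case
  proof (rule ksmooth_on_SucI[OF U])
    show "((\<lambda>x. L (f x)) has_derivative (\<lambda>v. L (frechet_derivative f (at x) v))) (at x)" if "x \<in> U" for x
      using bounded_linear.has_derivative[OF L ksmooth_on_has_derivative[OF Suc.prems that]] .
    show "ksmooth_on n U (\<lambda>x. L (frechet_derivative f (at x) b))" if "b \<in> Basis" for b
      using Suc that by auto
  qed
qed

lemma ksmooth_on_add:
  assumes U: "open U" and "ksmooth_on n U f" "ksmooth_on n U g"
  shows "ksmooth_on n U (\<lambda>x. f x + g x)"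
  using assms(2-)
proof (induction n arbitrary: f g)
  case 0
  then show ?case by auto
next
  case (Suc n)
  show ?case
  proof (rule ksmooth_on_SucI[OF U])
    show "((\<lambda>x. f x + g x) has_derivative
        (\<lambda>v. frechet_derivative f (at x) v + frechet_derivative g (at x) v)) (at x)" if "x \<in> U" for x
      using Suc.prems that by (intro has_derivative_add ksmooth_on_has_derivative)
    show "ksmooth_on n U (\<lambda>x. frechet_derivative f (at x) b + frechet_derivative g (at x) b)"
      if "b \<in> Basis" for b
      using Suc that by auto
  qed
qed

lemma ksmooth_on_sum:
  assumes "open U" and "\<And>i. i \<in> I \<Longrightarrow> ksmooth_on n U (f i)"
  shows "ksmooth_on n U (\<lambda>x. \<Sum>i\<in>I. f i x)"
  using assms(2)
  by (induction I rule: infinite_finite_induct) (auto intro: ksmooth_on_const ksmooth_on_add assms(1))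

lemma ksmooth_on_bilinear:
  assumes P: "bounded_bilinear P" and U: "open U" and "ksmooth_on n U f" "ksmooth_on n U g"
  shows "ksmooth_on n U (\<lambda>x. P (f x) (g x))"
  using assms(3-)
proof (induction n arbitrary: f g)
  case 0
  then show ?case
    using bounded_bilinear.FDERIV[OF P] unfolding ksmooth_on.simps differentiable_def by blast
next
  case (Suc n)
  show ?case
  proof (rule ksmooth_on_SucI[OF U])
    show "((\<lambda>x. P (f x) (g x)) has_derivative
        (\<lambda>v. P (f x) (frechet_derivative g (at x) v) + P (frechet_derivative f (at x) v) (g x))) (at x)"
      if "x \<in> U" for x
      using Suc.prems that by (intro bounded_bilinear.FDERIV[OF P] ksmooth_on_has_derivative)
    show "ksmooth_on n U (\<lambda>x. P (f x) (frechet_derivative g (at x) b) +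
        P (frechet_derivative f (at x) b) (g x))" if "b \<in> Basis" for b
      using Suc.prems that
      by (intro ksmooth_on_add U Suc.IH ksmooth_on_mono[of "Suc n" U f n] ksmooth_on_mono[of "Suc n" U g n]) simp_all
  qed
qed

lemma has_derivative_euclidean_expand:
  assumes "(g has_derivative g') F"
  shows "g' (v::'a::euclidean_space) = (\<Sum>c\<in>Basis. (v \<bullet> c) *\<^sub>R g' c)"
proof -
  have "linear g'" using assms has_derivative_linear by blast
  then have "g' (\<Sum>c\<in>Basis. (v \<bullet> c) *\<^sub>R c) = (\<Sum>c\<in>Basis. (v \<bullet> c) *\<^sub>R g' c)"
    by (simp add: linear_sum linear_scale)
  then show ?thesis by (simp add: euclidean_representation)
qed

text \<open>In the chain rule the derivative of g is applied to the direction
  \<open>frechet_derivative f (at x) b\<close>, which moves with x. Expanding this direction in the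
  basis leaves only partial derivatives of g along fixed vectors, composed with f, and to these the
  induction hypothesis applies.\<close>

lemma ksmooth_on_compose:
  fixes f :: "'a::euclidean_space \<Rightarrow> 'b::euclidean_space"
  assumes U: "open U" and V: "open V" and "ksmooth_on n U f" "ksmooth_on n V g" "f ` U \<subseteq> V"
  shows "ksmooth_on n U (\<lambda>x. g (f x))"
  using assms(3-)
proof (induction n arbitrary: g)
  case 0
  then show ?case
    using differentiable_chain_at[of f _ g] by (auto simp: o_def image_subset_iff)
next
  case (Suc n)
  have g': "(g has_derivative frechet_derivative g (at (f x))) (at (f x))" if "x \<in> U" for x
    using ksmooth_on_has_derivative[OF Suc.prems(2)] Suc.prems(3) that by auto
  have D: "((\<lambda>x. g (f x)) has_derivative
        (\<lambda>v. \<Sum>c\<in>Basis. (frechet_derivative f (at x) v \<bullet> c) *\<^sub>R frechet_derivative g (at (f x)) c)) (at x)"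
      if "x \<in> U" for x
  proof -
    have "(g \<circ> f has_derivative frechet_derivative g (at (f x)) \<circ> frechet_derivative f (at x)) (at x)"
      using diff_chain_at[OF ksmooth_on_has_derivative[OF Suc.prems(1) that] g'[OF that]] .
    moreover have "frechet_derivative g (at (f x)) \<circ> frechet_derivative f (at x) =
        (\<lambda>v. \<Sum>c\<in>Basis. (frechet_derivative f (at x) v \<bullet> c) *\<^sub>R frechet_derivative g (at (f x)) c)"
      unfolding o_def by (rule ext, rule has_derivative_euclidean_expand[OF g'[OF that]])
    ultimately show ?thesis by (simp only: o_def)
  qed
  show ?case
  proof (rule ksmooth_on_SucI[OF U D])
    fix b :: 'a assume b: "b \<in> Basis"
    have 1: "ksmooth_on n U (\<lambda>x. frechet_derivative f (at x) b \<bullet> c)" for c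
      by (rule ksmooth_on_linear_compose[OF bounded_linear_inner_left U]) (use Suc.prems(1) b in simp)
    have 2: "ksmooth_on n U (\<lambda>x. frechet_derivative g (at (f x)) c)" if "c \<in> Basis" for c
    proof (rule Suc.IH)
      show "ksmooth_on n U f" using Suc.prems(1) by (rule ksmooth_on_mono) simp
    qed (use Suc.prems that in simp_all)
    show "ksmooth_on n U (\<lambda>x. \<Sum>c\<in>Basis. (frechet_derivative f (at x) b \<bullet> c) *\<^sub>R
        frechet_derivative g (at (f x)) c)"
      by (intro ksmooth_on_sum ksmooth_on_bilinear[OF bounded_bilinear_scaleR] U 1 2)
  qed
qed

lemma smooth_on_open_compose:
  fixes f :: "'a::euclidean_space \<Rightarrow> 'b::euclidean_space"
  assumes "open U" "open V" "smooth_on_open U f" "smooth_on_open V g" "f ` U \<subseteq> V"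
  shows "smooth_on_open U (\<lambda>x. g (f x))"
  using assms ksmooth_on_compose[of U V _ f g] by (auto simp: smooth_on_open_iff_ksmooth)

lemma smooth_on_open_const [simp]: "smooth_on_open U (\<lambda>x. c)"
  by (simp add: smooth_on_open_iff_ksmooth ksmooth_on_const)

lemma smooth_on_open_linear: "bounded_linear L \<Longrightarrow> open U \<Longrightarrow> smooth_on_open U L"
  by (simp add: smooth_on_open_iff_ksmooth ksmooth_on_bounded_linear)

lemma smooth_on_open_linear_compose:
  "bounded_linear L \<Longrightarrow> open U \<Longrightarrow> smooth_on_open U f \<Longrightarrow> smooth_on_open U (\<lambda>x. L (f x))"
  by (simp add: smooth_on_open_iff_ksmooth ksmooth_on_linear_compose)

lemma smooth_on_open_bilinear:
  "bounded_bilinear P \<Longrightarrow> open U \<Longrightarrow> smooth_on_open U f \<Longrightarrow> smooth_on_open U g \<Longrightarrow>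
     smooth_on_open U (\<lambda>x. P (f x) (g x))"
  by (simp add: smooth_on_open_iff_ksmooth ksmooth_on_bilinear)

lemma smooth_on_open_add:
  "open U \<Longrightarrow> smooth_on_open U f \<Longrightarrow> smooth_on_open U g \<Longrightarrow> smooth_on_open U (\<lambda>x. f x + g x)"
  by (simp add: smooth_on_open_iff_ksmooth ksmooth_on_add)

lemma smooth_on_open_sum:
  "open U \<Longrightarrow> (\<And>i. i \<in> I \<Longrightarrow> smooth_on_open U (f i)) \<Longrightarrow> smooth_on_open U (\<lambda>x. \<Sum>i\<in>I. f i x)"
  by (simp add: smooth_on_open_iff_ksmooth ksmooth_on_sum)

lemma smooth_on_open_id: "open U \<Longrightarrow> smooth_on_open U (\<lambda>x. x)"
  by (intro smooth_on_open_linear bounded_linear_ident)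

lemma smooth_on_open_uminus: "open U \<Longrightarrow> smooth_on_open U f \<Longrightarrow> smooth_on_open U (\<lambda>x. - f x)"
  by (rule smooth_on_open_linear_compose[OF bounded_linear_minus[OF bounded_linear_ident]])

lemma smooth_on_open_diff:
  "open U \<Longrightarrow> smooth_on_open U f \<Longrightarrow> smooth_on_open U g \<Longrightarrow> smooth_on_open U (\<lambda>x. f x - g x)"
  using smooth_on_open_add[of U f "\<lambda>x. - g x"] smooth_on_open_uminus[of U g] by simp

lemma smooth_on_open_mult:
  fixes f g :: "'a::euclidean_space \<Rightarrow> 'b::real_normed_algebra"
  shows "open U \<Longrightarrow> smooth_on_open U f \<Longrightarrow> smooth_on_open U g \<Longrightarrow> smooth_on_open U (\<lambda>x. f x * g x)"
  by (rule smooth_on_open_bilinear[OF bounded_bilinear_mult])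

lemma smooth_on_open_scaleR:
  "open U \<Longrightarrow> smooth_on_open U f \<Longrightarrow> smooth_on_open U g \<Longrightarrow> smooth_on_open U (\<lambda>x. f x *\<^sub>R g x)"
  by (rule smooth_on_open_bilinear[OF bounded_bilinear_scaleR])

lemma smooth_on_open_inner:
  "open U \<Longrightarrow> smooth_on_open U f \<Longrightarrow> smooth_on_open U g \<Longrightarrow> smooth_on_open U (\<lambda>x. f x \<bullet> g x)"
  by (rule smooth_on_open_bilinear[OF bounded_bilinear_inner])

lemma smooth_on_open_power:
  fixes f :: "'a::euclidean_space \<Rightarrow> real"
  shows "open U \<Longrightarrow> smooth_on_open U f \<Longrightarrow> smooth_on_open U (\<lambda>x. f x ^ n)"
  by (induction n) (auto intro: smooth_on_open_mult)

lemma smooth_on_open_fst: "open U \<Longrightarrow> smooth_on_open U f \<Longrightarrow> smooth_on_open U (\<lambda>x. fst (f x))"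
  by (rule smooth_on_open_linear_compose[OF bounded_linear_fst])

lemma smooth_on_open_snd: "open U \<Longrightarrow> smooth_on_open U f \<Longrightarrow> smooth_on_open U (\<lambda>x. snd (f x))"
  by (rule smooth_on_open_linear_compose[OF bounded_linear_snd])

lemma smooth_on_open_nth:
  "open U \<Longrightarrow> smooth_on_open U f \<Longrightarrow> smooth_on_open U (\<lambda>x. f x $ i)"
  by (rule smooth_on_open_linear_compose[OF bounded_linear_vec_nth])

lemma smooth_on_open_Pair:
  fixes f :: "'a::euclidean_space \<Rightarrow> 'b::real_normed_vector" and g :: "'a \<Rightarrow> 'c::real_normed_vector"
  assumes "open U" "smooth_on_open U f" "smooth_on_open U g"
  shows "smooth_on_open U (\<lambda>x. (f x, g x))"
proof -
  have L: "bounded_linear (\<lambda>y::'b. (y, 0::'c))" "bounded_linear (\<lambda>y::'c. (0::'b, y))"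
    by (simp_all add: bounded_linear_Pair bounded_linear_ident bounded_linear_zero)
  have "smooth_on_open U (\<lambda>x. (f x, 0) + (0, g x))"
    by (rule smooth_on_open_add[OF assms(1) smooth_on_open_linear_compose[OF L(1) assms(1,2)]
      smooth_on_open_linear_compose[OF L(2) assms(1,3)]])
  then show ?thesis by simp
qed

lemma smooth_on_open_vec:
  fixes f :: "'a::euclidean_space \<Rightarrow> real^'n"
  assumes "open U" "\<And>i. smooth_on_open U (\<lambda>x. f x $ i)"
  shows "smooth_on_open U f"
proof -
  have "smooth_on_open U (\<lambda>x. \<Sum>i\<in>UNIV. (f x $ i) *\<^sub>R axis i (1::real))"
    by (intro smooth_on_open_sum smooth_on_open_scaleR assms) auto
  moreover have "(\<Sum>i\<in>UNIV. (f x $ i) *\<^sub>R axis i (1::real)) = f x" for x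
    using basis_expansion[of "f x"] by (simp add: scalar_mult_eq_scaleR)
  ultimately show ?thesis by simp
qed

lemma smooth_on_open_vec3:
  fixes f :: "'a::euclidean_space \<Rightarrow> real^3"
  assumes "open U" "smooth_on_open U (\<lambda>x. f x $ 1)" "smooth_on_open U (\<lambda>x. f x $ 2)" "smooth_on_open U (\<lambda>x. f x $ 3)"
  shows "smooth_on_open U f"
proof (rule smooth_on_open_vec[OF assms(1)])
  fix i :: 3 show "smooth_on_open U (\<lambda>x. f x $ i)"
    using assms(2-) exhaust_3[of i] by auto
qed

text \<open>For a function whose derivative is a smooth expression in the function itself, order n
  of h gives order n of \<open>h'\<close> and hence order n + 1 of h. Used for the reciprocal and
  the square root.\<close>

lemma smooth_on_open_real_bootstrap:
  fixes h :: "real \<Rightarrow> real"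
  assumes S: "open S" and h: "\<And>x. x \<in> S \<Longrightarrow> (h has_real_derivative h' x) (at x)"
    and step: "\<And>n. ksmooth_on n S h \<Longrightarrow> ksmooth_on n S h'"
  shows "smooth_on_open S h"
  unfolding smooth_on_open_iff_ksmooth
proof
  fix n show "ksmooth_on n S h"
  proof (induction n)
    case 0
    then show ?case using h by (auto simp: differentiable_def has_field_derivative_def)
  next
    case (Suc n)
    show ?case
      by (rule ksmooth_on_SucI[OF S h[unfolded has_field_derivative_def]]) (use step[OF Suc] in auto)
  qed
qed

lemma smooth_on_open_inverse_real: "smooth_on_open (- {0}) (inverse :: real \<Rightarrow> real)"
proof (rule smooth_on_open_real_bootstrap[where h' = "\<lambda>x. - (inverse x * inverse x)"])
  fix n assume "ksmooth_on n (- {0}) (inverse :: real \<Rightarrow> real)"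
  then show "ksmooth_on n (- {0::real}) (\<lambda>x. - (inverse x * inverse x))"
    by (intro ksmooth_on_linear_compose[OF bounded_linear_minus[OF bounded_linear_ident]]
        ksmooth_on_bilinear[OF bounded_bilinear_mult]) auto
qed (auto intro!: derivative_eq_intros simp: power2_eq_square)

lemma smooth_on_open_inverse:
  fixes f :: "'a::euclidean_space \<Rightarrow> real"
  assumes "open U" "smooth_on_open U f" "\<And>x. x \<in> U \<Longrightarrow> f x \<noteq> 0"
  shows "smooth_on_open U (\<lambda>x. inverse (f x))"
  using assms by (intro smooth_on_open_compose[OF _ _ _ smooth_on_open_inverse_real]) auto

lemma smooth_on_open_divide:
  fixes f g :: "'a::euclidean_space \<Rightarrow> real"
  assumes "open U" "smooth_on_open U f" "smooth_on_open U g" "\<And>x. x \<in> U \<Longrightarrow> g x \<noteq> 0"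
  shows "smooth_on_open U (\<lambda>x. f x / g x)"
  unfolding divide_inverse using assms by (intro smooth_on_open_mult smooth_on_open_inverse) auto

lemma smooth_on_open_sqrt_real: "smooth_on_open {0<..} sqrt"
proof (rule smooth_on_open_real_bootstrap[where h' = "\<lambda>x. inverse (sqrt x) / 2"])
  fix n assume "ksmooth_on n {0<..} sqrt"
  then have "ksmooth_on n {0<..} (\<lambda>x. inverse (sqrt x))"
    using ksmooth_on_compose[of "{0<..}" "- {0::real}" n sqrt inverse] smooth_on_openD[OF smooth_on_open_inverse_real]
    by (force simp: open_delete)
  then show "ksmooth_on n {0<..} (\<lambda>x. inverse (sqrt x) / 2)"
    by (intro ksmooth_on_linear_compose[OF bounded_linear_divide]) auto
qed (auto intro!: derivative_eq_intros)

lemma smooth_on_open_sqrt: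
  fixes f :: "'a::euclidean_space \<Rightarrow> real"
  assumes "open U" "smooth_on_open U f" "\<And>x. x \<in> U \<Longrightarrow> f x > 0"
  shows "smooth_on_open U (\<lambda>x. sqrt (f x))"
  using assms by (intro smooth_on_open_compose[OF _ _ _ smooth_on_open_sqrt_real]) auto

lemma ksmooth_on_sin_cos: "ksmooth_on n UNIV (sin :: real \<Rightarrow> real) \<and> ksmooth_on n UNIV (cos :: real \<Rightarrow> real)"
proof (induction n)
  case 0
  have "(sin has_real_derivative cos x) (at x)" "(cos has_real_derivative - sin x) (at x)" for x :: real
    by (auto intro!: derivative_eq_intros)
  then show ?case unfolding ksmooth_on.simps differentiable_def has_field_derivative_def by blast
next
  case (Suc n)
  have "ksmooth_on (Suc n) UNIV (sin :: real \<Rightarrow> real)"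
    by (rule ksmooth_on_SucI[where f' = "\<lambda>x v. cos x * v"]) (use Suc in \<open>auto intro!: derivative_eq_intros\<close>)
  moreover have "ksmooth_on (Suc n) UNIV (cos :: real \<Rightarrow> real)"
  proof (rule ksmooth_on_SucI[where f' = "\<lambda>x v. - sin x * v"])
    show "ksmooth_on n UNIV (\<lambda>x. - sin x * b)" if "b \<in> Basis" for b :: real
      using Suc ksmooth_on_linear_compose[OF bounded_linear_mult_left[of "-b"], of UNIV n sin]
      by simp
  qed (auto intro!: derivative_eq_intros)
  ultimately show ?case by blast
qed

lemma smooth_on_open_sin:
  fixes f :: "'a::euclidean_space \<Rightarrow> real"
  assumes "open U" "smooth_on_open U f"
  shows "smooth_on_open U (\<lambda>x. sin (f x))"
  using assms ksmooth_on_sin_cos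
  by (intro smooth_on_open_compose[of U UNIV f sin]) (auto simp: smooth_on_open_iff_ksmooth)

lemma smooth_on_open_cos:
  fixes f :: "'a::euclidean_space \<Rightarrow> real"
  assumes "open U" "smooth_on_open U f"
  shows "smooth_on_open U (\<lambda>x. cos (f x))"
  using assms ksmooth_on_sin_cos
  by (intro smooth_on_open_compose[of U UNIV f cos]) (auto simp: smooth_on_open_iff_ksmooth)

lemmas smooth_intros = smooth_on_open_const smooth_on_open_add smooth_on_open_diff smooth_on_open_uminus
  smooth_on_open_mult smooth_on_open_scaleR smooth_on_open_inner smooth_on_open_power
  smooth_on_open_fst smooth_on_open_snd smooth_on_open_nth smooth_on_open_Pair smooth_on_open_divide
  smooth_on_open_inverse smooth_on_open_sqrt smooth_on_open_sin smooth_on_open_cos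
  smooth_on_open_id

subsection \<open>A flat function, a bump and a step\<close>

text \<open>The case k = 0 is the standard flat function. The factors \<open>inverse t ^ k\<close>
  make the family closed under differentiation up to linear combinations, so that one induction
  covers all orders.\<close>

definition flat_fun :: "nat \<Rightarrow> real \<Rightarrow> real" where
  "flat_fun k t = (if t \<le> 0 then 0 else inverse t ^ k * exp (- inverse t))"

lemma tendsto_flat_fun_at_right: "(flat_fun k \<longlongrightarrow> 0) (at_right 0)"
proof -
  have "((\<lambda>t. inverse t ^ k / exp (inverse t)) \<longlongrightarrow> 0) (at_right (0::real))"
    by (rule filterlim_compose[OF tendsto_power_div_exp_0 filterlim_inverse_at_top_right])
  moreover have "eventually (\<lambda>t. inverse t ^ k / exp (inverse t) = flat_fun k t) (at_right (0::real))"
    unfolding eventually_at_right_field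
    by (intro exI[of _ 1]) (simp add: flat_fun_def exp_minus divide_inverse)
  ultimately show ?thesis using Lim_transform_eventually by blast
qed

lemma has_derivative_flat_fun:
  "(flat_fun k has_real_derivative (flat_fun (k + 2) t - real k * flat_fun (k + 1) t)) (at t)"
proof -
  consider "t < 0" | "t = 0" | "t > 0" by linarith
  then show ?thesis
  proof cases
    case 1
    have "((\<lambda>_. 0) has_real_derivative 0) (at t)" by simp
    then have "(flat_fun k has_real_derivative 0) (at t)"
      by (rule has_field_derivative_transform_within_open[of _ _ _ "{..<0}"])
        (use 1 in \<open>auto simp: flat_fun_def\<close>)
    then show ?thesis using 1 by (simp add: flat_fun_def)
  next
    case 2
    have l: "((\<lambda>h. flat_fun k h / h) \<longlongrightarrow> 0) (at_left 0)"
      by (rule Lim_transform_eventually[OF tendsto_const])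
        (auto simp: eventually_at_left_field flat_fun_def intro!: exI[of _ "-1"])
    \<comment> \<open>Division by h turns \<open>flat_fun k\<close> into
      \<open>flat_fun (k+1)\<close> on the positive side, and every member of the family tends to 0
      there.\<close>
    have r: "((\<lambda>h. flat_fun k h / h) \<longlongrightarrow> 0) (at_right 0)"
      by (rule Lim_transform_eventually[OF tendsto_flat_fun_at_right[of "k+1"]])
        (auto simp: eventually_at_right_field flat_fun_def divide_inverse intro!: exI[of _ 1])
    have "((\<lambda>h. flat_fun k h / h) \<longlongrightarrow> 0) (at 0)"
      using l r by (simp add: filterlim_split_at)
    then show ?thesis using 2 by (simp add: has_field_derivative_iff flat_fun_def)
  next
    case 3
    have d: "((\<lambda>t. inverse t ^ k * exp (- inverse t)) has_real_derivative
        (inverse t ^ (k+2) * exp (- inverse t) - real k * (inverse t ^ (k+1) * exp (- inverse t)))) (at t)"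
    proof (cases k)
      case 0
      then show ?thesis using 3
        by (auto intro!: derivative_eq_intros simp: power2_eq_square field_simps)
    next
      case (Suc m)
      show ?thesis unfolding Suc using 3
        by (auto intro!: derivative_eq_intros simp del: power_Suc) (simp add: field_simps)
    qed
    have "(flat_fun k has_real_derivative
        (inverse t ^ (k+2) * exp (- inverse t) - real k * (inverse t ^ (k+1) * exp (- inverse t)))) (at t)"
      by (rule has_field_derivative_transform_within_open[OF d, of "{0<..}"])
        (use 3 in \<open>auto simp: flat_fun_def\<close>)
    then show ?thesis using 3 by (simp add: flat_fun_def)
  qed
qed

lemma has_derivative_flat_fun_0: "(flat_fun 0 has_real_derivative flat_fun 2 t) (at t)"
  using has_derivative_flat_fun[of 0 t] by (simp add: numeral_2_eq_2)

lemma smooth_on_open_flat_fun: "smooth_on_open UNIV (flat_fun k)"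
  unfolding smooth_on_open_iff_ksmooth
proof
  fix n show "ksmooth_on n UNIV (flat_fun k)"
  proof (induction n arbitrary: k)
    case 0
    then show ?case
      using has_derivative_flat_fun unfolding ksmooth_on.simps differentiable_def has_field_derivative_def by blast
  next
    case (Suc n)
    show ?case
    proof (rule ksmooth_on_SucI[OF open_UNIV has_derivative_flat_fun[unfolded has_field_derivative_def]])
      fix b :: real assume b: "b \<in> Basis"
      have "ksmooth_on n UNIV (\<lambda>x. flat_fun (k + 2) x + (- real k) * flat_fun (k + 1) x)"
        by (intro ksmooth_on_add open_UNIV Suc.IH ksmooth_on_linear_compose[OF bounded_linear_mult_right])
      then show "ksmooth_on n UNIV (\<lambda>x. (flat_fun (k + 2) x - real k * flat_fun (k + 1) x) * b)"
        using b by simp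
    qed
  qed
qed

lemma flat_fun_0: "t \<le> 0 \<Longrightarrow> flat_fun k t = 0" and flat_fun_pos: "t > 0 \<Longrightarrow> flat_fun k t > 0"
  by (auto simp: flat_fun_def)

text \<open>The bump depends on the squared distance to c, so its derivative at c vanishes. For a
  cutoff composed with J this means that on the central level the flow is that of K alone.\<close>

lemma smooth_bump_exists:
  fixes c e :: real
  assumes "e > 0"
  obtains \<beta> \<beta>' where "smooth_on_open UNIV \<beta>" "\<And>x. (\<beta> has_real_derivative \<beta>' x) (at x)"
    "\<beta> c = 1" "\<beta>' c = 0" "\<And>x. \<bar>x - c\<bar> \<ge> e \<Longrightarrow> \<beta> x = 0" "\<And>x. \<bar>x - c\<bar> \<ge> e \<Longrightarrow> \<beta>' x = 0"
proof -
  define q where "q x = e\<^sup>2 - (x - c)\<^sup>2" for x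
  define \<beta> where "\<beta> x = flat_fun 0 (q x) / flat_fun 0 (e\<^sup>2)" for x
  define \<beta>' where "\<beta>' x = flat_fun 2 (q x) * (- 2 * (x - c)) / flat_fun 0 (e\<^sup>2)" for x
  have e: "flat_fun 0 (e\<^sup>2) > 0" using assms flat_fun_pos by simp
  have q0: "q x \<le> 0" if "\<bar>x - c\<bar> \<ge> e" for x
    using power_mono[OF that, of 2] assms by (simp add: q_def)
  have qs: "smooth_on_open UNIV q" unfolding q_def by (intro smooth_intros open_UNIV)
  show thesis
  proof
    have "smooth_on_open UNIV (\<lambda>x. flat_fun 0 (q x))"
      by (rule smooth_on_open_compose[OF _ _ qs smooth_on_open_flat_fun]) auto
    then show "smooth_on_open UNIV \<beta>"
      unfolding \<beta>_def using e by (intro smooth_intros open_UNIV) auto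
    show "(\<beta> has_real_derivative \<beta>' x) (at x)" for x
    proof -
      have "(q has_real_derivative (- 2 * (x - c))) (at x)"
        unfolding q_def by (auto intro!: derivative_eq_intros)
      from DERIV_cdivide[OF DERIV_chain2[OF has_derivative_flat_fun_0 this], of "flat_fun 0 (e\<^sup>2)"]
      show ?thesis unfolding \<beta>_def \<beta>'_def .
    qed
    show "\<beta> c = 1" using e by (simp add: \<beta>_def q_def)
    show "\<beta>' c = 0" by (simp add: \<beta>'_def)
    show "\<beta> x = 0" "\<beta>' x = 0" if "\<bar>x - c\<bar> \<ge> e" for x
      using q0[OF that] by (simp_all add: \<beta>_def \<beta>'_def flat_fun_0)
  qed
qed

text \<open>As \<open>a < b\<close>, at every x at least one of the two summands of the denominator
  D is positive. The derivative is provided as a smooth function of its own because it multiplies a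
  Hamiltonian when time is reparametrized.\<close>

lemma smooth_step_exists:
  fixes a b :: real
  assumes "a < b"
  obtains \<sigma> \<sigma>' where "smooth_on_open UNIV \<sigma>" "smooth_on_open UNIV \<sigma>'"
    "\<And>x. (\<sigma> has_real_derivative \<sigma>' x) (at x)"
    "\<And>x. \<sigma> x \<in> {0..1}" "\<And>x. x \<le> a \<Longrightarrow> \<sigma> x = 0" "\<And>x. x \<ge> b \<Longrightarrow> \<sigma> x = 1"
    "\<And>x. x \<le> a \<Longrightarrow> \<sigma>' x = 0" "\<And>x. x \<ge> b \<Longrightarrow> \<sigma>' x = 0"
proof -
  define D where "D x = flat_fun 0 (x - a) + flat_fun 0 (b - x)" for x
  define \<sigma> where "\<sigma> x = flat_fun 0 (x - a) / D x" for x
  define \<sigma>' where "\<sigma>' x = (flat_fun 2 (x - a) * D x - flat_fun 0 (x - a) * (flat_fun 2 (x - a) - flat_fun 2 (b - x))) / (D x * D x)" for x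
  have nn: "flat_fun k t \<ge> 0" for k t by (auto simp: flat_fun_def)
  have D: "D x > 0" for x
    using assms flat_fun_pos[of "x - a" 0] flat_fun_pos[of "b - x" 0] nn[of 0 "x-a"] nn[of 0 "b-x"]
    by (cases "x > a") (auto simp: D_def)
  have s: "smooth_on_open UNIV (\<lambda>x. flat_fun k (x - a))" "smooth_on_open UNIV (\<lambda>x. flat_fun k (b - x))" for k
    by (rule smooth_on_open_compose[OF open_UNIV open_UNIV _ smooth_on_open_flat_fun],
        (intro smooth_intros open_UNIV), simp)+
  have sD: "smooth_on_open UNIV D" unfolding D_def by (intro smooth_intros s open_UNIV)
  have dA: "((\<lambda>x. flat_fun 0 (x - a)) has_real_derivative flat_fun 2 (x - a)) (at x)" for x
  proof -
    have "((\<lambda>x. x - a) has_real_derivative 1) (at x)" by (auto intro!: derivative_eq_intros)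
    from DERIV_chain2[OF has_derivative_flat_fun_0 this] show ?thesis by simp
  qed
  have dB: "((\<lambda>x. flat_fun 0 (b - x)) has_real_derivative - flat_fun 2 (b - x)) (at x)" for x
  proof -
    have "((\<lambda>x. b - x) has_real_derivative -1) (at x)" by (auto intro!: derivative_eq_intros)
    from DERIV_chain2[OF has_derivative_flat_fun_0 this] show ?thesis by simp
  qed
  have dD: "(D has_real_derivative (flat_fun 2 (x - a) - flat_fun 2 (b - x))) (at x)" for x
    unfolding D_def using DERIV_add[OF dA dB] by simp
  have D0: "D x \<noteq> 0" "D x * D x \<noteq> 0" for x using D[of x] by simp_all
  show thesis
  proof
    show "smooth_on_open UNIV \<sigma>"
      unfolding \<sigma>_def by (intro smooth_intros s sD open_UNIV D0)
    show "smooth_on_open UNIV \<sigma>'"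
      unfolding \<sigma>'_def by (intro smooth_intros s sD open_UNIV D0)
    show "(\<sigma> has_real_derivative \<sigma>' x) (at x)" for x
      unfolding \<sigma>_def \<sigma>'_def
      by (rule DERIV_divide[OF dA dD D0(1)])
    show "\<sigma> x \<in> {0..1}" for x
      using D[of x] nn[of 0 "x-a"] nn[of 0 "b-x"] by (auto simp: \<sigma>_def D_def divide_le_eq_1)
    show "\<sigma> x = 1" if "x \<ge> b" for x
      using D[of x] that by (simp add: \<sigma>_def D_def flat_fun_0)
    show "\<sigma>' x = 0" if "x \<ge> b" for x
      using D[of x] that by (simp add: \<sigma>'_def D_def flat_fun_0)
  qed (auto simp: \<sigma>_def \<sigma>'_def flat_fun_0)
qed

subsection \<open>Integrals depending on a parameter\<close>

lemma has_derivative_integral_parameter: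
  fixes f :: "real \<times> 'a::euclidean_space \<Rightarrow> 'b::euclidean_space"
  assumes U: "open U" and V: "open V" and sub: "{a..b} \<times> U \<subseteq> V" and f: "smooth_on_open V f" and x: "x \<in> U"
  shows "((\<lambda>x. integral {a..b} (\<lambda>t. f (t, x))) has_derivative
     (\<lambda>v. integral {a..b} (\<lambda>t. frechet_derivative f (at (t, x)) (0, v)))) (at x)"
proof -
  obtain e where e: "e > 0" "ball x e \<subseteq> U" using U x openE by blast
  have sub': "(t, z) \<in> V" if "z \<in> ball x e" "t \<in> {a..b}" for z t
    using that e sub by blast
  \<comment> \<open>\<open>leibniz_rule\<close> asks for a derivative that is continuous as a map
    into bounded linear functions; that continuity is checked on basis vectors only.\<close>
  define F where "F z t = Blinfun (\<lambda>v. frechet_derivative f (at (t, z)) (0, v))" for z t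
  have df: "(f has_derivative frechet_derivative f (at (t, z))) (at (t, z))" if "z \<in> ball x e" "t \<in> {a..b}" for z t
    using smooth_on_open_has_derivative[OF f] that e sub by blast
  have bl: "bounded_linear (\<lambda>v. frechet_derivative f (at (t, z)) (0, v))" if "z \<in> ball x e" "t \<in> {a..b}" for z t
    using bounded_linear_compose[OF has_derivative_bounded_linear[OF df[OF that]], of "\<lambda>v. (0, v)"]
    by (simp add: bounded_linear_Pair bounded_linear_ident bounded_linear_zero)
  have F: "blinfun_apply (F z t) = (\<lambda>v. frechet_derivative f (at (t, z)) (0, v))" if "z \<in> ball x e" "t \<in> {a..b}" for z t
    unfolding F_def using bl[OF that] by (rule bounded_linear_Blinfun_apply)
  have 1: "((\<lambda>z. f (t, z)) has_derivative blinfun_apply (F z t)) (at z within ball x e)"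
    if "z \<in> ball x e" "t \<in> cbox a b" for z t
  proof -
    have *: "t \<in> {a..b}" using that by simp
    have "((\<lambda>z. (t, z)) has_derivative (\<lambda>v. (0, v))) (at z)" by (auto intro!: derivative_eq_intros)
    from diff_chain_at[OF this df[OF that(1) *]] show ?thesis
      by (simp add: o_def F[OF that(1) *] has_derivative_at_withinI)
  qed
  have cf: "continuous_on V f" by (rule smooth_on_open_imp_continuous_on[OF f])
  have 2: "(\<lambda>t. f (t, z)) integrable_on cbox a b" if "z \<in> ball x e" for z
    by (intro integrable_continuous continuous_on_compose2[OF cf] continuous_intros)
       (use that sub' in auto)
  have 3: "continuous_on (ball x e \<times> cbox a b) (\<lambda>(z, t). F z t)"
  proof (rule continuous_on_blinfun_componentwise)
    fix i :: 'a assume i: "i \<in> Basis"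
    then have "(0, i) \<in> (Basis :: (real \<times> 'a) set)" by (simp add: Basis_prod_def)
    then have c: "continuous_on V (\<lambda>y. frechet_derivative f (at y) (0, i))"
      using smooth_on_open_derivative[OF f] smooth_on_open_imp_continuous_on by blast
    have "continuous_on (ball x e \<times> cbox a b) (\<lambda>y. frechet_derivative f (at (snd y, fst y)) (0, i))"
      by (rule continuous_on_compose2[OF c, where f = "\<lambda>y. (snd y, fst y)"])
        (use sub' in \<open>auto intro!: continuous_intros\<close>)
    then show "continuous_on (ball x e \<times> cbox a b) (\<lambda>y. blinfun_apply (case y of (z, t) \<Rightarrow> F z t) i)"
      by (rule continuous_on_eq) (auto simp: F)
  qed
  have 4: "((\<lambda>x. integral (cbox a b) (\<lambda>t. f (t, x))) has_derivative blinfun_apply (integral (cbox a b) (F x))) (at x within ball x e)"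
    by (rule leibniz_rule[OF 1 2 3]) (use e in auto)
  have "continuous_on (cbox a b) (F x)"
    by (rule continuous_on_compose2[OF 3, where f = "\<lambda>t. (x, t)", simplified]) (use e in \<open>auto intro!: continuous_intros\<close>)
  then have "blinfun_apply (integral (cbox a b) (F x)) v = integral (cbox a b) (\<lambda>t. frechet_derivative f (at (t, x)) (0, v))" for v
    using e by (subst blinfun_apply_integral) (auto intro!: integrable_continuous_interval integral_cong simp: F)
  then have "blinfun_apply (integral (cbox a b) (F x)) = (\<lambda>v. integral {a..b} (\<lambda>t. frechet_derivative f (at (t, x)) (0, v)))"
    by auto
  then show ?thesis using 4 e by (simp add: at_within_open[of x "ball x e"])
qed

lemma smooth_on_open_integral_parameter:
  fixes f :: "real \<times> 'a::euclidean_space \<Rightarrow> 'b::euclidean_space"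
  assumes U: "open U" and V: "open V" and sub: "{a..b} \<times> U \<subseteq> V" and f: "smooth_on_open V f"
  shows "smooth_on_open U (\<lambda>x. integral {a..b} (\<lambda>t. f (t, x)))"
  unfolding smooth_on_open_iff_ksmooth
proof
  fix n show "ksmooth_on n U (\<lambda>x. integral {a..b} (\<lambda>t. f (t, x)))"
    using f
  proof (induction n arbitrary: f)
    case 0
    then show ?case using has_derivative_integral_parameter[OF U V sub 0]
      unfolding ksmooth_on.simps differentiable_def by blast
  next
    case (Suc n)
    show ?case
    proof (rule ksmooth_on_SucI[OF U has_derivative_integral_parameter[OF U V sub Suc.prems]])
      fix b' :: 'a assume "b' \<in> Basis"
      then have "(0, b') \<in> (Basis :: (real \<times> 'a) set)" by (simp add: Basis_prod_def)
      then have "smooth_on_open V (\<lambda>y. frechet_derivative f (at y) (0, b'))"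
        using smooth_on_open_derivative[OF Suc.prems] by blast
      from Suc.IH[OF this]
      show "ksmooth_on n U (\<lambda>x. integral {a..b} (\<lambda>t. frechet_derivative f (at (t, x)) (0, b')))" .
    qed
  qed
qed

subsection \<open>Smoothness of inverse maps in dimension three\<close>

abbreviation cross3' :: "real^3 \<Rightarrow> real^3 \<Rightarrow> real^3" (infixr "\<otimes>" 80) where
  "u \<otimes> v \<equiv> cross3 u v"

lemma smooth_on_open_cross3:
  "open U \<Longrightarrow> smooth_on_open U f \<Longrightarrow> smooth_on_open U g \<Longrightarrow> smooth_on_open U (\<lambda>x. f x \<otimes> g x)"
  by (rule smooth_on_open_bilinear[OF bilinear_cross[unfolded bilinear_conv_bounded_bilinear]])

text \<open>Cramer's rule for the linear system with columns A, B, C, the triple product being the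
  determinant. In this form the solution is visibly smooth in the columns.\<close>

definition cramer3 :: "real^3 \<Rightarrow> real^3 \<Rightarrow> real^3 \<Rightarrow> real^3 \<Rightarrow> real^3" where
  "cramer3 A B C b = inverse (A \<bullet> (B \<otimes> C)) *\<^sub>R
     ((b \<bullet> (B \<otimes> C)) *\<^sub>R axis 1 1 + (b \<bullet> (C \<otimes> A)) *\<^sub>R axis 2 1 + (b \<bullet> (A \<otimes> B)) *\<^sub>R axis 3 1)"

lemma Basis_real3: "(Basis :: (real^3) set) = {axis 1 1, axis 2 1, axis 3 1}"
  by (auto simp: Basis_vec_def UNIV_3)

lemma vec3_expand: "(v::real^3) = (v$1) *\<^sub>R axis 1 1 + (v$2) *\<^sub>R axis 2 1 + (v$3) *\<^sub>R axis 3 1"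
  by (simp add: vec_eq_iff forall_3 axis_def)

lemma
  fixes T :: "real^3 \<Rightarrow> real^3"
  assumes T: "linear T" "inj T"
  defines "A \<equiv> T (axis 1 1)" and "B \<equiv> T (axis 2 1)" and "C \<equiv> T (axis 3 1)"
  shows inj_linear_triple_nonzero: "A \<bullet> (B \<otimes> C) \<noteq> 0"
    and inj_linear_cramer3: "T (cramer3 A B C b) = b"
proof -
  have ex: "T v = (v$1) *\<^sub>R A + (v$2) *\<^sub>R B + (v$3) *\<^sub>R C" for v
    unfolding A_def B_def C_def
    by (subst vec3_expand) (simp only: linear_add[OF T(1)] linear_scale[OF T(1)])
  have cyc: "B \<bullet> (C \<otimes> A) = A \<bullet> (B \<otimes> C)" "C \<bullet> (A \<otimes> B) = A \<bullet> (B \<otimes> C)"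
    by (simp_all add: cross3_simps)
  have v: "T v \<bullet> (B \<otimes> C) = v$1 * (A \<bullet> (B \<otimes> C))" "T v \<bullet> (C \<otimes> A) = v$2 * (A \<bullet> (B \<otimes> C))"
    "T v \<bullet> (A \<otimes> B) = v$3 * (A \<bullet> (B \<otimes> C))" for v
    unfolding ex by (simp_all add: inner_add_left dot_cross_self cyc)
  have surj: "surj T" using T linear_injective_imp_surjective by blast
  show nz: "A \<bullet> (B \<otimes> C) \<noteq> 0"
  proof
    assume 0: "A \<bullet> (B \<otimes> C) = 0"
    obtain w where "B \<otimes> C = T w" using surj by (metis surjD)
    then have "(B \<otimes> C) \<bullet> (B \<otimes> C) = 0" using v(1)[of w] 0 by simp
    then have z: "B \<otimes> C = 0" by simp
    \<comment> \<open>Once \<open>B \<otimes> C\<close> vanishes, the columns B and C are dependent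
      with coefficients \<open>C \<bullet> C\<close> and \<open>- (B \<bullet> C)\<close>.
      Injectivity forces both coefficients to be 0, hence C = 0, which contradicts injectivity
      again.\<close>
    have "(C \<bullet> C) *\<^sub>R B - (B \<bullet> C) *\<^sub>R C = - ((B \<otimes> C) \<otimes> C)"
      by (simp add: vec_eq_iff forall_3 cross3_def inner_vec_def sum_3 algebra_simps)
    then have "(C \<bullet> C) *\<^sub>R B - (B \<bullet> C) *\<^sub>R C = 0" by (simp add: z)
    moreover have "T (vector [0, C \<bullet> C, - (B \<bullet> C)]) = (C \<bullet> C) *\<^sub>R B - (B \<bullet> C) *\<^sub>R C"
      by (simp add: ex)
    ultimately have "T (vector [0, C \<bullet> C, - (B \<bullet> C)]) = T 0" using linear_0[OF T(1)] by simp
    then have "(vector [0, C \<bullet> C, - (B \<bullet> C)] :: real^3) = 0" using T(2) by (simp add: inj_eq)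
    then have "(vector [0, C \<bullet> C, - (B \<bullet> C)] :: real^3) $ 2 = 0" by simp
    then have "C = 0" by simp
    then have "T (axis 3 1) = T 0" using linear_0[OF T(1)] by (simp add: C_def)
    then show False using T(2) by (simp add: inj_eq axis_eq_0_iff)
  qed
  obtain w where w: "b = T w" using surj by (metis surjD)
  have "cramer3 A B C b = w"
    unfolding cramer3_def w v using nz
    by (simp add: vec_eq_iff forall_3 axis_def)
  then show "T (cramer3 A B C b) = b" using w by simp
qed

text \<open>The derivative of g at y is the inverse matrix of the derivative of f at
  \<open>g y\<close>, that is, a smooth function h of \<open>g y\<close>. Each order of smoothness
  of g therefore yields the next.\<close>

lemma smooth_on_open_inverse_map3:
  fixes f g :: "real^3 \<Rightarrow> real^3"
  assumes U: "open U" and V: "open V" and f: "smooth_on_open U f"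
    and gU: "\<And>y. y \<in> V \<Longrightarrow> g y \<in> U" and fg: "\<And>y. y \<in> V \<Longrightarrow> f (g y) = y"
    and gf: "\<And>x. x \<in> U \<Longrightarrow> g (f x) = x"
    and inj: "\<And>x. x \<in> U \<Longrightarrow> inj (frechet_derivative f (at x))"
  shows "smooth_on_open V g"
proof -
  define Df where "Df x = frechet_derivative f (at x)" for x
  define h where "h b x = cramer3 (Df x (axis 1 1)) (Df x (axis 2 1)) (Df x (axis 3 1)) b" for b x
  have lin: "linear (Df x)" if "x \<in> U" for x
    unfolding Df_def using smooth_on_open_has_derivative[OF f that] has_derivative_linear by blast
  have h: "Df x (h b x) = b" if "x \<in> U" for x b
    unfolding h_def by (rule inj_linear_cramer3[OF lin[OF that]]) (use inj that Df_def in simp)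
  have nz: "Df x (axis 1 1) \<bullet> (Df x (axis 2 1) \<otimes> Df x (axis 3 1)) \<noteq> 0" if "x \<in> U" for x
    by (rule inj_linear_triple_nonzero[OF lin[OF that]]) (use inj that Df_def in simp)
  have sD: "smooth_on_open U (\<lambda>x. Df x (axis i 1))" for i
    unfolding Df_def by (rule smooth_on_open_derivative[OF f]) (simp add: axis_in_Basis_iff)
  have sh: "smooth_on_open U (h b)" for b
    unfolding h_def cramer3_def by (intro smooth_intros smooth_on_open_cross3 U sD nz)
  have dg: "(g has_derivative (\<lambda>b. h b (g y))) (at y)" if y: "y \<in> V" for y
  proof (rule has_derivative_inverse_strong_x[OF U gU[OF y] smooth_on_open_imp_continuous_on[OF f] gf])
    show "(f has_derivative Df (g y)) (at (g y))"
      unfolding Df_def by (rule smooth_on_open_has_derivative[OF f gU[OF y]])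
    show "Df (g y) \<circ> (\<lambda>b. h b (g y)) = id" using h[OF gU[OF y]] by (simp add: fun_eq_iff)
  qed (use y fg in simp_all)
  show ?thesis
    unfolding smooth_on_open_iff_ksmooth
  proof
    fix n show "ksmooth_on n V g"
    proof (induction n)
      case 0
      then show ?case using dg by (auto simp: differentiable_def)
    next
      case (Suc n)
      show ?case
        by (rule ksmooth_on_SucI[OF V dg ksmooth_on_compose[OF V U Suc smooth_on_openD[OF sh]]]) (use gU in auto)
    qed
  qed
qed

section \<open>Hamiltonian flows on a product of round spheres\<close>

text \<open>On tangent vectors \<open>p \<bullet> (u \<otimes> v)\<close> is the area form of the
  unit sphere, of total area 4 pi; the two factors thus have areas \<open>4 * pi * c1\<close> and
  \<open>4 * pi * c2\<close>.\<close>

definition round_form :: "real \<Rightarrow> real \<Rightarrow> point two_form" where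
  "round_form c1 c2 = sum_form (\<lambda>p u v. c1 * (p \<bullet> (u \<otimes> v))) (\<lambda>p u v. c2 * (p \<bullet> (u \<otimes> v)))"

lemma inner_real3: "(u::real^3) \<bullet> v = u$1 * v$1 + u$2 * v$2 + u$3 * v$3"
  by (simp add: inner_vec_def sum_3)

lemma cross3_nth:
  "(u \<otimes> v) $ 1 = u$2 * v$3 - u$3 * v$2" "(u \<otimes> v) $ 2 = u$3 * v$1 - u$1 * v$3" "(u \<otimes> v) $ 3 = u$1 * v$2 - u$2 * v$1"
  by (simp_all add: cross3_def)

lemma vec3_eq_iff: "(u::real^3) = v \<longleftrightarrow> u$1 = v$1 \<and> u$2 = v$2 \<and> u$3 = v$3"
  by (simp add: vec_eq_iff forall_3)

lemma S2_iff: "p \<in> S2 \<longleftrightarrow> (p$1)\<^sup>2 + (p$2)\<^sup>2 + (p$3)\<^sup>2 = 1"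
  by (simp add: norm_eq_1 inner_real3 power2_eq_square)

lemma S2_inner: "p \<in> S2 \<Longrightarrow> p \<bullet> p = 1"
  by (simp add: norm_eq_1)

text \<open>This makes \<open>g \<otimes> p\<close> the Hamiltonian vector on the unit sphere of a
  function with ambient gradient g. The normal part of g drops out of the cross product, so the
  result depends only on the restriction of the function to the sphere.\<close>

lemma triple_cross_tangent:
  "p \<in> S2 \<Longrightarrow> p \<bullet> v = 0 \<Longrightarrow> p \<bullet> ((g \<otimes> p) \<otimes> v) = g \<bullet> v"
proof -
  assume p: "p \<in> S2" "p \<bullet> v = 0"
  have "p \<bullet> ((g \<otimes> p) \<otimes> v) = (p \<bullet> p) * (g \<bullet> v) - (p \<bullet> g) * (p \<bullet> v)"
    by (simp add: inner_real3 cross3_nth algebra_simps)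
  then show ?thesis using p S2_inner by simp
qed

definition ham_field :: "real \<Rightarrow> real \<Rightarrow> real^3 \<Rightarrow> real^3 \<Rightarrow> point \<Rightarrow> point" where
  "ham_field c1 c2 g1 g2 x = ((1 / c1) *\<^sub>R (g1 \<otimes> fst x), (1 / c2) *\<^sub>R (g2 \<otimes> snd x))"

lemma hamiltonian_vector_ham_field:
  assumes c: "c1 \<noteq> 0" "c2 \<noteq> 0" and x: "x \<in> S2xS2"
    and F: "(F has_derivative (\<lambda>v. g1 \<bullet> fst v + g2 \<bullet> snd v)) (at x)"
  shows "hamiltonian_vector (round_form c1 c2) F x (ham_field c1 c2 g1 g2 x)"
  unfolding hamiltonian_vector_def
proof
  show "ham_field c1 c2 g1 g2 x \<in> tangent_S2xS2 x"
    by (simp add: ham_field_def tangent_S2xS2_def tangent_S2_def dot_cross_self)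
  have x': "fst x \<in> S2" "snd x \<in> S2" using x by auto
  show "\<forall>v\<in>tangent_S2xS2 x. round_form c1 c2 x (ham_field c1 c2 g1 g2 x) v = frechet_derivative F (at x) v"
    unfolding frechet_derivative_at[OF F, symmetric] ham_field_def round_form_def sum_form_def tangent_S2xS2_def tangent_S2_def
    using c x' by (auto simp: cross_mult_left triple_cross_tangent)
qed

text \<open>Nondegeneracy: for a tangent vector u the vector \<open>p \<otimes> u\<close> is its
  quarter turn, and pairing the two gives \<open>u \<bullet> u\<close>. This is applied to the
  difference of two Hamiltonian vectors, one factor at a time.\<close>

lemma hamiltonian_vector_unique:
  assumes c: "c1 \<noteq> 0" "c2 \<noteq> 0" and x: "x \<in> S2xS2"
    and F: "(F has_derivative (\<lambda>v. g1 \<bullet> fst v + g2 \<bullet> snd v)) (at x)"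
    and X: "hamiltonian_vector (round_form c1 c2) F x X"
  shows "X = ham_field c1 c2 g1 g2 x"
proof -
  define Y where "Y = X - ham_field c1 c2 g1 g2 x"
  have H: "hamiltonian_vector (round_form c1 c2) F x (ham_field c1 c2 g1 g2 x)"
    by (rule hamiltonian_vector_ham_field[OF c x F])
  have x': "fst x \<in> S2" "snd x \<in> S2" using x by auto
  have tY: "fst x \<bullet> fst Y = 0" "snd x \<bullet> snd Y = 0"
    using X H by (auto simp: hamiltonian_vector_def tangent_S2xS2_def tangent_S2_def Y_def inner_diff_right mem_Times_iff)
  have eq: "c1 * (fst x \<bullet> (fst Y \<otimes> fst v)) + c2 * (snd x \<bullet> (snd Y \<otimes> snd v)) = 0" if "v \<in> tangent_S2xS2 x" for v
  proof -
    have "round_form c1 c2 x X v = round_form c1 c2 x (ham_field c1 c2 g1 g2 x) v"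
      using X H that by (simp add: hamiltonian_vector_def)
    then show ?thesis
      by (simp add: round_form_def sum_form_def Y_def left_diff_distrib inner_diff_right Cross3.left_diff_distrib right_diff_distrib)
  qed
  have aux: "p \<bullet> (u \<otimes> (p \<otimes> u)) = u \<bullet> u" if "p \<in> S2" "p \<bullet> u = 0" for p u :: "real^3"
  proof -
    have "p \<bullet> (u \<otimes> (p \<otimes> u)) = (p \<bullet> p) * (u \<bullet> u) - (p \<bullet> u) * (p \<bullet> u)"
      by (simp add: inner_real3 cross3_nth algebra_simps)
    then show ?thesis using that S2_inner by simp
  qed
  have "fst Y \<bullet> fst Y = 0"
    using eq[of "(fst x \<otimes> fst Y, 0)"] aux[OF x'(1) tY(1)] c
    by (simp add: tangent_S2xS2_def tangent_S2_def dot_cross_self)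
  moreover have "snd Y \<bullet> snd Y = 0"
    using eq[of "(0, snd x \<otimes> snd Y)"] aux[OF x'(2) tY(2)] c
    by (simp add: tangent_S2xS2_def tangent_S2_def dot_cross_self)
  ultimately show ?thesis by (simp add: Y_def prod_eq_iff)
qed

section \<open>Time-independent Hamiltonians; reflexivity and transitivity of equivalence\<close>

lemma hamiltonian_flow_autonomous:
  assumes c: "c1 \<noteq> 0" "c2 \<noteq> 0" and W: "open W" "S2xS2 \<subseteq> W" "smooth_on_open W F"
    and init: "\<And>x. x \<in> S2xS2 \<Longrightarrow> \<Phi> 0 x = x"
    and stay: "\<And>t x. x \<in> S2xS2 \<Longrightarrow> \<Phi> t x \<in> S2xS2"
    and ode: "\<And>t x. x \<in> S2xS2 \<Longrightarrow> \<exists>g1 g2. (F has_derivative (\<lambda>v. g1 \<bullet> fst v + g2 \<bullet> snd v)) (at (\<Phi> t x)) \<and>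
      ((\<lambda>s. \<Phi> s x) has_vector_derivative ham_field c1 c2 g1 g2 (\<Phi> t x)) (at t)"
  shows "hamiltonian_flow (round_form c1 c2) (\<lambda>(t, x). F x) \<Phi>"
  unfolding hamiltonian_flow_def
proof (intro conjI ballI)
  have "smooth_on_open (UNIV \<times> W) (\<lambda>y::real \<times> point. F (snd y))"
    by (rule smooth_on_open_compose[OF _ W(1) _ W(3)])
      (use W in \<open>auto intro!: open_Times smooth_intros\<close>)
  then show "\<exists>U. open U \<and> {0..1} \<times> S2xS2 \<subseteq> U \<and> smooth_on_open U (\<lambda>(t::real, x). F x)"
    using W by (intro exI[of _ "UNIV \<times> W"]) (auto simp: case_prod_unfold intro!: open_Times)
next
  fix t :: real and x :: point assume "t \<in> {0..1}" and x: "x \<in> S2xS2"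
  from ode[OF x, of t] obtain g1 g2 where g: "(F has_derivative (\<lambda>v. g1 \<bullet> fst v + g2 \<bullet> snd v)) (at (\<Phi> t x))"
      "((\<lambda>s. \<Phi> s x) has_vector_derivative ham_field c1 c2 g1 g2 (\<Phi> t x)) (at t)" by blast
  show "\<exists>X. hamiltonian_vector (round_form c1 c2) (\<lambda>y. case (t, y) of (t, x) \<Rightarrow> F x) (\<Phi> t x) X \<and>
      ((\<lambda>s. \<Phi> s x) has_vector_derivative X) (at t within {0..1})"
    using hamiltonian_vector_ham_field[OF c stay[OF x] g(1)] has_vector_derivative_at_within[OF g(2)]
    by (intro exI[of _ "ham_field c1 c2 g1 g2 (\<Phi> t x)"]) simp
qed (use init stay in auto)

lemma ham_equivalentI:
  assumes "hamiltonian_flow \<Omega> H \<Phi>" "\<Phi> 1 ` L = L'"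
  shows "ham_equivalent \<Omega> L L'"
  unfolding ham_equivalent_def Ham_def using assms by (intro bexI[of _ "\<Phi> 1"]) auto

lemma ham_equivalentE:
  assumes "ham_equivalent \<Omega> L L'" "L \<subseteq> S2xS2"
  obtains H \<Phi> where "hamiltonian_flow \<Omega> H \<Phi>" "\<Phi> 1 ` L = L'"
proof -
  from assms obtain \<phi> H \<Phi> where "hamiltonian_flow \<Omega> H \<Phi>" "\<forall>x\<in>S2xS2. \<phi> x = \<Phi> 1 x" "\<phi> ` L = L'"
    by (auto simp: ham_equivalent_def Ham_def)
  moreover have "\<Phi> 1 ` L = \<phi> ` L" using calculation(2) assms(2) by (intro image_cong) auto
  ultimately show thesis using that by simp
qed

lemma ham_equivalent_refl:
  assumes "c1 \<noteq> 0" "c2 \<noteq> 0"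
  shows "ham_equivalent (round_form c1 c2) L L"
proof (rule ham_equivalentI)
  show "hamiltonian_flow (round_form c1 c2) (\<lambda>(t, x). 0) (\<lambda>t x. x)"
  proof (rule hamiltonian_flow_autonomous[OF assms open_UNIV])
    fix t :: real and x :: point
    have "((\<lambda>x::point. 0::real) has_derivative (\<lambda>v. 0 \<bullet> fst v + 0 \<bullet> snd v)) (at x)" by simp
    moreover have "((\<lambda>s::real. x) has_vector_derivative ham_field c1 c2 0 0 x) (at t)"
      by (simp add: ham_field_def has_vector_derivative_def zero_prod_def[symmetric])
    ultimately show "\<exists>g1 g2. ((\<lambda>x. 0::real) has_derivative (\<lambda>v. g1 \<bullet> fst v + g2 \<bullet> snd v)) (at x) \<and>
      ((\<lambda>s::real. x) has_vector_derivative ham_field c1 c2 g1 g2 x) (at t)" by blast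
  qed auto
qed simp

lemma hamiltonian_vector_scale:
  assumes "hamiltonian_vector (round_form c1 c2) F x X" "F differentiable (at x)"
  shows "hamiltonian_vector (round_form c1 c2) (\<lambda>y. a * F y) x (a *\<^sub>R X)"
proof -
  have "((\<lambda>y. a * F y) has_derivative (\<lambda>v. a * frechet_derivative F (at x) v)) (at x)"
    using assms(2) by (intro has_derivative_mult_right) (simp add: frechet_derivative_works)
  then have "frechet_derivative (\<lambda>y. a * F y) (at x) = (\<lambda>v. a * frechet_derivative F (at x) v)"
    using frechet_derivative_at by metis
  moreover have "round_form c1 c2 x (a *\<^sub>R X) v = a * round_form c1 c2 x X v" for v
    by (simp add: round_form_def sum_form_def cross_mult_left algebra_simps)
  moreover have "a *\<^sub>R X \<in> tangent_S2xS2 x" if "X \<in> tangent_S2xS2 x"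
    using that by (simp add: tangent_S2xS2_def tangent_S2_def mem_Times_iff)
  ultimately show ?thesis
    using assms(1) unfolding hamiltonian_vector_def by simp
qed

lemma hamiltonian_flowD:
  assumes "hamiltonian_flow \<Omega> H \<Phi>"
  shows "\<exists>U. open U \<and> {0..1} \<times> S2xS2 \<subseteq> U \<and> smooth_on_open U H"
    and "x \<in> S2xS2 \<Longrightarrow> \<Phi> 0 x = x"
    and "t \<in> {0..1} \<Longrightarrow> x \<in> S2xS2 \<Longrightarrow> \<Phi> t x \<in> S2xS2"
    and "t \<in> {0..1} \<Longrightarrow> x \<in> S2xS2 \<Longrightarrow> \<exists>X. hamiltonian_vector \<Omega> (\<lambda>y. H (t, y)) (\<Phi> t x) X \<and>
             ((\<lambda>s. \<Phi> s x) has_vector_derivative X) (at t within {0..1})"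
proof -
  note a = assms[unfolded hamiltonian_flow_def]
  show "\<exists>U. open U \<and> {0..1} \<times> S2xS2 \<subseteq> U \<and> smooth_on_open U H"
    by (rule conjunct1[OF a])
  show "\<Phi> 0 x = x" if "x \<in> S2xS2"
    by (rule bspec[OF conjunct1[OF conjunct2[OF a]] that])
  note b = bspec[OF bspec[OF conjunct2[OF conjunct2[OF a]]]]
  show "\<Phi> t x \<in> S2xS2" if "t \<in> {0..1}" "x \<in> S2xS2"
    by (rule conjunct1[OF b[OF that]])
  show "\<exists>X. hamiltonian_vector \<Omega> (\<lambda>y. H (t, y)) (\<Phi> t x) X \<and>
             ((\<lambda>s. \<Phi> s x) has_vector_derivative X) (at t within {0..1})" if "t \<in> {0..1}" "x \<in> S2xS2"
    by (rule conjunct2[OF b[OF that]])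
qed

text \<open>A flow run at speed \<open>s'\<close> is generated by \<open>s'\<close> times the
  Hamiltonian. Since \<sigma> takes all its values in \<open>{0..1}\<close>, the derivative within
  the interval becomes a two-sided derivative in t.\<close>

lemma hamiltonian_flow_reparametrize:
  assumes fl: "hamiltonian_flow (round_form c1 c2) H \<Phi>" and x: "x \<in> S2xS2"
    and s: "(\<sigma> has_real_derivative s') (at t)" "\<And>x. \<sigma> x \<in> {0..1}"
  shows "\<exists>X. hamiltonian_vector (round_form c1 c2) (\<lambda>y. s' * H (\<sigma> t, y)) (\<Phi> (\<sigma> t) x) X \<and>
     ((\<lambda>s. \<Phi> (\<sigma> s) x) has_vector_derivative X) (at t)"
proof -
  from hamiltonian_flowD(4)[OF fl s(2)[of t] x] obtain X where X: "hamiltonian_vector (round_form c1 c2) (\<lambda>y. H (\<sigma> t, y)) (\<Phi> (\<sigma> t) x) X"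
     "((\<lambda>s. \<Phi> s x) has_vector_derivative X) (at (\<sigma> t) within {0..1})"
    by blast
  have m: "\<Phi> (\<sigma> t) x \<in> S2xS2" by (rule hamiltonian_flowD(3)[OF fl s(2)[of t] x])
  from hamiltonian_flowD(1)[OF fl] obtain U where U: "open U" "{0..1} \<times> S2xS2 \<subseteq> U" "smooth_on_open U H" by blast
  have "(\<sigma> t, \<Phi> (\<sigma> t) x) \<in> U" by (rule subsetD[OF U(2) SigmaI[OF s(2) m]])
  from smooth_on_open_has_derivative[OF U(3) this]
  have d: "(H has_derivative frechet_derivative H (at (\<sigma> t, \<Phi> (\<sigma> t) x))) (at (\<sigma> t, \<Phi> (\<sigma> t) x))" .
  have "((\<lambda>y. (\<sigma> t, y)) has_derivative (\<lambda>v. (0, v))) (at (\<Phi> (\<sigma> t) x))"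
    by (auto intro!: derivative_eq_intros)
  from diff_chain_at[OF this d] have "(\<lambda>y. H (\<sigma> t, y)) differentiable (at (\<Phi> (\<sigma> t) x))"
    unfolding o_def by (rule differentiableI)
  from hamiltonian_vector_scale[OF X(1) this]
  have 1: "hamiltonian_vector (round_form c1 c2) (\<lambda>y. s' * H (\<sigma> t, y)) (\<Phi> (\<sigma> t) x) (s' *\<^sub>R X)" .
  have "(\<sigma> has_vector_derivative s') (at t within UNIV)"
    using s(1) by (simp add: has_real_derivative_iff_has_vector_derivative)
  moreover have "((\<lambda>s. \<Phi> s x) has_vector_derivative X) (at (\<sigma> t) within \<sigma> ` UNIV)"
    by (rule has_vector_derivative_within_subset[OF X(2)]) (use s(2) in auto)
  ultimately have "((\<lambda>s. \<Phi> s x) \<circ> \<sigma> has_vector_derivative s' *\<^sub>R X) (at t within UNIV)"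
    by (rule vector_diff_chain_within)
  then have "((\<lambda>s. \<Phi> (\<sigma> s) x) has_vector_derivative s' *\<^sub>R X) (at t)" by (simp add: o_def)
  then show ?thesis using 1 by (intro exI[of _ "s' *\<^sub>R X"] conjI)
qed

text \<open>Concatenation of two flows. Both are brought to rest during the middle third of the time
  interval, so the two Hamiltonians act in disjoint periods and their sum K is smooth.\<close>

lemma ham_equivalent_trans:
  assumes 1: "ham_equivalent (round_form c1 c2) L L'" and 2: "ham_equivalent (round_form c1 c2) L' L''"
    and L: "L \<subseteq> S2xS2"
  shows "ham_equivalent (round_form c1 c2) L L''"
proof -
  obtain H \<Phi> where f: "hamiltonian_flow (round_form c1 c2) H \<Phi>" "\<Phi> 1 ` L = L'"
    using ham_equivalentE[OF 1 L] by blast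
  have st: "\<Phi> t x \<in> S2xS2" if "t \<in> {0..1}" "x \<in> S2xS2" for t x
    by (rule hamiltonian_flowD(3)[OF f(1) that])
  have L': "L' \<subseteq> S2xS2" unfolding f(2)[symmetric] using L st[of 1] by (intro image_subsetI) (simp add: subsetD)
  obtain H' \<Phi>' where f': "hamiltonian_flow (round_form c1 c2) H' \<Phi>'" "\<Phi>' 1 ` L' = L''"
    using ham_equivalentE[OF 2 L'] by blast
  have st': "\<Phi>' t x \<in> S2xS2" if "t \<in> {0..1}" "x \<in> S2xS2" for t x
    by (rule hamiltonian_flowD(3)[OF f'(1) that])
  have i: "\<Phi> 0 x = x" "\<Phi>' 0 x = x" if "x \<in> S2xS2" for x
    by (rule hamiltonian_flowD(2)[OF f(1) that], rule hamiltonian_flowD(2)[OF f'(1) that])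
  obtain U where U: "open U" "{0..1} \<times> S2xS2 \<subseteq> U" "smooth_on_open U H"
    using hamiltonian_flowD(1)[OF f(1)] by blast
  obtain U' where U': "open U'" "{0..1} \<times> S2xS2 \<subseteq> U'" "smooth_on_open U' H'"
    using hamiltonian_flowD(1)[OF f'(1)] by blast
  obtain \<sigma> \<sigma>' where s: "smooth_on_open UNIV \<sigma>" "smooth_on_open UNIV \<sigma>'"
    "\<And>x. (\<sigma> has_real_derivative \<sigma>' x) (at x)"
    "\<And>x. \<sigma> x \<in> {0..1}" "\<And>x. x \<le> 0 \<Longrightarrow> \<sigma> x = 0" "\<And>x. x \<ge> 1/3 \<Longrightarrow> \<sigma> x = 1"
    "\<And>x. x \<le> 0 \<Longrightarrow> \<sigma>' x = 0" "\<And>x. x \<ge> 1/3 \<Longrightarrow> \<sigma>' x = 0"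
    by (rule smooth_step_exists[of 0 "1/3"], simp, rule that, assumption+)
  obtain \<tau> \<tau>' where t: "smooth_on_open UNIV \<tau>" "smooth_on_open UNIV \<tau>'"
    "\<And>x. (\<tau> has_real_derivative \<tau>' x) (at x)"
    "\<And>x. \<tau> x \<in> {0..1}" "\<And>x. x \<le> 2/3 \<Longrightarrow> \<tau> x = 0" "\<And>x. x \<ge> 1 \<Longrightarrow> \<tau> x = 1"
    "\<And>x. x \<le> 2/3 \<Longrightarrow> \<tau>' x = 0" "\<And>x. x \<ge> 1 \<Longrightarrow> \<tau>' x = 0"
    by (rule smooth_step_exists[of "2/3" 1], simp, rule that, assumption+)
  define K where "K y = \<sigma>' (fst y) * H (\<sigma> (fst y), snd y) + \<tau>' (fst y) * H' (\<tau> (fst y), snd y)" for y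
  define \<Psi> where "\<Psi> r x = \<Phi>' (\<tau> r) (\<Phi> (\<sigma> r) x)" for r x
  define V where "V = (\<lambda>y. (\<sigma> (fst y), snd y)) -` U \<inter> (\<lambda>y. (\<tau> (fst y), snd y)) -` U'"
  have sm1: "smooth_on_open UNIV (\<lambda>y::real \<times> point. \<rho> (fst y))" if "smooth_on_open UNIV \<rho>" for \<rho> :: "real \<Rightarrow> real"
    by (rule smooth_on_open_compose[OF open_UNIV open_UNIV _ that]) (auto intro!: smooth_intros)
  have sm2: "smooth_on_open UNIV (\<lambda>y::real \<times> point. (\<rho> (fst y), snd y))" if "smooth_on_open UNIV \<rho>" for \<rho> :: "real \<Rightarrow> real"
    by (intro smooth_intros sm1[OF that] open_UNIV)
  have cont: "continuous_on UNIV (\<lambda>y::real \<times> point. (\<rho> (fst y), snd y))" if "smooth_on_open UNIV \<rho>" for \<rho> :: "real \<Rightarrow> real"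
    by (rule smooth_on_open_imp_continuous_on[OF sm2[OF that]])
  have oV: "open V" unfolding V_def
    by (intro open_Int open_vimage U(1) U'(1) cont s(1) t(1))
  have smK: "smooth_on_open V K"
  proof -
    have "smooth_on_open V (\<lambda>y. H (\<sigma> (fst y), snd y))"
      by (rule smooth_on_open_compose[OF oV U(1) smooth_on_open_subset[OF sm2[OF s(1)]] U(3)]) (auto simp: V_def)
    moreover have "smooth_on_open V (\<lambda>y. H' (\<tau> (fst y), snd y))"
      by (rule smooth_on_open_compose[OF oV U'(1) smooth_on_open_subset[OF sm2[OF t(1)]] U'(3)]) (auto simp: V_def)
    ultimately show ?thesis unfolding K_def
      by (intro smooth_intros oV smooth_on_open_subset[OF sm1[OF s(2)]] smooth_on_open_subset[OF sm1[OF t(2)]]) auto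
  qed
  have ode: "\<exists>X. hamiltonian_vector (round_form c1 c2) (\<lambda>y. K (r, y)) (\<Psi> r x) X \<and>
             ((\<lambda>s. \<Psi> s x) has_vector_derivative X) (at r)" if x: "x \<in> S2xS2" for r x
  \<comment> \<open>The ranges r < 2/3 and r > 1/3 are open and cover the line, and on each of them
    \<Psi> is a single reparametrized flow; hence a two-sided derivative exists at every r.\<close>
  proof (cases "r < 2/3")
    case True
    from hamiltonian_flow_reparametrize[OF f(1) x s(3,4), of r] obtain X where
      X: "hamiltonian_vector (round_form c1 c2) (\<lambda>y. \<sigma>' r * H (\<sigma> r, y)) (\<Phi> (\<sigma> r) x) X"
        "((\<lambda>s. \<Phi> (\<sigma> s) x) has_vector_derivative X) (at r)" by blast
    have e: "\<Psi> q x = \<Phi> (\<sigma> q) x" if "q < 2/3" for q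
      using t(5)[of q] that i(2)[OF st[OF s(4) x]] by (simp add: \<Psi>_def)
    have "((\<lambda>s. \<Psi> s x) has_vector_derivative X) (at r)"
      by (rule has_vector_derivative_transform_within_open[OF X(2), of "{..<2/3}"]) (use True e in auto)
    then show ?thesis using X(1) e[OF True] t(7)[of r] True
      by (intro exI[of _ X]) (simp add: K_def)
  next
    case False
    define y where "y = \<Phi> 1 x"
    have y: "y \<in> S2xS2" unfolding y_def using st[of 1 x] x by simp
    from hamiltonian_flow_reparametrize[OF f'(1) y t(3,4), of r] obtain X where
      X: "hamiltonian_vector (round_form c1 c2) (\<lambda>y. \<tau>' r * H' (\<tau> r, y)) (\<Phi>' (\<tau> r) y) X"
        "((\<lambda>s. \<Phi>' (\<tau> s) y) has_vector_derivative X) (at r)" by blast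
    have e: "\<Psi> q x = \<Phi>' (\<tau> q) y" if "q > 1/3" for q
      using s(6)[of q] that by (simp add: \<Psi>_def y_def)
    have "((\<lambda>s. \<Psi> s x) has_vector_derivative X) (at r)"
      by (rule has_vector_derivative_transform_within_open[OF X(2), of "{1/3<..}"]) (use False e in auto)
    then show ?thesis using X(1) e[of r] s(8)[of r] False
      by (intro exI[of _ X]) (simp add: K_def)
  qed
  have "hamiltonian_flow (round_form c1 c2) K \<Psi>"
    unfolding hamiltonian_flow_def
  proof (intro conjI ballI)
    show "\<exists>U. open U \<and> {0..1} \<times> S2xS2 \<subseteq> U \<and> smooth_on_open U K"
    proof (intro exI[of _ V] conjI oV smK)
      have "(\<sigma> r, x) \<in> U" "(\<tau> r, x) \<in> U'" if "x \<in> S2xS2" for r x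
        by (rule subsetD[OF U(2) SigmaI[OF s(4) that]], rule subsetD[OF U'(2) SigmaI[OF t(4) that]])
      then show "{0..1} \<times> S2xS2 \<subseteq> V" unfolding V_def by auto
    qed
    show "\<Psi> 0 x = x" if "x \<in> S2xS2" for x
      using s(5)[of 0] t(5)[of 0] i that by (simp add: \<Psi>_def)
    fix r :: real and x :: point assume r: "r \<in> {0..1}" "x \<in> S2xS2"
    show "\<Psi> r x \<in> S2xS2" unfolding \<Psi>_def by (intro st st' s(4) t(4) r(2))
    show "\<exists>X. hamiltonian_vector (round_form c1 c2) (\<lambda>y. K (r, y)) (\<Psi> r x) X \<and>
             ((\<lambda>s. \<Psi> s x) has_vector_derivative X) (at r within {0..1})"
      by (rule ex_forward[OF ode[OF r(2), of r]]) (auto intro: has_vector_derivative_at_within)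
  qed
  moreover have "\<Psi> 1 ` L = L''"
  proof -
    have "\<Psi> 1 = \<Phi>' 1 \<circ> \<Phi> 1" using s(6)[of 1] t(6)[of 1] by (auto simp: \<Psi>_def)
    then have "\<Psi> 1 ` L = \<Phi>' 1 ` (\<Phi> 1 ` L)" by (simp only: image_comp)
    then show ?thesis by (simp only: f(2) f'(2))
  qed
  ultimately show ?thesis by (rule ham_equivalentI)
qed

subsection \<open>Rotations and reflections along probes\<close>

definition round_torus :: "real \<Rightarrow> real \<Rightarrow> point set" where
  "round_torus z1 z2 = {p \<in> S2. p $ 3 = z1} \<times> {q \<in> S2. q $ 3 = z2}"

lemma round_torus_subset: "round_torus z1 z2 \<subseteq> S2xS2"
  by (auto simp: round_torus_def)

lemma has_vector_derivative_vector3: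
  assumes "(f has_real_derivative f') F" "(g has_real_derivative g') F" "(h has_real_derivative h') F"
  shows "((\<lambda>t. vector [f t, g t, h t] :: real^3) has_vector_derivative vector [f', g', h']) F"
proof -
  have e: "(vector [a, b, c] :: real^3) = a *\<^sub>R axis 1 1 + b *\<^sub>R axis 2 1 + c *\<^sub>R axis 3 1" for a b c
    by (simp add: vec3_eq_iff axis_def)
  show ?thesis unfolding e
    by (intro has_vector_derivative_add bounded_linear.has_vector_derivative[OF bounded_linear_scaleR_left]
        assms[unfolded has_real_derivative_iff_has_vector_derivative])
qed

lemma has_vector_derivative_real3:
  fixes f :: "real \<Rightarrow> real^3"
  assumes "((\<lambda>t. f t $ 1) has_real_derivative d $ 1) F" "((\<lambda>t. f t $ 2) has_real_derivative d $ 2) F"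
    "((\<lambda>t. f t $ 3) has_real_derivative d $ 3) F"
  shows "(f has_vector_derivative d) F"
proof -
  have "(\<lambda>t. vector [f t $ 1, f t $ 2, f t $ 3]) = f" "vector [d $ 1, d $ 2, d $ 3] = d"
    by (simp_all add: fun_eq_iff vec3_eq_iff)
  then show ?thesis using has_vector_derivative_vector3[OF assms] by simp
qed

text \<open>Rotation about the first coordinate axis. This axis is horizontal, so a half turn
  exchanges the latitudes z and -z.\<close>

definition turn :: "real \<Rightarrow> real^3 \<Rightarrow> real^3" where
  "turn t p = vector [p$1, p$2 * cos t - p$3 * sin t, p$3 * cos t + p$2 * sin t]"

lemma turn_nth [simp]: "turn t p $ 1 = p$1" "turn t p $ 2 = p$2 * cos t - p$3 * sin t"
  "turn t p $ 3 = p$3 * cos t + p$2 * sin t"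
  by (simp_all add: turn_def)

lemma rot_sq: "(a * cos t - b * sin t)\<^sup>2 + (b * cos t + a * sin t)\<^sup>2 = a\<^sup>2 + (b::real)\<^sup>2"
proof -
  have "(a * cos t - b * sin t)\<^sup>2 + (b * cos t + a * sin t)\<^sup>2 = (a\<^sup>2 + b\<^sup>2) * ((cos t)\<^sup>2 + (sin t)\<^sup>2)"
    by algebra
  then show ?thesis by simp
qed

lemma turn_S2: "p \<in> S2 \<Longrightarrow> turn t p \<in> S2"
  unfolding S2_iff by (simp add: rot_sq add.assoc)

lemma norm_turn [simp]: "norm p = 1 \<Longrightarrow> norm (turn t p) = 1"
  using turn_S2[of p t] by simp

lemma turn_derivative:
  "((\<lambda>t. turn (pi * t) p) has_vector_derivative ((pi *\<^sub>R axis 1 1) \<otimes> turn (pi * t) p)) (at t)"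
  by (rule has_vector_derivative_real3)
    (auto simp: cross3_nth axis_def algebra_simps intro!: derivative_eq_intros)

lemma turn_pi_image: "turn pi ` {p \<in> S2. p $ 3 = z} = {p \<in> S2. p $ 3 = - z}"
proof -
  have "turn pi (turn pi p) = p" for p by (simp add: vec3_eq_iff)
  moreover have "turn pi p \<in> {p \<in> S2. p $ 3 = - z}" if "p \<in> {p \<in> S2. p $ 3 = z}" for p z
    using that turn_S2[of _ pi] by auto
  ultimately show ?thesis
    by (intro subset_antisym subsetI) (auto intro!: image_eqI[of _ "turn pi" "turn pi _"])
qed

lemma inner_pi_axis: "(c * pi) * v $ 1 = ((c * pi) *\<^sub>R axis 1 1) \<bullet> (v::real^3)"
  by (simp add: inner_axis')

lemma ham_equivalent_reflect_fst:
  assumes c: "c1 \<noteq> 0" "c2 \<noteq> 0"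
  shows "ham_equivalent (round_form c1 c2) (round_torus z1 z2) (round_torus (- z1) z2)"
proof (rule ham_equivalentI)
  let ?\<Phi> = "\<lambda>t x. (turn (pi * t) (fst x), snd x)"
  show "hamiltonian_flow (round_form c1 c2) (\<lambda>(t, x). c1 * pi * fst x $ 1) ?\<Phi>"
  proof (rule hamiltonian_flow_autonomous[OF c open_UNIV])
    show "smooth_on_open UNIV (\<lambda>x::point. c1 * pi * fst x $ 1)" by (intro smooth_intros open_UNIV)
    fix t :: real and x :: point assume "x \<in> S2xS2"
    show "\<exists>g1 g2. ((\<lambda>x. c1 * pi * fst x $ 1) has_derivative (\<lambda>v. g1 \<bullet> fst v + g2 \<bullet> snd v)) (at (?\<Phi> t x)) \<and>
       ((\<lambda>s. ?\<Phi> s x) has_vector_derivative ham_field c1 c2 g1 g2 (?\<Phi> t x)) (at t)"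
    proof (intro exI conjI)
      show "((\<lambda>x. c1 * pi * fst x $ 1) has_derivative (\<lambda>v. ((c1 * pi) *\<^sub>R axis 1 1) \<bullet> fst v + 0 \<bullet> snd v)) (at (?\<Phi> t x))"
        unfolding inner_pi_axis by (auto intro!: derivative_eq_intros)
      have "ham_field c1 c2 ((c1 * pi) *\<^sub>R axis 1 1) 0 (?\<Phi> t x) = ((pi *\<^sub>R axis 1 1) \<otimes> turn (pi * t) (fst x), 0)"
        using c by (simp add: ham_field_def cross_mult_left)
      then show "((\<lambda>s. ?\<Phi> s x) has_vector_derivative ham_field c1 c2 ((c1 * pi) *\<^sub>R axis 1 1) 0 (?\<Phi> t x)) (at t)"
        by (auto intro!: has_vector_derivative_Pair turn_derivative)
    qed
  qed (auto simp: vec3_eq_iff)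
  show "?\<Phi> 1 ` round_torus z1 z2 = round_torus (- z1) z2"
  proof -
    have *: "?\<Phi> 1 ` (A \<times> B) = (turn pi ` A) \<times> B" for A B by force
    show ?thesis unfolding round_torus_def by (simp only: * turn_pi_image)
  qed
qed

lemma ham_equivalent_reflect_snd:
  assumes c: "c1 \<noteq> 0" "c2 \<noteq> 0"
  shows "ham_equivalent (round_form c1 c2) (round_torus z1 z2) (round_torus z1 (- z2))"
proof (rule ham_equivalentI)
  let ?\<Phi> = "\<lambda>t x. (fst x, turn (pi * t) (snd x))"
  show "hamiltonian_flow (round_form c1 c2) (\<lambda>(t, x). c2 * pi * snd x $ 1) ?\<Phi>"
  proof (rule hamiltonian_flow_autonomous[OF c open_UNIV])
    show "smooth_on_open UNIV (\<lambda>x::point. c2 * pi * snd x $ 1)" by (intro smooth_intros open_UNIV)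
    fix t :: real and x :: point assume "x \<in> S2xS2"
    show "\<exists>g1 g2. ((\<lambda>x. c2 * pi * snd x $ 1) has_derivative (\<lambda>v. g1 \<bullet> fst v + g2 \<bullet> snd v)) (at (?\<Phi> t x)) \<and>
       ((\<lambda>s. ?\<Phi> s x) has_vector_derivative ham_field c1 c2 g1 g2 (?\<Phi> t x)) (at t)"
    proof (intro exI conjI)
      show "((\<lambda>x. c2 * pi * snd x $ 1) has_derivative (\<lambda>v. 0 \<bullet> fst v + ((c2 * pi) *\<^sub>R axis 1 1) \<bullet> snd v)) (at (?\<Phi> t x))"
        unfolding inner_pi_axis by (auto intro!: derivative_eq_intros)
      have "ham_field c1 c2 0 ((c2 * pi) *\<^sub>R axis 1 1) (?\<Phi> t x) = (0, (pi *\<^sub>R axis 1 1) \<otimes> turn (pi * t) (snd x))"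
        using c by (simp add: ham_field_def cross_mult_left)
      then show "((\<lambda>s. ?\<Phi> s x) has_vector_derivative ham_field c1 c2 0 ((c2 * pi) *\<^sub>R axis 1 1) (?\<Phi> t x)) (at t)"
        by (auto intro!: has_vector_derivative_Pair turn_derivative)
    qed
  qed (auto simp: vec3_eq_iff)
  show "?\<Phi> 1 ` round_torus z1 z2 = round_torus z1 (- z2)"
  proof -
    have *: "?\<Phi> 1 ` (A \<times> B) = A \<times> (turn pi ` B)" for A B by force
    show ?thesis unfolding round_torus_def by (simp only: * turn_pi_image)
  qed
qed

lemma gradient_eq_inner:
  assumes "linear (D :: point \<Rightarrow> real)"
  shows "D = (\<lambda>v. vector [D (axis 1 1, 0), D (axis 2 1, 0), D (axis 3 1, 0)] \<bullet> fst v +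
    vector [D (0, axis 1 1), D (0, axis 2 1), D (0, axis 3 1)] \<bullet> snd v)"
proof
  fix v :: point
  have "v = (fst v $ 1) *\<^sub>R (axis 1 1, 0) + (fst v $ 2) *\<^sub>R (axis 2 1, 0) + (fst v $ 3) *\<^sub>R (axis 3 1, 0) +
    (snd v $ 1) *\<^sub>R (0, axis 1 1) + (snd v $ 2) *\<^sub>R (0, axis 2 1) + (snd v $ 3) *\<^sub>R (0, axis 3 1)"
    by (simp add: prod_eq_iff vec3_eq_iff axis_def)
  then have "D v = D ((fst v $ 1) *\<^sub>R (axis 1 1, 0) + (fst v $ 2) *\<^sub>R (axis 2 1, 0) + (fst v $ 3) *\<^sub>R (axis 3 1, 0) +
    (snd v $ 1) *\<^sub>R (0, axis 1 1) + (snd v $ 2) *\<^sub>R (0, axis 2 1) + (snd v $ 3) *\<^sub>R (0, axis 3 1))" by simp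
  also have "\<dots> = (fst v $ 1) * D (axis 1 1, 0) + (fst v $ 2) * D (axis 2 1, 0) + (fst v $ 3) * D (axis 3 1, 0) +
    (snd v $ 1) * D (0, axis 1 1) + (snd v $ 2) * D (0, axis 2 1) + (snd v $ 3) * D (0, axis 3 1)"
    by (simp only: linear_add[OF assms] linear_scale[OF assms] real_scaleR_def)
  finally show "D v = vector [D (axis 1 1, 0), D (axis 2 1, 0), D (axis 3 1, 0)] \<bullet> fst v +
    vector [D (0, axis 1 1), D (0, axis 2 1), D (0, axis 3 1)] \<bullet> snd v"
    by (simp add: inner_real3)
qed

lemma ham_field_zero: "ham_field c1 c2 0 0 x = 0"
  by (simp add: ham_field_def zero_prod_def)

text \<open>
  The cutoff \<open>\<beta> \<circ> J\<close> makes \<open>K\<close> a global Hamiltonian. Since \<open>J\<close> and \<open>K\<close> are constant along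
  trajectories, the flow of \<open>\<beta>(J) K\<close> is a flow of \<open>a J + b K\<close> with constants \<open>a\<close>, \<open>b\<close> depending
  on the trajectory.
\<close>

lemma cutoff_hamiltonian_flow:
  fixes J K :: "point \<Rightarrow> real"
  assumes c: "c1 \<noteq> 0" "c2 \<noteq> 0" and e: "e > 0" and W: "open W" "smooth_on_open W K" and J: "smooth_on_open UNIV J"
    and sub: "\<And>x. x \<in> S2xS2 \<Longrightarrow> \<bar>J x - j0\<bar> < e \<Longrightarrow> x \<in> W"
    and flow: "\<And>a b t x. x \<in> S2xS2 \<Longrightarrow> \<bar>J x - j0\<bar> < e \<Longrightarrow> \<Psi> a b 0 x = x \<and> \<Psi> a b t x \<in> S2xS2 \<and>
        J (\<Psi> a b t x) = J x \<and> K (\<Psi> a b t x) = K x \<and>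
        (\<exists>g1 g2 k1 k2. (J has_derivative (\<lambda>v. g1 \<bullet> fst v + g2 \<bullet> snd v)) (at (\<Psi> a b t x)) \<and>
           (K has_derivative (\<lambda>v. k1 \<bullet> fst v + k2 \<bullet> snd v)) (at (\<Psi> a b t x)) \<and>
           ((\<lambda>s. \<Psi> a b s x) has_vector_derivative
              ham_field c1 c2 (a *\<^sub>R g1 + b *\<^sub>R k1) (a *\<^sub>R g2 + b *\<^sub>R k2) (\<Psi> a b t x)) (at t))"
  obtains H \<Phi> where "hamiltonian_flow (round_form c1 c2) H \<Phi>"
    "\<And>x. x \<in> S2xS2 \<Longrightarrow> J x = j0 \<Longrightarrow> \<Phi> 1 x = \<Psi> 0 \<theta> 1 x"
proof -
  \<comment> \<open>The cutoff already ends at half the radius: the open set where F is known to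
    vanish and the domain of K then cover the whole product.\<close>
  have "e / 2 > 0" using e by simp
  from smooth_bump_exists[OF this, of j0] obtain \<beta>0 \<beta>0' where b0: "smooth_on_open UNIV \<beta>0"
    "\<And>x. (\<beta>0 has_real_derivative \<beta>0' x) (at x)"
    "\<beta>0 j0 = 1" "\<beta>0' j0 = 0" "\<And>x. \<bar>x - j0\<bar> \<ge> e / 2 \<Longrightarrow> \<beta>0 x = 0" "\<And>x. \<bar>x - j0\<bar> \<ge> e / 2 \<Longrightarrow> \<beta>0' x = 0"
    by blast
  define \<beta> where "\<beta> x = \<theta> * \<beta>0 x" for x
  define \<beta>' where "\<beta>' x = \<theta> * \<beta>0' x" for x
  have b: "smooth_on_open UNIV \<beta>" "(\<beta> has_real_derivative \<beta>' x) (at x)" for x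
    unfolding \<beta>_def \<beta>'_def by (intro smooth_intros b0 open_UNIV, intro DERIV_cmult b0)
  define F where "F x = \<beta> (J x) * K x" for x
  define W2 where "W2 = {x. \<bar>J x - j0\<bar> > e / 2}"
  have oW2: "open W2" unfolding W2_def
    by (intro open_Collect_less continuous_intros smooth_on_open_imp_continuous_on[OF J])
  have F0: "F x = 0" if "x \<in> W2" for x
    using that b0(5)[of "J x"] by (simp add: F_def \<beta>_def W2_def)
  have cov: "S2xS2 \<subseteq> W \<union> W2"
  proof
    fix x assume "x \<in> S2xS2"
    then show "x \<in> W \<union> W2" using sub[of x] e by (cases "\<bar>J x - j0\<bar> < e") (auto simp: W2_def)
  qed
  have sF: "smooth_on_open (W \<union> W2) F"
  proof (rule smooth_on_open_Un)
    have "smooth_on_open W (\<lambda>x. \<beta> (J x))"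
      by (rule smooth_on_open_compose[OF W(1) open_UNIV smooth_on_open_subset[OF J] b(1)]) auto
    then show "smooth_on_open W F"
      unfolding F_def by (intro smooth_intros W)
    show "smooth_on_open W2 F"
      by (rule smooth_on_open_cong[OF oW2 _ smooth_on_open_const[of W2 0]]) (simp add: F0)
  qed
  \<comment> \<open>The coefficients of dJ and dK in the differential of
    \<open>\<beta> (J x) * K x\<close>. On the level j0 they are 0 and \<theta>, because the bump
    has value 1 and derivative 0 at its centre.\<close>
  define \<Phi> where "\<Phi> t x = (if \<bar>J x - j0\<bar> < e then \<Psi> (\<beta>' (J x) * K x) (\<beta> (J x)) t x else x)" for t x
  have fl: "hamiltonian_flow (round_form c1 c2) (\<lambda>(t, x). F x) \<Phi>"
  proof (rule hamiltonian_flow_autonomous[OF c _ cov sF])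
    show "open (W \<union> W2)" by (rule open_Un[OF W(1) oW2])
    show "\<Phi> 0 x = x" if "x \<in> S2xS2" for x
      using flow[OF that] by (simp add: \<Phi>_def)
    show "\<Phi> t x \<in> S2xS2" if "x \<in> S2xS2" for t x
      unfolding \<Phi>_def using flow[OF that] that by presburger
    fix t x assume x: "x \<in> S2xS2"
    show "\<exists>g1 g2. (F has_derivative (\<lambda>v. g1 \<bullet> fst v + g2 \<bullet> snd v)) (at (\<Phi> t x)) \<and>
      ((\<lambda>s. \<Phi> s x) has_vector_derivative ham_field c1 c2 g1 g2 (\<Phi> t x)) (at t)"
    proof (cases "\<bar>J x - j0\<bar> < e")
      case True
      define a where "a = \<beta>' (J x) * K x"
      define b' where "b' = \<beta> (J x)"
      define y where "y = \<Psi> a b' t x"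
      have y: "\<Phi> t x = y" using True by (simp add: \<Phi>_def y_def a_def b'_def)
      from flow[OF x True, of a b' t] obtain g1 g2 k1 k2 where
        J: "J y = J x" "K y = K x" and
        d: "(J has_derivative (\<lambda>v. g1 \<bullet> fst v + g2 \<bullet> snd v)) (at y)"
           "(K has_derivative (\<lambda>v. k1 \<bullet> fst v + k2 \<bullet> snd v)) (at y)" and
        v: "((\<lambda>s. \<Psi> a b' s x) has_vector_derivative
              ham_field c1 c2 (a *\<^sub>R g1 + b' *\<^sub>R k1) (a *\<^sub>R g2 + b' *\<^sub>R k2) y) (at t)"
        unfolding y_def by blast
      have "((\<lambda>x. \<beta> (J x)) has_derivative (\<lambda>v. \<beta>' (J y) * (g1 \<bullet> fst v + g2 \<bullet> snd v))) (at y)"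
        using diff_chain_at[OF d(1) b(2)[unfolded has_field_derivative_def]] by (simp add: o_def)
      from has_derivative_mult[OF this d(2)]
      have "(F has_derivative (\<lambda>v. (a *\<^sub>R g1 + b' *\<^sub>R k1) \<bullet> fst v + (a *\<^sub>R g2 + b' *\<^sub>R k2) \<bullet> snd v)) (at y)"
        unfolding F_def
        by (rule has_derivative_eq_rhs) (auto simp: fun_eq_iff J a_def b'_def inner_add_left algebra_simps)
      moreover have "(\<lambda>s. \<Phi> s x) = (\<lambda>s. \<Psi> a b' s x)" using True by (simp add: \<Phi>_def a_def b'_def)
      ultimately show ?thesis unfolding y using v
        by (intro exI[of _ "a *\<^sub>R g1 + b' *\<^sub>R k1"] exI[of _ "a *\<^sub>R g2 + b' *\<^sub>R k2"] conjI) simp_all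
    next
      case False
      then have x2: "x \<in> W2" and Px: "\<Phi> s x = x" for s using e by (auto simp: W2_def \<Phi>_def)
      have "(F has_derivative (\<lambda>v. 0)) (at x)"
        by (rule has_derivative_transform_within_open[OF has_derivative_const[of 0] oW2 x2]) (simp add: F0)
      then show ?thesis unfolding Px
        by (intro exI[of _ 0]) (simp add: ham_field_zero)
    qed
  qed
  show thesis
  proof (rule that[OF fl])
    fix x assume "x \<in> S2xS2" "J x = j0"
    then show "\<Phi> 1 x = \<Psi> 0 \<theta> 1 x" using e b0 by (simp add: \<Phi>_def \<beta>_def \<beta>'_def)
  qed
qed

section \<open>The shear move\<close>

context
  fixes c1 c2 :: real
begin

text \<open>J generates rotations of the two factors in opposite directions. They leave
  \<open>shear_K\<close> invariant, so the two functions commute and J is preserved by the flow of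
  K.\<close>

private definition shear_J :: "point \<Rightarrow> real" where
  "shear_J x = c1 * fst x $ 3 - c2 * snd x $ 3"

private definition shear_K :: "point \<Rightarrow> real" where
  "shear_K x = c2 * (fst x $ 1 * snd x $ 1 - fst x $ 2 * snd x $ 2) / sqrt ((fst x $ 1)\<^sup>2 + (fst x $ 2)\<^sup>2)"

text \<open>
  In the frame of the second sphere that rotates with the longitude of the first point, the flow
  of \<open>shear_K\<close> is a rotation about a horizontal axis.
\<close>

private definition shear_flow :: "real \<Rightarrow> real \<Rightarrow> real \<Rightarrow> point \<Rightarrow> point" where
  "shear_flow a b t x = (let
      r = sqrt ((fst x $ 1)\<^sup>2 + (fst x $ 2)\<^sup>2);
      C0 = fst x $ 1 / r; S0 = fst x $ 2 / r;
      C = C0 * cos (a * t) - S0 * sin (a * t); S = S0 * cos (a * t) + C0 * sin (a * t);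
      Q1 = C0 * snd x $ 1 - S0 * snd x $ 2; P2 = C0 * snd x $ 2 + S0 * snd x $ 1; P3 = snd x $ 3;
      Q2 = P2 * cos (b * t) - P3 * sin (b * t); Q3 = P3 * cos (b * t) + P2 * sin (b * t);
      z = (shear_J x + c2 * Q3) / c1; \<rho> = sqrt (1 - z\<^sup>2)
    in (vector [\<rho> * C, \<rho> * S, z], vector [C * Q1 + S * Q2, C * Q2 - S * Q1, Q3]))"

private lemma shear_K_derivative:
  assumes r: "r > 0" and x: "fst x $ 1 = r * C" "fst x $ 2 = r * S" "C\<^sup>2 + S\<^sup>2 = 1"
  shows "(shear_K has_derivative (\<lambda>v. vector [c2 * S * (C * snd x $ 2 + S * snd x $ 1) / r,
     - c2 * C * (C * snd x $ 2 + S * snd x $ 1) / r, 0] \<bullet> fst v + vector [c2 * C, - c2 * S, 0] \<bullet> snd v)) (at x)"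
proof -
  have "(r * C)\<^sup>2 + (r * S)\<^sup>2 = r\<^sup>2 * (C\<^sup>2 + S\<^sup>2)" by (simp add: power_mult_distrib distrib_left)
  then have R: "(fst x $ 1)\<^sup>2 + (fst x $ 2)\<^sup>2 = r\<^sup>2" using x by simp
  then have sR: "sqrt ((fst x $ 1)\<^sup>2 + (fst x $ 2)\<^sup>2) = r" using r by simp
  have pos: "(fst x $ 1)\<^sup>2 + (fst x $ 2)\<^sup>2 > 0" using R r by simp
  have n: "((\<lambda>x. c2 * (fst x $ 1 * snd x $ 1 - fst x $ 2 * snd x $ 2)) has_derivative
      (\<lambda>v. c2 * (fst v $ 1 * snd x $ 1 + fst x $ 1 * snd v $ 1 - (fst v $ 2 * snd x $ 2 + fst x $ 2 * snd v $ 2)))) (at x)"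
    by (auto intro!: derivative_eq_intros bounded_linear.has_derivative[OF bounded_linear_vec_nth] simp: algebra_simps)
  have "((\<lambda>x. (fst x $ 1)\<^sup>2 + (fst x $ 2)\<^sup>2) has_derivative
      (\<lambda>v. 2 * fst x $ 1 * fst v $ 1 + 2 * fst x $ 2 * fst v $ 2)) (at x)"
    by (auto intro!: derivative_eq_intros bounded_linear.has_derivative[OF bounded_linear_vec_nth] simp: algebra_simps)
  from has_derivative_real_sqrt[OF pos this]
  have s: "((\<lambda>x. sqrt ((fst x $ 1)\<^sup>2 + (fst x $ 2)\<^sup>2)) has_derivative
      (\<lambda>v. (C * fst v $ 1 + S * fst v $ 2))) (at x)"
    by (rule has_derivative_eq_rhs) (simp add: fun_eq_iff sR, use r in \<open>simp add: x(1,2) field_simps\<close>)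
  have nz: "sqrt ((fst x $ 1)\<^sup>2 + (fst x $ 2)\<^sup>2) \<noteq> 0" using sR r by simp
  have R2: "(r * C)\<^sup>2 + (r * S)\<^sup>2 = r\<^sup>2" using R x(1,2) by simp
  have alg: "(c2 * (u1 * q1 + r * C * w1 - (u2 * q2 + r * S * w2)) * r - c2 * (r * C * q1 - r * S * q2) * (C * u1 + S * u2)) / r\<^sup>2 =
      c2 * S * (C * q2 + S * q1) * u1 / r - c2 * C * (C * q2 + S * q1) * u2 / r + (c2 * C * w1 - c2 * S * w2)"
    for u1 u2 w1 w2 q1 q2
  proof -
    have "c2 * (u1 * q1 + r * C * w1 - (u2 * q2 + r * S * w2)) * r - c2 * (r * C * q1 - r * S * q2) * (C * u1 + S * u2) =
       (c2 * S * (C * q2 + S * q1) * u1 - c2 * C * (C * q2 + S * q1) * u2 + r * (c2 * C * w1 - c2 * S * w2)) * r"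
      using x(3) by algebra
    then show ?thesis using r by (simp add: field_simps power2_eq_square)
  qed
  have sr: "sqrt (r\<^sup>2) = r" using r by simp
  show ?thesis unfolding shear_K_def
    by (rule has_derivative_eq_rhs[OF has_derivative_divide'[OF n s nz]])
      (simp add: fun_eq_iff x(1,2) inner_real3 R2 sr abs_of_pos[OF r] alg power2_eq_square[symmetric])
qed

text \<open>The bound \<open>\<bar>shear_J x\<bar> + c2 < c1\<close> keeps the first point away from
  its poles, where \<open>shear_K\<close> is singular: whatever the second height w, the first
  height \<open>(shear_J x + c2 * w) / c1\<close> stays below 1 in absolute value.\<close>

private lemma shear_flow_properties:
  assumes c: "c1 > 0" "c2 > 0" and x: "x \<in> S2xS2" and J: "\<bar>shear_J x\<bar> + c2 < c1"
  shows "shear_flow a b 0 x = x \<and> shear_flow a b t x \<in> S2xS2 \<and>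
        shear_J (shear_flow a b t x) = shear_J x \<and> shear_K (shear_flow a b t x) = shear_K x \<and>
        (\<exists>g1 g2 k1 k2. (shear_J has_derivative (\<lambda>v. g1 \<bullet> fst v + g2 \<bullet> snd v)) (at (shear_flow a b t x)) \<and>
           (shear_K has_derivative (\<lambda>v. k1 \<bullet> fst v + k2 \<bullet> snd v)) (at (shear_flow a b t x)) \<and>
           ((\<lambda>s. shear_flow a b s x) has_vector_derivative
              ham_field c1 c2 (a *\<^sub>R g1 + b *\<^sub>R k1) (a *\<^sub>R g2 + b *\<^sub>R k2) (shear_flow a b t x)) (at t))"
proof -
  define r where "r = sqrt ((fst x $ 1)\<^sup>2 + (fst x $ 2)\<^sup>2)"
  have p: "(fst x $ 1)\<^sup>2 + (fst x $ 2)\<^sup>2 + (fst x $ 3)\<^sup>2 = 1" and q: "(snd x $ 1)\<^sup>2 + (snd x $ 2)\<^sup>2 + (snd x $ 3)\<^sup>2 = 1"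
    using x S2_iff by (auto simp: mem_Times_iff)
  have q3: "\<bar>snd x $ 3\<bar> \<le> 1" using q abs_le_square_iff[of "snd x $ 3" 1] by (smt (verit) one_power2 zero_le_power2)
  have zb: "((shear_J x + c2 * w) / c1)\<^sup>2 < 1" if "\<bar>w\<bar> \<le> 1" for w
  proof -
    have "\<bar>c2 * w\<bar> \<le> c2" using that c by (simp add: abs_mult mult_left_le)
    then have "\<bar>shear_J x + c2 * w\<bar> < c1" using J by linarith
    then have "\<bar>(shear_J x + c2 * w) / c1\<bar> < 1" using c by (simp add: field_simps)
    then show ?thesis by (simp add: abs_square_less_1)
  qed
  have "fst x $ 3 = (shear_J x + c2 * snd x $ 3) / c1" using c by (simp add: shear_J_def)
  then have p3: "(fst x $ 3)\<^sup>2 < 1" using zb[OF q3] by simp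
  then have r2: "r\<^sup>2 = 1 - (fst x $ 3)\<^sup>2" and r: "r > 0" using p by (simp_all add: r_def)
  define C0 S0 where "C0 = fst x $ 1 / r" and "S0 = fst x $ 2 / r"
  have C0: "fst x $ 1 = r * C0" "fst x $ 2 = r * S0" using r by (simp_all add: C0_def S0_def)
  have "r\<^sup>2 * (C0\<^sup>2 + S0\<^sup>2) = r\<^sup>2 * 1"
    using r2 p C0 by (simp add: power_mult_distrib distrib_left)
  then have CS0: "C0\<^sup>2 + S0\<^sup>2 = 1" using r by simp
  define C where "C s = C0 * cos (a * s) - S0 * sin (a * s)" for s
  define S where "S s = S0 * cos (a * s) + C0 * sin (a * s)" for s
  \<comment> \<open>Coordinates of the second point in the frame that turns with the longitude of
    the first. \<open>shear_K\<close> is c2 times the first coordinate, and its flow rotates the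
    other two.\<close>
  define Q1 P2 P3 where "Q1 = C0 * snd x $ 1 - S0 * snd x $ 2" and "P2 = C0 * snd x $ 2 + S0 * snd x $ 1" and "P3 = snd x $ 3"
  define Q2 where "Q2 s = P2 * cos (b * s) - P3 * sin (b * s)" for s
  define Q3 where "Q3 s = P3 * cos (b * s) + P2 * sin (b * s)" for s
  define z where "z s = (shear_J x + c2 * Q3 s) / c1" for s
  define \<rho> where "\<rho> s = sqrt (1 - (z s)\<^sup>2)" for s
  have fl: "shear_flow a b s x = (vector [\<rho> s * C s, \<rho> s * S s, z s], vector [C s * Q1 + S s * Q2 s, C s * Q2 s - S s * Q1, Q3 s])" for s
    unfolding shear_flow_def Let_def r_def[symmetric] C0_def[symmetric] S0_def[symmetric] C_def[symmetric] S_def[symmetric]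
      Q1_def[symmetric] P2_def[symmetric] P3_def[symmetric] Q2_def[symmetric] Q3_def[symmetric] z_def[symmetric] \<rho>_def[symmetric] ..
  have CS: "(C s)\<^sup>2 + (S s)\<^sup>2 = 1" for s
    unfolding C_def S_def using CS0 by (simp add: rot_sq)
  have Q0: "Q1\<^sup>2 + P2\<^sup>2 + P3\<^sup>2 = 1"
    using q CS0 unfolding Q1_def P2_def P3_def by algebra
  have Q: "Q1\<^sup>2 + (Q2 s)\<^sup>2 + (Q3 s)\<^sup>2 = 1" for s
    using Q0 unfolding Q2_def Q3_def by (simp add: add.assoc rot_sq)
  have Q3b: "\<bar>Q3 s\<bar> \<le> 1" for s
    using Q[of s] abs_le_square_iff[of "Q3 s" 1] by (smt (verit) one_power2 zero_le_power2)
  have z1: "(z s)\<^sup>2 < 1" for s unfolding z_def by (rule zb[OF Q3b])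
  have \<rho>: "\<rho> s > 0" "(\<rho> s)\<^sup>2 = 1 - (z s)\<^sup>2" for s using z1[of s] by (simp_all add: \<rho>_def)
  have cz: "c1 * z s = shear_J x + c2 * Q3 s" for s using c by (simp add: z_def)
  have 1: "shear_flow a b 0 x = x"
  proof -
    have "z 0 = fst x $ 3" using c by (simp add: z_def Q3_def P3_def shear_J_def)
    then have "\<rho> 0 = r" using r r2 by (simp add: \<rho>_def real_sqrt_unique)
    moreover have "C0 * Q1 + S0 * P2 = snd x $ 1" "C0 * P2 - S0 * Q1 = snd x $ 2"
      using CS0 unfolding Q1_def P2_def by algebra+
    ultimately show ?thesis using \<open>z 0 = fst x $ 3\<close> C0
      by (simp add: fl prod_eq_iff vec3_eq_iff C_def S_def Q2_def Q3_def P3_def)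
  qed
  have 2: "shear_flow a b t x \<in> S2xS2"
  proof -
    have "(\<rho> t * C t)\<^sup>2 + (\<rho> t * S t)\<^sup>2 + (z t)\<^sup>2 = 1"
      using CS[of t] \<rho>(2)[of t] by algebra
    moreover have "(C t * Q1 + S t * Q2 t)\<^sup>2 + (C t * Q2 t - S t * Q1)\<^sup>2 + (Q3 t)\<^sup>2 = 1"
      using CS[of t] Q[of t] by algebra
    ultimately show ?thesis unfolding fl mem_Times_iff S2_iff by simp
  qed
  have 3: "shear_J (shear_flow a b t x) = shear_J x"
    using cz[of t] by (simp add: shear_J_def fl)
  have K: "shear_K y = c2 * Q1" if "fst y $ 1 = rr * cc" "fst y $ 2 = rr * ss" "cc\<^sup>2 + ss\<^sup>2 = 1" "rr > 0"
     "cc * snd y $ 1 - ss * snd y $ 2 = Q1" for y rr cc ss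
  proof -
    have "(rr * cc)\<^sup>2 + (rr * ss)\<^sup>2 = rr\<^sup>2 * (cc\<^sup>2 + ss\<^sup>2)" by (simp add: power_mult_distrib distrib_left)
    then have "sqrt ((fst y $ 1)\<^sup>2 + (fst y $ 2)\<^sup>2) = rr" using that by simp
    moreover have "fst y $ 1 * snd y $ 1 - fst y $ 2 * snd y $ 2 = rr * Q1" using that by algebra
    ultimately show ?thesis using that(4) by (simp add: shear_K_def)
  qed
  have 4: "shear_K (shear_flow a b t x) = shear_K x"
  proof -
    have "C t * (C t * Q1 + S t * Q2 t) - S t * (C t * Q2 t - S t * Q1) = Q1"
      using CS[of t] by algebra
    then have "shear_K (shear_flow a b t x) = c2 * Q1"
      by (intro K[of _ "\<rho> t" "C t" "S t"]) (simp_all add: fl CS \<rho>)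
    moreover have "shear_K x = c2 * Q1"
      by (intro K[of _ r C0 S0]) (simp_all add: C0 CS0 r Q1_def)
    ultimately show ?thesis by simp
  qed
  have dJ: "(shear_J has_derivative (\<lambda>v. vector [0, 0, c1] \<bullet> fst v + vector [0, 0, - c2] \<bullet> snd v)) (at y)" for y
    unfolding shear_J_def
    by (auto intro!: derivative_eq_intros bounded_linear.has_derivative[OF bounded_linear_vec_nth] simp: inner_real3)
  have Q2t: "C t * snd (shear_flow a b t x) $ 2 + S t * snd (shear_flow a b t x) $ 1 = Q2 t"
    using CS[of t] unfolding fl by simp algebra
  have dK: "(shear_K has_derivative (\<lambda>v. vector [c2 * S t * Q2 t / \<rho> t, - c2 * C t * Q2 t / \<rho> t, 0] \<bullet> fst v +
      vector [c2 * C t, - c2 * S t, 0] \<bullet> snd v)) (at (shear_flow a b t x))"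
    using shear_K_derivative[OF \<rho>(1)[of t], of "shear_flow a b t x" "C t" "S t"] CS[of t] unfolding Q2t
    by (simp add: fl)
  have dC: "(C has_real_derivative (- a * S t)) (at t)" and dS: "(S has_real_derivative (a * C t)) (at t)"
    unfolding C_def S_def by (auto intro!: derivative_eq_intros simp: algebra_simps)
  have dQ2: "(Q2 has_real_derivative (- b * Q3 t)) (at t)" and dQ3: "(Q3 has_real_derivative (b * Q2 t)) (at t)"
    unfolding Q2_def Q3_def by (auto intro!: derivative_eq_intros simp: algebra_simps)
  have dz: "(z has_real_derivative (c2 * b * Q2 t / c1)) (at t)"
    unfolding z_def using c by (auto intro!: derivative_eq_intros dQ3)
  have d\<rho>: "(\<rho> has_real_derivative (- z t * (c2 * b * Q2 t / c1) / \<rho> t)) (at t)"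
  proof -
    have d: "((\<lambda>s. 1 - (z s)\<^sup>2) has_real_derivative (- 2 * z t * (c2 * b * Q2 t / c1))) (at t)"
      by (auto intro!: derivative_eq_intros dz)
    have "1 - (z t)\<^sup>2 > 0" using z1[of t] by simp
    from DERIV_chain2[OF DERIV_real_sqrt[OF this] d]
    have *: "((\<lambda>s. sqrt (1 - (z s)\<^sup>2)) has_real_derivative
      inverse (sqrt (1 - (z t)\<^sup>2)) / 2 * (- 2 * z t * (c2 * b * Q2 t / c1))) (at t)" .
    have e: "\<rho> = (\<lambda>s. sqrt (1 - (z s)\<^sup>2))" by (rule ext) (simp only: \<rho>_def)
    have "inverse w / 2 * (- 2 * u * v) = - u * v / w" for u v w :: real
      by (cases "w = 0") (simp_all add: field_simps)
    from DERIV_cong[OF * this] show ?thesis unfolding e .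
  qed
  let ?g1 = "a *\<^sub>R vector [0, 0, c1] + b *\<^sub>R vector [c2 * S t * Q2 t / \<rho> t, - c2 * C t * Q2 t / \<rho> t, 0] :: real^3"
  let ?g2 = "a *\<^sub>R vector [0, 0, - c2] + b *\<^sub>R vector [c2 * C t, - c2 * S t, 0] :: real^3"
  have c0: "c1 \<noteq> 0" "c2 \<noteq> 0" using c by simp_all
  have ir: "\<rho> t * inverse (\<rho> t) = 1" "c1 * inverse c1 = 1" using \<rho>(1)[of t] c by simp_all
  have v1: "((\<lambda>s. vector [\<rho> s * C s, \<rho> s * S s, z s] :: real^3) has_vector_derivative
      (1 / c1) *\<^sub>R (?g1 \<otimes> vector [\<rho> t * C t, \<rho> t * S t, z t])) (at t)"
  proof (rule has_vector_derivative_real3)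
    show "((\<lambda>s. (vector [\<rho> s * C s, \<rho> s * S s, z s] :: real^3) $ 1) has_real_derivative
      ((1 / c1) *\<^sub>R (?g1 \<otimes> vector [\<rho> t * C t, \<rho> t * S t, z t])) $ 1) (at t)"
      unfolding vector_3 by (rule DERIV_cong[OF DERIV_mult[OF d\<rho> dC]]) (use c in \<open>simp add: cross3_nth field_simps\<close>)
    show "((\<lambda>s. (vector [\<rho> s * C s, \<rho> s * S s, z s] :: real^3) $ 2) has_real_derivative
      ((1 / c1) *\<^sub>R (?g1 \<otimes> vector [\<rho> t * C t, \<rho> t * S t, z t])) $ 2) (at t)"
      unfolding vector_3 by (rule DERIV_cong[OF DERIV_mult[OF d\<rho> dS]]) (use c in \<open>simp add: cross3_nth field_simps\<close>)
    have "((1 / c1) *\<^sub>R (?g1 \<otimes> vector [\<rho> t * C t, \<rho> t * S t, z t])) $ 3 =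
      inverse c1 * (b * c2 * Q2 t * (\<rho> t * inverse (\<rho> t)) * ((C t)\<^sup>2 + (S t)\<^sup>2))"
      by (simp add: cross3_nth divide_inverse algebra_simps power2_eq_square)
    then show "((\<lambda>s. (vector [\<rho> s * C s, \<rho> s * S s, z s] :: real^3) $ 3) has_real_derivative
      ((1 / c1) *\<^sub>R (?g1 \<otimes> vector [\<rho> t * C t, \<rho> t * S t, z t])) $ 3) (at t)"
      using dz by (simp add: c0 CS ir divide_inverse mult.commute mult.left_commute)
  qed
  have v2: "((\<lambda>s. vector [C s * Q1 + S s * Q2 s, C s * Q2 s - S s * Q1, Q3 s] :: real^3) has_vector_derivative
      (1 / c2) *\<^sub>R (?g2 \<otimes> vector [C t * Q1 + S t * Q2 t, C t * Q2 t - S t * Q1, Q3 t])) (at t)"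
  proof (rule has_vector_derivative_real3)
    show "((\<lambda>s. (vector [C s * Q1 + S s * Q2 s, C s * Q2 s - S s * Q1, Q3 s] :: real^3) $ 1) has_real_derivative
      ((1 / c2) *\<^sub>R (?g2 \<otimes> vector [C t * Q1 + S t * Q2 t, C t * Q2 t - S t * Q1, Q3 t])) $ 1) (at t)"
      unfolding vector_3
      by (rule DERIV_cong[OF DERIV_add[OF DERIV_cmult_right[OF dC] DERIV_mult[OF dS dQ2]]]) (use c in \<open>simp add: cross3_nth field_simps\<close>)
    show "((\<lambda>s. (vector [C s * Q1 + S s * Q2 s, C s * Q2 s - S s * Q1, Q3 s] :: real^3) $ 2) has_real_derivative
      ((1 / c2) *\<^sub>R (?g2 \<otimes> vector [C t * Q1 + S t * Q2 t, C t * Q2 t - S t * Q1, Q3 t])) $ 2) (at t)"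
      unfolding vector_3
      by (rule DERIV_cong[OF DERIV_diff[OF DERIV_mult[OF dC dQ2] DERIV_cmult_right[OF dS]]]) (use c in \<open>simp add: cross3_nth field_simps\<close>)
    have "((1 / c2) *\<^sub>R (?g2 \<otimes> vector [C t * Q1 + S t * Q2 t, C t * Q2 t - S t * Q1, Q3 t])) $ 3 =
       b * Q2 t * ((C t)\<^sup>2 + (S t)\<^sup>2)"
      using c by (simp add: cross3_nth field_simps power2_eq_square)
    then show "((\<lambda>s. (vector [C s * Q1 + S s * Q2 s, C s * Q2 s - S s * Q1, Q3 s] :: real^3) $ 3) has_real_derivative
      ((1 / c2) *\<^sub>R (?g2 \<otimes> vector [C t * Q1 + S t * Q2 t, C t * Q2 t - S t * Q1, Q3 t])) $ 3) (at t)"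
      using dQ3 by (simp add: CS)
  qed
  have v: "((\<lambda>s. shear_flow a b s x) has_vector_derivative ham_field c1 c2 ?g1 ?g2 (shear_flow a b t x)) (at t)"
    unfolding fl ham_field_def fst_conv snd_conv by (rule has_vector_derivative_Pair[OF v1 v2])
  show ?thesis by (intro conjI exI) (rule 1 2 3 4 dJ dK v)+
qed

text \<open>At time 1 with b = pi the second point has made a half turn about a horizontal axis of
  its frame, so its height changes sign. Conservation of J then moves the first height by
  \<open>- 2 * (c2 / c1) * z2\<close>.\<close>

lemma ham_equivalent_shear:
  assumes c: "c1 > 0" "c2 > 0" and z: "\<bar>c1 * z1 - c2 * z2\<bar> + c2 < c1"
  shows "ham_equivalent (round_form c1 c2) (round_torus z1 z2) (round_torus (z1 - 2 * (c2 / c1) * z2) (- z2))"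
proof -
  define j0 where "j0 = c1 * z1 - c2 * z2"
  define e where "e = c1 - c2 - \<bar>j0\<bar>"
  have e: "e > 0" using z by (simp add: e_def j0_def)
  have Jb: "\<bar>shear_J x\<bar> + c2 < c1" if "\<bar>shear_J x - j0\<bar> < e" for x using that by (simp add: e_def)
  define W where "W = {x::point. (fst x $ 1)\<^sup>2 + (fst x $ 2)\<^sup>2 > 0}"
  have oW: "open W" unfolding W_def by (intro open_Collect_less continuous_intros)
  have sK: "smooth_on_open W shear_K" unfolding shear_K_def
    by (intro smooth_intros oW) (auto simp: W_def)
  have sJ: "smooth_on_open UNIV shear_J" unfolding shear_J_def by (intro smooth_intros open_UNIV)
  have sub: "x \<in> W" if x: "x \<in> S2xS2" and j: "\<bar>shear_J x - j0\<bar> < e" for x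
  proof -
    have p: "(fst x $ 1)\<^sup>2 + (fst x $ 2)\<^sup>2 + (fst x $ 3)\<^sup>2 = 1" and q: "(snd x $ 1)\<^sup>2 + (snd x $ 2)\<^sup>2 + (snd x $ 3)\<^sup>2 = 1"
      using x S2_iff by (auto simp: mem_Times_iff)
    have q3: "\<bar>snd x $ 3\<bar> \<le> 1" using q abs_le_square_iff[of "snd x $ 3" 1] by (smt (verit) one_power2 zero_le_power2)
    then have "\<bar>c2 * snd x $ 3\<bar> \<le> c2" using c by (simp add: abs_mult mult_left_le)
    then have "\<bar>c1 * fst x $ 3\<bar> < c1" using Jb[OF j] by (simp add: shear_J_def)
    then have "\<bar>fst x $ 3\<bar> < 1" using c by (simp add: abs_mult)
    then have "(fst x $ 3)\<^sup>2 < 1" by (simp add: abs_square_less_1)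
    then show ?thesis using p by (simp add: W_def)
  qed
  obtain H \<Phi> where fl: "hamiltonian_flow (round_form c1 c2) H \<Phi>"
    and \<Phi>: "\<And>x. x \<in> S2xS2 \<Longrightarrow> shear_J x = j0 \<Longrightarrow> \<Phi> 1 x = shear_flow 0 pi 1 x"
  proof (rule cutoff_hamiltonian_flow[of c1 c2 e W shear_K shear_J j0 shear_flow pi])
    show "c1 \<noteq> 0" "c2 \<noteq> 0" using c by simp_all
  qed (rule e oW sK sJ sub shear_flow_properties[OF c _ Jb] that; assumption)+
  \<comment> \<open>T is an involution on the level j0, since two half turns make a full one. The
    target torus lies on the same level, so the inclusion shown for both tori gives
    equality.\<close>
  define T where "T x = shear_flow 0 pi 1 x" for x
  let ?z = "z1 - 2 * (c2 / c1) * z2"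
  have Tmem: "T x \<in> round_torus (u - 2 * (c2 / c1) * w) (- w)" and TT: "T (T x) = x"
    if x: "x \<in> round_torus u w" and uw: "c1 * u - c2 * w = j0" for x u w
  proof -
    have xM: "x \<in> S2xS2" using x round_torus_subset by blast
    have x3: "fst x $ 3 = u" "snd x $ 3 = w" using x by (auto simp: round_torus_def)
    have Jx: "shear_J x = j0" using uw by (simp add: shear_J_def x3)
    have Jx': "\<bar>shear_J x\<bar> + c2 < c1" using z unfolding Jx by (simp add: j0_def)
    have pr: "T x \<in> S2xS2" "shear_J (T x) = shear_J x"
      unfolding T_def
      by (rule conjunct1[OF conjunct2[OF shear_flow_properties[OF c xM Jx']]],
          rule conjunct1[OF conjunct2[OF conjunct2[OF shear_flow_properties[OF c xM Jx']]]])
    have T3: "snd (T x) $ 3 = - w" by (simp add: T_def shear_flow_def Let_def x3)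
    then have T3': "fst (T x) $ 3 = u - 2 * (c2 / c1) * w"
      using pr(2) c unfolding Jx by (simp add: shear_J_def uw[symmetric] field_simps)
    show "T x \<in> round_torus (u - 2 * (c2 / c1) * w) (- w)"
      using pr(1) T3 T3' by (simp add: round_torus_def mem_Times_iff)
    have T2: "T (T x) = shear_flow 0 pi 2 x"
    proof -
      have p: "(fst x $ 1)\<^sup>2 + (fst x $ 2)\<^sup>2 + (fst x $ 3)\<^sup>2 = 1"
        using xM S2_iff by (auto simp: mem_Times_iff)
      define r where "r = sqrt ((fst x $ 1)\<^sup>2 + (fst x $ 2)\<^sup>2)"
      have "x \<in> W" using sub[OF xM] e Jx by simp
      then have r: "r > 0" "r\<^sup>2 = (fst x $ 1)\<^sup>2 + (fst x $ 2)\<^sup>2" by (simp_all add: W_def r_def)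
      define \<rho> where "\<rho> = sqrt (1 - (fst (T x) $ 3)\<^sup>2)"
      have "T x \<in> W" using sub[OF pr(1)] e Jx pr(2) by simp
      moreover have "(fst (T x) $ 1)\<^sup>2 + (fst (T x) $ 2)\<^sup>2 + (fst (T x) $ 3)\<^sup>2 = 1"
        using pr(1) S2_iff by (auto simp: mem_Times_iff)
      ultimately have rho: "\<rho> > 0" by (simp add: W_def \<rho>_def)
      define C S where "C = fst x $ 1 / r" and "S = fst x $ 2 / r"
      have x12: "fst x $ 1 = r * C" "fst x $ 2 = r * S" using r by (simp_all add: C_def S_def)
      have "r\<^sup>2 * (C\<^sup>2 + S\<^sup>2) = r\<^sup>2 * 1" using r x12 by (simp add: power_mult_distrib distrib_left)
      then have CS: "C\<^sup>2 + S\<^sup>2 = 1" using r(1) by simp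
      define Q1 P2 where "Q1 = C * snd x $ 1 - S * snd x $ 2" and "P2 = C * snd x $ 2 + S * snd x $ 1"
      have zT: "fst (T x) $ 3 = (shear_J x + c2 * (- snd x $ 3)) / c1"
        by (simp add: T_def shear_flow_def Let_def)
      have Tx: "T x = (vector [\<rho> * C, \<rho> * S, fst (T x) $ 3], vector [C * Q1 - S * P2, - C * P2 - S * Q1, - snd x $ 3])"
        unfolding zT \<rho>_def
        by (simp add: T_def shear_flow_def Let_def Q1_def P2_def C_def S_def r_def)
      have "sqrt ((\<rho> * C)\<^sup>2 + (\<rho> * S)\<^sup>2) = \<rho>"
        using rho CS by (simp add: power_mult_distrib flip: distrib_left)
      moreover have Tn: "fst (T x) $ 1 = \<rho> * C" "fst (T x) $ 2 = \<rho> * S" "snd (T x) $ 1 = C * Q1 - S * P2"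
        "snd (T x) $ 2 = - C * P2 - S * Q1" "snd (T x) $ 3 = - snd x $ 3"
        using arg_cong[OF Tx, of "\<lambda>y. fst y $ 1"] arg_cong[OF Tx, of "\<lambda>y. fst y $ 2"] arg_cong[OF Tx, of "\<lambda>y. snd y $ 1"]
          arg_cong[OF Tx, of "\<lambda>y. snd y $ 2"] arg_cong[OF Tx, of "\<lambda>y. snd y $ 3"] by simp_all
      ultimately have C': "sqrt ((fst (T x) $ 1)\<^sup>2 + (fst (T x) $ 2)\<^sup>2) = \<rho>" "fst (T x) $ 1 / \<rho> = C" "fst (T x) $ 2 / \<rho> = S"
        using rho by simp_all
      have Q': "C * snd (T x) $ 1 - S * snd (T x) $ 2 = Q1" "C * snd (T x) $ 2 + S * snd (T x) $ 1 = - P2"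
         "snd (T x) $ 3 = - snd x $ 3"
        using CS unfolding Tn by (algebra, algebra, simp)
      have rr: "sqrt ((fst x $ 1)\<^sup>2 + (fst x $ 2)\<^sup>2) = r" "fst x $ 1 / r = C" "fst x $ 2 / r = S" by (simp_all add: r_def C_def S_def)
      have "T (T x) = shear_flow 0 pi 1 (T x)" by (simp add: T_def)
      also have "\<dots> = shear_flow 0 pi 2 x"
        unfolding shear_flow_def Let_def C' Q' rr pr(2) Q1_def[symmetric] P2_def[symmetric]
        by (simp add: mult.commute[of pi 2])
      finally show ?thesis .
    qed
    have "shear_flow 0 pi 2 x = shear_flow 0 0 2 x"
      by (simp add: shear_flow_def Let_def mult.commute[of pi 2])
    also have "\<dots> = shear_flow 0 0 0 x" by (simp add: shear_flow_def Let_def)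
    also have "\<dots> = x" using shear_flow_properties[OF c xM Jx', of 0 0 0] by (elim conjE)
    finally show "T (T x) = x" using T2 by simp
  qed
  have uw': "c1 * ?z - c2 * (- z2) = j0" using c by (simp add: j0_def field_simps)
  have img: "\<Phi> 1 ` round_torus z1 z2 = T ` round_torus z1 z2"
  proof (rule image_cong[OF refl])
    fix x assume x: "x \<in> round_torus z1 z2"
    then have "shear_J x = j0" by (auto simp: round_torus_def shear_J_def j0_def)
    then show "\<Phi> 1 x = T x" unfolding T_def using \<Phi> x round_torus_subset by blast
  qed
  have "T ` round_torus z1 z2 = round_torus ?z (- z2)"
  proof
    show "T ` round_torus z1 z2 \<subseteq> round_torus ?z (- z2)"
      using Tmem[of _ z1 z2] by (auto simp: j0_def)
    show "round_torus ?z (- z2) \<subseteq> T ` round_torus z1 z2"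
    proof
      fix x assume x: "x \<in> round_torus ?z (- z2)"
      have "?z - 2 * (c2 / c1) * (- z2) = z1" by simp
      then have "T x \<in> round_torus z1 z2" using Tmem[OF x uw'] by simp
      then show "x \<in> T ` round_torus z1 z2" using TT[OF x uw'] by (metis image_eqI)
    qed
  qed
  then show ?thesis using ham_equivalentI[OF fl img[THEN trans]] by blast
qed

end

section \<open>The corner move\<close>

context
  fixes c1 c2 :: real
begin

private definition corner_J :: "point \<Rightarrow> real" where
  "corner_J x = c1 * (1 - fst x $ 3) + c2 * (1 + snd x $ 3)"

private definition corner_K :: "point \<Rightarrow> real" where
  "corner_K x = sqrt (2 * c1) * sqrt (2 * c2) * (fst x $ 1 * snd x $ 1 - fst x $ 2 * snd x $ 2) /
     (sqrt (1 + fst x $ 3) * sqrt (1 - snd x $ 3))"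

text \<open>
  Azimuthal equal-area charts around the north pole of the first and the south pole of the second
  sphere; they identify the form with the standard one on the plane of two complex variables, where
  \<open>J\<close> is half the squared norm and \<open>K\<close> generates a unitary rotation.
\<close>

private definition corner_point :: "real \<Rightarrow> real \<Rightarrow> real \<Rightarrow> real \<Rightarrow> point" where
  "corner_point E1 G1 E2 G2 = (let
      z1 = 1 - (E1\<^sup>2 + G1\<^sup>2) / (2 * c1); z2 = (E2\<^sup>2 + G2\<^sup>2) / (2 * c2) - 1;
      s1 = sqrt (1 + z1) / sqrt (2 * c1); s2 = sqrt (1 - z2) / sqrt (2 * c2)
    in (vector [E1 * s1, - G1 * s1, z1], vector [E2 * s2, G2 * s2, z2]))"

private definition corner_flow :: "real \<Rightarrow> real \<Rightarrow> real \<Rightarrow> point \<Rightarrow> point" where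
  "corner_flow a b t x = (let
      s1 = sqrt (1 + fst x $ 3) / sqrt (2 * c1); s2 = sqrt (1 - snd x $ 3) / sqrt (2 * c2);
      X1 = fst x $ 1 / s1; Y1 = - fst x $ 2 / s1; X2 = snd x $ 1 / s2; Y2 = snd x $ 2 / s2;
      U1 = X1 * cos (b * t) - Y2 * sin (b * t); V1 = Y1 * cos (b * t) + X2 * sin (b * t);
      U2 = X2 * cos (b * t) - Y1 * sin (b * t); V2 = Y2 * cos (b * t) + X1 * sin (b * t)
    in corner_point (U1 * cos (a * t) - V1 * sin (a * t)) (V1 * cos (a * t) + U1 * sin (a * t))
         (U2 * cos (a * t) - V2 * sin (a * t)) (V2 * cos (a * t) + U2 * sin (a * t)))"

context
  assumes c: "c1 > 0" "c2 > 0"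
begin

text \<open>The minus sign in the first factor gives both charts the same orientation, as the
  outward normals at the north and the south pole are opposite.\<close>

private lemma corner_point_nth:
  assumes "s1 = sqrt (2 - (E1\<^sup>2 + G1\<^sup>2) / (2 * c1))" "s2 = sqrt (2 - (E2\<^sup>2 + G2\<^sup>2) / (2 * c2))"
  shows "fst (corner_point E1 G1 E2 G2) $ 1 = E1 * s1 / sqrt (2 * c1)"
    "fst (corner_point E1 G1 E2 G2) $ 2 = - G1 * s1 / sqrt (2 * c1)"
    "fst (corner_point E1 G1 E2 G2) $ 3 = 1 - (E1\<^sup>2 + G1\<^sup>2) / (2 * c1)"
    "snd (corner_point E1 G1 E2 G2) $ 1 = E2 * s2 / sqrt (2 * c2)"
    "snd (corner_point E1 G1 E2 G2) $ 2 = G2 * s2 / sqrt (2 * c2)"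
    "snd (corner_point E1 G1 E2 G2) $ 3 = (E2\<^sup>2 + G2\<^sup>2) / (2 * c2) - 1"
  unfolding corner_point_def Let_def assms by simp_all

private lemma corner_J_derivative:
  "(corner_J has_derivative (\<lambda>v. vector [0, 0, - c1] \<bullet> fst v + vector [0, 0, c2] \<bullet> snd v)) (at y)"
  unfolding corner_J_def
  by (auto intro!: derivative_eq_intros bounded_linear.has_derivative[OF bounded_linear_vec_nth] simp: inner_real3)

private lemma corner_K_derivative:
  assumes N: "E1\<^sup>2 + G1\<^sup>2 < 4 * c1" "E2\<^sup>2 + G2\<^sup>2 < 4 * c2"
    and s: "s1 = sqrt (2 - (E1\<^sup>2 + G1\<^sup>2) / (2 * c1))" "s2 = sqrt (2 - (E2\<^sup>2 + G2\<^sup>2) / (2 * c2))"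
    and A: "A1 = sqrt (2 * c1)" "A2 = sqrt (2 * c2)"
  shows "(corner_K has_derivative
    (\<lambda>v. vector [A1 * E2 / s1, - A1 * G2 / s1, - (E1 * E2 + G1 * G2) / (2 * s1\<^sup>2)] \<bullet> fst v +
         vector [A2 * E1 / s2, A2 * G1 / s2, (E1 * E2 + G1 * G2) / (2 * s2\<^sup>2)] \<bullet> snd v)) (at (corner_point E1 G1 E2 G2))"
proof -
  define x where "x = corner_point E1 G1 E2 G2"
  note nth = corner_point_nth[OF s, folded x_def A]
  have pos: "s1 > 0" "s2 > 0" "A1 > 0" "A2 > 0" using N c by (simp_all add: s A field_simps)
  have s12: "sqrt (1 + fst x $ 3) = s1" "sqrt (1 - snd x $ 3) = s2" by (simp_all add: nth s)
  have pos': "1 + fst x $ 3 > 0" "1 - snd x $ 3 > 0" using pos by (simp_all add: s12[symmetric])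
  have n: "((\<lambda>x. A1 * A2 * (fst x $ 1 * snd x $ 1 - fst x $ 2 * snd x $ 2)) has_derivative
      (\<lambda>v. A1 * A2 * (fst v $ 1 * snd x $ 1 + fst x $ 1 * snd v $ 1 - (fst v $ 2 * snd x $ 2 + fst x $ 2 * snd v $ 2)))) (at x)"
    by (auto intro!: derivative_eq_intros bounded_linear.has_derivative[OF bounded_linear_vec_nth] simp: algebra_simps)
  have "((\<lambda>x::point. 1 + fst x $ 3) has_derivative (\<lambda>v. fst v $ 3)) (at x)"
    by (auto intro!: derivative_eq_intros bounded_linear.has_derivative[OF bounded_linear_vec_nth])
  from has_derivative_real_sqrt[OF pos'(1) this]
  have d1: "((\<lambda>x::point. sqrt (1 + fst x $ 3)) has_derivative (\<lambda>v. fst v $ 3 / (2 * s1))) (at x)"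
    by (rule has_derivative_eq_rhs) (use pos in \<open>simp add: s12 fun_eq_iff field_simps\<close>)
  have "((\<lambda>x::point. 1 - snd x $ 3) has_derivative (\<lambda>v. - (snd v $ 3))) (at x)"
    by (auto intro!: derivative_eq_intros bounded_linear.has_derivative[OF bounded_linear_vec_nth])
  from has_derivative_real_sqrt[OF pos'(2) this]
  have d2: "((\<lambda>x::point. sqrt (1 - snd x $ 3)) has_derivative (\<lambda>v. - (snd v $ 3) / (2 * s2))) (at x)"
    by (rule has_derivative_eq_rhs) (use pos in \<open>simp add: s12 fun_eq_iff field_simps\<close>)
  have nz: "sqrt (1 + fst x $ 3) * sqrt (1 - snd x $ 3) \<noteq> 0" using pos by (simp add: s12)
  have alg: "(A1 * A2 * (u1 * (E2 * s2 / A2) + E1 * s1 / A1 * w1 - (u2 * (G2 * s2 / A2) + - G1 * s1 / A1 * w2)) * (s1 * s2) -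
      A1 * A2 * (E1 * s1 / A1 * (E2 * s2 / A2) - - G1 * s1 / A1 * (G2 * s2 / A2)) * (s1 * (- w3 / (2 * s2)) + u3 / (2 * s1) * s2)) /
      (s1 * s2 * (s1 * s2)) =
      (A1 * E2 / s1 * u1 + - A1 * G2 / s1 * u2 + - (E1 * E2 + G1 * G2) / (2 * s1\<^sup>2) * u3) +
      (A2 * E1 / s2 * w1 + A2 * G1 / s2 * w2 + (E1 * E2 + G1 * G2) / (2 * s2\<^sup>2) * w3)" for u1 u2 u3 w1 w2 w3
    using pos by (simp add: field_simps power2_eq_square)
  have eq: "(A1 * A2 * (fst v $ 1 * snd x $ 1 + fst x $ 1 * snd v $ 1 - (fst v $ 2 * snd x $ 2 + fst x $ 2 * snd v $ 2)) *
      (sqrt (1 + fst x $ 3) * sqrt (1 - snd x $ 3)) -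
     A1 * A2 * (fst x $ 1 * snd x $ 1 - fst x $ 2 * snd x $ 2) *
      (sqrt (1 + fst x $ 3) * (- (snd v $ 3) / (2 * s2)) + fst v $ 3 / (2 * s1) * sqrt (1 - snd x $ 3))) /
     (sqrt (1 + fst x $ 3) * sqrt (1 - snd x $ 3) * (sqrt (1 + fst x $ 3) * sqrt (1 - snd x $ 3))) =
     vector [A1 * E2 / s1, - A1 * G2 / s1, - (E1 * E2 + G1 * G2) / (2 * s1\<^sup>2)] \<bullet> fst v +
         vector [A2 * E1 / s2, A2 * G1 / s2, (E1 * E2 + G1 * G2) / (2 * s2\<^sup>2)] \<bullet> snd v" for v :: point
    unfolding s12 nth(1,2,4,5) inner_real3 vector_3 by (rule alg)
  show ?thesis unfolding corner_K_def x_def[symmetric] A[symmetric]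
    by (rule has_derivative_eq_rhs[OF has_derivative_divide'[OF n has_derivative_mult[OF d1 d2] nz]])
      (rule ext, rule eq)
qed

text \<open>Inverse of the chart. Pi times the squared radius
  \<open>2 * c1 * (1 - fst x $ 3)\<close> is the area of the polar cap through the point, which is
  the equal-area property.\<close>

private lemma corner_chart_cancel:
  assumes x: "x \<in> S2xS2" and p: "1 + fst x $ 3 > 0" "1 - snd x $ 3 > 0"
  defines "s1 \<equiv> sqrt (1 + fst x $ 3) / sqrt (2 * c1)" and "s2 \<equiv> sqrt (1 - snd x $ 3) / sqrt (2 * c2)"
  shows "(fst x $ 1 / s1)\<^sup>2 + (- fst x $ 2 / s1)\<^sup>2 = 2 * c1 * (1 - fst x $ 3)"
    and "(snd x $ 1 / s2)\<^sup>2 + (snd x $ 2 / s2)\<^sup>2 = 2 * c2 * (1 + snd x $ 3)"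
    and "corner_point (fst x $ 1 / s1) (- fst x $ 2 / s1) (snd x $ 1 / s2) (snd x $ 2 / s2) = x"
proof -
  have P: "(fst x $ 1)\<^sup>2 + (fst x $ 2)\<^sup>2 + (fst x $ 3)\<^sup>2 = 1" and Q: "(snd x $ 1)\<^sup>2 + (snd x $ 2)\<^sup>2 + (snd x $ 3)\<^sup>2 = 1"
    using x S2_iff by (auto simp: mem_Times_iff)
  have s: "s1 > 0" "s2 > 0" using p c by (simp_all add: s1_def s2_def)
  have s2: "2 * c1 * s1\<^sup>2 = 1 + fst x $ 3" "2 * c2 * s2\<^sup>2 = 1 - snd x $ 3"
    using p c by (simp_all add: s1_def s2_def power_divide)
  have "(fst x $ 1)\<^sup>2 + (fst x $ 2)\<^sup>2 = 2 * c1 * s1\<^sup>2 * (1 - fst x $ 3)" unfolding s2 using P by algebra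
  then show 1: "(fst x $ 1 / s1)\<^sup>2 + (- fst x $ 2 / s1)\<^sup>2 = 2 * c1 * (1 - fst x $ 3)"
    using s by (simp add: power_divide field_simps)
  have "(snd x $ 1)\<^sup>2 + (snd x $ 2)\<^sup>2 = 2 * c2 * s2\<^sup>2 * (1 + snd x $ 3)" unfolding s2 using Q by algebra
  then show 2: "(snd x $ 1 / s2)\<^sup>2 + (snd x $ 2 / s2)\<^sup>2 = 2 * c2 * (1 + snd x $ 3)"
    using s by (simp add: power_divide field_simps)
  have "2 - 2 * c1 * (1 - fst x $ 3) / (2 * c1) = 1 + fst x $ 3" "2 - 2 * c2 * (1 + snd x $ 3) / (2 * c2) = 1 - snd x $ 3"
    using c by (simp_all add: field_simps)
  then have sq: "sqrt (1 + fst x $ 3) = sqrt (2 - ((fst x $ 1 / s1)\<^sup>2 + (- fst x $ 2 / s1)\<^sup>2) / (2 * c1))"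
     "sqrt (1 - snd x $ 3) = sqrt (2 - ((snd x $ 1 / s2)\<^sup>2 + (snd x $ 2 / s2)\<^sup>2) / (2 * c2))"
    unfolding 1 2 by simp_all
  have f: "w / s1 * sqrt (1 + fst x $ 3) / sqrt (2 * c1) = w" "w / s2 * sqrt (1 - snd x $ 3) / sqrt (2 * c2) = w" for w
  proof -
    have "sqrt (1 + fst x $ 3) = s1 * sqrt (2 * c1)" "sqrt (1 - snd x $ 3) = s2 * sqrt (2 * c2)"
      using c by (simp_all add: s1_def s2_def)
    then show "w / s1 * sqrt (1 + fst x $ 3) / sqrt (2 * c1) = w" "w / s2 * sqrt (1 - snd x $ 3) / sqrt (2 * c2) = w"
      using s c by simp_all
  qed
  show "corner_point (fst x $ 1 / s1) (- fst x $ 2 / s1) (snd x $ 1 / s2) (snd x $ 2 / s2) = x"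
    unfolding prod_eq_iff vec3_eq_iff corner_point_nth[OF sq] 1 2 f
    using f(1)[of "fst x $ 2"] c by simp
qed

private lemma corner_point_props:
  assumes N: "E1\<^sup>2 + G1\<^sup>2 < 4 * c1" "E2\<^sup>2 + G2\<^sup>2 < 4 * c2"
  shows "corner_point E1 G1 E2 G2 \<in> S2xS2"
    and "corner_J (corner_point E1 G1 E2 G2) = ((E1\<^sup>2 + G1\<^sup>2) + (E2\<^sup>2 + G2\<^sup>2)) / 2"
    and "corner_K (corner_point E1 G1 E2 G2) = E1 * E2 + G1 * G2"
    and "corner_flow 0 (pi / 2) 1 (corner_point E1 G1 E2 G2) = corner_point (- G2) E2 (- G1) E1"
proof -
  define s1 s2 A1 A2 where s: "s1 = sqrt (2 - (E1\<^sup>2 + G1\<^sup>2) / (2 * c1))" "s2 = sqrt (2 - (E2\<^sup>2 + G2\<^sup>2) / (2 * c2))"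
    and A: "A1 = sqrt (2 * c1)" "A2 = sqrt (2 * c2)"
  note nth = corner_point_nth[OF s, folded A]
  have pos: "s1 > 0" "s2 > 0" "A1 > 0" "A2 > 0" using N c by (simp_all add: s A field_simps)
  have A2': "A1\<^sup>2 = 2 * c1" "A2\<^sup>2 = 2 * c2" using c by (simp_all add: A)
  have "2 - (E1\<^sup>2 + G1\<^sup>2) / (2 * c1) \<ge> 0" "2 - (E2\<^sup>2 + G2\<^sup>2) / (2 * c2) \<ge> 0" using N c by (simp_all add: field_simps)
  then have s2': "s1\<^sup>2 = 2 - (E1\<^sup>2 + G1\<^sup>2) / (2 * c1)" "s2\<^sup>2 = 2 - (E2\<^sup>2 + G2\<^sup>2) / (2 * c2)" by (simp_all add: s)
  have m: "(E * s / A)\<^sup>2 + (G * s / A)\<^sup>2 + (1 - (E\<^sup>2 + G\<^sup>2) / (2 * cc))\<^sup>2 = 1"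
    if "A\<^sup>2 = 2 * cc" "s\<^sup>2 = 2 - (E\<^sup>2 + G\<^sup>2) / (2 * cc)" "cc > 0" for E G s A cc :: real
  proof -
    define n where "n = (E\<^sup>2 + G\<^sup>2) / (2 * cc)"
    have "(E * s / A)\<^sup>2 + (G * s / A)\<^sup>2 = n * s\<^sup>2"
      using that(1) by (simp add: n_def power_divide power_mult_distrib add_divide_distrib[symmetric] distrib_right)
    then show ?thesis unfolding that(2) n_def[symmetric] by algebra
  qed
  have m2: "(E * s / A)\<^sup>2 + (G * s / A)\<^sup>2 + ((E\<^sup>2 + G\<^sup>2) / (2 * cc) - 1)\<^sup>2 = 1"
    if "A\<^sup>2 = 2 * cc" "s\<^sup>2 = 2 - (E\<^sup>2 + G\<^sup>2) / (2 * cc)" "cc > 0" for E G s A cc :: real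
    using m[OF that] by (simp add: power2_commute)
  show mem: "corner_point E1 G1 E2 G2 \<in> S2xS2"
    unfolding mem_Times_iff S2_iff nth using m[OF A2'(1) s2'(1) c(1)] m2[OF A2'(2) s2'(2) c(2)] by simp
  show "corner_J (corner_point E1 G1 E2 G2) = ((E1\<^sup>2 + G1\<^sup>2) + (E2\<^sup>2 + G2\<^sup>2)) / 2"
    unfolding corner_J_def nth using c by (simp add: field_simps)
  have ss: "sqrt (1 + fst (corner_point E1 G1 E2 G2) $ 3) = s1" "sqrt (1 - snd (corner_point E1 G1 E2 G2) $ 3) = s2"
    unfolding nth by (simp_all add: s)
  show "corner_K (corner_point E1 G1 E2 G2) = E1 * E2 + G1 * G2"
    by (simp only: corner_K_def ss A[symmetric], simp only: nth) (use pos in \<open>simp add: field_simps\<close>)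
  have w: "E1 * s1 / A1 / (s1 / A1) = E1" "- (- G1 * s1 / A1) / (s1 / A1) = G1" "E2 * s2 / A2 / (s2 / A2) = E2"
      "G2 * s2 / A2 / (s2 / A2) = G2" using pos by simp_all
  show "corner_flow 0 (pi / 2) 1 (corner_point E1 G1 E2 G2) = corner_point (- G2) E2 (- G1) E1"
    by (simp only: corner_flow_def Let_def ss A[symmetric], simp only: nth w) simp
qed

text \<open>Components of Hamilton's equation on the first sphere in terms of chart coordinates. The
  reciprocals k and i of A and s enter as variables with \<open>A * k = 1\<close> and
  \<open>s * i = 1\<close>, which leaves polynomial identities.\<close>

private lemma corner_alg:
  fixes E G E' G' a b A s cc z zd h3 k i :: real
  assumes "A * k = 1" "s * i = 1" "s\<^sup>2 = 1 + z" "z = 1 - (E\<^sup>2 + G\<^sup>2) * k\<^sup>2" "zd = 2 * k\<^sup>2 * (b * (E * G' - G * E'))"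
    "h3 = - a - b * (E * E' + G * G') * i\<^sup>2 * k\<^sup>2"
  shows "((- a * G - b * G') * s + E * (zd * i / 2)) * k = 2 * k\<^sup>2 * (b * (- A * G' * i)) * z - h3 * (- G * s * k)"
    "- ((a * E + b * E') * s + G * (zd * i / 2)) * k = h3 * (E * s * k) - 2 * k\<^sup>2 * (b * (A * E' * i)) * z"
    "zd = 2 * k\<^sup>2 * (b * (A * E' * i)) * (- G * s * k) - 2 * k\<^sup>2 * (b * (- A * G' * i)) * (E * s * k)"
  using assms by algebra+

private lemma corner_alg':
  fixes E G E' G' a b A s cc z zd h3 k i :: real
  assumes "A * k = 1" "s * i = 1" "s\<^sup>2 = 1 - z" "z = (E\<^sup>2 + G\<^sup>2) * k\<^sup>2 - 1" "zd = 2 * k\<^sup>2 * (b * (G * E' - E * G'))"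
    "h3 = a + b * (E * E' + G * G') * i\<^sup>2 * k\<^sup>2"
  shows "((- a * G - b * G') * s - E * (zd * i / 2)) * k = 2 * k\<^sup>2 * (b * (A * G' * i)) * z - h3 * (G * s * k)"
    "((a * E + b * E') * s - G * (zd * i / 2)) * k = h3 * (E * s * k) - 2 * k\<^sup>2 * (b * (A * E' * i)) * z"
    "zd = 2 * k\<^sup>2 * (b * (A * E' * i)) * (G * s * k) - 2 * k\<^sup>2 * (b * (A * G' * i)) * (E * s * k)"
  using assms by algebra+

text \<open>Both summands of \<open>corner_J\<close> are nonnegative, so each of them is below
  \<open>2 * c2\<close>. Hence the second point is not the north pole, and by
  \<open>c2 \<le> c1\<close> the first is not the south pole; these are the points that the charts
  miss.\<close>

private lemma corner_domain:
  assumes x: "x \<in> S2xS2" and J: "corner_J x < 2 * c2" and c12: "c2 \<le> c1"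
  shows "1 + fst x $ 3 > 0" "1 - snd x $ 3 > 0"
proof -
  have P: "(fst x $ 1)\<^sup>2 + (fst x $ 2)\<^sup>2 + (fst x $ 3)\<^sup>2 = 1" and Q: "(snd x $ 1)\<^sup>2 + (snd x $ 2)\<^sup>2 + (snd x $ 3)\<^sup>2 = 1"
    using x S2_iff by (auto simp: mem_Times_iff)
  have le1: "w \<le> 1 \<and> - 1 \<le> w" if "u + v + w\<^sup>2 = 1" "u \<ge> 0" "v \<ge> 0" for u v w :: real
    using that abs_le_square_iff[of w 1] by auto
  have b3: "fst x $ 3 \<le> 1" "- 1 \<le> snd x $ 3" using le1[OF P] le1[OF Q] by auto
  have "c1 * (1 - fst x $ 3) \<ge> 0" "c2 * (1 + snd x $ 3) \<ge> 0" using b3 c by simp_all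
  then have "c1 * (1 - fst x $ 3) < 2 * c2" "c2 * (1 + snd x $ 3) < c2 * 2"
    using J unfolding corner_J_def by linarith+
  then have "c1 * (1 - fst x $ 3) < c1 * 2" "c2 * (1 + snd x $ 3) < c2 * 2" using c12 by linarith+
  then have "1 - fst x $ 3 < 2" "1 + snd x $ 3 < 2" using c by (simp_all only: mult_less_cancel_left_pos)
  then show "1 + fst x $ 3 > 0" "1 - snd x $ 3 > 0" using c by simp_all
qed

private lemma corner_flow_properties:
  assumes x: "x \<in> S2xS2" and J: "corner_J x < 2 * c2" and c12: "c2 \<le> c1"
  shows "corner_flow a b 0 x = x \<and> corner_flow a b t x \<in> S2xS2 \<and>
        corner_J (corner_flow a b t x) = corner_J x \<and> corner_K (corner_flow a b t x) = corner_K x \<and>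
        (\<exists>g1 g2 k1 k2. (corner_J has_derivative (\<lambda>v. g1 \<bullet> fst v + g2 \<bullet> snd v)) (at (corner_flow a b t x)) \<and>
           (corner_K has_derivative (\<lambda>v. k1 \<bullet> fst v + k2 \<bullet> snd v)) (at (corner_flow a b t x)) \<and>
           ((\<lambda>s. corner_flow a b s x) has_vector_derivative
              ham_field c1 c2 (a *\<^sub>R g1 + b *\<^sub>R k1) (a *\<^sub>R g2 + b *\<^sub>R k2) (corner_flow a b t x)) (at t))"
proof -
  note pp = corner_domain[OF x J c12]
  define s1 s2 where "s1 = sqrt (1 + fst x $ 3) / sqrt (2 * c1)" and "s2 = sqrt (1 - snd x $ 3) / sqrt (2 * c2)"
  define X1 Y1 X2 Y2 where "X1 = fst x $ 1 / s1" and "Y1 = - fst x $ 2 / s1" and "X2 = snd x $ 1 / s2" and "Y2 = snd x $ 2 / s2"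
  note XY = X1_def Y1_def X2_def Y2_def
  note cc = corner_chart_cancel[OF x pp, folded s1_def s2_def, folded XY]
  define U1 where "U1 s = X1 * cos (b * s) - Y2 * sin (b * s)" for s
  define V1 where "V1 s = Y1 * cos (b * s) + X2 * sin (b * s)" for s
  define U2 where "U2 s = X2 * cos (b * s) - Y1 * sin (b * s)" for s
  define V2 where "V2 s = Y2 * cos (b * s) + X1 * sin (b * s)" for s
  define E1 where "E1 s = U1 s * cos (a * s) - V1 s * sin (a * s)" for s
  define G1 where "G1 s = V1 s * cos (a * s) + U1 s * sin (a * s)" for s
  define E2 where "E2 s = U2 s * cos (a * s) - V2 s * sin (a * s)" for s
  define G2 where "G2 s = V2 s * cos (a * s) + U2 s * sin (a * s)" for s
  have fl: "corner_flow a b s x = corner_point (E1 s) (G1 s) (E2 s) (G2 s)" for s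
    unfolding corner_flow_def Let_def s1_def[symmetric] s2_def[symmetric] XY[symmetric]
      E1_def E2_def G1_def G2_def U1_def V1_def U2_def V2_def ..
  have "X1\<^sup>2 + Y1\<^sup>2 < 4 * c1" "X2\<^sup>2 + Y2\<^sup>2 < 4 * c2" unfolding cc(1,2) using pp c by simp_all
  note x_props = corner_point_props[OF this, unfolded cc(3)]
  \<comment> \<open>The rotation by \<open>b * s\<close> mixes X1 with Y2 and X2 with Y1, the
    rotation by \<open>a * s\<close> mixes U1 with V1 and U2 with V2. Each preserves a sum of two
    squares, and together they preserve the total, which is twice J.\<close>
  have rot: "(E1 s)\<^sup>2 + (G1 s)\<^sup>2 = (U1 s)\<^sup>2 + (V1 s)\<^sup>2" "(E2 s)\<^sup>2 + (G2 s)\<^sup>2 = (U2 s)\<^sup>2 + (V2 s)\<^sup>2"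
    "(U1 s)\<^sup>2 + (V2 s)\<^sup>2 = X1\<^sup>2 + Y2\<^sup>2" "(U2 s)\<^sup>2 + (V1 s)\<^sup>2 = X2\<^sup>2 + Y1\<^sup>2" for s
    unfolding E1_def G1_def E2_def G2_def U1_def V1_def U2_def V2_def by (rule rot_sq)+
  have tot: "(E1 s)\<^sup>2 + (G1 s)\<^sup>2 + ((E2 s)\<^sup>2 + (G2 s)\<^sup>2) = 2 * corner_J x" for s
  proof -
    have "2 * corner_J x = X1\<^sup>2 + Y1\<^sup>2 + (X2\<^sup>2 + Y2\<^sup>2)" using x_props(2) by simp
    then show ?thesis using rot[of s] by algebra
  qed
  have lt: "(E1 s)\<^sup>2 + (G1 s)\<^sup>2 < 4 * c1" "(E2 s)\<^sup>2 + (G2 s)\<^sup>2 < 4 * c2" for s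
    using tot[of s] J c12 zero_le_power2[of "E1 s"] zero_le_power2[of "E2 s"] zero_le_power2[of "G1 s"] zero_le_power2[of "G2 s"]
    by linarith+
  note t_props = corner_point_props[OF lt]
  have K: "E1 s * E2 s + G1 s * G2 s = X1 * X2 + Y1 * Y2" for s
  proof -
    have r: "(u * C - v * S) * (u' * C - v' * S) + (v * C + u * S) * (v' * C + u' * S) = u * u' + v * v'"
      if "C\<^sup>2 + S\<^sup>2 = 1" for u v u' v' C S :: real using that by algebra
    have "E1 s * E2 s + G1 s * G2 s = U1 s * U2 s + V1 s * V2 s"
      unfolding E1_def E2_def G1_def G2_def by (rule r) simp
    also have "\<dots> = X1 * X2 + Y1 * Y2"
    proof -
      have "(u * C - v * S) * (u' * C - v' * S) + (v' * C + u' * S) * (v * C + u * S) = u * u' + v' * v"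
        if "C\<^sup>2 + S\<^sup>2 = 1" for u v u' v' C S :: real using that by algebra
      then show ?thesis unfolding U1_def U2_def V1_def V2_def by simp
    qed
    finally show ?thesis .
  qed
  have 1: "corner_flow a b 0 x = x"
    by (simp add: fl E1_def G1_def E2_def G2_def U1_def V1_def U2_def V2_def cc(3))
  have 2: "corner_flow a b t x \<in> S2xS2" unfolding fl by (rule t_props(1))
  have 3: "corner_J (corner_flow a b t x) = corner_J x" unfolding fl t_props(2) using tot[of t] by simp
  have 4: "corner_K (corner_flow a b t x) = corner_K x" unfolding fl t_props(3) K x_props(3) ..
  define r1 where "r1 s = sqrt (2 - ((E1 s)\<^sup>2 + (G1 s)\<^sup>2) / (2 * c1))" for s
  define r2 where "r2 s = sqrt (2 - ((E2 s)\<^sup>2 + (G2 s)\<^sup>2) / (2 * c2))" for s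
  define A1 A2 where A: "A1 = sqrt (2 * c1)" "A2 = sqrt (2 * c2)"
  have A2': "A1\<^sup>2 = 2 * c1" "A2\<^sup>2 = 2 * c2" using c by (simp_all add: A)
  have rp: "2 - ((E1 s)\<^sup>2 + (G1 s)\<^sup>2) / (2 * c1) > 0" "2 - ((E2 s)\<^sup>2 + (G2 s)\<^sup>2) / (2 * c2) > 0" for s
    using lt[of s] c by (simp_all add: field_simps)
  have pos: "r1 t > 0" "r2 t > 0" "A1 > 0" "A2 > 0" using rp[of t] c by (simp_all add: r1_def r2_def A)
  note nth = corner_point_nth[OF r1_def r2_def, folded A]
  let ?g1 = "a *\<^sub>R vector [0, 0, - c1] + b *\<^sub>R vector [A1 * E2 t / r1 t, - A1 * G2 t / r1 t, - (E1 t * E2 t + G1 t * G2 t) / (2 * (r1 t)\<^sup>2)] :: real^3"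
  let ?g2 = "a *\<^sub>R vector [0, 0, c2] + b *\<^sub>R vector [A2 * E1 t / r2 t, A2 * G1 t / r2 t, (E1 t * E2 t + G1 t * G2 t) / (2 * (r2 t)\<^sup>2)] :: real^3"
  have dU: "(U1 has_real_derivative (- b * V2 t)) (at t)" "(V1 has_real_derivative (b * U2 t)) (at t)"
    "(U2 has_real_derivative (- b * V1 t)) (at t)" "(V2 has_real_derivative (b * U1 t)) (at t)"
    unfolding U1_def V1_def U2_def V2_def by (auto intro!: derivative_eq_intros simp: algebra_simps)
  have dE: "(E1 has_real_derivative (- a * G1 t - b * G2 t)) (at t)" "(G1 has_real_derivative (a * E1 t + b * E2 t)) (at t)"
    "(E2 has_real_derivative (- a * G2 t - b * G1 t)) (at t)" "(G2 has_real_derivative (a * E2 t + b * E1 t)) (at t)"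
    unfolding E1_def G1_def E2_def G2_def by (auto intro!: derivative_eq_intros dU simp: algebra_simps)
  define k1 i1 k2 i2 where "k1 = 1 / A1" and "i1 = 1 / r1 t" and "k2 = 1 / A2" and "i2 = 1 / r2 t"
  define z1 where "z1 s = 1 - ((E1 s)\<^sup>2 + (G1 s)\<^sup>2) / (2 * c1)" for s
  define z2 where "z2 s = ((E2 s)\<^sup>2 + (G2 s)\<^sup>2) / (2 * c2) - 1" for s
  define zd1 where "zd1 = 2 * k1\<^sup>2 * (b * (E1 t * G2 t - G1 t * E2 t))"
  define zd2 where "zd2 = 2 * k2\<^sup>2 * (b * (G2 t * E1 t - E2 t * G1 t))"
  have kk: "k1\<^sup>2 = 1 / (2 * c1)" "k2\<^sup>2 = 1 / (2 * c2)" by (simp_all add: k1_def k2_def power_divide A2')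
  have dz1: "(z1 has_real_derivative zd1) (at t)"
    unfolding z1_def zd1_def kk using c by (auto intro!: derivative_eq_intros dE simp: field_simps)
  have dz2: "(z2 has_real_derivative zd2) (at t)"
    unfolding z2_def zd2_def kk using c by (auto intro!: derivative_eq_intros dE simp: field_simps)
  have rz: "r1 s = sqrt (1 + z1 s)" "r2 s = sqrt (1 - z2 s)" for s by (simp_all add: r1_def r2_def z1_def z2_def)
  have rzp: "1 + z1 t > 0" "1 - z2 t > 0" using rp[of t] by (simp_all add: z1_def z2_def)
  have "((\<lambda>s. 1 + z1 s) has_real_derivative zd1) (at t)" by (auto intro!: derivative_eq_intros dz1)
  from DERIV_chain2[OF DERIV_real_sqrt[OF rzp(1)] this]
  have dr1: "(r1 has_real_derivative zd1 * i1 / 2) (at t)"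
    unfolding rz[abs_def, symmetric] i1_def rz(1)[symmetric] by (rule DERIV_cong) (simp add: field_simps)
  have "((\<lambda>s. 1 - z2 s) has_real_derivative - zd2) (at t)" by (auto intro!: derivative_eq_intros dz2)
  from DERIV_chain2[OF DERIV_real_sqrt[OF rzp(2)] this]
  have dr2: "(r2 has_real_derivative - (zd2 * i2 / 2)) (at t)"
    unfolding rz[abs_def, symmetric] i2_def rz(2)[symmetric] by (rule DERIV_cong) (simp add: field_simps)
  have ki: "A1 * k1 = 1" "r1 t * i1 = 1" "A2 * k2 = 1" "r2 t * i2 = 1"
    using pos by (simp_all add: k1_def i1_def k2_def i2_def)
  have rsq: "(r1 t)\<^sup>2 = 1 + z1 t" "(r2 t)\<^sup>2 = 1 - z2 t" using rzp by (simp_all add: rz)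
  have zk: "z1 t = 1 - ((E1 t)\<^sup>2 + (G1 t)\<^sup>2) * k1\<^sup>2" "z2 t = ((E2 t)\<^sup>2 + (G2 t)\<^sup>2) * k2\<^sup>2 - 1"
    by (simp_all add: z1_def z2_def kk)
  define h1 where "h1 = - a - b * (E1 t * E2 t + G1 t * G2 t) * i1\<^sup>2 * k1\<^sup>2"
  define h2 where "h2 = a + b * (E2 t * E1 t + G2 t * G1 t) * i2\<^sup>2 * k2\<^sup>2"
  note al1 = corner_alg[OF ki(1,2) rsq(1) zk(1) zd1_def h1_def]
  note al2 = corner_alg'[OF ki(3,4) rsq(2) zk(2) zd2_def h2_def]
  have kd: "w / A1 = w * k1" "w / A2 = w * k2" "w / r1 t = w * i1" "w / r2 t = w * i2"
    "w / (2 * (r1 t)\<^sup>2) = w * i1\<^sup>2 / 2" "w / (2 * (r2 t)\<^sup>2) = w * i2\<^sup>2 / 2" for w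
    by (simp_all add: k1_def k2_def i1_def i2_def power_divide)
  have cd: "1 / c1 = 2 * k1\<^sup>2" "1 / c2 = 2 * k2\<^sup>2" "c1 * (2 * k1\<^sup>2) = 1" "c2 * (2 * k2\<^sup>2) = 1" using c by (simp_all add: kk)
  have w1: "((1 / c1) *\<^sub>R (?g1 \<otimes> vector [E1 t * r1 t / A1, - G1 t * r1 t / A1, z1 t])) =
    vector [2 * k1\<^sup>2 * (b * (- A1 * G2 t * i1)) * z1 t - h1 * (- G1 t * r1 t * k1),
      h1 * (E1 t * r1 t * k1) - 2 * k1\<^sup>2 * (b * (A1 * E2 t * i1)) * z1 t,
      2 * k1\<^sup>2 * (b * (A1 * E2 t * i1)) * (- G1 t * r1 t * k1) - 2 * k1\<^sup>2 * (b * (- A1 * G2 t * i1)) * (E1 t * r1 t * k1)]"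
    unfolding h1_def kd cd(1) vec3_eq_iff cross3_nth vector_scaleR_component vector_add_component vector_3 real_scaleR_def
  proof (intro conjI, goal_cases)
    case 1 show ?case using cd(3) by algebra
  next
    case 2 show ?case using cd(3) by algebra
  qed (simp add: algebra_simps)
  have w2: "((1 / c2) *\<^sub>R (?g2 \<otimes> vector [E2 t * r2 t / A2, G2 t * r2 t / A2, z2 t])) =
    vector [2 * k2\<^sup>2 * (b * (A2 * G1 t * i2)) * z2 t - h2 * (G2 t * r2 t * k2),
      h2 * (E2 t * r2 t * k2) - 2 * k2\<^sup>2 * (b * (A2 * E1 t * i2)) * z2 t,
      2 * k2\<^sup>2 * (b * (A2 * E1 t * i2)) * (G2 t * r2 t * k2) - 2 * k2\<^sup>2 * (b * (A2 * G1 t * i2)) * (E2 t * r2 t * k2)]"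
    unfolding h2_def kd cd(2) vec3_eq_iff cross3_nth vector_scaleR_component vector_add_component vector_3 real_scaleR_def
  proof (intro conjI, goal_cases)
    case 1 show ?case using cd(4) by algebra
  next
    case 2 show ?case using cd(4) by algebra
  qed (simp add: algebra_simps)
  have v1: "((\<lambda>s. vector [E1 s * r1 s / A1, - G1 s * r1 s / A1, z1 s] :: real^3) has_vector_derivative
      (1 / c1) *\<^sub>R (?g1 \<otimes> vector [E1 t * r1 t / A1, - G1 t * r1 t / A1, z1 t])) (at t)"
    unfolding w1 unfolding al1[symmetric] kd(1)
  proof (rule has_vector_derivative_vector3[OF _ _ dz1])
    show "((\<lambda>s. E1 s * r1 s * k1) has_real_derivative ((- a * G1 t - b * G2 t) * r1 t + E1 t * (zd1 * i1 / 2)) * k1) (at t)"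
      by (rule DERIV_cong[OF DERIV_cmult_right[OF DERIV_mult[OF dE(1) dr1]]]) (simp add: algebra_simps)
    show "((\<lambda>s. - G1 s * r1 s * k1) has_real_derivative - ((a * E1 t + b * E2 t) * r1 t + G1 t * (zd1 * i1 / 2)) * k1) (at t)"
      by (rule DERIV_cong[OF DERIV_cmult_right[OF DERIV_mult[OF DERIV_minus[OF dE(2)] dr1]]]) (simp add: algebra_simps)
  qed
  have v2: "((\<lambda>s. vector [E2 s * r2 s / A2, G2 s * r2 s / A2, z2 s] :: real^3) has_vector_derivative
      (1 / c2) *\<^sub>R (?g2 \<otimes> vector [E2 t * r2 t / A2, G2 t * r2 t / A2, z2 t])) (at t)"
    unfolding w2 unfolding al2[symmetric] kd(2)
  proof (rule has_vector_derivative_vector3[OF _ _ dz2])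
    show "((\<lambda>s. E2 s * r2 s * k2) has_real_derivative ((- a * G2 t - b * G1 t) * r2 t - E2 t * (zd2 * i2 / 2)) * k2) (at t)"
      by (rule DERIV_cong[OF DERIV_cmult_right[OF DERIV_mult[OF dE(3) dr2]]]) (simp add: algebra_simps)
    show "((\<lambda>s. G2 s * r2 s * k2) has_real_derivative ((a * E2 t + b * E1 t) * r2 t - G2 t * (zd2 * i2 / 2)) * k2) (at t)"
      by (rule DERIV_cong[OF DERIV_cmult_right[OF DERIV_mult[OF dE(4) dr2]]]) (simp add: algebra_simps)
  qed
  have fl': "corner_flow a b s x = (vector [E1 s * r1 s / A1, - G1 s * r1 s / A1, z1 s], vector [E2 s * r2 s / A2, G2 s * r2 s / A2, z2 s])" for s
    unfolding fl prod_eq_iff vec3_eq_iff nth by (simp add: z1_def z2_def)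
  have v: "((\<lambda>s. corner_flow a b s x) has_vector_derivative ham_field c1 c2 ?g1 ?g2 (corner_flow a b t x)) (at t)"
    unfolding fl' ham_field_def fst_conv snd_conv by (rule has_vector_derivative_Pair[OF v1 v2])
  note dK = corner_K_derivative[OF lt[of t] r1_def[of t] r2_def[of t] A, folded fl]
  show ?thesis by (intro conjI exI) (rule 1 2 3 4 corner_J_derivative dK v)+
qed

text \<open>A quarter turn exchanges the squared chart radii \<open>2 * c1 * (1 - z1)\<close> and
  \<open>2 * c2 * (1 + z2)\<close>; solving for the heights gives the target torus. Their sum is
  conserved, so the target satisfies the same bound and can be treated in the same charts.\<close>

lemma ham_equivalent_corner:
  assumes c12: "c2 \<le> c1" and z: "z1 \<le> 1" "- 1 \<le> z2" "c1 * (1 - z1) + c2 * (1 + z2) < 2 * c2"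
  shows "ham_equivalent (round_form c1 c2) (round_torus z1 z2)
    (round_torus (1 - c2 * (1 + z2) / c1) (c1 * (1 - z1) / c2 - 1))"
proof -
  define j0 where "j0 = c1 * (1 - z1) + c2 * (1 + z2)"
  define e where "e = 2 * c2 - j0"
  have e: "e > 0" using z by (simp add: e_def j0_def)
  have Jb: "corner_J x < 2 * c2" if "\<bar>corner_J x - j0\<bar> < e" for x using that by (simp add: e_def)
  define W where "W = {x::point. 1 + fst x $ 3 > 0} \<inter> {x. 1 - snd x $ 3 > 0}"
  have oW: "open W" unfolding W_def by (intro open_Int open_Collect_less continuous_intros)
  have sK: "smooth_on_open W corner_K" unfolding corner_K_def
    by (intro smooth_intros oW) (auto simp: W_def)
  have sJ: "smooth_on_open UNIV corner_J" unfolding corner_J_def by (intro smooth_intros open_UNIV)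
  have sub: "x \<in> W" if x: "x \<in> S2xS2" and j: "\<bar>corner_J x - j0\<bar> < e" for x
    using corner_domain[OF x Jb[OF j] c12] by (simp add: W_def)
  obtain H \<Phi> where fl: "hamiltonian_flow (round_form c1 c2) H \<Phi>"
    and \<Phi>: "\<And>x. x \<in> S2xS2 \<Longrightarrow> corner_J x = j0 \<Longrightarrow> \<Phi> 1 x = corner_flow 0 (pi / 2) 1 x"
  proof (rule cutoff_hamiltonian_flow[of c1 c2 e W corner_K corner_J j0 corner_flow "pi / 2"])
    show "c1 \<noteq> 0" "c2 \<noteq> 0" using c by simp_all
  qed (rule e oW sK sJ sub corner_flow_properties[OF _ Jb c12] that; assumption)+
  let ?u = "1 - c2 * (1 + z2) / c1" let ?w = "c1 * (1 - z1) / c2 - 1"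
  have torus: "corner_point E1 G1 E2 G2 \<in> round_torus u w \<longleftrightarrow> E1\<^sup>2 + G1\<^sup>2 = 2 * c1 * (1 - u) \<and> E2\<^sup>2 + G2\<^sup>2 = 2 * c2 * (1 + w)"
    if "E1\<^sup>2 + G1\<^sup>2 < 4 * c1" "E2\<^sup>2 + G2\<^sup>2 < 4 * c2" for E1 G1 E2 G2 u w
    using corner_point_props(1)[OF that] c unfolding round_torus_def
    by (auto simp: mem_Times_iff corner_point_nth[OF refl refl] field_simps)
  have chart: "\<exists>E1 G1 E2 G2. x = corner_point E1 G1 E2 G2 \<and> E1\<^sup>2 + G1\<^sup>2 < 4 * c1 \<and> E2\<^sup>2 + G2\<^sup>2 < 4 * c2 \<and>
      E1\<^sup>2 + G1\<^sup>2 = 2 * c1 * (1 - u) \<and> E2\<^sup>2 + G2\<^sup>2 = 2 * c2 * (1 + w)"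
    if x: "x \<in> round_torus u w" and j: "c1 * (1 - u) + c2 * (1 + w) < 2 * c2" for x u w
  proof -
    have xM: "x \<in> S2xS2" and x3: "fst x $ 3 = u" "snd x $ 3 = w" using x by (auto simp: round_torus_def)
    have "corner_J x < 2 * c2" using j by (simp add: corner_J_def x3)
    note p = corner_domain[OF xM this c12]
    note cc = corner_chart_cancel[OF xM p]
    have b: "2 * c1 * (1 - fst x $ 3) < 4 * c1" "2 * c2 * (1 + snd x $ 3) < 4 * c2" using p c by simp_all
    show ?thesis
      by (intro exI conjI, rule cc(3)[symmetric]) (simp_all only: cc(1,2) x3[symmetric] b)
  qed
  have small: "N1 < 4 * c1" "N2 < 4 * c2" if "N1 = 2 * c2 * (1 + z2)" "N2 = 2 * c1 * (1 - z1)" for N1 N2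
  proof -
    have "c2 * (1 + z2) \<ge> 0" "c1 * (1 - z1) \<ge> 0" using z c by simp_all
    then show "N1 < 4 * c1" "N2 < 4 * c2" using that z(3) c12 by linarith+
  qed
  have "\<Phi> 1 ` round_torus z1 z2 = round_torus ?u ?w"
  proof
    show "\<Phi> 1 ` round_torus z1 z2 \<subseteq> round_torus ?u ?w"
    proof (rule image_subsetI)
      fix x assume x: "x \<in> round_torus z1 z2"
      have xM: "x \<in> S2xS2" and "fst x $ 3 = z1" "snd x $ 3 = z2" using x by (auto simp: round_torus_def)
      then have P: "\<Phi> 1 x = corner_flow 0 (pi / 2) 1 x" by (intro \<Phi>) (simp_all add: corner_J_def j0_def)
      from chart[OF x z(3)] obtain E1 G1 E2 G2 where ch: "x = corner_point E1 G1 E2 G2" "E1\<^sup>2 + G1\<^sup>2 < 4 * c1" "E2\<^sup>2 + G2\<^sup>2 < 4 * c2"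
         "E1\<^sup>2 + G1\<^sup>2 = 2 * c1 * (1 - z1)" "E2\<^sup>2 + G2\<^sup>2 = 2 * c2 * (1 + z2)" by blast
      have "\<Phi> 1 x = corner_point (- G2) E2 (- G1) E1" unfolding P unfolding ch(1) by (rule corner_point_props(4)[OF ch(2,3)])
      also have "\<dots> \<in> round_torus ?u ?w"
        using ch(4,5) small c by (subst torus) (simp_all add: add.commute[of "G1\<^sup>2"] add.commute[of "G2\<^sup>2"])
      finally show "\<Phi> 1 x \<in> round_torus ?u ?w" .
    qed
    show "round_torus ?u ?w \<subseteq> \<Phi> 1 ` round_torus z1 z2"
    proof
      fix y assume y: "y \<in> round_torus ?u ?w"
      have "c1 * (1 - ?u) + c2 * (1 + ?w) < 2 * c2" using z(3) c by simp
      from chart[OF y this] obtain E1 G1 E2 G2 where ch: "y = corner_point E1 G1 E2 G2" "E1\<^sup>2 + G1\<^sup>2 < 4 * c1" "E2\<^sup>2 + G2\<^sup>2 < 4 * c2"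
         "E1\<^sup>2 + G1\<^sup>2 = 2 * c1 * (1 - ?u)" "E2\<^sup>2 + G2\<^sup>2 = 2 * c2 * (1 + ?w)" by blast
      have ch': "E1\<^sup>2 + G1\<^sup>2 = 2 * c2 * (1 + z2)" "E2\<^sup>2 + G2\<^sup>2 = 2 * c1 * (1 - z1)" using ch(4,5) c by simp_all
      have "c2 * (1 + z2) \<ge> 0" "c1 * (1 - z1) \<ge> 0" using z c by simp_all
      then have "G2\<^sup>2 + E2\<^sup>2 < 4 * c1" "G1\<^sup>2 + E1\<^sup>2 < 4 * c2" using ch' z(3) c12 by linarith+
      then have b: "G2\<^sup>2 + (- E2)\<^sup>2 < 4 * c1" "G1\<^sup>2 + (- E1)\<^sup>2 < 4 * c2" by simp_all
      \<comment> \<open>Obtained by inverting the quarter turn, which takes the chart coordinates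
        \<open>(E1, G1, E2, G2)\<close> to \<open>(- G2, E2, - G1, E1)\<close>.\<close>
      define x where "x = corner_point G2 (- E2) G1 (- E1)"
      have x: "x \<in> round_torus z1 z2" unfolding x_def torus[OF b] using ch' by (simp add: add.commute)
      have xM: "x \<in> S2xS2" and "fst x $ 3 = z1" "snd x $ 3 = z2" using x by (auto simp: round_torus_def)
      then have "\<Phi> 1 x = corner_flow 0 (pi / 2) 1 x" by (intro \<Phi>) (simp_all add: corner_J_def j0_def)
      also have "\<dots> = y" unfolding x_def corner_point_props(4)[OF b] ch(1) by simp
      finally show "y \<in> \<Phi> 1 ` round_torus z1 z2" using x by blast
    qed
  qed
  then show ?thesis by (rule ham_equivalentI[OF fl])
qed

end

end

section \<open>An infinite family of equivalent tori\<close>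

text \<open>On a round sphere of total area a the parallel at height z and the equator bound the
  signed area a z / 2 (Archimedes). For the total areas \<open>2 * (1 + \<alpha>)\<close> and
  \<open>2 * \<alpha>\<close> the signed areas x and y occur at the heights given here.\<close>

definition round_split :: "real \<Rightarrow> real \<Rightarrow> real \<Rightarrow> point set" where
  "round_split \<alpha> x y = round_torus (x / (1 + \<alpha>)) (y / \<alpha>)"

text \<open>The weights are the total areas \<open>2 * (1 + \<alpha>)\<close> and
  \<open>2 * \<alpha>\<close> divided by the area 4 pi of the unit sphere.\<close>

definition split_form :: "real \<Rightarrow> point two_form" where
  "split_form \<alpha> = round_form ((1 + \<alpha>) / (2 * pi)) (\<alpha> / (2 * pi))"

definition split_equiv :: "real \<Rightarrow> real \<Rightarrow> real \<Rightarrow> real \<Rightarrow> bool" where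
  "split_equiv \<alpha> y x x' \<longleftrightarrow>
     ham_equivalent (split_form \<alpha>) (round_split \<alpha> x y) (round_split \<alpha> x' y)"

context
  fixes \<alpha> y :: real
  assumes \<alpha>: "\<alpha> > 0" and y: "0 < y" "y < \<alpha>"
begin

private abbreviation eqv :: "real \<Rightarrow> real \<Rightarrow> real \<Rightarrow> real \<Rightarrow> bool" where
  "eqv u w u' w' \<equiv> ham_equivalent (split_form \<alpha>) (round_split \<alpha> u w) (round_split \<alpha> u' w')"

private lemma c_pos: "(1 + \<alpha>) / (2 * pi) > 0" "\<alpha> / (2 * pi) > 0"
  using \<alpha> by simp_all

private lemma c_nz: "(1 + \<alpha>) / (2 * pi) \<noteq> 0" "\<alpha> / (2 * pi) \<noteq> 0"
  using c_pos by linarith+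

private lemma rescale:
  "b \<noteq> 0 \<Longrightarrow> b / (2 * pi) * (u / b) = u / (2 * pi)"
  "b \<noteq> 0 \<Longrightarrow> b / (2 * pi) * (1 - u / b) = (b - u) / (2 * pi)"
  "b \<noteq> 0 \<Longrightarrow> b / (2 * pi) * (1 + u / b) = (b + u) / (2 * pi)" for b u :: real
  by (simp_all add: field_simps)

private lemma rescale2:
  "a \<noteq> 0 \<Longrightarrow> b \<noteq> 0 \<Longrightarrow> u / b - 2 * (a / (2 * pi) / (b / (2 * pi))) * (w / a) = (u - 2 * w) / b"
  "a \<noteq> 0 \<Longrightarrow> b \<noteq> 0 \<Longrightarrow> 1 - a / (2 * pi) * (1 + w / a) / (b / (2 * pi)) = (b - a - w) / b"
  "a \<noteq> 0 \<Longrightarrow> b \<noteq> 0 \<Longrightarrow> b / (2 * pi) * (1 - u / b) / (a / (2 * pi)) - 1 = (b - a - u) / a" for a b u w :: real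
  by (simp_all add: field_simps)

private lemma \<alpha>_nz: "1 + \<alpha> \<noteq> 0" "\<alpha> \<noteq> 0"
  using \<alpha> by simp_all

private lemma eqv_trans: "eqv u w u' w' \<Longrightarrow> eqv u' w' u'' w'' \<Longrightarrow> eqv u w u'' w''"
  unfolding split_form_def round_split_def by (rule ham_equivalent_trans[OF _ _ round_torus_subset])

private lemma eqv_fst: "eqv u w (- u) w"
  using ham_equivalent_reflect_fst[OF c_nz] by (simp add: split_form_def round_split_def)

private lemma eqv_snd: "eqv u w u (- w)"
  using ham_equivalent_reflect_snd[OF c_nz] by (simp add: split_form_def round_split_def)

private lemma eqv_shear: "\<bar>u - w\<bar> < 1 \<Longrightarrow> eqv u w (u - 2 * w) (- w)"
proof -
  assume uw: "\<bar>u - w\<bar> < 1"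
  have "(1 + \<alpha>) / (2 * pi) * (u / (1 + \<alpha>)) - \<alpha> / (2 * pi) * (w / \<alpha>) = (u - w) / (2 * pi)"
    unfolding rescale(1)[OF \<alpha>_nz(1)] rescale(1)[OF \<alpha>_nz(2)] by (simp add: diff_divide_distrib)
  moreover have "\<bar>(u - w) / (2 * pi)\<bar> + \<alpha> / (2 * pi) < (1 + \<alpha>) / (2 * pi)"
    using uw by (simp add: field_simps)
  ultimately have "ham_equivalent (split_form \<alpha>) (round_torus (u / (1 + \<alpha>)) (w / \<alpha>))
     (round_torus (u / (1 + \<alpha>) - 2 * (\<alpha> / (2 * pi) / ((1 + \<alpha>) / (2 * pi))) * (w / \<alpha>)) (- (w / \<alpha>)))"
    unfolding split_form_def by (intro ham_equivalent_shear c_pos) simp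
  moreover have "u / (1 + \<alpha>) - 2 * (\<alpha> / (2 * pi) / ((1 + \<alpha>) / (2 * pi))) * (w / \<alpha>) = (u - 2 * w) / (1 + \<alpha>)"
    by (rule rescale2(1)[OF \<alpha>_nz(2,1)])
  ultimately show ?thesis by (simp add: round_split_def)
qed

text \<open>In area units the bound on \<open>corner_J\<close> becomes \<open>1 < u - w\<close>, and
  that on \<open>shear_J\<close> was \<open>\<bar>u - w\<bar> < 1\<close>: the two moves act on
  opposite sides of the line \<open>u - w = 1\<close>.\<close>

private lemma eqv_corner: "u \<le> 1 + \<alpha> \<Longrightarrow> - \<alpha> \<le> w \<Longrightarrow> 1 < u - w \<Longrightarrow> eqv u w (1 - w) (1 - u)"
proof -
  assume uw: "u \<le> 1 + \<alpha>" "- \<alpha> \<le> w" "1 < u - w"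
  have "ham_equivalent (split_form \<alpha>) (round_torus (u / (1 + \<alpha>)) (w / \<alpha>))
     (round_torus (1 - \<alpha> / (2 * pi) * (1 + w / \<alpha>) / ((1 + \<alpha>) / (2 * pi)))
        ((1 + \<alpha>) / (2 * pi) * (1 - u / (1 + \<alpha>)) / (\<alpha> / (2 * pi)) - 1))"
    unfolding split_form_def
  proof (rule ham_equivalent_corner[OF c_pos])
    show "\<alpha> / (2 * pi) \<le> (1 + \<alpha>) / (2 * pi)" by (simp add: field_simps)
    show "u / (1 + \<alpha>) \<le> 1" "- 1 \<le> w / \<alpha>" using uw \<alpha> by (simp_all add: field_simps)
    have "(1 + \<alpha>) / (2 * pi) * (1 - u / (1 + \<alpha>)) + \<alpha> / (2 * pi) * (1 + w / \<alpha>) = (1 + 2 * \<alpha> - (u - w)) / (2 * pi)"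
      unfolding rescale(2)[OF \<alpha>_nz(1)] rescale(3)[OF \<alpha>_nz(2)] by (simp add: field_simps)
    also have "\<dots> < 2 * \<alpha> / (2 * pi)" using uw(3) by (intro divide_strict_right_mono) simp_all
    finally show "(1 + \<alpha>) / (2 * pi) * (1 - u / (1 + \<alpha>)) + \<alpha> / (2 * pi) * (1 + w / \<alpha>) < 2 * (\<alpha> / (2 * pi))" by simp
  qed
  moreover have "1 - \<alpha> / (2 * pi) * (1 + w / \<alpha>) / ((1 + \<alpha>) / (2 * pi)) = (1 - w) / (1 + \<alpha>)"
    unfolding rescale2(2)[OF \<alpha>_nz(2,1)] by simp
  moreover have "(1 + \<alpha>) / (2 * pi) * (1 - u / (1 + \<alpha>)) / (\<alpha> / (2 * pi)) - 1 = (1 - u) / \<alpha>"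
    unfolding rescale2(3)[OF \<alpha>_nz(2,1)] by simp
  ultimately show ?thesis by (simp add: round_split_def)
qed

text \<open>Two corner moves separated by reflections of the second factor. The bound
  \<open>\<bar>v\<bar> < y\<close> places both starting points beyond the line
  \<open>u - w = 1\<close>: the differences are \<open>1 + v + y\<close> and
  \<open>1 + y - v\<close>.\<close>

private lemma eqv_flip: "\<bar>v\<bar> < y \<Longrightarrow> eqv (1 + v) y (1 - v) y"
proof -
  assume v: "\<bar>v\<bar> < y"
  have "eqv (1 + v) y (1 + v) (- y)" by (rule eqv_snd)
  moreover have "eqv (1 + v) (- y) (1 + y) (- v)" using eqv_corner[of "1 + v" "- y"] v y by simp
  moreover have "eqv (1 + y) (- v) (1 + y) v" using eqv_snd[of "1 + y" "- v"] by simp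
  moreover have "eqv (1 + y) v (1 - v) (- y)" using eqv_corner[of "1 + y" v] v y by simp
  moreover have "eqv (1 - v) (- y) (1 - v) y" using eqv_snd[of "1 - v" "- y"] by simp
  ultimately show ?thesis using eqv_trans by metis
qed

private lemma eqv_down: "\<bar>u - y\<bar> < 1 \<Longrightarrow> eqv u y (u - 2 * y) y"
  using eqv_trans[OF eqv_shear[of u y] eqv_snd[of "u - 2 * y" "- y"]] by simp

private lemma eqv_up: "\<bar>u + y\<bar> < 1 \<Longrightarrow> eqv u y (u + 2 * y) y"
proof -
  assume u: "\<bar>u + y\<bar> < 1"
  have "eqv u y (- u) y" by (rule eqv_fst)
  moreover have "eqv (- u) y (- u - 2 * y) y" using eqv_down[of "- u"] u by simp
  moreover have "eqv (- u - 2 * y) y (u + 2 * y) y" using eqv_fst[of "- u - 2 * y" y] by (simp add: add.commute)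
  ultimately show ?thesis using eqv_trans by metis
qed

text \<open>Both directions are carried along: inverses come from the moves themselves, so that
  reflexivity and transitivity of equivalence suffice.\<close>

private definition related :: "real \<Rightarrow> bool" where
  "related u \<longleftrightarrow> eqv 1 y u y \<and> eqv u y 1 y"

private lemma related_fst: "related u \<Longrightarrow> related (- u)"
  unfolding related_def using eqv_trans eqv_fst[of u y] eqv_fst[of "- u" y] by (metis minus_minus)

private lemma related_flip: "\<bar>v\<bar> < y \<Longrightarrow> related (1 + v) \<Longrightarrow> related (1 - v)"
  unfolding related_def using eqv_trans eqv_flip[of v] eqv_flip[of "- v"] by (metis abs_minus_cancel diff_minus_eq_add uminus_add_conv_diff add_uminus_conv_diff)

private lemma related_up: "\<bar>u + y\<bar> < 1 \<Longrightarrow> related u \<Longrightarrow> related (u + 2 * y)"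
proof -
  assume u: "\<bar>u + y\<bar> < 1" "related u"
  have 1: "eqv u y (u + 2 * y) y" using u by (intro eqv_up)
  have 2: "eqv (u + 2 * y) y u y" using eqv_down[of "u + 2 * y"] u by simp
  show ?thesis using u(2) eqv_trans[OF _ 1] eqv_trans[OF 2] by (simp add: related_def)
qed

text \<open>Reflection to -(1 + v), translations by 2 y back to the window around 1 and a flip act
  on v as addition of 2 modulo 2 y. One step of the induction on n is one application of this return
  map; k records the number of full turns.\<close>

private lemma related_orbit:
  assumes irr: "y \<notin> \<rat>" and v: "\<bar>2 * real n - 2 * real_of_int k * y\<bar> < y"
  shows "related (1 + (2 * real n - 2 * real_of_int k * y))"
  using v
proof (induction n arbitrary: k)
  case 0
  then have "\<bar>2 * real_of_int k\<bar> * y < 1 * y" using y by (simp add: abs_mult)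
  then have "\<bar>2 * real_of_int k\<bar> < 1" using y by (simp only: mult_less_cancel_right_pos)
  then have "k = 0" by linarith
  moreover have "eqv 1 y 1 y" using ham_equivalent_refl[OF c_nz] by (simp add: split_form_def)
  ultimately show ?case by (simp add: related_def)
next
  case (Suc n)
  \<comment> \<open>Chooses the representative v of 2 n modulo 2 y in the half-open window from -y
    to y; the left end point would make y rational.\<close>
  define j where "j = \<lfloor>(2 * real n + y) / (2 * y)\<rfloor>"
  define v where "v = 2 * real n - 2 * real_of_int j * y"
  have "real_of_int j \<le> (2 * real n + y) / (2 * y)" "(2 * real n + y) / (2 * y) < real_of_int j + 1"
    unfolding j_def by linarith+
  then have v1: "- y \<le> v" "v < y" using y by (simp_all add: v_def field_simps)
  have "v \<noteq> - y"
  proof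
    assume "v = - y"
    then have "(2 * real_of_int j - 1) * y = 2 * real n" by (simp add: v_def algebra_simps)
    moreover have "2 * real_of_int j - 1 \<noteq> 0"
    proof
      assume "2 * real_of_int j - 1 = 0"
      then have "2 * j = 1" by linarith
      then show False by presburger
    qed
    ultimately have "y = 2 * real n / (2 * real_of_int j - 1)" by (simp add: field_simps)
    also have "\<dots> \<in> \<rat>" by (intro Rats_divide Rats_mult Rats_diff Rats_of_int Rats_of_nat Rats_number_of Rats_1)
    finally show False using irr by simp
  qed
  then have v: "\<bar>v\<bar> < y" using v1 by simp
  have IH: "related (1 + v)" unfolding v_def by (rule Suc.IH) (use v in \<open>simp add: v_def\<close>)
  define v' where "v' = 2 * real (Suc n) - 2 * real_of_int k * y"
  have v': "\<bar>v'\<bar> < y" using Suc.prems by (simp add: v'_def)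
  have d: "2 * real_of_int (k - j) * y = 2 + v - v'" by (simp add: v_def v'_def algebra_simps)
  have "k - j \<ge> 0"
  proof (rule ccontr)
    assume "\<not> ?thesis"
    then have "real_of_int (k - j) \<le> -1" by linarith
    then have "2 * real_of_int (k - j) * y \<le> 2 * (-1) * y" using y by (intro mult_right_mono mult_left_mono) auto
    then show False using d v v' by linarith
  qed
  then obtain m where m: "k - j = int m" using nonneg_int_cases by blast
  have d': "2 * real m * y = 2 + v - v'" using d m by simp
  have up: "related (- (1 + v) + 2 * real i * y)" if "i \<le> m" for i
    using that
  proof (induction i)
    case 0
    then show ?case using related_fst[OF IH] by simp
  next
    case (Suc i)
    have "real (Suc i) \<le> real m" using Suc.prems by simp
    then have "real (Suc i) * y \<le> real m * y" using y by (intro mult_right_mono) auto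
    then have "2 * real i * y \<le> 2 * real m * y - 2 * y" by (simp add: algebra_simps)
    moreover have "2 * real i * y \<ge> 0" using y by simp
    ultimately have "\<bar>- (1 + v) + 2 * real i * y + y\<bar> < 1" using d' v v' by linarith
    then have "related (- (1 + v) + 2 * real i * y + 2 * y)" using related_up Suc by simp
    then show ?case by (simp add: algebra_simps)
  qed
  have "related (1 + (- v'))" using up[of m] d' by simp
  then have "related (1 - (- v'))" using v' by (intro related_flip) simp_all
  then show ?case by (simp add: v'_def)
qed

lemma equivalent_tori_sequence:
  assumes irr: "y \<notin> \<rat>" and x: "\<bar>x - 1\<bar> < y"
  obtains X where "\<And>i::nat. \<bar>X i - 1\<bar> < y" "X \<longlonglongrightarrow> x"
    "\<And>i. \<exists>a b::int. X i = of_int a + of_int b * y" "\<And>i j. split_equiv \<alpha> y (X i) (X j)"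
proof -
  define \<theta> where "\<theta> = 1 / y"
  have th: "\<theta> \<notin> \<rat>"
  proof
    assume "\<theta> \<in> \<rat>"
    then have "1 / \<theta> \<in> \<rat>" by simp
    then show False using irr by (simp add: \<theta>_def)
  qed
  have ex: "\<exists>n k. \<bar>(1 + (2 * real n - 2 * real_of_int k * y)) - x\<bar> < min e (y - \<bar>x - 1\<bar>)" if e: "e > 0" for e
  proof -
    define d where "d = min e (y - \<bar>x - 1\<bar>)"
    have d: "d > 0" using e x by (simp add: d_def)
    then have "d / (2 * y) > 0" using y by simp
    \<comment> \<open>Multiplication by 2 y turns an approximation of
      \<open>(x - 1) / (2 * y)\<close> by n \<theta> - h into one of x - 1 by 2 n - 2 h y. The
      tolerance d is also small enough to stay inside the window around 1.\<close>
    from sequence_of_fractional_parts_is_dense[OF th this, of "(x - 1) / (2 * y)"]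
    obtain h n where n: "n > 0" "\<bar>of_int n * \<theta> - of_int h - (x - 1) / (2 * y)\<bar> < d / (2 * y)" by blast
    then have "\<bar>of_int n * \<theta> - of_int h - (x - 1) / (2 * y)\<bar> * (2 * y) < d"
      using y by (simp only: pos_less_divide_eq)
    then have "\<bar>2 * y * (of_int n * \<theta> - of_int h - (x - 1) / (2 * y))\<bar> < d"
      unfolding abs_mult using y by (simp add: mult.commute)
    moreover have "2 * y * (of_int n * \<theta> - of_int h - (x - 1) / (2 * y)) = 1 + (2 * real (nat n) - 2 * real_of_int h * y) - x"
      using y n(1) by (simp add: \<theta>_def field_simps)
    ultimately show ?thesis unfolding d_def[symmetric] by metis
  qed
  have "\<forall>i. \<exists>n k. \<bar>(1 + (2 * real n - 2 * real_of_int k * y)) - x\<bar> < min (1 / real (Suc i)) (y - \<bar>x - 1\<bar>)"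
    using ex by simp
  then obtain n k where nk: "\<And>i. \<bar>(1 + (2 * real (n i) - 2 * real_of_int (k i) * y)) - x\<bar> < min (1 / real (Suc i)) (y - \<bar>x - 1\<bar>)"
    by metis
  define X where "X i = 1 + (2 * real (n i) - 2 * real_of_int (k i) * y)" for i
  have X: "\<bar>X i - x\<bar> < 1 / real (Suc i)" "\<bar>X i - 1\<bar> < y" for i
    using nk[of i] unfolding X_def by linarith+
  have rel: "related (X i)" for i
    unfolding X_def by (rule related_orbit[OF irr]) (use X(2)[of i] in \<open>simp add: X_def\<close>)
  show thesis
  proof
    show "\<bar>X i - 1\<bar> < y" for i by (rule X(2))
    have "(\<lambda>i. X i - x) \<longlonglongrightarrow> 0"
      by (rule Lim_null_comparison[OF _ LIMSEQ_inverse_real_of_nat])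
        (use X(1) in \<open>auto intro!: always_eventually less_imp_le simp: inverse_eq_divide\<close>)
    then show "X \<longlonglongrightarrow> x" by (simp add: LIM_zero_iff)
    show "\<exists>a b::int. X i = of_int a + of_int b * y" for i
      by (intro exI[of _ "1 + 2 * int (n i)"] exI[of _ "- 2 * k i"]) (simp add: X_def)
    show "split_equiv \<alpha> y (X i) (X j)" for i j
      using rel[of i] rel[of j] eqv_trans unfolding related_def split_equiv_def by blast
  qed
qed

end

section \<open>Regularity of Hamiltonian flows in the initial point\<close>

lemma onorm_le_sum_Basis:
  fixes f :: "'a::euclidean_space \<Rightarrow> 'b::real_normed_vector"
  assumes "bounded_linear f"
  shows "onorm f \<le> (\<Sum>b\<in>Basis. norm (f b))"
  by (rule onorm_componentwise[OF assms])

lemma smooth_on_open_locally_bounded_derivative: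
  fixes f :: "'a::euclidean_space \<Rightarrow> 'b::real_normed_vector"
  assumes f: "smooth_on_open U f" and C: "compact C" "C \<subseteq> U"
  obtains B where "B \<ge> 0" "\<And>x. x \<in> C \<Longrightarrow> onorm (frechet_derivative f (at x)) \<le> B"
proof -
  have "continuous_on C (\<lambda>x. \<Sum>b\<in>Basis. norm (frechet_derivative f (at x) b))"
    by (intro continuous_on_sum continuous_on_norm continuous_on_subset[OF smooth_on_open_imp_continuous_on C(2)]
        smooth_on_open_derivative[OF f])
  then have "bounded ((\<lambda>x. \<Sum>b\<in>Basis. norm (frechet_derivative f (at x) b)) ` C)"
    using C(1) compact_continuous_image compact_imp_bounded by blast
  then obtain B where B: "B > 0" "\<And>x. x \<in> C \<Longrightarrow> norm (\<Sum>b\<in>Basis. norm (frechet_derivative f (at x) b)) \<le> B"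
    unfolding bounded_pos by blast
  have "onorm (frechet_derivative f (at x)) \<le> B" if "x \<in> C" for x
  proof -
    have "x \<in> U" using that C(2) by blast
    then have "bounded_linear (frechet_derivative f (at x))"
      using smooth_on_open_has_derivative[OF f] has_derivative_bounded_linear by blast
    then have "onorm (frechet_derivative f (at x)) \<le> (\<Sum>b\<in>Basis. norm (frechet_derivative f (at x) b))"
      by (rule onorm_le_sum_Basis)
    then show ?thesis using B(2)[OF that] by simp
  qed
  then show thesis using that[of B] B(1) by simp
qed

text \<open>The mean value inequality needs convexity, and a product of spheres is not convex. It is
  used on small balls, and compactness provides one constant for all of K. The one-point time set
  only adapts the time-dependent notion \<open>local_lipschitz\<close>.\<close>

lemma smooth_on_open_lipschitz_on_compact:
  fixes f :: "'a::euclidean_space \<Rightarrow> 'b::real_normed_vector"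
  assumes U: "open U" and f: "smooth_on_open U f" and K: "compact K" "K \<subseteq> U"
  obtains L where "L \<ge> 0" "\<And>x y. x \<in> K \<Longrightarrow> y \<in> K \<Longrightarrow> norm (f x - f y) \<le> L * norm (x - y)"
proof -
  have "local_lipschitz {0::real} K (\<lambda>_. f)"
  proof (rule local_lipschitzI)
    fix t :: real and x assume "x \<in> K"
    then obtain r where r: "r > 0" "cball x r \<subseteq> U" using U K(2) open_contains_cball by blast
    obtain B where B: "B \<ge> 0" "\<And>y. y \<in> cball x r \<Longrightarrow> onorm (frechet_derivative f (at y)) \<le> B"
      using smooth_on_open_locally_bounded_derivative[OF f compact_cball r(2)] by blast
    have "norm (f y - f z) \<le> B * norm (y - z)" if "y \<in> cball x r" "z \<in> cball x r" for y z
      by (rule differentiable_bound[OF convex_cball _ B(2) that(1,2)])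
        (use smooth_on_open_has_derivative[OF f] r(2) has_derivative_at_withinI in blast)
    then have "B-lipschitz_on (cball x r \<inter> K) f"
      using B(1) by (auto simp: lipschitz_on_def dist_norm)
    then show "\<exists>u>0. \<exists>L. \<forall>s\<in>cball t u \<inter> {0}. L-lipschitz_on (cball x u \<inter> K) f" using r(1) by blast
  qed
  then obtain L where "\<And>t. t \<in> {0::real} \<Longrightarrow> L-lipschitz_on K f"
    by (rule local_lipschitz_compact_implies_lipschitz) (auto simp: K)
  then have "L-lipschitz_on K f" by simp
  then show thesis using that[of L] by (auto simp: lipschitz_on_def dist_norm)
qed

text \<open>Trapezoidal rule. The average over both end points is the form in which the gradients at
  neighbouring vertices of a polygon enter later.\<close>

lemma smooth_on_open_second_order_on_compact:
  fixes f :: "'a::euclidean_space \<Rightarrow> real"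
  assumes U: "open U" and f: "smooth_on_open U f" and K: "compact K" "K \<subseteq> U"
  obtains C e where "C \<ge> 0" "e > 0"
    "\<And>x y. x \<in> K \<Longrightarrow> y \<in> K \<Longrightarrow> norm (y - x) \<le> e \<Longrightarrow>
       \<bar>f y - f x - (frechet_derivative f (at x) (y - x) + frechet_derivative f (at y) (y - x)) / 2\<bar> \<le> C * (norm (y - x))\<^sup>2"
proof -
  obtain e where e: "e > 0" "(\<Union>x\<in>K. cball x e) \<subseteq> U"
    using compact_subset_open_imp_cball_epsilon_subset[OF K(1) U K(2)] by blast
  \<comment> \<open>The closed e-neighbourhood of K, written as a sum of two compact sets to obtain
    compactness. It contains the segment between any two points of K at distance at most e.\<close>
  define K' where "K' = {x + y |x y. x \<in> K \<and> y \<in> cball 0 e}"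
  have K'e: "K' = (\<Union>x\<in>K. cball x e)"
  proof -
    have "z \<in> cball x e \<longleftrightarrow> (\<exists>y. z = x + y \<and> y \<in> cball 0 e)" for x z :: 'a
      by (auto simp: dist_norm norm_minus_commute intro!: exI[of _ "z - x"])
    then show ?thesis unfolding K'_def by blast
  qed
  have cK': "compact K'" unfolding K'_def by (intro compact_sums K compact_cball)
  have K'U: "K' \<subseteq> U" using e K'e by simp
  have "\<exists>L\<ge>0. \<forall>x\<in>K'. \<forall>y\<in>K'. norm (frechet_derivative f (at x) b - frechet_derivative f (at y) b) \<le> L * norm (x - y)" if "b \<in> Basis" for b
    using smooth_on_open_lipschitz_on_compact[OF U smooth_on_open_derivative[OF f that] cK' K'U] by metis
  then obtain L where L: "\<And>b. b \<in> Basis \<Longrightarrow> L b \<ge> 0"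
    "\<And>b x y. b \<in> Basis \<Longrightarrow> x \<in> K' \<Longrightarrow> y \<in> K' \<Longrightarrow> norm (frechet_derivative f (at x) b - frechet_derivative f (at y) b) \<le> L b * norm (x - y)"
    by metis
  define M where "M = sum L Basis"
  have M: "M \<ge> 0" unfolding M_def by (intro sum_nonneg L(1))
  have bl: "bounded_linear (frechet_derivative f (at x))" if "x \<in> K'" for x
    using smooth_on_open_has_derivative[OF f] K'U that has_derivative_bounded_linear by blast
  have on: "onorm (\<lambda>v. frechet_derivative f (at x) v - frechet_derivative f (at y) v) \<le> M * norm (x - y)"
    if "x \<in> K'" "y \<in> K'" for x y
  proof -
    have "onorm (\<lambda>v. frechet_derivative f (at x) v - frechet_derivative f (at y) v)
       \<le> (\<Sum>b\<in>Basis. norm (frechet_derivative f (at x) b - frechet_derivative f (at y) b))"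
      by (rule onorm_le_sum_Basis) (intro bounded_linear_sub bl that)
    also have "\<dots> \<le> (\<Sum>b\<in>Basis. L b * norm (x - y))" by (intro sum_mono L(2) that)
    finally show ?thesis by (simp add: M_def sum_distrib_right)
  qed
  have "\<bar>f y - f x - (frechet_derivative f (at x) (y - x) + frechet_derivative f (at y) (y - x)) / 2\<bar> \<le> (2 * M) * (norm (y - x))\<^sup>2"
    if xy: "x \<in> K" "y \<in> K" "norm (y - x) \<le> e" for x y
  proof -
    have seg: "closed_segment x y \<subseteq> K'" "\<And>z. z \<in> closed_segment x y \<Longrightarrow> norm (z - x) \<le> norm (y - x)"
    proof -
      show n: "norm (z - x) \<le> norm (y - x)" if "z \<in> closed_segment x y" for z
        using segment_bound1[OF that] by simp
      show "closed_segment x y \<subseteq> K'"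
        using n xy unfolding K'e by (force simp: dist_norm norm_minus_commute)
    qed
    have xK: "x \<in> K'" "y \<in> K'" using seg(1) by auto
    define g where "g z = f z - frechet_derivative f (at x) z" for z
    have "norm (g y - g x) \<le> (M * norm (y - x)) * norm (y - x)"
    proof (rule differentiable_bound[of "closed_segment x y" g "\<lambda>z v. frechet_derivative f (at z) v - frechet_derivative f (at x) v"])
      fix z assume z: "z \<in> closed_segment x y"
      then have zK: "z \<in> K'" using seg(1) by blast
      show "(g has_derivative (\<lambda>v. frechet_derivative f (at z) v - frechet_derivative f (at x) v)) (at z within closed_segment x y)"
        unfolding g_def using zK K'U
        by (intro has_derivative_diff has_derivative_at_withinI[OF smooth_on_open_has_derivative[OF f]]
            bounded_linear_imp_has_derivative bl xK) auto
      have "M * norm (z - x) \<le> M * norm (y - x)" by (intro mult_left_mono seg(2) z M)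
      then show "onorm (\<lambda>v. frechet_derivative f (at z) v - frechet_derivative f (at x) v) \<le> M * norm (y - x)"
        using on[OF zK xK(1)] by linarith
    qed auto
    moreover have "g y - g x = f y - f x - frechet_derivative f (at x) (y - x)"
      using bl[OF xK(1)] by (simp add: g_def linear_diff bounded_linear.linear)
    ultimately have 1: "\<bar>f y - f x - frechet_derivative f (at x) (y - x)\<bar> \<le> M * (norm (y - x))\<^sup>2"
      by (simp add: power2_eq_square)
    have "norm (frechet_derivative f (at y) (y - x) - frechet_derivative f (at x) (y - x)) \<le>
       onorm (\<lambda>v. frechet_derivative f (at y) v - frechet_derivative f (at x) v) * norm (y - x)"
      by (rule onorm[of "\<lambda>v. frechet_derivative f (at y) v - frechet_derivative f (at x) v"]) (intro bounded_linear_sub bl xK)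
    also have "\<dots> \<le> M * norm (y - x) * norm (y - x)" by (intro mult_right_mono on xK) simp
    finally have 2: "\<bar>frechet_derivative f (at y) (y - x) - frechet_derivative f (at x) (y - x)\<bar> \<le> M * (norm (y - x))\<^sup>2"
      by (simp add: power2_eq_square)
    show ?thesis using 1 2 by (simp add: abs_le_iff field_simps)
  qed
  then show thesis using that[of "2 * M" e] M e(1) by simp
qed

text \<open>Gronwall's inequality: \<open>exp (- 2 * L * t)\<close> times the squared distance is
  nonincreasing. Squaring avoids the point where the norm is not differentiable.\<close>

lemma lipschitz_field_trajectories_diverge:
  fixes u v :: "real \<Rightarrow> 'a::real_inner"
  assumes u: "\<And>t. t \<in> {0..1} \<Longrightarrow> (u has_vector_derivative u' t) (at t within {0..1})"
    and v: "\<And>t. t \<in> {0..1} \<Longrightarrow> (v has_vector_derivative v' t) (at t within {0..1})"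
    and L: "L \<ge> 0" "\<And>t. t \<in> {0..1} \<Longrightarrow> norm (u' t - v' t) \<le> L * norm (u t - v t)" and t: "t \<in> {0..1}"
  shows "norm (u t - v t) \<le> exp L * norm (u 0 - v 0)"
proof -
  define d where "d s = u s - v s" for s
  define d' where "d' s = u' s - v' s" for s
  define g where "g s = exp (- 2 * L * s) * (d s \<bullet> d s)" for s
  define g' where "g' s = exp (- 2 * L * s) * (2 * (d s \<bullet> d' s) - 2 * L * (d s \<bullet> d s))" for s
  have dd: "(d has_vector_derivative d' s) (at s within {0..1})" if "s \<in> {0..1}" for s
    unfolding d_def d'_def by (intro has_vector_derivative_diff u v that)
  have gd: "(g has_derivative (\<lambda>h. h * g' s)) (at s within {0..1})" if "s \<in> {0..1}" for s
  proof -
    have 1: "((\<lambda>s. exp (- 2 * L * s)) has_derivative (\<lambda>h. exp (- 2 * L * s) * (- 2 * L * h))) (at s within {0..1})"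
      by (auto intro!: derivative_eq_intros)
    have 2: "((\<lambda>s. d s \<bullet> d s) has_derivative (\<lambda>h. d s \<bullet> (h *\<^sub>R d' s) + (h *\<^sub>R d' s) \<bullet> d s)) (at s within {0..1})"
      by (intro has_derivative_inner dd[OF that, unfolded has_vector_derivative_def])
    show ?thesis unfolding g_def g'_def
      by (rule has_derivative_eq_rhs[OF has_derivative_mult[OF 1 2]]) (simp add: fun_eq_iff inner_commute algebra_simps)
  qed
  have neg: "g' s \<le> 0" if "s \<in> {0..1}" for s
  proof -
    have "d s \<bullet> d' s \<le> norm (d s) * norm (d' s)" by (rule norm_cauchy_schwarz)
    also have "\<dots> \<le> norm (d s) * (L * norm (d s))" using L(2)[OF that] by (intro mult_left_mono) (simp_all add: d_def d'_def)
    finally have "d s \<bullet> d' s \<le> L * (d s \<bullet> d s)" by (simp add: power2_norm_eq_inner[symmetric] power2_eq_square mult.left_commute)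
    then show ?thesis by (simp add: g'_def mult_le_0_iff)
  qed
  have sub: "{0..t} \<subseteq> {0..1}" using t by auto
  have gd': "(g has_derivative (\<lambda>h. h * g' s)) (at s within {0..t})" if "0 \<le> s" "s \<le> t" for s
    by (rule has_derivative_subset[OF gd sub]) (use that t in auto)
  have "\<exists>x\<in>{0..t}. g t - g 0 = (t - 0) * g' x"
    by (rule mvt_very_simple[OF _ gd']) (use t in auto)
  then obtain x where x: "x \<in> {0..t}" "g t - g 0 = t * g' x" by auto
  have "x \<in> {0..1}" using x(1) sub by blast
  then have "t * g' x \<le> 0" using neg t by (intro mult_nonneg_nonpos) auto
  then have "g t \<le> g 0" using x(2) by linarith
  then have "exp (- 2 * L * t) * (norm (d t))\<^sup>2 \<le> (norm (d 0))\<^sup>2" by (simp add: g_def power2_norm_eq_inner)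
  then have "exp (2 * L * t) * (exp (- 2 * L * t) * (norm (d t))\<^sup>2) \<le> exp (2 * L * t) * (norm (d 0))\<^sup>2"
    by (intro mult_left_mono) simp_all
  then have "(norm (d t))\<^sup>2 \<le> exp (2 * L * t) * (norm (d 0))\<^sup>2"
    by (simp add: mult.assoc[symmetric] exp_add[symmetric])
  also have "\<dots> \<le> exp (2 * L) * (norm (d 0))\<^sup>2"
    using L(1) t by (intro mult_right_mono) (simp_all add: mult_left_le)
  also have "\<dots> = (exp L * norm (d 0))\<^sup>2" by (simp add: power_mult_distrib exp_double)
  finally show ?thesis unfolding d_def by (rule power2_le_imp_le) simp
qed

text \<open>The definition of a flow only asserts the existence of a Hamiltonian vector at each
  time. Its uniqueness identifies it with the field of the ambient gradient, which is smooth in time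
  and point, so that estimates for vector fields apply.\<close>

lemma hamiltonian_flow_field:
  assumes c: "c1 > 0" "c2 > 0" and fl: "hamiltonian_flow (round_form c1 c2) H \<Phi>"
  obtains U G1 G2 where "open U" "{0..1} \<times> S2xS2 \<subseteq> U" "smooth_on_open U H" "smooth_on_open U G1" "smooth_on_open U G2"
    "\<And>t x v. (t, x) \<in> U \<Longrightarrow> frechet_derivative H (at (t, x)) (0, v) = G1 (t, x) \<bullet> fst v + G2 (t, x) \<bullet> snd v"
    "\<And>t x. t \<in> {0..1} \<Longrightarrow> x \<in> S2xS2 \<Longrightarrow> ((\<lambda>s. \<Phi> s x) has_vector_derivative
        ham_field c1 c2 (G1 (t, \<Phi> t x)) (G2 (t, \<Phi> t x)) (\<Phi> t x)) (at t within {0..1})"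
proof -
  obtain U where U: "open U" "{0..1} \<times> S2xS2 \<subseteq> U" "smooth_on_open U H" using hamiltonian_flowD(1)[OF fl] by blast
  define DH where "DH w v = frechet_derivative H (at w) (0, v)" for w :: "real \<times> point" and v :: point
  define G1 :: "real \<times> point \<Rightarrow> real^3" where "G1 w = vector [DH w (axis 1 1, 0), DH w (axis 2 1, 0), DH w (axis 3 1, 0)]" for w
  define G2 :: "real \<times> point \<Rightarrow> real^3" where "G2 w = vector [DH w (0, axis 1 1), DH w (0, axis 2 1), DH w (0, axis 3 1)]" for w
  have sD: "smooth_on_open U (\<lambda>w. DH w (axis i 1, 0))" "smooth_on_open U (\<lambda>w. DH w (0, axis i 1))" for i
    unfolding DH_def by (intro smooth_on_open_derivative[OF U(3)]; simp add: Basis_prod_def axis_in_Basis_iff)+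
  have sG: "smooth_on_open U G1" "smooth_on_open U G2"
    by (rule smooth_on_open_vec3[OF U(1)]; simp add: G1_def G2_def sD)+
  have dH: "(H has_derivative frechet_derivative H (at w)) (at w)" if "w \<in> U" for w
    by (rule smooth_on_open_has_derivative[OF U(3) that])
  have DH: "DH w v = G1 w \<bullet> fst v + G2 w \<bullet> snd v" if "w \<in> U" for w v
  proof -
    have l: "linear (frechet_derivative H (at w))" using dH[OF that] has_derivative_linear by blast
    have "linear (DH w)"
    proof (rule linearI)
      show "DH w (u + v) = DH w u + DH w v" for u v unfolding DH_def linear_add[OF l, symmetric] by simp
      show "DH w (r *\<^sub>R v) = r *\<^sub>R DH w v" for r v unfolding DH_def linear_scale[OF l, symmetric] by simp
    qed
    from fun_cong[OF gradient_eq_inner[OF this], of v] show ?thesis unfolding G1_def G2_def .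
  qed
  have "((\<lambda>s. \<Phi> s x) has_vector_derivative ham_field c1 c2 (G1 (t, \<Phi> t x)) (G2 (t, \<Phi> t x)) (\<Phi> t x)) (at t within {0..1})"
    if t: "t \<in> {0..1}" and x: "x \<in> S2xS2" for t x
  proof -
    define y where "y = \<Phi> t x"
    have y: "y \<in> S2xS2" unfolding y_def by (rule hamiltonian_flowD(3)[OF fl t x])
    have tU: "(t, y) \<in> U" by (rule subsetD[OF U(2) SigmaI[OF t y]])
    from hamiltonian_flowD(4)[OF fl t x, folded y_def] obtain X where
      X: "hamiltonian_vector (round_form c1 c2) (\<lambda>y. H (t, y)) y X" "((\<lambda>s. \<Phi> s x) has_vector_derivative X) (at t within {0..1})" by blast
    have "((\<lambda>y. (t, y)) has_derivative (\<lambda>v. (0, v))) (at y)" by (auto intro!: derivative_eq_intros)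
    from diff_chain_at[OF this dH[OF tU]]
    have "((\<lambda>y. H (t, y)) has_derivative (\<lambda>v. DH (t, y) v)) (at y)" by (simp add: o_def DH_def)
    then have d: "((\<lambda>y. H (t, y)) has_derivative (\<lambda>v. G1 (t, y) \<bullet> fst v + G2 (t, y) \<bullet> snd v)) (at y)"
      by (simp only: DH[OF tU])
    have "X = ham_field c1 c2 (G1 (t, y)) (G2 (t, y)) y"
      by (rule hamiltonian_vector_unique[OF _ _ y d X(1)]) (use c in simp_all)
    then show ?thesis using X(2) by (simp add: y_def)
  qed
  then show thesis using that[OF U sG] DH by (simp add: DH_def)
qed

lemma compact_time_S2xS2: "compact ({0..1::real} \<times> S2xS2)"
  by (intro compact_Times compact_Icc compact_sphere)

text \<open>The constant is uniform in t: neighbouring vertices of an inscribed N-gon stay at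
  distance of order 1/N throughout the flow.\<close>

lemma hamiltonian_flow_lipschitz:
  assumes c: "c1 > 0" "c2 > 0" and fl: "hamiltonian_flow (round_form c1 c2) H \<Phi>"
  obtains L where "L \<ge> 0" "\<And>t x y. t \<in> {0..1} \<Longrightarrow> x \<in> S2xS2 \<Longrightarrow> y \<in> S2xS2 \<Longrightarrow> norm (\<Phi> t x - \<Phi> t y) \<le> L * norm (x - y)"
proof -
  obtain U G1 G2 where U: "open U" "{0..1} \<times> S2xS2 \<subseteq> U" "smooth_on_open U H" "smooth_on_open U G1" "smooth_on_open U G2"
    and v: "\<And>t x. t \<in> {0..1} \<Longrightarrow> x \<in> S2xS2 \<Longrightarrow> ((\<lambda>s. \<Phi> s x) has_vector_derivative
        ham_field c1 c2 (G1 (t, \<Phi> t x)) (G2 (t, \<Phi> t x)) (\<Phi> t x)) (at t within {0..1})"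
    using hamiltonian_flow_field[OF c fl] by metis
  define V where "V w = ham_field c1 c2 (G1 w) (G2 w) (snd w)" for w
  have "smooth_on_open U V" unfolding V_def ham_field_def
    by (intro smooth_intros smooth_on_open_cross3 U)
  then obtain L where L: "L \<ge> 0" "\<And>x y. x \<in> {0..1} \<times> S2xS2 \<Longrightarrow> y \<in> {0..1} \<times> S2xS2 \<Longrightarrow> norm (V x - V y) \<le> L * norm (x - y)"
    using smooth_on_open_lipschitz_on_compact[OF U(1) _ compact_time_S2xS2 U(2)] by metis
  have "norm (\<Phi> t x - \<Phi> t y) \<le> exp L * norm (x - y)" if t: "t \<in> {0..1}" and xy: "x \<in> S2xS2" "y \<in> S2xS2" for t x y
  proof -
    have "norm (\<Phi> t x - \<Phi> t y) \<le> exp L * norm (\<Phi> 0 x - \<Phi> 0 y)"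
    proof (rule lipschitz_field_trajectories_diverge[OF v v L(1) _ t])
      fix s :: real assume s: "s \<in> {0..1}"
      have "norm (V (s, \<Phi> s x) - V (s, \<Phi> s y)) \<le> L * norm ((s, \<Phi> s x) - (s, \<Phi> s y))"
        by (intro L(2) SigmaI s hamiltonian_flowD(3)[OF fl s] xy)
      then show "norm (ham_field c1 c2 (G1 (s, \<Phi> s x)) (G2 (s, \<Phi> s x)) (\<Phi> s x) -
          ham_field c1 c2 (G1 (s, \<Phi> s y)) (G2 (s, \<Phi> s y)) (\<Phi> s y)) \<le> L * norm (\<Phi> s x - \<Phi> s y)"
        by (simp add: V_def norm_Pair)
    qed (assumption | rule xy)+
    then show ?thesis by (simp only: hamiltonian_flowD(2)[OF fl xy(1)] hamiltonian_flowD(2)[OF fl xy(2)])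
  qed
  then show thesis using that[of "exp L"] by simp
qed

section \<open>Spinors and the holonomy of polygons on the sphere\<close>

definition herm :: "complex \<times> complex \<Rightarrow> complex \<times> complex \<Rightarrow> complex" where
  "herm a b = cnj (fst a) * fst b + cnj (snd a) * snd b"

text \<open>Action on a spinor of the combination of the Pauli matrices with coefficients m. The
  infinitesimal rotation with angular velocity m lifts to spinors as \<open>- \<i> / 2\<close> times
  this operator.\<close>

definition pauli :: "real^3 \<Rightarrow> complex \<times> complex \<Rightarrow> complex \<times> complex" where
  "pauli m a = (of_real (m$3) * fst a + Complex (m$1) (- m$2) * snd a,
     Complex (m$1) (m$2) * fst a - of_real (m$3) * snd a)"

text \<open>
  \<open>spin_over \<xi> p \<nu>\<close> says that the matrix of rank one with entries \<open>\<xi>\<^sub>r cnj \<xi>\<^sub>s\<close> is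
  \<open>\<nu>\<close> times the identity plus \<open>p\<close> applied to the Pauli matrices.
\<close>

definition spin_over :: "complex \<times> complex \<Rightarrow> real^3 \<Rightarrow> real \<Rightarrow> bool" where
  "spin_over \<xi> p \<nu> \<longleftrightarrow> \<nu> > 0 \<and>
     (Re (fst \<xi>))\<^sup>2 + (Im (fst \<xi>))\<^sup>2 = \<nu> * (1 + p$3) \<and> (Re (snd \<xi>))\<^sup>2 + (Im (snd \<xi>))\<^sup>2 = \<nu> * (1 - p$3) \<and>
     Re (fst \<xi>) * Re (snd \<xi>) + Im (fst \<xi>) * Im (snd \<xi>) = \<nu> * p$1 \<and>
     Re (fst \<xi>) * Im (snd \<xi>) - Im (fst \<xi>) * Re (snd \<xi>) = \<nu> * p$2"

text \<open>The left side is the trace of the product of the two rank one matrices; products of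
  Pauli matrices contribute twice the inner product of their coefficient vectors.\<close>

lemma cmod_herm:
  assumes "spin_over \<xi> p \<nu>" "spin_over \<eta> q \<mu>"
  shows "(cmod (herm \<xi> \<eta>))\<^sup>2 = 2 * \<nu> * \<mu> * (1 + p \<bullet> q)"
proof -
  define a1 a2 b1 b2 c1 c2 d1 d2 where ab: "a1 = Re (fst \<xi>)" "a2 = Im (fst \<xi>)" "b1 = Re (snd \<xi>)" "b2 = Im (snd \<xi>)"
    "c1 = Re (fst \<eta>)" "c2 = Im (fst \<eta>)" "d1 = Re (snd \<eta>)" "d2 = Im (snd \<eta>)"
  have "(cmod (herm \<xi> \<eta>))\<^sup>2 = (a1 * c1 + a2 * c2 + (b1 * d1 + b2 * d2))\<^sup>2 + (a1 * c2 - a2 * c1 + (b1 * d2 - b2 * d1))\<^sup>2"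
    unfolding cmod_power2 herm_def ab by simp
  also have "\<dots> = (a1\<^sup>2 + a2\<^sup>2) * (c1\<^sup>2 + c2\<^sup>2) + (b1\<^sup>2 + b2\<^sup>2) * (d1\<^sup>2 + d2\<^sup>2) +
      2 * ((a1 * b1 + a2 * b2) * (c1 * d1 + c2 * d2) + (a1 * b2 - a2 * b1) * (c1 * d2 - c2 * d1))" by algebra
  also have "\<dots> = (\<nu> * (1 + p$3)) * (\<mu> * (1 + q$3)) + (\<nu> * (1 - p$3)) * (\<mu> * (1 - q$3)) +
      2 * ((\<nu> * p$1) * (\<mu> * q$1) + (\<nu> * p$2) * (\<mu> * q$2))"
    using assms unfolding spin_over_def ab[symmetric] by (simp only:)
  finally show ?thesis by (simp add: inner_real3 algebra_simps)
qed

text \<open>The complex number is the trace of the product of the two rank one matrices with the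
  matrix of m inserted between them. The term containing p, m and q together is an imaginary triple
  product, so the real part is linear in p + q.\<close>

lemma herm_pauli:
  assumes "spin_over \<xi> p \<nu>" "spin_over \<eta> q \<mu>"
  shows "Re (herm \<xi> (pauli m \<eta>) * cnj (herm \<xi> \<eta>)) = 2 * \<nu> * \<mu> * (m \<bullet> (p + q))"
proof -
  define a1 a2 b1 b2 c1 c2 d1 d2 where ab: "a1 = Re (fst \<xi>)" "a2 = Im (fst \<xi>)" "b1 = Re (snd \<xi>)" "b2 = Im (snd \<xi>)"
    "c1 = Re (fst \<eta>)" "c2 = Im (fst \<eta>)" "d1 = Re (snd \<eta>)" "d2 = Im (snd \<eta>)"
  have "Re (herm \<xi> (pauli m \<eta>) * cnj (herm \<xi> \<eta>)) =
      m$3 * ((a1\<^sup>2 + a2\<^sup>2) * (c1\<^sup>2 + c2\<^sup>2) - (b1\<^sup>2 + b2\<^sup>2) * (d1\<^sup>2 + d2\<^sup>2)) +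
      m$1 * ((c1 * d1 + c2 * d2) * ((a1\<^sup>2 + a2\<^sup>2) + (b1\<^sup>2 + b2\<^sup>2)) + (a1 * b1 + a2 * b2) * ((c1\<^sup>2 + c2\<^sup>2) + (d1\<^sup>2 + d2\<^sup>2))) +
      m$2 * ((c1 * d2 - c2 * d1) * ((a1\<^sup>2 + a2\<^sup>2) + (b1\<^sup>2 + b2\<^sup>2)) + (a1 * b2 - a2 * b1) * ((c1\<^sup>2 + c2\<^sup>2) + (d1\<^sup>2 + d2\<^sup>2)))"
    unfolding ab by (simp add: herm_def pauli_def) algebra
  also have "\<dots> = m$3 * ((\<nu> * (1 + p$3)) * (\<mu> * (1 + q$3)) - (\<nu> * (1 - p$3)) * (\<mu> * (1 - q$3))) +
      m$1 * ((\<mu> * q$1) * ((\<nu> * (1 + p$3)) + (\<nu> * (1 - p$3))) + (\<nu> * p$1) * ((\<mu> * (1 + q$3)) + (\<mu> * (1 - q$3)))) +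
      m$2 * ((\<mu> * q$2) * ((\<nu> * (1 + p$3)) + (\<nu> * (1 - p$3))) + (\<nu> * p$2) * ((\<mu> * (1 + q$3)) + (\<mu> * (1 - q$3))))"
    using assms unfolding spin_over_def ab[symmetric] by (simp only:)
  finally show ?thesis by (simp add: inner_real3 algebra_simps)
qed

lemma herm_nonzero:
  assumes "spin_over \<xi> p \<nu>" "spin_over \<eta> q \<mu>" "p \<bullet> q > - 1"
  shows "herm \<xi> \<eta> \<noteq> 0"
proof
  assume "herm \<xi> \<eta> = 0"
  then have "2 * \<nu> * \<mu> * (1 + p \<bullet> q) = 0" using cmod_herm[OF assms(1,2)] by simp
  then show False using assms by (simp add: spin_over_def)
qed

lemma Re_herm_pauli_quotient:
  assumes "spin_over \<xi> p \<nu>" "spin_over \<eta> q \<mu>" "p \<bullet> q > - 1"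
  shows "Re (herm \<xi> (pauli m \<eta>) / herm \<xi> \<eta>) = (m \<bullet> (p + q)) / (1 + p \<bullet> q)"
proof -
  have "Re (herm \<xi> (pauli m \<eta>) / herm \<xi> \<eta>) = Re (herm \<xi> (pauli m \<eta>) * cnj (herm \<xi> \<eta>)) / (cmod (herm \<xi> \<eta>))\<^sup>2"
    by (subst complex_div_cnj) (simp add: Re_divide_of_real del: of_real_power flip: of_real_power)
  also have "\<dots> = (2 * \<nu> * \<mu> * (m \<bullet> (p + q))) / (2 * \<nu> * \<mu> * (1 + p \<bullet> q))"
    unfolding cmod_herm[OF assms(1,2)] herm_pauli[OF assms(1,2)] ..
  also have "\<dots> = (m \<bullet> (p + q)) / (1 + p \<bullet> q)" using assms by (simp add: spin_over_def)
  finally show ?thesis .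
qed

text \<open>The spinors over p span one complex line: the determinant of two of them has squared
  modulus equal to the product of the traces of their matrices minus the trace of the product, which
  is 0.\<close>

lemma spin_over_unique:
  assumes p: "p \<in> S2" and s: "spin_over \<xi> p \<nu>" "spin_over \<xi>' p \<nu>'"
  obtains \<kappa> where "\<kappa> \<noteq> 0" "\<xi>' = (\<kappa> * fst \<xi>, \<kappa> * snd \<xi>)"
proof -
  define a1 a2 b1 b2 c1 c2 d1 d2 where ab: "a1 = Re (fst \<xi>)" "a2 = Im (fst \<xi>)" "b1 = Re (snd \<xi>)" "b2 = Im (snd \<xi>)"
    "c1 = Re (fst \<xi>')" "c2 = Im (fst \<xi>')" "d1 = Re (snd \<xi>')" "d2 = Im (snd \<xi>')"
  have P: "(p$1)\<^sup>2 + (p$2)\<^sup>2 + (p$3)\<^sup>2 = 1" using p S2_iff by blast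
  have "(cmod (fst \<xi> * snd \<xi>' - fst \<xi>' * snd \<xi>))\<^sup>2 = (a1\<^sup>2 + a2\<^sup>2) * (d1\<^sup>2 + d2\<^sup>2) + (c1\<^sup>2 + c2\<^sup>2) * (b1\<^sup>2 + b2\<^sup>2)
     - 2 * ((a1 * b1 + a2 * b2) * (c1 * d1 + c2 * d2) + (a1 * b2 - a2 * b1) * (c1 * d2 - c2 * d1))"
    unfolding cmod_power2 ab by simp algebra
  also have "\<dots> = (\<nu> * (1 + p$3)) * (\<nu>' * (1 - p$3)) + (\<nu>' * (1 + p$3)) * (\<nu> * (1 - p$3))
     - 2 * ((\<nu> * p$1) * (\<nu>' * p$1) + (\<nu> * p$2) * (\<nu>' * p$2))"
    using s unfolding spin_over_def ab[symmetric] by (simp only:)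
  also have "\<dots> = 0" using P by algebra
  finally have x: "fst \<xi> * snd \<xi>' = fst \<xi>' * snd \<xi>" by simp
  have n: "(cmod (fst \<xi>))\<^sup>2 = \<nu> * (1 + p$3)" "(cmod (snd \<xi>))\<^sup>2 = \<nu> * (1 - p$3)"
    "(cmod (fst \<xi>'))\<^sup>2 = \<nu>' * (1 + p$3)" "(cmod (snd \<xi>'))\<^sup>2 = \<nu>' * (1 - p$3)" "\<nu> > 0" "\<nu>' > 0"
    using s by (simp_all add: spin_over_def cmod_power2)
  show thesis
  proof (cases "p$3 = - 1")
    case False
    then have f: "fst \<xi> \<noteq> 0" "fst \<xi>' \<noteq> 0" using n by auto
    show thesis by (rule that[of "fst \<xi>' / fst \<xi>"]) (use f x in \<open>simp_all add: prod_eq_iff field_simps\<close>)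
  next
    case True
    then have f: "fst \<xi> = 0" "fst \<xi>' = 0" "snd \<xi> \<noteq> 0" "snd \<xi>' \<noteq> 0" using n by auto
    show thesis by (rule that[of "snd \<xi>' / snd \<xi>"]) (use f in \<open>simp_all add: prod_eq_iff\<close>)
  qed
qed

section \<open>Local frames of the spinor line bundle and their derivatives\<close>

definition gauge_lin :: "bool \<Rightarrow> real^3 \<Rightarrow> complex \<times> complex" where
  "gauge_lin j u = (if j then (of_real (u$3), Complex (u$1) (u$2)) else (Complex (u$1) (- u$2), - of_real (u$3)))"

text \<open>The two columns of the identity plus p applied to the Pauli matrices;
  \<open>gauge_lin\<close> is the part linear in p. On the sphere the first column vanishes only at
  the south pole and the second only at the north pole, where the corresponding weight is 0.\<close>

definition gauge :: "bool \<Rightarrow> real^3 \<Rightarrow> complex \<times> complex" where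
  "gauge j p = (if j then (of_real (1 + p$3), Complex (p$1) (p$2)) else (Complex (p$1) (- p$2), of_real (1 - p$3)))"

definition gauge_weight :: "bool \<Rightarrow> real^3 \<Rightarrow> real" where
  "gauge_weight j p = (if j then 1 + p$3 else 1 - p$3)"

lemma spin_over_gauge:
  assumes "p \<in> S2" "gauge_weight j p > 0"
  shows "spin_over (gauge j p) p (gauge_weight j p)"
proof -
  have P: "(p$1)\<^sup>2 + (p$2)\<^sup>2 + (p$3)\<^sup>2 = 1" using assms S2_iff by blast
  then have "(p$1)\<^sup>2 + (p$2)\<^sup>2 = (1 + p$3) * (1 - p$3)" by algebra
  then show ?thesis using assms(2)
    by (cases j) (simp_all add: spin_over_def gauge_def gauge_weight_def power2_eq_square algebra_simps)
qed

text \<open>The frame follows the spinor lift of the rotation with angular velocity n up to a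
  multiple \<kappa> of itself. This change of gauge has an explicit formula with the reciprocal of
  the weight, and it will cancel around a closed polygon.\<close>

lemma gauge_transport:
  assumes p: "p \<in> S2" and w: "gauge_weight j p > 0"
  obtains \<kappa> where
    "fst (gauge_lin j (n \<otimes> p)) = - \<i> / 2 * fst (pauli n (gauge j p)) + \<kappa> * fst (gauge j p)"
    "snd (gauge_lin j (n \<otimes> p)) = - \<i> / 2 * snd (pauli n (gauge j p)) + \<kappa> * snd (gauge j p)"
proof -
  have P: "(p$1)\<^sup>2 + (p$2)\<^sup>2 + (p$3)\<^sup>2 = 1" using p S2_iff by blast
  show thesis
  proof (cases j)
    case True
    define k where "k = 1 / (1 + p$3)"
    have k: "k * (1 + p$3) = 1" using w True by (simp add: k_def gauge_weight_def)
    show thesis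
      apply (rule that[of "Complex (- (n$2 * p$1 - n$1 * p$2) * k / 2) (n$3 / 2 + (n$1 * p$1 + n$2 * p$2) * k / 2)"])
       apply (simp_all add: True gauge_lin_def gauge_def pauli_def complex_eq_iff cross3_nth)
       apply (intro conjI; insert k P; algebra)+
      done
  next
    case False
    define k where "k = 1 / (1 - p$3)"
    have k: "k * (1 - p$3) = 1" using w False by (simp add: k_def gauge_weight_def)
    show thesis
      apply (rule that[of "Complex (- (n$1 * p$2 - n$2 * p$1) * k / 2) (- n$3 / 2 + (n$1 * p$1 + n$2 * p$2) * k / 2)"])
       apply (simp_all add: False gauge_lin_def gauge_def pauli_def complex_eq_iff cross3_nth)
       apply (intro conjI; insert k P; algebra)+
      done
  qed
qed

lemma gauge_has_vector_derivative:
  assumes "(p has_vector_derivative p') (at t within T)"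
  shows "((\<lambda>s. fst (gauge j (p s))) has_vector_derivative fst (gauge_lin j p')) (at t within T)"
    "((\<lambda>s. snd (gauge j (p s))) has_vector_derivative snd (gauge_lin j p')) (at t within T)"
proof -
  have l: "bounded_linear (\<lambda>u. fst (gauge_lin j u))" "bounded_linear (\<lambda>u. snd (gauge_lin j u))"
    unfolding linear_conv_bounded_linear[symmetric]
    by (rule linearI; cases j; simp add: gauge_lin_def complex_eq_iff)+
  have e: "fst (gauge j q) = fst (gauge j 0) + fst (gauge_lin j q)" "snd (gauge j q) = snd (gauge j 0) + snd (gauge_lin j q)" for q
    by (cases j; simp add: gauge_def gauge_lin_def complex_eq_iff)+
  have "((\<lambda>s. fst (gauge j 0) + fst (gauge_lin j (p s))) has_vector_derivative (0 + fst (gauge_lin j p'))) (at t within T)"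
    "((\<lambda>s. snd (gauge j 0) + snd (gauge_lin j (p s))) has_vector_derivative (0 + snd (gauge_lin j p'))) (at t within T)"
    by (intro has_vector_derivative_add has_vector_derivative_const bounded_linear.has_vector_derivative[OF l(1) assms]
        bounded_linear.has_vector_derivative[OF l(2) assms])+
  then show "((\<lambda>s. fst (gauge j (p s))) has_vector_derivative fst (gauge_lin j p')) (at t within T)"
    "((\<lambda>s. snd (gauge j (p s))) has_vector_derivative snd (gauge_lin j p')) (at t within T)"
    unfolding e[symmetric] by simp_all
qed

text \<open>Logarithmic derivative: the real part of \<open>a' / a t\<close> only changes the
  modulus, which \<open>sgn\<close> removes.\<close>

lemma sgn_has_vector_derivative:
  fixes a :: "real \<Rightarrow> complex"
  assumes a: "(a has_vector_derivative a') (at t within T)" and nz: "a t \<noteq> 0"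
  shows "((\<lambda>s. sgn (a s)) has_vector_derivative (\<i> * of_real (Im (a' / a t)) * sgn (a t))) (at t within T)"
proof -
  define r where "r = cmod (a t)"
  have r: "r > 0" using nz by (simp add: r_def)
  have "((\<lambda>s. norm (a s)) has_derivative (\<lambda>h. sgn (a t) \<bullet> (h *\<^sub>R a'))) (at t within T)"
    by (rule has_derivative_eq_rhs[OF has_derivative_compose[OF a[unfolded has_vector_derivative_def] has_derivative_norm[OF nz]]])
      (simp add: inner_commute)
  then have "((\<lambda>s. norm (a s)) has_vector_derivative (sgn (a t) \<bullet> a')) (at t within T)"
    by (simp add: has_vector_derivative_def)
  then have n: "((\<lambda>s. norm (a s)) has_real_derivative (sgn (a t) \<bullet> a')) (at t within T)"
    by (simp add: has_real_derivative_iff_has_vector_derivative)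
  have "((\<lambda>s. inverse (norm (a s))) has_real_derivative (- ((sgn (a t) \<bullet> a') * inverse (r ^ Suc (Suc 0))))) (at t within T)"
    using DERIV_inverse_fun[OF n] r by (simp add: r_def)
  then have i: "((\<lambda>s. inverse (norm (a s))) has_real_derivative (- (sgn (a t) \<bullet> a') / r\<^sup>2)) (at t within T)"
    by (simp add: field_simps power2_eq_square)
  have "((\<lambda>s. inverse (norm (a s)) *\<^sub>R a s) has_vector_derivative
      (inverse (norm (a t)) *\<^sub>R a' + (- (sgn (a t) \<bullet> a') / r\<^sup>2) *\<^sub>R a t)) (at t within T)"
    by (rule has_vector_derivative_scaleR[OF i a])
  moreover have "inverse (norm (a t)) *\<^sub>R a' + (- (sgn (a t) \<bullet> a') / r\<^sup>2) *\<^sub>R a t = \<i> * of_real (Im (a' / a t)) * sgn (a t)"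
  proof -
    define w where "w = a' / a t"
    have a': "a' = w * a t" using nz by (simp add: w_def)
    have "sgn (a t) \<bullet> a' = Re w * r"
    proof -
      have "sgn (a t) \<bullet> a' = (1 / r) * (a t \<bullet> a')" by (simp add: sgn_div_norm r_def inverse_eq_divide)
      also have "a t \<bullet> a' = Re w * r\<^sup>2"
        unfolding a' r_def cmod_power2 by (simp add: inner_complex_def power2_eq_square algebra_simps)
      finally show ?thesis using r by (simp add: power2_eq_square)
    qed
    then have "inverse (norm (a t)) *\<^sub>R a' + (- (sgn (a t) \<bullet> a') / r\<^sup>2) *\<^sub>R a t = (1 / r) *\<^sub>R (w * a t) - (Re w / r) *\<^sub>R a t"
      using r unfolding r_def[symmetric] a' by (simp add: inverse_eq_divide power2_eq_square)
    also have "\<dots> = (1 / r) *\<^sub>R ((w - of_real (Re w)) * a t)"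
      by (simp add: scaleR_conv_of_real algebra_simps)
    also have "w - of_real (Re w) = \<i> * of_real (Im w)" by (simp add: complex_eq_iff)
    also have "(1 / r) *\<^sub>R (\<i> * of_real (Im w) * a t) = \<i> * of_real (Im w) * sgn (a t)"
      by (simp add: sgn_div_norm r_def inverse_eq_divide)
    finally show ?thesis by (simp add: w_def)
  qed
  ultimately show ?thesis by (simp add: sgn_div_norm)
qed

section \<open>The phase of a closed polygon and its derivative\<close>

lemma sum_cyclic_shift:
  fixes f :: "nat \<Rightarrow> 'a::comm_monoid_add"
  assumes "N > 0" shows "(\<Sum>i<N. f (Suc i mod N)) = (\<Sum>i<N. f i)"
proof -
  obtain M where N: "N = Suc M" using assms gr0_implies_Suc by blast
  have "(\<Sum>i<N. f (Suc i mod N)) = (\<Sum>i<M. f (Suc i)) + f 0" by (simp add: N)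
  also have "\<dots> = (\<Sum>i<N. f i)" unfolding N sum.lessThan_Suc_shift by (simp add: add.commute)
  finally show ?thesis .
qed

lemma prod_cyclic_shift:
  fixes f :: "nat \<Rightarrow> 'a::comm_monoid_mult"
  assumes "N > 0" shows "(\<Prod>i<N. f (Suc i mod N)) = (\<Prod>i<N. f i)"
proof -
  obtain M where N: "N = Suc M" using assms gr0_implies_Suc by blast
  have "(\<Prod>i<N. f (Suc i mod N)) = (\<Prod>i<M. f (Suc i)) * f 0" by (simp add: N)
  also have "\<dots> = (\<Prod>i<N. f i)" unfolding N prod.lessThan_Suc_shift by (simp add: mult.commute)
  finally show ?thesis .
qed

text \<open>The change of frame at the south pole is harmless, since the phase of a polygon does not
  depend on the spinors chosen over its vertices.\<close>

definition spinor :: "real^3 \<Rightarrow> complex \<times> complex" where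
  "spinor p = gauge (p$3 \<noteq> - 1) p"

text \<open>Discrete holonomy of the spinor line bundle (Pancharatnam phase). For a geodesic polygon
  it is the exponential of \<i> times half the enclosed solid angle.\<close>

definition polygon_phase :: "nat \<Rightarrow> (nat \<Rightarrow> real^3) \<Rightarrow> complex" where
  "polygon_phase N p = (\<Prod>i<N. sgn (herm (spinor (p i)) (spinor (p (Suc i mod N)))))"

lemma spin_over_spinor: "p \<in> S2 \<Longrightarrow> spin_over (spinor p) p (gauge_weight (p$3 \<noteq> - 1) p)"
proof -
  assume p: "p \<in> S2"
  have "\<bar>p$3\<bar> \<le> 1" using p component_le_norm_cart[of p 3] by simp
  then have "gauge_weight (p$3 \<noteq> - 1) p > 0" by (auto simp: gauge_weight_def)
  then show ?thesis unfolding spinor_def by (rule spin_over_gauge[OF p])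
qed

text \<open>Every vertex occurs once in each argument of \<open>herm\<close>, so rescaling its
  spinor by \<kappa> contributes the positive factor \<open>cnj \<kappa> * \<kappa>\<close>, whose
  \<open>sgn\<close> is 1.\<close>

lemma polygon_phase_any_spinors:
  assumes N: "N > 0" and p: "\<And>i. i < N \<Longrightarrow> p i \<in> S2" and s: "\<And>i. i < N \<Longrightarrow> spin_over (\<xi> i) (p i) (\<nu> i)"
  shows "polygon_phase N p = (\<Prod>i<N. sgn (herm (\<xi> i) (\<xi> (Suc i mod N))))"
proof -
  have "\<exists>\<kappa>. \<kappa> \<noteq> 0 \<and> \<xi> i = (\<kappa> * fst (spinor (p i)), \<kappa> * snd (spinor (p i)))" if "i < N" for i
    by (rule spin_over_unique[OF p[OF that] spin_over_spinor[OF p[OF that]] s[OF that]]) blast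
  then obtain \<kappa> where \<kappa>: "\<And>i. i < N \<Longrightarrow> \<kappa> i \<noteq> 0" "\<And>i. i < N \<Longrightarrow> \<xi> i = (\<kappa> i * fst (spinor (p i)), \<kappa> i * snd (spinor (p i)))"
    by metis
  have m: "Suc i mod N < N" for i using N by simp
  have "(\<Prod>i<N. sgn (herm (\<xi> i) (\<xi> (Suc i mod N)))) =
      (\<Prod>i<N. sgn (cnj (\<kappa> i)) * sgn (\<kappa> (Suc i mod N)) * sgn (herm (spinor (p i)) (spinor (p (Suc i mod N)))))"
  proof (rule prod.cong[OF refl])
    fix i assume "i \<in> {..<N}"
    then have i: "i < N" by simp
    have "herm (\<xi> i) (\<xi> (Suc i mod N)) = cnj (\<kappa> i) * \<kappa> (Suc i mod N) * herm (spinor (p i)) (spinor (p (Suc i mod N)))"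
      unfolding \<kappa>(2)[OF i] \<kappa>(2)[OF m] by (simp add: herm_def algebra_simps)
    then show "sgn (herm (\<xi> i) (\<xi> (Suc i mod N))) =
       sgn (cnj (\<kappa> i)) * sgn (\<kappa> (Suc i mod N)) * sgn (herm (spinor (p i)) (spinor (p (Suc i mod N))))"
      by (simp add: sgn_mult)
  qed
  also have "\<dots> = (\<Prod>i<N. sgn (cnj (\<kappa> i))) * (\<Prod>i<N. sgn (\<kappa> (Suc i mod N))) * polygon_phase N p"
    by (simp add: prod.distrib polygon_phase_def)
  also have "(\<Prod>i<N. sgn (\<kappa> (Suc i mod N))) = (\<Prod>i<N. sgn (\<kappa> i))" by (rule prod_cyclic_shift[OF N])
  also have "(\<Prod>i<N. sgn (cnj (\<kappa> i))) * (\<Prod>i<N. sgn (\<kappa> i)) = 1"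
  proof -
    have "sgn (cnj (\<kappa> i)) * sgn (\<kappa> i) = 1" if "i < N" for i
    proof -
      have "cnj (\<kappa> i) * \<kappa> i = of_real ((cmod (\<kappa> i))\<^sup>2)" by (simp add: complex_norm_square mult.commute del: of_real_power)
      then have "sgn (cnj (\<kappa> i) * \<kappa> i) = 1" using \<kappa>(1)[OF that] by (simp add: sgn_of_real del: of_real_power)
      then show ?thesis by (simp add: sgn_mult)
    qed
    then show ?thesis by (simp add: prod.distrib[symmetric])
  qed
  finally show ?thesis by simp
qed

text \<open>Here \<open>n i\<close> is the angular velocity of vertex i. As the Pauli matrices are
  Hermitian, an edge only sees the difference of the angular velocities of its ends; the gauge terms
  enter as differences of imaginary parts, which cancel cyclically.\<close>

lemma polygon_phase_derivative:
  assumes N: "N > 0" and t: "t \<in> T"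
    and p: "\<And>i s. i < N \<Longrightarrow> s \<in> T \<Longrightarrow> p i s \<in> S2"
    and d: "\<And>i. i < N \<Longrightarrow> (p i has_vector_derivative (n i \<otimes> p i t)) (at t within T)"
    and ang: "\<And>i. i < N \<Longrightarrow> p i t \<bullet> p (Suc i mod N) t > - 1"
  shows "((\<lambda>s. polygon_phase N (\<lambda>i. p i s)) has_vector_derivative
     (\<i> * of_real (\<Sum>i<N. ((n i - n (Suc i mod N)) \<bullet> (p i t + p (Suc i mod N) t)) / (1 + p i t \<bullet> p (Suc i mod N) t) / 2)
        * polygon_phase N (\<lambda>i. p i t))) (at t within T)"
proof -
  \<comment> \<open>A frame that is nonzero at time t stays nonzero nearby, so one fixed smooth
    frame per vertex computes the phase on a neighbourhood of t.\<close>
  define j where "j i \<longleftrightarrow> p i t $ 3 \<noteq> - 1" for i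
  define \<xi> where "\<xi> i s = gauge (j i) (p i s)" for i s
  have m: "Suc i mod N < N" for i using N by simp
  have w: "gauge_weight (j i) (p i t) > 0" if "i < N" for i
  proof -
    have "\<bar>p i t $ 3\<bar> \<le> 1" using p[OF that t] component_le_norm_cart[of "p i t" 3] by simp
    then show ?thesis by (auto simp: gauge_weight_def j_def)
  qed
  have ev1: "\<forall>\<^sub>F s in at t within T. gauge_weight (j i) (p i s) > 0" if "i < N" for i
  proof -
    have "(p i \<longlongrightarrow> p i t) (at t within T)"
      using has_vector_derivative_continuous[OF d[OF that]] by (simp add: continuous_within)
    then have "((\<lambda>s. gauge_weight (j i) (p i s)) \<longlongrightarrow> gauge_weight (j i) (p i t)) (at t within T)"
      unfolding gauge_weight_def by (cases "j i") (auto intro!: tendsto_intros)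
    then show ?thesis using w[OF that] by (rule order_tendstoD)
  qed
  have ev: "\<forall>\<^sub>F s in at t within T. \<forall>i\<in>{..<N}. gauge_weight (j i) (p i s) > 0"
    by (rule eventually_ball_finite) (use ev1 in auto)
  have phase: "(\<Prod>i<N. sgn (herm (\<xi> i s) (\<xi> (Suc i mod N) s))) = polygon_phase N (\<lambda>i. p i s)"
    if s: "s \<in> T" and g: "\<forall>i\<in>{..<N}. gauge_weight (j i) (p i s) > 0" for s
    by (rule polygon_phase_any_spinors[OF N, symmetric, where \<nu> = "\<lambda>i. gauge_weight (j i) (p i s)"])
      (use p[OF _ s] g in \<open>auto simp: \<xi>_def intro!: spin_over_gauge\<close>)
  have "\<exists>k. fst (gauge_lin (j i) (n i \<otimes> p i t)) = - \<i> / 2 * fst (pauli (n i) (\<xi> i t)) + k * fst (\<xi> i t) \<and>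
       snd (gauge_lin (j i) (n i \<otimes> p i t)) = - \<i> / 2 * snd (pauli (n i) (\<xi> i t)) + k * snd (\<xi> i t)" if "i < N" for i
    unfolding \<xi>_def by (rule gauge_transport[OF p[OF that t] w[OF that]]) blast
  then obtain \<kappa> where \<kappa>: "\<And>i. i < N \<Longrightarrow> fst (gauge_lin (j i) (n i \<otimes> p i t)) = - \<i> / 2 * fst (pauli (n i) (\<xi> i t)) + \<kappa> i * fst (\<xi> i t)"
       "\<And>i. i < N \<Longrightarrow> snd (gauge_lin (j i) (n i \<otimes> p i t)) = - \<i> / 2 * snd (pauli (n i) (\<xi> i t)) + \<kappa> i * snd (\<xi> i t)"
    by metis
  define a where "a i s = herm (\<xi> i s) (\<xi> (Suc i mod N) s)" for i s
  define a' where "a' i = \<i> / 2 * herm (\<xi> i t) (pauli (n i - n (Suc i mod N)) (\<xi> (Suc i mod N) t)) +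
     (cnj (\<kappa> i) + \<kappa> (Suc i mod N)) * a i t" for i
  have da: "(a i has_vector_derivative a' i) (at t within T)" if i: "i < N" for i
  proof -
    note g1 = gauge_has_vector_derivative[OF d[OF i], of "j i", folded \<xi>_def]
    note g2 = gauge_has_vector_derivative[OF d[OF m[of i]], of "j (Suc i mod N)", folded \<xi>_def]
    note c = bounded_linear.has_vector_derivative[OF bounded_linear_cnj]
    have "(a i has_vector_derivative
       (cnj (fst (\<xi> i t)) * fst (gauge_lin (j (Suc i mod N)) (n (Suc i mod N) \<otimes> p (Suc i mod N) t)) +
        cnj (fst (gauge_lin (j i) (n i \<otimes> p i t))) * fst (\<xi> (Suc i mod N) t)) +
       (cnj (snd (\<xi> i t)) * snd (gauge_lin (j (Suc i mod N)) (n (Suc i mod N) \<otimes> p (Suc i mod N) t)) +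
        cnj (snd (gauge_lin (j i) (n i \<otimes> p i t))) * snd (\<xi> (Suc i mod N) t))) (at t within T)"
      unfolding a_def herm_def
      by (intro has_vector_derivative_add has_vector_derivative_mult c g1 g2)
    moreover have "(cnj (fst (\<xi> i t)) * fst (gauge_lin (j (Suc i mod N)) (n (Suc i mod N) \<otimes> p (Suc i mod N) t)) +
        cnj (fst (gauge_lin (j i) (n i \<otimes> p i t))) * fst (\<xi> (Suc i mod N) t)) +
       (cnj (snd (\<xi> i t)) * snd (gauge_lin (j (Suc i mod N)) (n (Suc i mod N) \<otimes> p (Suc i mod N) t)) +
        cnj (snd (gauge_lin (j i) (n i \<otimes> p i t))) * snd (\<xi> (Suc i mod N) t)) = a' i"
    proof -
      have cC: "cnj (Complex x y) = Complex x (- y)" for x y by (simp add: complex_eq_iff)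
      have "Complex (n i $ 1 - n (Suc i mod N) $ 1) y = Complex (n i $ 1) 0 - Complex (n (Suc i mod N) $ 1) 0 + Complex 0 y" for y
        by (simp add: complex_eq_iff)
      have C: "Complex x y = of_real x + \<i> * of_real y" for x y by (simp add: complex_eq_iff)
      show ?thesis
        unfolding \<kappa>[OF i] \<kappa>[OF m] a'_def a_def herm_def pauli_def C
        by (simp add: algebra_simps)
    qed
    ultimately show ?thesis by simp
  qed
  have anz: "a i t \<noteq> 0" if "i < N" for i
    unfolding a_def \<xi>_def using that ang[OF that] p[OF _ t] w m
    by (intro herm_nonzero[of _ "p i t" "gauge_weight (j i) (p i t)" _ "p (Suc i mod N) t" "gauge_weight (j (Suc i mod N)) (p (Suc i mod N) t)"]
        spin_over_gauge) auto
  have Im: "Im (a' i / a i t) = ((n i - n (Suc i mod N)) \<bullet> (p i t + p (Suc i mod N) t)) / (1 + p i t \<bullet> p (Suc i mod N) t) / 2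
      + (Im (\<kappa> (Suc i mod N)) - Im (\<kappa> i))" if i: "i < N" for i
  proof -
    have "a' i / a i t = \<i> / 2 * (herm (\<xi> i t) (pauli (n i - n (Suc i mod N)) (\<xi> (Suc i mod N) t)) / a i t) + (cnj (\<kappa> i) + \<kappa> (Suc i mod N))"
      using anz[OF i] by (simp add: a'_def add_divide_distrib)
    moreover have "Im (\<i> / 2 * w + (cnj k + k')) = Re w / 2 + (Im k' - Im k)" for w k k' by simp
    ultimately have "Im (a' i / a i t) = Re (herm (\<xi> i t) (pauli (n i - n (Suc i mod N)) (\<xi> (Suc i mod N) t)) / a i t) / 2
       + (Im (\<kappa> (Suc i mod N)) - Im (\<kappa> i))" by (simp only:)
    also have "Re (herm (\<xi> i t) (pauli (n i - n (Suc i mod N)) (\<xi> (Suc i mod N) t)) / a i t) =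
       ((n i - n (Suc i mod N)) \<bullet> (p i t + p (Suc i mod N) t)) / (1 + p i t \<bullet> p (Suc i mod N) t)"
      unfolding a_def \<xi>_def
      by (rule Re_herm_pauli_quotient[OF spin_over_gauge spin_over_gauge ang[OF i]]) (use p[OF _ t] w m i in auto)
    finally show ?thesis .
  qed
  have nz: "sgn (a i t) \<noteq> 0" if "i < N" for i using anz[OF that] by (simp add: sgn_zero_iff)
  have "((\<lambda>s. \<Prod>i\<in>{..<N}. sgn (a i s)) has_derivative
     (\<lambda>h. \<Sum>i\<in>{..<N}. (h *\<^sub>R (\<i> * of_real (Im (a' i / a i t)) * sgn (a i t))) * (\<Prod>k\<in>{..<N} - {i}. sgn (a k t)))) (at t within T)"
    by (rule has_derivative_prod) (use sgn_has_vector_derivative[OF da anz] in \<open>auto simp: has_vector_derivative_def\<close>)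
  moreover have "(\<Sum>i\<in>{..<N}. (h *\<^sub>R (\<i> * of_real (Im (a' i / a i t)) * sgn (a i t))) * (\<Prod>k\<in>{..<N} - {i}. sgn (a k t)))
     = h *\<^sub>R (\<i> * of_real (\<Sum>i<N. Im (a' i / a i t)) * (\<Prod>i<N. sgn (a i t)))" for h
  proof -
    have "(h *\<^sub>R (\<i> * of_real (Im (a' i / a i t)) * sgn (a i t))) * (\<Prod>k\<in>{..<N} - {i}. sgn (a k t))
        = h *\<^sub>R (\<i> * of_real (Im (a' i / a i t)) * (\<Prod>i<N. sgn (a i t)))" if "i \<in> {..<N}" for i
      using prod.remove[OF finite_lessThan that, of "\<lambda>k. sgn (a k t)"] by simp
    then have "(\<Sum>i\<in>{..<N}. (h *\<^sub>R (\<i> * of_real (Im (a' i / a i t)) * sgn (a i t))) * (\<Prod>k\<in>{..<N} - {i}. sgn (a k t)))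
       = (\<Sum>i\<in>{..<N}. h *\<^sub>R (\<i> * of_real (Im (a' i / a i t)) * (\<Prod>i<N. sgn (a i t))))"
      by (intro sum.cong refl) blast
    also have "\<dots> = h *\<^sub>R (\<i> * of_real (\<Sum>i<N. Im (a' i / a i t)) * (\<Prod>i<N. sgn (a i t)))"
      by (simp add: scaleR_sum_right sum_distrib_left sum_distrib_right)
    finally show ?thesis .
  qed
  ultimately have D: "((\<lambda>s. \<Prod>i<N. sgn (a i s)) has_vector_derivative
     (\<i> * of_real (\<Sum>i<N. Im (a' i / a i t)) * (\<Prod>i<N. sgn (a i t)))) (at t within T)"
    by (simp add: has_vector_derivative_def)
  have tot: "(\<Sum>i<N. Im (a' i / a i t)) = (\<Sum>i<N. ((n i - n (Suc i mod N)) \<bullet> (p i t + p (Suc i mod N) t)) / (1 + p i t \<bullet> p (Suc i mod N) t) / 2)"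
  proof -
    have "(\<Sum>i<N. Im (a' i / a i t)) = (\<Sum>i<N. ((n i - n (Suc i mod N)) \<bullet> (p i t + p (Suc i mod N) t)) / (1 + p i t \<bullet> p (Suc i mod N) t) / 2
        + (Im (\<kappa> (Suc i mod N)) - Im (\<kappa> i)))"
      by (intro sum.cong refl Im) simp
    also have "\<dots> = (\<Sum>i<N. ((n i - n (Suc i mod N)) \<bullet> (p i t + p (Suc i mod N) t)) / (1 + p i t \<bullet> p (Suc i mod N) t) / 2) +
       ((\<Sum>i<N. Im (\<kappa> (Suc i mod N))) - (\<Sum>i<N. Im (\<kappa> i)))"
      by (simp only: sum.distrib sum_subtractf)
    also have "(\<Sum>i<N. Im (\<kappa> (Suc i mod N))) = (\<Sum>i<N. Im (\<kappa> i))" by (rule sum_cyclic_shift[OF N])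
    finally show ?thesis by simp
  qed
  have ph_t: "(\<Prod>i<N. sgn (a i t)) = polygon_phase N (\<lambda>i. p i t)"
    unfolding a_def by (rule phase[OF t]) (use w in auto)
  have "((\<lambda>s. polygon_phase N (\<lambda>i. p i s)) has_derivative
     (\<lambda>h. h *\<^sub>R (\<i> * of_real (\<Sum>i<N. Im (a' i / a i t)) * (\<Prod>i<N. sgn (a i t))))) (at t within T)"
  proof (rule has_derivative_transform_eventually[OF D[unfolded has_vector_derivative_def]])
    have "\<forall>\<^sub>F s in at t within T. s \<in> T" by (simp add: eventually_at_filter)
    then show "\<forall>\<^sub>F s in at t within T. (\<Prod>i<N. sgn (a i s)) = polygon_phase N (\<lambda>i. p i s)"
      using ev unfolding a_def by eventually_elim (rule phase)
  qed (use ph_t t in auto)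
  then show ?thesis unfolding tot ph_t has_vector_derivative_def .
qed

section \<open>Areas bounded by loops are invariant modulo periods\<close>

text \<open>The phase solves a linear equation with rate \<i> D. The real number
  \<open>integral {0..1} D\<close> is recorded, not only its class modulo 2 pi, because the
  integrals of the two factors are later added with unrelated weights.\<close>

lemma polygon_phase_transport:
  assumes N: "N > 0"
    and p: "\<And>i t. i < N \<Longrightarrow> t \<in> {0..1} \<Longrightarrow> p i t \<in> S2"
    and d: "\<And>i t. i < N \<Longrightarrow> t \<in> {0..1} \<Longrightarrow> (p i has_vector_derivative (n i t \<otimes> p i t)) (at t within {0..1})"
    and n: "\<And>i. i < N \<Longrightarrow> continuous_on {0..1} (n i)"
    and ang: "\<And>i t. i < N \<Longrightarrow> t \<in> {0..1} \<Longrightarrow> p i t \<bullet> p (Suc i mod N) t > - 1"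
  defines "D \<equiv> \<lambda>t. \<Sum>i<N. ((n i t - n (Suc i mod N) t) \<bullet> (p i t + p (Suc i mod N) t)) / (1 + p i t \<bullet> p (Suc i mod N) t) / 2"
  shows "continuous_on {0..1} D"
    and "polygon_phase N (\<lambda>i. p i 1) = exp (\<i> * of_real (integral {0..1} D)) * polygon_phase N (\<lambda>i. p i 0)"
proof -
  have m: "Suc i mod N < N" for i using N by simp
  have cp: "continuous_on {0..1} (p i)" if "i < N" for i
    unfolding continuous_on_eq_continuous_within
    using has_vector_derivative_continuous[OF d[OF that]] by blast
  have nz: "1 + p i t \<bullet> p (Suc i mod N) t \<noteq> 0" if "i < N" "t \<in> {0..1}" for i t using ang[OF that] by linarith
  show cD: "continuous_on {0..1} D"
    unfolding D_def
    by (intro continuous_on_sum continuous_on_divide continuous_on_inner continuous_on_add continuous_on_diff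
        continuous_on_const n cp m ballI nz) auto
  define h where "h t = integral {0..t} D" for t
  have dh: "(h has_vector_derivative D t) (at t within {0..1})" if "t \<in> {0..1}" for t
    unfolding h_def by (rule integral_has_vector_derivative[OF cD that])
  define W where "W t = exp (- \<i> * of_real (h t)) * polygon_phase N (\<lambda>i. p i t)" for t
  have dW: "(W has_vector_derivative 0) (at t within {0..1})" if t: "t \<in> {0..1}" for t
  proof -
    have dU: "((\<lambda>s. polygon_phase N (\<lambda>i. p i s)) has_vector_derivative (\<i> * of_real (D t) * polygon_phase N (\<lambda>i. p i t))) (at t within {0..1})"
      using polygon_phase_derivative[OF N t, of p "\<lambda>i. n i t"] p d[OF _ t] ang[OF _ t] unfolding D_def by blast
    have "((\<lambda>s. - \<i> * complex_of_real (h s)) has_vector_derivative (- \<i> * complex_of_real (D t))) (at t within {0..1})"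
      by (intro has_vector_derivative_mult_right bounded_linear.has_vector_derivative[OF bounded_linear_of_real dh[OF t]])
    from field_vector_diff_chain_within[OF this DERIV_exp[THEN has_field_derivative_at_within]]
    have dE: "((\<lambda>s. exp (- \<i> * complex_of_real (h s))) has_vector_derivative (- \<i> * complex_of_real (D t) * exp (- \<i> * of_real (h t)))) (at t within {0..1})"
      by (simp add: o_def)
    have "(W has_vector_derivative (exp (- \<i> * of_real (h t)) * (\<i> * of_real (D t) * polygon_phase N (\<lambda>i. p i t)) +
       (- \<i> * complex_of_real (D t) * exp (- \<i> * of_real (h t))) * polygon_phase N (\<lambda>i. p i t))) (at t within {0..1})"
      unfolding W_def by (rule has_vector_derivative_mult[OF dE dU])
    then show ?thesis by (simp add: algebra_simps)
  qed
  obtain c where c: "\<And>t. t \<in> {0..1} \<Longrightarrow> W t = c"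
    using has_vector_derivative_zero_constant[OF convex_real_interval(5) dW] by blast
  have "W 1 = W 0" using c[of 0] c[of 1] by simp
  then have "exp (- \<i> * of_real (h 1)) * polygon_phase N (\<lambda>i. p i 1) = polygon_phase N (\<lambda>i. p i 0)"
    by (simp add: W_def h_def)
  then have "exp (\<i> * of_real (h 1)) * (exp (- \<i> * of_real (h 1)) * polygon_phase N (\<lambda>i. p i 1)) = exp (\<i> * of_real (h 1)) * polygon_phase N (\<lambda>i. p i 0)"
    by simp
  then show "polygon_phase N (\<lambda>i. p i 1) = exp (\<i> * of_real (integral {0..1} D)) * polygon_phase N (\<lambda>i. p i 0)"
    by (simp add: mult.assoc[symmetric] exp_add[symmetric] h_def)
qed

section \<open>Polygons on a circle of latitude\<close>

lemma norm_sgn_diff_1: "norm (sgn w - 1) \<le> 2 * norm (w - 1)" for w :: complex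
proof (cases "w = 0")
  case False
  have "sgn w - w = (1 - norm w) *\<^sub>R sgn w"
  proof -
    have "norm w *\<^sub>R sgn w = w" using False by (simp add: sgn_div_norm)
    then show ?thesis by (simp only: scaleR_left_diff_distrib scaleR_one)
  qed
  then have "norm (sgn w - w) = \<bar>norm w - 1\<bar>" using False by (simp add: norm_sgn)
  also have "\<dots> \<le> norm (w - 1)" using norm_triangle_ineq3[of w 1] by simp
  finally show ?thesis using norm_triangle_ineq[of "sgn w - w" "w - 1"] by simp
qed simp

lemma norm_iexp_minus_linear: "norm (exp (\<i> * of_real x) - 1 - \<i> * of_real x) \<le> x\<^sup>2"
  using Taylor_exp[of "\<i> * of_real x" 1] by (simp add: norm_mult power2_eq_square algebra_simps)

text \<open>A convex combination with weights a and b of unit numbers at angles 0 and D. After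
  rotation by the mean angle b D the angles are - b D and a D, whose weighted sum is 0, so that only
  second order terms remain.\<close>

lemma latitude_edge_phase:
  fixes z D :: real
  assumes z: "\<bar>z\<bar> < 1"
  shows "norm ((of_real ((1 + z) / 2) + of_real ((1 - z) / 2) * exp (\<i> * of_real D)) * exp (- \<i> * of_real ((1 - z) / 2 * D)) - 1) \<le> D\<^sup>2"
proof -
  define a b where "a = (1 + z) / 2" and "b = (1 - z) / 2"
  have ab: "a + b = 1" "0 \<le> a" "a \<le> 1" "0 \<le> b" "b \<le> 1" using z by (simp_all add: a_def b_def field_simps)
  have e: "exp (\<i> * of_real D) * exp (- \<i> * of_real (b * D)) = exp (\<i> * of_real (a * D))"
  proof -
    have "\<i> * of_real D + - \<i> * of_real (b * D) = \<i> * of_real ((1 - b) * D)" by (simp add: algebra_simps)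
    moreover have "1 - b = a" using ab by simp
    ultimately show ?thesis by (simp only: exp_add[symmetric])
  qed
  have "(of_real a + of_real b * exp (\<i> * of_real D)) * exp (- \<i> * of_real (b * D)) - 1 =
     of_real a * exp (- \<i> * of_real (b * D)) + of_real b * exp (\<i> * of_real (a * D)) - of_real (a + b)"
    unfolding e[symmetric] ab by (simp add: algebra_simps)
  also have "\<dots> = of_real a * (exp (\<i> * of_real (- (b * D))) - 1 - \<i> * of_real (- (b * D))) +
     of_real b * (exp (\<i> * of_real (a * D)) - 1 - \<i> * of_real (a * D))"
    by (simp add: algebra_simps)
  also have "norm \<dots> \<le> a * (- (b * D))\<^sup>2 + b * (a * D)\<^sup>2"
    using ab by (intro norm_triangle_le add_mono) (simp_all only: norm_mult norm_of_real abs_of_nonneg, (intro mult_left_mono norm_iexp_minus_linear; assumption)+)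
  also have "\<dots> = a * b * (a + b) * D\<^sup>2" by (simp add: power2_eq_square algebra_simps)
  also have "\<dots> \<le> 1 * 1 * 1 * D\<^sup>2" using ab by (intro mult_right_mono mult_mono) simp_all
  finally show ?thesis by (simp add: a_def b_def)
qed

text \<open>The limiting angle is half the solid angle \<open>2 * pi * (1 - z)\<close> of the polar
  cap, counted w times. Each of the N edges contributes an error of second order in its
  angle.\<close>

lemma latitude_polygon_phase_angles:
  assumes N: "N > 0" and z: "\<bar>z\<bar> < 1" and p: "\<And>i. i < N \<Longrightarrow> p i \<in> S2" "\<And>i. i < N \<Longrightarrow> p i $ 3 = z"
    and D: "\<And>i. i < N \<Longrightarrow> Complex (p (Suc i mod N) $ 1) (p (Suc i mod N) $ 2) = Complex (p i $ 1) (p i $ 2) * exp (\<i> * of_real (D i))"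
    and e: "\<And>i. i < N \<Longrightarrow> \<bar>D i\<bar> \<le> e" and s: "(\<Sum>i<N. D i) = 2 * pi * w"
  shows "norm (polygon_phase N p - exp (\<i> * of_real (pi * (1 - z) * w))) \<le> 2 * real N * e\<^sup>2"
proof -
  define b where "b = (1 - z) / 2"
  define v where "v i = (of_real ((1 + z) / 2) + of_real b * exp (\<i> * of_real (D i))) * exp (- \<i> * of_real (b * D i))" for i
  have m: "Suc i mod N < N" for i using N by simp
  have edge: "sgn (herm (spinor (p i)) (spinor (p (Suc i mod N)))) = exp (\<i> * of_real (b * D i)) * sgn (v i)" if i: "i < N" for i
  proof -
    have "(p i $ 1)\<^sup>2 + (p i $ 2)\<^sup>2 + (p i $ 3)\<^sup>2 = 1" using p(1)[OF i] S2_iff by blast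
    then have sq: "(p i $ 1)\<^sup>2 + (p i $ 2)\<^sup>2 = 1 - z\<^sup>2" using p(2)[OF i] by simp
    have cc: "cnj (Complex (p i $ 1) (p i $ 2)) * Complex (p i $ 1) (p i $ 2) = of_real (1 - z\<^sup>2)"
      using sq by (simp add: complex_eq_iff power2_eq_square)
    have zn: "z \<noteq> - 1" using z by auto
    have "herm (spinor (p i)) (spinor (p (Suc i mod N))) =
       of_real (1 + z) * of_real (1 + z) + cnj (Complex (p i $ 1) (p i $ 2)) * Complex (p i $ 1) (p i $ 2) * exp (\<i> * of_real (D i))"
      using zn D[OF i] by (simp add: herm_def spinor_def gauge_def p(2)[OF i] p(2)[OF m] mult.assoc)
    also have "\<dots> = of_real (2 * (1 + z)) * (of_real ((1 + z) / 2) + of_real b * exp (\<i> * of_real (D i)))"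
      unfolding cc b_def by (simp add: field_simps power2_eq_square)
    also have "\<dots> = of_real (2 * (1 + z)) * (exp (\<i> * of_real (b * D i)) * v i)"
      unfolding v_def by (simp add: mult.assoc mult.left_commute[of "exp (\<i> * _)"] exp_minus)
    finally have "sgn (herm (spinor (p i)) (spinor (p (Suc i mod N)))) =
        sgn (complex_of_real (2 * (1 + z))) * (sgn (exp (\<i> * of_real (b * D i))) * sgn (v i))"
      by (simp only: sgn_mult)
    moreover have "sgn (complex_of_real (2 * (1 + z))) = 1" using z by (simp only: sgn_of_real) simp
    moreover have "sgn (exp (\<i> * of_real (b * D i))) = exp (\<i> * of_real (b * D i))" by (simp add: sgn_div_norm)
    ultimately show ?thesis by simp
  qed
  have "polygon_phase N p = (\<Prod>i<N. exp (\<i> * of_real (b * D i)) * sgn (v i))"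
    unfolding polygon_phase_def by (intro prod.cong refl edge) simp
  also have "\<dots> = exp (\<Sum>i<N. \<i> * of_real (b * D i)) * (\<Prod>i<N. sgn (v i))"
    by (simp add: prod.distrib exp_sum)
  also have "(\<Sum>i<N. \<i> * complex_of_real (b * D i)) = \<i> * of_real (b * (\<Sum>i<N. D i))"
    by (simp add: sum_distrib_left)
  also have "b * (\<Sum>i<N. D i) = pi * (1 - z) * w" unfolding s b_def by simp
  finally have "polygon_phase N p - exp (\<i> * of_real (pi * (1 - z) * w)) =
     exp (\<i> * of_real (pi * (1 - z) * w)) * ((\<Prod>i<N. sgn (v i)) - (\<Prod>i<N. 1))" by (simp add: algebra_simps)
  then have "norm (polygon_phase N p - exp (\<i> * of_real (pi * (1 - z) * w))) = norm ((\<Prod>i<N. sgn (v i)) - (\<Prod>i<N. 1))"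
    by (simp add: norm_mult)
  also have "\<dots> \<le> (\<Sum>i<N. norm (sgn (v i) - 1))" by (rule norm_prod_diff) (simp_all add: norm_sgn)
  also have "\<dots> \<le> (\<Sum>i<N. 2 * e\<^sup>2)"
  proof (rule sum_mono)
    fix i assume "i \<in> {..<N}"
    then have i: "i < N" by simp
    have "norm (v i - 1) \<le> (D i)\<^sup>2" unfolding v_def b_def by (rule latitude_edge_phase[OF z])
    also have "(D i)\<^sup>2 \<le> e\<^sup>2" using e[OF i] by (simp add: abs_le_square_iff[symmetric])
    finally show "norm (sgn (v i) - 1) \<le> 2 * e\<^sup>2" using norm_sgn_diff_1[of "v i"] by linarith
  qed
  finally show ?thesis by simp
qed

text \<open>Here the vertices are only known to be close to their neighbours: the angles are
  imaginary parts of logarithms of quotients, and the winding number is their sum over 2 pi. The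
  bound on w keeps it bounded as N grows with N e bounded, which is needed for a compactness
  argument.\<close>

lemma latitude_polygon_phase:
  assumes N: "N > 0" and z: "\<bar>z\<bar> < 1" and p: "\<And>i. i < N \<Longrightarrow> p i \<in> S2" "\<And>i. i < N \<Longrightarrow> p i $ 3 = z"
    and e: "\<And>i. i < N \<Longrightarrow> norm (p i - p (Suc i mod N)) \<le> e" and small: "e < sqrt (1 - z\<^sup>2) / 2"
  obtains w :: int where
    "norm (polygon_phase N p - exp (\<i> * of_real (pi * (1 - z) * of_int w))) \<le> 8 * real N * e\<^sup>2 / (1 - z\<^sup>2)"
    "\<bar>real_of_int w\<bar> \<le> real N * e / sqrt (1 - z\<^sup>2)"
proof -
  define r where "r = sqrt (1 - z\<^sup>2)"
  have z2: "z\<^sup>2 < 1" using z by (simp add: abs_square_less_1)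
  then have r: "r > 0" "r\<^sup>2 = 1 - z\<^sup>2" by (simp_all add: r_def)
  have m: "Suc i mod N < N" for i using N by simp
  define c where "c i = Complex (p i $ 1) (p i $ 2)" for i
  have nc: "norm (c i) = r" if "i < N" for i
  proof -
    have "(p i $ 1)\<^sup>2 + (p i $ 2)\<^sup>2 + (p i $ 3)\<^sup>2 = 1" using p(1)[OF that] S2_iff by blast
    then have "(p i $ 1)\<^sup>2 + (p i $ 2)\<^sup>2 = 1 - z\<^sup>2" using p(2)[OF that] by simp
    then show ?thesis by (simp add: c_def cmod_def r_def)
  qed
  have cnz: "c i \<noteq> 0" if "i < N" for i using nc[OF that] r by auto
  define D where "D i = Im (Ln (c (Suc i mod N) / c i))" for i
  have q1: "norm (c (Suc i mod N) / c i - 1) \<le> e / r" if i: "i < N" for i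
  proof -
    have "c (Suc i mod N) / c i - 1 = (c (Suc i mod N) - c i) / c i" using cnz[OF i] by (simp add: field_simps)
    then have n: "norm (c (Suc i mod N) / c i - 1) = norm (c (Suc i mod N) - c i) / r"
      by (simp add: norm_divide nc[OF i])
    have "(norm (c (Suc i mod N) - c i))\<^sup>2 \<le> (norm (p i - p (Suc i mod N)))\<^sup>2"
      by (simp add: c_def cmod_power2 power2_norm_eq_inner inner_real3 power2_eq_square[symmetric] power2_commute)
    then have "norm (c (Suc i mod N) - c i) \<le> norm (p i - p (Suc i mod N))" by (rule power2_le_imp_le) simp
    also have "\<dots> \<le> e" by (rule e[OF i])
    finally show ?thesis unfolding n using r by (simp add: divide_right_mono)
  qed
  \<comment> \<open>The quotients of neighbours lie within 1/2 of 1, where the logarithm is at most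
    twice the distance to 1.\<close>
  have er: "e / r < 1/2" using small r by (simp add: r_def field_simps)
  have De: "\<bar>D i\<bar> \<le> 2 * (e / r)" if i: "i < N" for i
  proof -
    have "norm (Ln (1 + (c (Suc i mod N) / c i - 1))) \<le> 2 * norm (c (Suc i mod N) / c i - 1)"
      by (rule norm_Ln_le) (use q1[OF i] er in linarith)
    then have "norm (Ln (c (Suc i mod N) / c i)) \<le> 2 * (e / r)" using q1[OF i] by simp
    then show ?thesis unfolding D_def using abs_Im_le_cmod order_trans by blast
  qed
  have expD: "exp (\<i> * of_real (D i)) = c (Suc i mod N) / c i" if i: "i < N" for i
  proof -
    have nz: "c (Suc i mod N) / c i \<noteq> 0" using cnz[OF i] cnz[OF m] by simp
    have "Re (Ln (c (Suc i mod N) / c i)) = 0" using nz nc[OF i] nc[OF m] r by (simp add: norm_divide)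
    then have "\<i> * of_real (D i) = Ln (c (Suc i mod N) / c i)" by (simp add: D_def complex_eq_iff)
    then show ?thesis using nz by simp
  qed
  \<comment> \<open>The quotients multiply to 1 around the polygon, hence the angles add up to an
    integer multiple of 2 pi.\<close>
  have "exp (\<i> * of_real (\<Sum>i<N. D i)) = (\<Prod>i<N. exp (\<i> * of_real (D i)))"
    by (simp add: exp_sum[symmetric] sum_distrib_left)
  also have "\<dots> = (\<Prod>i<N. c (Suc i mod N) / c i)" by (intro prod.cong refl expD) simp
  also have "\<dots> = 1" using cnz by (simp add: prod_dividef prod_cyclic_shift[OF N])
  finally have "exp (\<i> * of_real (\<Sum>i<N. D i)) = exp 0" by simp
  then obtain w :: int where "\<i> * complex_of_real (\<Sum>i<N. D i) = 0 + (of_int (2 * w) * pi) * \<i>" unfolding exp_eq by blast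
  then have w: "(\<Sum>i<N. D i) = 2 * pi * of_int w" by (simp add: complex_eq_iff)
  have "norm (polygon_phase N p - exp (\<i> * of_real (pi * (1 - z) * of_int w))) \<le> 2 * real N * (2 * (e / r))\<^sup>2"
  proof (rule latitude_polygon_phase_angles[OF N z p _ De w])
    fix i assume i: "i < N"
    show "Complex (p (Suc i mod N) $ 1) (p (Suc i mod N) $ 2) = Complex (p i $ 1) (p i $ 2) * exp (\<i> * of_real (D i))"
      unfolding expD[OF i] using cnz[OF i] by (simp add: c_def[symmetric])
  qed
  also have "\<dots> = 8 * real N * e\<^sup>2 / (1 - z\<^sup>2)" by (simp add: power_divide power_mult_distrib r(2))
  finally have 1: "norm (polygon_phase N p - exp (\<i> * of_real (pi * (1 - z) * of_int w))) \<le> 8 * real N * e\<^sup>2 / (1 - z\<^sup>2)" .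
  have "2 * pi * \<bar>of_int w\<bar> = \<bar>\<Sum>i<N. D i\<bar>" unfolding w by (simp add: abs_mult)
  also have "\<dots> \<le> (\<Sum>i<N. \<bar>D i\<bar>)" by (rule sum_abs)
  also have "\<dots> \<le> (\<Sum>i<N. 2 * (e / r))" by (intro sum_mono De) simp
  finally have "2 * pi * \<bar>of_int w\<bar> \<le> (\<Sum>i<N. 2 * (e / r))" .
  moreover have "(\<Sum>i<N. 2 * (e / r)) = 2 * (real N * e / r)" by simp
  ultimately have "pi * \<bar>of_int w\<bar> \<le> real N * e / r" by linarith
  moreover have "1 * \<bar>real_of_int w\<bar> \<le> pi * \<bar>of_int w\<bar>" using pi_gt3 by (intro mult_right_mono) auto
  ultimately have "\<bar>real_of_int w\<bar> \<le> real N * e / sqrt (1 - z\<^sup>2)" unfolding r_def by linarith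
  with 1 show thesis by (rule that)
qed

lemma polygon_phase_constant: "q \<in> S2 \<Longrightarrow> polygon_phase N (\<lambda>_. q) = 1"
proof -
  assume q: "q \<in> S2"
  have "herm (spinor q) (spinor q) = of_real ((cmod (fst (spinor q)))\<^sup>2 + (cmod (snd (spinor q)))\<^sup>2)"
    by (simp add: herm_def complex_norm_square mult.commute del: of_real_power)
  moreover have "herm (spinor q) (spinor q) \<noteq> 0"
    by (rule herm_nonzero[OF spin_over_spinor[OF q] spin_over_spinor[OF q]]) (use S2_inner[OF q] in simp)
  ultimately have "sgn (herm (spinor q) (spinor q)) = 1"
    by (smt (verit) of_real_0 of_real_1 sgn_of_real sgn_pos zero_le_power2 of_real_eq_iff)
  then show ?thesis by (simp add: polygon_phase_def)
qed

section \<open>Change of the phases along a Hamiltonian flow\<close>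

lemma inner_S2_S2: "p \<in> S2 \<Longrightarrow> q \<in> S2 \<Longrightarrow> p \<bullet> q = 1 - (norm (p - q))\<^sup>2 / 2"
  by (simp add: power2_norm_eq_inner inner_diff_left inner_diff_right inner_commute S2_inner diff_divide_distrib)

text \<open>Since \<open>1 + p \<bullet> p'\<close> differs from 2 to second order, the edge term is
  close to \<open>(g - g') \<bullet> (p + p') / 4\<close>. Summation by parts on this edge turns it
  into half the trapezoidal increment of a function with gradient g plus a difference that
  telescopes around the polygon.\<close>

lemma edge_density_estimate:
  fixes g g' p p' :: "real^3"
  assumes p: "p \<in> S2" "p' \<in> S2" and d: "norm (p - p') \<le> \<delta>" "\<delta> \<le> 1" and M: "norm (g - g') \<le> M * \<delta>" "M \<ge> 0"
  shows "\<bar>((g - g') \<bullet> (p + p')) / (1 + p \<bullet> p') / 2\<bar> \<le> M * \<delta>"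
    and "\<bar>((g - g') \<bullet> (p + p')) / (1 + p \<bullet> p') / 2 - ((g + g') \<bullet> (p' - p) / 4 + (g \<bullet> p - g' \<bullet> p') / 2)\<bar> \<le> M * \<delta>\<^sup>2"
proof -
  define s where "s = (norm (p - p'))\<^sup>2"
  have d0: "\<delta> \<ge> 0" using d(1) norm_ge_zero order_trans by blast
  have s: "0 \<le> s" "s \<le> \<delta>\<^sup>2" "s \<le> 1"
  proof -
    show "0 \<le> s" by (simp add: s_def)
    show 1: "s \<le> \<delta>\<^sup>2" using power_mono[OF d(1), of 2] by (simp add: s_def)
    show "s \<le> 1" using 1 power_mono[OF d(2) d0, of 2] by simp
  qed
  have pp: "1 + p \<bullet> p' = 2 - s / 2" using inner_S2_S2[OF p] by (simp add: s_def)
  have x: "\<bar>(g - g') \<bullet> (p + p')\<bar> \<le> M * \<delta> * 2"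
  proof -
    have "\<bar>(g - g') \<bullet> (p + p')\<bar> \<le> norm (g - g') * norm (p + p')" by (rule Cauchy_Schwarz_ineq2)
    also have "\<dots> \<le> (M * \<delta>) * 2"
      using M d0 norm_triangle_ineq[of p p'] p by (intro mult_mono) simp_all
    finally show ?thesis .
  qed
  have pos: "2 - s / 2 > 0" "2 - s / 2 \<ge> 1" using s by linarith+
  have "\<bar>((g - g') \<bullet> (p + p')) / (1 + p \<bullet> p') / 2\<bar> = \<bar>(g - g') \<bullet> (p + p')\<bar> / (2 - s / 2) / 2"
    unfolding pp abs_divide using pos by simp
  also have "\<dots> \<le> (M * \<delta> * 2) / 1 / 2" using x pos M d0 by (intro divide_right_mono frac_le) simp_all
  finally show "\<bar>((g - g') \<bullet> (p + p')) / (1 + p \<bullet> p') / 2\<bar> \<le> M * \<delta>" by simp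
  have "(g - g') \<bullet> (p + p') / 4 = (g + g') \<bullet> (p' - p) / 4 + (g \<bullet> p - g' \<bullet> p') / 2"
    by (simp add: inner_add_left inner_add_right inner_diff_left inner_diff_right field_simps)
  then have "((g - g') \<bullet> (p + p')) / (1 + p \<bullet> p') / 2 - ((g + g') \<bullet> (p' - p) / 4 + (g \<bullet> p - g' \<bullet> p') / 2) =
     ((g - g') \<bullet> (p + p')) / (2 - s / 2) / 2 - (g - g') \<bullet> (p + p') / 4" by (simp only: pp)
  also have "\<dots> = ((g - g') \<bullet> (p + p')) * (1 / (2 - s / 2) / 2 - 1 / 4)" by (simp add: right_diff_distrib)
  also have "\<bar>\<dots>\<bar> \<le> (M * \<delta> * 2) * (s / 2)"
  proof -
    have e: "1 / (2 - s / 2) / 2 - 1 / 4 = s / 2 / (4 * (2 - s / 2))" using pos by (simp add: field_simps)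
    have "\<bar>1 / (2 - s / 2) / 2 - 1 / 4\<bar> = s / 2 / (4 * (2 - s / 2))" unfolding e using s pos by (intro abs_of_nonneg divide_nonneg_nonneg) simp_all
    also have "\<dots> \<le> s / 2 / 1" using s pos by (intro frac_le) simp_all
    finally show ?thesis unfolding abs_mult using x M d0 by (intro mult_mono) simp_all
  qed
  also have "\<dots> = M * \<delta> * s" by simp
  also have "\<dots> \<le> M * 1 * \<delta>\<^sup>2" using s M d d0 by (intro mult_mono) simp_all
  finally show "\<bar>((g - g') \<bullet> (p + p')) / (1 + p \<bullet> p') / 2 - ((g + g') \<bullet> (p' - p) / 4 + (g \<bullet> p - g' \<bullet> p') / 2)\<bar> \<le> M * \<delta>\<^sup>2"
    by simp
qed

text \<open>Compactness: the data for all N are bounded, so a subsequence converges, and limits of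
  integers are integers. In the limit the exponentials determine x and y modulo 2 pi, which
  introduces k and l, while \<open>c1 * x + c2 * y\<close> becomes 0.\<close>

lemma integer_relation_from_approximations:
  fixes E B c1 c2 a1 b1 b2 :: real
  assumes ap: "\<And>N::nat. N \<ge> N0 \<Longrightarrow> \<exists>x y (m::int) (n::int). \<bar>c1 * x + c2 * y\<bar> \<le> E / real N \<and>
     \<bar>x\<bar> \<le> B \<and> \<bar>y\<bar> \<le> B \<and> \<bar>real_of_int m\<bar> \<le> B \<and> \<bar>real_of_int n\<bar> \<le> B \<and>
     norm (exp (\<i> * of_real x) * exp (\<i> * of_real (pi * a1)) - exp (\<i> * of_real (pi * b1 * of_int m))) \<le> E / real N \<and>
     norm (exp (\<i> * of_real y) - exp (\<i> * of_real (pi * b2 * of_int n))) \<le> E / real N"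
  shows "\<exists>m k n l :: int. c1 * a1 = of_int m * (c1 * b1) + of_int k * (2 * c1) + of_int n * (c2 * b2) + of_int l * (2 * c2)"
proof -
  have "\<forall>j. \<exists>x y (m::int) (n::int). \<bar>c1 * x + c2 * y\<bar> \<le> E / real (N0 + Suc j) \<and>
     \<bar>x\<bar> \<le> B \<and> \<bar>y\<bar> \<le> B \<and> \<bar>real_of_int m\<bar> \<le> B \<and> \<bar>real_of_int n\<bar> \<le> B \<and>
     norm (exp (\<i> * of_real x) * exp (\<i> * of_real (pi * a1)) - exp (\<i> * of_real (pi * b1 * of_int m))) \<le> E / real (N0 + Suc j) \<and>
     norm (exp (\<i> * of_real y) - exp (\<i> * of_real (pi * b2 * of_int n))) \<le> E / real (N0 + Suc j)"
    by (intro allI ap) simp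
  then obtain x y m n where
    s: "\<And>j. \<bar>c1 * x j + c2 * y j\<bar> \<le> E / real (N0 + Suc j)"
    and b: "\<And>j. \<bar>x j\<bar> \<le> B" "\<And>j. \<bar>y j\<bar> \<le> B" "\<And>j. \<bar>real_of_int (m j)\<bar> \<le> B" "\<And>j. \<bar>real_of_int (n j)\<bar> \<le> B"
    and e1: "\<And>j. norm (exp (\<i> * of_real (x j)) * exp (\<i> * of_real (pi * a1)) - exp (\<i> * of_real (pi * b1 * of_int (m j)))) \<le> E / real (N0 + Suc j)"
    and e2: "\<And>j. norm (exp (\<i> * of_real (y j)) - exp (\<i> * of_real (pi * b2 * of_int (n j)))) \<le> E / real (N0 + Suc j)"
    by metis
  define f where "f j = (x j, y j, real_of_int (m j), real_of_int (n j))" for j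
  have "range f \<subseteq> {-B..B} \<times> {-B..B} \<times> {-B..B} \<times> {-B..B}"
    using b by (auto simp: f_def abs_le_iff minus_le_iff)
  then have "bounded (range f)"
    by (rule bounded_subset[rotated]) (intro bounded_Times bounded_closed_interval)
  from bounded_imp_convergent_subsequence[OF this] obtain l r where r: "strict_mono r" "(f \<circ> r) \<longlonglongrightarrow> l" by blast
  define X Y \<mu> \<nu> where "X = fst l" and "Y = fst (snd l)" and "\<mu> = fst (snd (snd l))" and "\<nu> = snd (snd (snd l))"
  have L: "(\<lambda>j. x (r j)) \<longlonglongrightarrow> X" "(\<lambda>j. y (r j)) \<longlonglongrightarrow> Y" "(\<lambda>j. real_of_int (m (r j))) \<longlonglongrightarrow> \<mu>" "(\<lambda>j. real_of_int (n (r j))) \<longlonglongrightarrow> \<nu>"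
    using tendsto_fst[OF r(2)] tendsto_fst[OF tendsto_snd[OF r(2)]] tendsto_fst[OF tendsto_snd[OF tendsto_snd[OF r(2)]]]
      tendsto_snd[OF tendsto_snd[OF tendsto_snd[OF r(2)]]]
    by (simp_all add: f_def o_def X_def Y_def \<mu>_def \<nu>_def)
  have E0: "(\<lambda>j. E / real (N0 + Suc (r j))) \<longlonglongrightarrow> 0"
  proof -
    have "(\<lambda>j. E / real (N0 + Suc j)) \<longlonglongrightarrow> 0"
      using LIMSEQ_ignore_initial_segment[OF lim_const_over_n[of E], of "Suc N0"] by (simp add: algebra_simps)
    from LIMSEQ_subseq_LIMSEQ[OF this r(1)] show ?thesis by (simp add: o_def)
  qed
  have "(\<lambda>j. c1 * x (r j) + c2 * y (r j)) \<longlonglongrightarrow> 0"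
    by (rule Lim_null_comparison[OF _ E0]) (use s in auto)
  moreover have "(\<lambda>j. c1 * x (r j) + c2 * y (r j)) \<longlonglongrightarrow> c1 * X + c2 * Y" by (intro tendsto_intros L)
  ultimately have XY: "c1 * X + c2 * Y = 0" using LIMSEQ_unique by blast
  have "\<mu> \<in> \<int>" "\<nu> \<in> \<int>"
    by (rule closed_sequentially[OF closed_Ints _ L(3)], simp, rule closed_sequentially[OF closed_Ints _ L(4)], simp)
  then obtain m' n' where mn: "\<mu> = of_int m'" "\<nu> = of_int n'" by (auto elim!: Ints_cases)
  have "(\<lambda>j. exp (\<i> * of_real (x (r j))) * exp (\<i> * of_real (pi * a1)) - exp (\<i> * of_real (pi * b1 * of_int (m (r j))))) \<longlonglongrightarrow> 0"
    by (rule Lim_null_comparison[OF _ E0]) (use e1 in auto)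
  moreover have "(\<lambda>j. exp (\<i> * of_real (x (r j))) * exp (\<i> * of_real (pi * a1)) - exp (\<i> * of_real (pi * b1 * of_int (m (r j))))) \<longlonglongrightarrow>
     exp (\<i> * of_real X) * exp (\<i> * of_real (pi * a1)) - exp (\<i> * of_real (pi * b1 * \<mu>))" by (intro tendsto_intros L)
  ultimately have "exp (\<i> * of_real X) * exp (\<i> * of_real (pi * a1)) - exp (\<i> * of_real (pi * b1 * \<mu>)) = 0"
    using LIMSEQ_unique by blast
  then have "exp (\<i> * of_real (X + pi * a1)) = exp (\<i> * of_real (pi * b1 * \<mu>))" by (simp add: exp_add[symmetric] distrib_left)
  then obtain k :: int where "\<i> * complex_of_real (X + pi * a1) = \<i> * of_real (pi * b1 * \<mu>) + (of_int (2 * k) * pi) * \<i>" unfolding exp_eq by blast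
  then have k: "X = pi * b1 * of_int m' + 2 * of_int k * pi - pi * a1" by (simp add: complex_eq_iff mn)
  have "(\<lambda>j. exp (\<i> * of_real (y (r j))) - exp (\<i> * of_real (pi * b2 * of_int (n (r j))))) \<longlonglongrightarrow> 0"
    by (rule Lim_null_comparison[OF _ E0]) (use e2 in auto)
  moreover have "(\<lambda>j. exp (\<i> * of_real (y (r j))) - exp (\<i> * of_real (pi * b2 * of_int (n (r j))))) \<longlonglongrightarrow>
     exp (\<i> * of_real Y) - exp (\<i> * of_real (pi * b2 * \<nu>))" by (intro tendsto_intros L)
  ultimately have "exp (\<i> * of_real Y) - exp (\<i> * of_real (pi * b2 * \<nu>)) = 0"
    using LIMSEQ_unique by blast
  then have "exp (\<i> * of_real Y) = exp (\<i> * of_real (pi * b2 * \<nu>))" by simp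
  then obtain l :: int where "\<i> * complex_of_real Y = \<i> * of_real (pi * b2 * \<nu>) + (of_int (2 * l) * pi) * \<i>" unfolding exp_eq by blast
  then have l: "Y = pi * b2 * of_int n' + 2 * of_int l * pi" by (simp add: complex_eq_iff mn)
  have "pi * (c1 * a1) = pi * (of_int m' * (c1 * b1) + of_int k * (2 * c1) + of_int n' * (c2 * b2) + of_int l * (2 * c2))"
    using XY unfolding k l by (simp add: algebra_simps)
  then show ?thesis by (simp only: mult_cancel_left pi_neq_zero) blast
qed

lemma combine_edge_estimates:
  fixes X Y :: real
  assumes "X' + Y' = q / 4 + d" "0 \<le> c" "\<bar>X - X'\<bar> \<le> a" "\<bar>Y - Y'\<bar> \<le> b" "\<bar>h' - h - q / 2\<bar> \<le> c"
  shows "\<bar>X + Y - ((h' - h) / 2 + d)\<bar> \<le> a + b + c"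
proof -
  have e: "X + Y - ((h' - h) / 2 + d) = (X - X') + (Y - Y') - (h' - h - q / 2) / 2"
    using assms(1) by (simp add: field_simps)
  have "\<bar>(X - X') + (Y - Y') - (h' - h - q / 2) / 2\<bar> \<le> \<bar>X - X'\<bar> + \<bar>Y - Y'\<bar> + \<bar>(h' - h - q / 2) / 2\<bar>"
    by linarith
  also have "\<bar>(h' - h - q / 2) / 2\<bar> = \<bar>h' - h - q / 2\<bar> / 2" by simp
  finally have f: "\<bar>X + Y - ((h' - h) / 2 + d)\<bar> \<le> \<bar>X - X'\<bar> + \<bar>Y - Y'\<bar> + \<bar>h' - h - q / 2\<bar> / 2" unfolding e .
  have "p \<le> a + b + c" if "p \<le> x + y + w / 2" "x \<le> a" "y \<le> b" "w \<le> c" for p x y w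
    using that assms(2) by linarith
  from this[OF f assms(3-5)] show ?thesis .
qed

lemma unit_circle_chord: "(cos a - cos b)\<^sup>2 + (sin a - sin b)\<^sup>2 \<le> (a - b)\<^sup>2" for a b :: real
proof -
  have "(cos a - cos b)\<^sup>2 + (sin a - sin b)\<^sup>2 = (cos a)\<^sup>2 + (sin a)\<^sup>2 + ((cos b)\<^sup>2 + (sin b)\<^sup>2) - 2 * (cos a * cos b + sin a * sin b)"
    by (simp add: power2_eq_square algebra_simps)
  also have "\<dots> = 2 - 2 * cos (2 * ((a - b) / 2))" by (simp add: cos_diff diff_divide_distrib)
  also have "\<dots> = 4 * (sin ((a - b) / 2))\<^sup>2" unfolding cos_double_sin by simp
  also have "\<dots> \<le> 4 * ((a - b) / 2)\<^sup>2" using iffD1[OF abs_le_square_iff abs_sin_x_le_abs_x[of "(a - b) / 2"]] by (rule mult_left_mono) simp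
  finally show ?thesis by (simp add: power_divide)
qed

text \<open>In units of 2 pi, \<open>c1 * (1 - z1)\<close> is the area of a cap and
  \<open>2 * c1\<close>, \<open>2 * c2\<close> are those of the spheres. The cap is bounded by the
  parallel at height z1 with the second point held fixed. The image of this loop lies on the target
  torus, where m and n are its winding numbers; inscribed N-gons are followed along the
  flow.\<close>

lemma ham_equivalent_round_torus_areas:
  assumes c: "c1 > 0" "c2 > 0" and z: "\<bar>z1\<bar> < 1" "\<bar>z2\<bar> < 1" "\<bar>z1'\<bar> < 1" "\<bar>z2'\<bar> < 1"
    and eq: "ham_equivalent (round_form c1 c2) (round_torus z1 z2) (round_torus z1' z2')"
  shows "\<exists>m k n l :: int. c1 * (1 - z1) =
     of_int m * (c1 * (1 - z1')) + of_int k * (2 * c1) + of_int n * (c2 * (1 - z2')) + of_int l * (2 * c2)"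
proof -
  obtain H \<Phi> where fl: "hamiltonian_flow (round_form c1 c2) H \<Phi>" and img: "\<Phi> 1 ` round_torus z1 z2 = round_torus z1' z2'"
    using ham_equivalentE[OF eq round_torus_subset] by blast
  obtain U G1 G2 where U: "open U" "{0..1} \<times> S2xS2 \<subseteq> U" "smooth_on_open U H" "smooth_on_open U G1" "smooth_on_open U G2"
    and DH: "\<And>t x v. (t, x) \<in> U \<Longrightarrow> frechet_derivative H (at (t, x)) (0, v) = G1 (t, x) \<bullet> fst v + G2 (t, x) \<bullet> snd v"
    and ode: "\<And>t x. t \<in> {0..1} \<Longrightarrow> x \<in> S2xS2 \<Longrightarrow> ((\<lambda>s. \<Phi> s x) has_vector_derivative
        ham_field c1 c2 (G1 (t, \<Phi> t x)) (G2 (t, \<Phi> t x)) (\<Phi> t x)) (at t within {0..1})"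
    using hamiltonian_flow_field[OF c fl] by metis
  obtain L where L: "L \<ge> 0" "\<And>t x y. t \<in> {0..1} \<Longrightarrow> x \<in> S2xS2 \<Longrightarrow> y \<in> S2xS2 \<Longrightarrow> norm (\<Phi> t x - \<Phi> t y) \<le> L * norm (x - y)"
    using hamiltonian_flow_lipschitz[OF c fl] by metis
  obtain M1 where M1: "M1 \<ge> 0" "\<And>x y. x \<in> {0..1} \<times> S2xS2 \<Longrightarrow> y \<in> {0..1} \<times> S2xS2 \<Longrightarrow> norm (G1 x - G1 y) \<le> M1 * norm (x - y)"
    using smooth_on_open_lipschitz_on_compact[OF U(1) U(4) compact_time_S2xS2 U(2)] by metis
  obtain M2 where M2: "M2 \<ge> 0" "\<And>x y. x \<in> {0..1} \<times> S2xS2 \<Longrightarrow> y \<in> {0..1} \<times> S2xS2 \<Longrightarrow> norm (G2 x - G2 y) \<le> M2 * norm (x - y)"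
    using smooth_on_open_lipschitz_on_compact[OF U(1) U(5) compact_time_S2xS2 U(2)] by metis
  obtain C e where Ce: "C \<ge> 0" "e > 0" "\<And>x y. x \<in> {0..1} \<times> S2xS2 \<Longrightarrow> y \<in> {0..1} \<times> S2xS2 \<Longrightarrow> norm (y - x) \<le> e \<Longrightarrow>
       \<bar>H y - H x - (frechet_derivative H (at x) (y - x) + frechet_derivative H (at y) (y - x)) / 2\<bar> \<le> C * (norm (y - x))\<^sup>2"
    using smooth_on_open_second_order_on_compact[OF U(1) U(3) compact_time_S2xS2 U(2)] by metis
  define r q0 where "r = sqrt (1 - z1\<^sup>2)" and "q0 = (vector [sqrt (1 - z2\<^sup>2), 0, z2] :: real^3)"
  define r1 r2 where "r1 = sqrt (1 - z1'\<^sup>2)" and "r2 = sqrt (1 - z2'\<^sup>2)"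
  have zz: "z1\<^sup>2 < 1" "z2\<^sup>2 < 1" "z1'\<^sup>2 < 1" "z2'\<^sup>2 < 1" using z by (simp_all add: abs_square_less_1)
  then have r: "r > 0" "r\<^sup>2 = 1 - z1\<^sup>2" "r1 > 0" "r2 > 0" "r1\<^sup>2 = 1 - z1'\<^sup>2" "r2\<^sup>2 = 1 - z2'\<^sup>2" by (simp_all add: r_def r1_def r2_def)
  have q0: "q0 \<in> S2" "q0 $ 3 = z2" using zz unfolding S2_iff by (simp_all add: q0_def)
  define A where "A = L * (2 * pi)"
  have A0: "A \<ge> 0" using L(1) by (simp add: A_def)
  \<comment> \<open>Bounds for the edge length: 1 excludes antipodal neighbours, e is the range of
    the trapezoidal estimate, and r1, r2 allow winding numbers to be read off from the final
    polygons.\<close>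
  define m0 where "m0 = min (min 1 e) (min (r1 / 3) (r2 / 3))"
  have m0: "m0 > 0" using Ce r by (simp add: m0_def)
  obtain N0 where N0: "N0 > 0" "A / m0 < real N0" using reals_Archimedean2[of "max 0 (A / m0)"] by (auto intro: gr0I)
  define B where "B = M1 * A / c1 + M2 * A / c2 + A / r1 + A / r2"
  define E where "E = (M1 + M2 + C) * A\<^sup>2 + 8 * pi\<^sup>2 + 8 * A\<^sup>2 / (1 - z1'\<^sup>2) + 8 * A\<^sup>2 / (1 - z2'\<^sup>2)"
  have claim: "\<exists>x y (m::int) (n::int). \<bar>c1 * x + c2 * y\<bar> \<le> E / real N \<and>
     \<bar>x\<bar> \<le> B \<and> \<bar>y\<bar> \<le> B \<and> \<bar>real_of_int m\<bar> \<le> B \<and> \<bar>real_of_int n\<bar> \<le> B \<and>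
     norm (exp (\<i> * of_real x) * exp (\<i> * of_real (pi * (1 - z1))) - exp (\<i> * of_real (pi * (1 - z1') * of_int m))) \<le> E / real N \<and>
     norm (exp (\<i> * of_real y) - exp (\<i> * of_real (pi * (1 - z2') * of_int n))) \<le> E / real N" if NN: "N \<ge> N0" for N
  proof -
    have N: "N > 0" "real N > 0" using NN N0 by simp_all
    define \<delta> where "\<delta> = A / real N"
    have d0: "\<delta> \<ge> 0" using A0 by (simp add: \<delta>_def)
    have "A < m0 * real N0" using N0(2) m0 by (simp add: field_simps)
    also have "\<dots> \<le> m0 * real N" using NN m0 by simp
    finally have "\<delta> < m0" using N by (simp add: \<delta>_def field_simps)
    then have ds: "\<delta> \<le> 1" "\<delta> \<le> e" "\<delta> < r1 / 2" "\<delta> < r2 / 2" using r by (simp_all add: m0_def)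
    have Nd: "real N * \<delta> = A" using N by (simp add: \<delta>_def)
    then have Nd2: "real N * \<delta>\<^sup>2 = A\<^sup>2 / real N" using N by (simp add: \<delta>_def power2_eq_square)
    define nx where "nx i = Suc i mod N" for i
    have nx: "nx i < N" for i using N by (simp add: nx_def)
    define \<theta> where "\<theta> = 2 * pi / real N"
    define \<gamma> where "\<gamma> i = (vector [r * cos (\<theta> * real i), r * sin (\<theta> * real i), z1] :: real^3)" for i
    have \<gamma>S: "\<gamma> i \<in> S2" "\<gamma> i $ 3 = z1" for i
    proof -
      have "(r * cos (\<theta> * real i))\<^sup>2 + (r * sin (\<theta> * real i))\<^sup>2 = r\<^sup>2 * ((cos (\<theta> * real i))\<^sup>2 + (sin (\<theta> * real i))\<^sup>2)"
        by algebra
      then show "\<gamma> i \<in> S2" unfolding S2_iff by (simp add: \<gamma>_def r(2))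
      show "\<gamma> i $ 3 = z1" by (simp add: \<gamma>_def)
    qed
    have \<gamma>nx: "\<gamma> (nx i) = \<gamma> (Suc i)" if "i < N" for i
    proof (cases "Suc i = N")
      case True
      have "\<theta> * real N = 2 * pi" using N by (simp add: \<theta>_def)
      then show ?thesis using True by (simp add: nx_def \<gamma>_def)
    next
      case False
      then show ?thesis using that by (simp add: nx_def)
    qed
    have \<gamma>d: "norm (\<gamma> i - \<gamma> (nx i)) \<le> 2 * pi / real N" if "i < N" for i
    proof -
      have "(norm (\<gamma> i - \<gamma> (nx i)))\<^sup>2 = r\<^sup>2 * ((cos (\<theta> * real i) - cos (\<theta> * real (Suc i)))\<^sup>2 + (sin (\<theta> * real i) - sin (\<theta> * real (Suc i)))\<^sup>2)"
      proof -
        have v: "\<gamma> i - \<gamma> (Suc i) = vector [r * (cos (\<theta> * real i) - cos (\<theta> * real (Suc i))), r * (sin (\<theta> * real i) - sin (\<theta> * real (Suc i))), 0]"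
          by (simp add: vec3_eq_iff \<gamma>_def right_diff_distrib)
        have "(r * a) * (r * a) + (r * b) * (r * b) + 0 * 0 = r\<^sup>2 * (a\<^sup>2 + b\<^sup>2)" for a b by algebra
        then show ?thesis unfolding \<gamma>nx[OF that] power2_norm_eq_inner inner_real3 v vector_3 .
      qed
      also have "\<dots> \<le> 1 * (\<theta> * real i - \<theta> * real (Suc i))\<^sup>2"
        using r(2) by (intro mult_mono unit_circle_chord) simp_all
      also have "\<dots> = \<theta>\<^sup>2" by (simp add: algebra_simps)
      finally have "norm (\<gamma> i - \<gamma> (nx i)) \<le> \<theta>" by (rule power2_le_imp_le) (simp add: \<theta>_def)
      then show ?thesis by (simp add: \<theta>_def)
    qed
    define u where "u i t = \<Phi> t (\<gamma> i, q0)" for i t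
    have x0: "(\<gamma> i, q0) \<in> S2xS2" for i using \<gamma>S q0 by simp
    have uS: "u i t \<in> S2xS2" if "t \<in> {0..1}" for i t unfolding u_def by (rule hamiltonian_flowD(3)[OF fl that x0])
    have uS': "fst (u i t) \<in> S2" "snd (u i t) \<in> S2" if "t \<in> {0..1}" for i t using uS[OF that, of i] by (simp_all add: mem_Times_iff)
    have uK: "(t, u i t) \<in> {0..1} \<times> S2xS2" if "t \<in> {0..1}" for i t by (intro SigmaI that uS)
    have uU: "(t, u i t) \<in> U" if "t \<in> {0..1}" for i t using uK[OF that] U(2) by blast
    have ud: "norm (u i t - u (nx i) t) \<le> \<delta>" if "t \<in> {0..1}" "i < N" for i t
    proof -
      have "norm (u i t - u (nx i) t) \<le> L * norm ((\<gamma> i, q0) - (\<gamma> (nx i), q0))" unfolding u_def by (rule L(2)[OF that(1) x0 x0])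
      also have "\<dots> \<le> L * (2 * pi / real N)" using \<gamma>d[OF that(2)] by (intro mult_left_mono L(1)) (simp add: norm_Pair)
      finally show ?thesis by (simp add: \<delta>_def A_def)
    qed
    have pd: "norm (fst (u i t) - fst (u (nx i) t)) \<le> \<delta>" "norm (snd (u i t) - snd (u (nx i) t)) \<le> \<delta>" if "t \<in> {0..1}" "i < N" for i t
    proof -
      have "norm (fst w) \<le> norm w" "norm (snd w) \<le> norm w" for w :: point
        using norm_fst_le[of "fst w" "snd w"] norm_snd_le[of "snd w" "fst w"] by simp_all
      from order_trans[OF this(1) ud[OF that]] order_trans[OF this(2) ud[OF that]]
      show "norm (fst (u i t) - fst (u (nx i) t)) \<le> \<delta>" "norm (snd (u i t) - snd (u (nx i) t)) \<le> \<delta>" by simp_all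
    qed
    have ang: "fst (u i t) \<bullet> fst (u (nx i) t) > - 1" "snd (u i t) \<bullet> snd (u (nx i) t) > - 1" if "t \<in> {0..1}" "i < N" for i t
    proof -
      have "(norm (fst (u i t) - fst (u (nx i) t)))\<^sup>2 \<le> 1" "(norm (snd (u i t) - snd (u (nx i) t)))\<^sup>2 \<le> 1"
        using pd[OF that] ds(1) by (auto intro!: power_le_one)
      then show "fst (u i t) \<bullet> fst (u (nx i) t) > - 1" "snd (u i t) \<bullet> snd (u (nx i) t) > - 1"
        unfolding inner_S2_S2[OF uS'(1)[OF that(1)] uS'(1)[OF that(1)]] inner_S2_S2[OF uS'(2)[OF that(1)] uS'(2)[OF that(1)]] by linarith+
    qed
    define g1 g2 where "g1 i t = G1 (t, u i t)" and "g2 i t = G2 (t, u i t)" for i t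
    have du: "((\<lambda>s. u i s) has_vector_derivative ham_field c1 c2 (g1 i t) (g2 i t) (u i t)) (at t within {0..1})" if "t \<in> {0..1}" for i t
      unfolding u_def g1_def g2_def by (rule ode[OF that x0])
    have cu: "continuous_on {0..1} (u i)" for i
      unfolding continuous_on_eq_continuous_within using has_vector_derivative_continuous[OF du] by blast
    have cg: "continuous_on {0..1} (g1 i)" "continuous_on {0..1} (g2 i)" for i
      unfolding g1_def g2_def
      by (rule continuous_on_compose2[OF smooth_on_open_imp_continuous_on[OF U(4)]], intro continuous_intros cu, use uU in blast,
          rule continuous_on_compose2[OF smooth_on_open_imp_continuous_on[OF U(5)]], intro continuous_intros cu, use uU in blast)
    have dp: "((\<lambda>s. fst (u i s)) has_vector_derivative (((1 / c1) *\<^sub>R g1 i t) \<otimes> fst (u i t))) (at t within {0..1})"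
      "((\<lambda>s. snd (u i s)) has_vector_derivative (((1 / c2) *\<^sub>R g2 i t) \<otimes> snd (u i t))) (at t within {0..1})" if "t \<in> {0..1}" for i t
      using bounded_linear.has_vector_derivative[OF bounded_linear_fst du[OF that, of i]]
        bounded_linear.has_vector_derivative[OF bounded_linear_snd du[OF that, of i]]
      by (simp_all add: ham_field_def cross_mult_left)
    \<comment> \<open>X and Y are the edge terms of the phase derivatives multiplied by c1 and c2,
      which cancels the reciprocal weights in the angular velocities.\<close>
    define X where "X i t = ((g1 i t - g1 (nx i) t) \<bullet> (fst (u i t) + fst (u (nx i) t))) / (1 + fst (u i t) \<bullet> fst (u (nx i) t)) / 2" for i t
    define Y where "Y i t = ((g2 i t - g2 (nx i) t) \<bullet> (snd (u i t) + snd (u (nx i) t))) / (1 + snd (u i t) \<bullet> snd (u (nx i) t)) / 2" for i t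
    define D1 where "D1 t = (\<Sum>i<N. (((1 / c1) *\<^sub>R g1 i t - (1 / c1) *\<^sub>R g1 (Suc i mod N) t) \<bullet> (fst (u i t) + fst (u (Suc i mod N) t))) / (1 + fst (u i t) \<bullet> fst (u (Suc i mod N) t)) / 2)" for t
    define D2 where "D2 t = (\<Sum>i<N. (((1 / c2) *\<^sub>R g2 i t - (1 / c2) *\<^sub>R g2 (Suc i mod N) t) \<bullet> (snd (u i t) + snd (u (Suc i mod N) t))) / (1 + snd (u i t) \<bullet> snd (u (Suc i mod N) t)) / 2)" for t
    have cD1: "c1 * D1 t = (\<Sum>i<N. X i t)" for t
      unfolding D1_def X_def nx_def sum_distrib_left using c
      by (intro sum.cong refl) (simp add: scaleR_diff_right[symmetric])
    have cD2: "c2 * D2 t = (\<Sum>i<N. Y i t)" for t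
      unfolding D2_def Y_def nx_def sum_distrib_left using c
      by (intro sum.cong refl) (simp add: scaleR_diff_right[symmetric])
    have T1: "continuous_on {0..1} D1" "polygon_phase N (\<lambda>i. fst (u i 1)) = exp (\<i> * of_real (integral {0..1} D1)) * polygon_phase N (\<lambda>i. fst (u i 0))"
      unfolding D1_def
    proof -
      have a1: "\<And>i t. i < N \<Longrightarrow> t \<in> {0..1} \<Longrightarrow> fst (u i t) \<in> S2" by (rule uS')
      have a2: "\<And>i t. i < N \<Longrightarrow> t \<in> {0..1} \<Longrightarrow> ((\<lambda>s. fst (u i s)) has_vector_derivative (((1 / c1) *\<^sub>R g1 i t) \<otimes> fst (u i t))) (at t within {0..1})"
        by (rule dp)
      have a3: "\<And>i. i < N \<Longrightarrow> continuous_on {0..1} (\<lambda>t. (1 / c1) *\<^sub>R g1 i t)" by (intro continuous_intros cg)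
      have a4: "\<And>i t. i < N \<Longrightarrow> t \<in> {0..1} \<Longrightarrow> fst (u i t) \<bullet> fst (u (Suc i mod N) t) > - 1"
        using ang unfolding nx_def by blast
      note tr = polygon_phase_transport[OF N(1), of "\<lambda>i t. fst (u i t)" "\<lambda>i t. (1 / c1) *\<^sub>R g1 i t", OF a1 a2 a3 a4]
      show "continuous_on {0..1} (\<lambda>t. \<Sum>i<N. (((1 / c1) *\<^sub>R g1 i t - (1 / c1) *\<^sub>R g1 (Suc i mod N) t) \<bullet> (fst (u i t) + fst (u (Suc i mod N) t))) / (1 + fst (u i t) \<bullet> fst (u (Suc i mod N) t)) / 2)"
        by (rule tr(1))
      show "polygon_phase N (\<lambda>i. fst (u i 1)) = exp (\<i> * of_real (integral {0..1} (\<lambda>t. \<Sum>i<N. (((1 / c1) *\<^sub>R g1 i t - (1 / c1) *\<^sub>R g1 (Suc i mod N) t) \<bullet> (fst (u i t) + fst (u (Suc i mod N) t))) / (1 + fst (u i t) \<bullet> fst (u (Suc i mod N) t)) / 2))) * polygon_phase N (\<lambda>i. fst (u i 0))"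
        by (rule tr(2))
    qed
    have T2: "continuous_on {0..1} D2" "polygon_phase N (\<lambda>i. snd (u i 1)) = exp (\<i> * of_real (integral {0..1} D2)) * polygon_phase N (\<lambda>i. snd (u i 0))"
      unfolding D2_def
    proof -
      have a1: "\<And>i t. i < N \<Longrightarrow> t \<in> {0..1} \<Longrightarrow> snd (u i t) \<in> S2" by (rule uS')
      have a2: "\<And>i t. i < N \<Longrightarrow> t \<in> {0..1} \<Longrightarrow> ((\<lambda>s. snd (u i s)) has_vector_derivative (((1 / c2) *\<^sub>R g2 i t) \<otimes> snd (u i t))) (at t within {0..1})"
        by (rule dp)
      have a3: "\<And>i. i < N \<Longrightarrow> continuous_on {0..1} (\<lambda>t. (1 / c2) *\<^sub>R g2 i t)" by (intro continuous_intros cg)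
      have a4: "\<And>i t. i < N \<Longrightarrow> t \<in> {0..1} \<Longrightarrow> snd (u i t) \<bullet> snd (u (Suc i mod N) t) > - 1"
        using ang unfolding nx_def by blast
      note tr = polygon_phase_transport[OF N(1), of "\<lambda>i t. snd (u i t)" "\<lambda>i t. (1 / c2) *\<^sub>R g2 i t", OF a1 a2 a3 a4]
      show "continuous_on {0..1} (\<lambda>t. \<Sum>i<N. (((1 / c2) *\<^sub>R g2 i t - (1 / c2) *\<^sub>R g2 (Suc i mod N) t) \<bullet> (snd (u i t) + snd (u (Suc i mod N) t))) / (1 + snd (u i t) \<bullet> snd (u (Suc i mod N) t)) / 2)"
        by (rule tr(1))
      show "polygon_phase N (\<lambda>i. snd (u i 1)) = exp (\<i> * of_real (integral {0..1} (\<lambda>t. \<Sum>i<N. (((1 / c2) *\<^sub>R g2 i t - (1 / c2) *\<^sub>R g2 (Suc i mod N) t) \<bullet> (snd (u i t) + snd (u (Suc i mod N) t))) / (1 + snd (u i t) \<bullet> snd (u (Suc i mod N) t)) / 2))) * polygon_phase N (\<lambda>i. snd (u i 0))"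
        by (rule tr(2))
    qed
    have gd: "norm (g1 i t - g1 (nx i) t) \<le> M1 * \<delta>" "norm (g2 i t - g2 (nx i) t) \<le> M2 * \<delta>" if "t \<in> {0..1}" "i < N" for i t
    proof -
      have "norm ((t, u i t) - (t, u (nx i) t)) \<le> \<delta>" using ud[OF that] by (simp add: norm_Pair)
      then show "norm (g1 i t - g1 (nx i) t) \<le> M1 * \<delta>" "norm (g2 i t - g2 (nx i) t) \<le> M2 * \<delta>"
        unfolding g1_def g2_def using M1(2)[OF uK[OF that(1)] uK[OF that(1)]] M2(2)[OF uK[OF that(1)] uK[OF that(1)]] M1(1) M2(1)
        by (meson mult_left_mono order_trans)+
    qed
    have est1: "\<bar>X i t\<bar> \<le> M1 * \<delta>"
        "\<bar>X i t - ((g1 i t + g1 (nx i) t) \<bullet> (fst (u (nx i) t) - fst (u i t)) / 4 + (g1 i t \<bullet> fst (u i t) - g1 (nx i) t \<bullet> fst (u (nx i) t)) / 2)\<bar> \<le> M1 * \<delta>\<^sup>2"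
      if "t \<in> {0..1}" "i < N" for i t
      unfolding X_def
      by (rule edge_density_estimate[OF uS'(1)[OF that(1)] uS'(1)[OF that(1)] pd(1)[OF that] ds(1) gd(1)[OF that] M1(1)])+
    have est2: "\<bar>Y i t\<bar> \<le> M2 * \<delta>"
        "\<bar>Y i t - ((g2 i t + g2 (nx i) t) \<bullet> (snd (u (nx i) t) - snd (u i t)) / 4 + (g2 i t \<bullet> snd (u i t) - g2 (nx i) t \<bullet> snd (u (nx i) t)) / 2)\<bar> \<le> M2 * \<delta>\<^sup>2"
      if "t \<in> {0..1}" "i < N" for i t
      unfolding Y_def
      by (rule edge_density_estimate[OF uS'(2)[OF that(1)] uS'(2)[OF that(1)] pd(2)[OF that] ds(1) gd(2)[OF that] M2(1)])+
    have bD: "\<bar>D1 t\<bar> \<le> M1 * A / c1" "\<bar>D2 t\<bar> \<le> M2 * A / c2" if t: "t \<in> {0..1}" for t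
    proof -
      have "\<bar>c1 * D1 t\<bar> \<le> (\<Sum>i<N. M1 * \<delta>)" unfolding cD1 by (rule order_trans[OF sum_abs sum_mono]) (use est1(1)[OF t] in simp)
      then show "\<bar>D1 t\<bar> \<le> M1 * A / c1" using c Nd by (simp add: abs_mult field_simps)
      have "\<bar>c2 * D2 t\<bar> \<le> (\<Sum>i<N. M2 * \<delta>)" unfolding cD2 by (rule order_trans[OF sum_abs sum_mono]) (use est2(1)[OF t] in simp)
      then show "\<bar>D2 t\<bar> \<le> M2 * A / c2" using c Nd by (simp add: abs_mult field_simps)
    qed
    \<comment> \<open>On each edge X + Y is half the increment of H plus a telescoping difference,
      up to order \<open>\<delta>\<^sup>2\<close>; both factors are needed to form this increment.
      Around the closed polygon only the N errors survive, of total order 1/N.\<close>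
    have bS: "\<bar>c1 * D1 t + c2 * D2 t\<bar> \<le> (M1 + M2 + C) * A\<^sup>2 / real N" if t: "t \<in> {0..1}" for t
    proof -
      define X' where "X' i = (g1 i t + g1 (nx i) t) \<bullet> (fst (u (nx i) t) - fst (u i t)) / 4 + (g1 i t \<bullet> fst (u i t) - g1 (nx i) t \<bullet> fst (u (nx i) t)) / 2" for i
      define Y' where "Y' i = (g2 i t + g2 (nx i) t) \<bullet> (snd (u (nx i) t) - snd (u i t)) / 4 + (g2 i t \<bullet> snd (u i t) - g2 (nx i) t \<bullet> snd (u (nx i) t)) / 2" for i
      define h where "h i = H (t, u i t)" for i
      define \<tau> where "\<tau> i = (g1 i t \<bullet> fst (u i t) + g2 i t \<bullet> snd (u i t)) / 2" for i
      have edge: "\<bar>X i t + Y i t - ((h (nx i) - h i) / 2 + (\<tau> i - \<tau> (nx i)))\<bar> \<le> (M1 + M2 + C) * \<delta>\<^sup>2" if i: "i < N" for i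
      proof -
        have 1: "\<bar>X i t - X' i\<bar> \<le> M1 * \<delta>\<^sup>2" "\<bar>Y i t - Y' i\<bar> \<le> M2 * \<delta>\<^sup>2"
          unfolding X'_def Y'_def by (rule est1(2)[OF t i], rule est2(2)[OF t i])
        define v where "v = u (nx i) t - u i t"
        have v: "norm v \<le> \<delta>" using ud[OF t i] by (simp add: v_def norm_minus_commute)
        have w: "(t, u (nx i) t) - (t, u i t) = (0, v)" by (simp add: v_def)
        have nv: "norm (0::real, v) = norm v" by (simp add: norm_Pair)
        have "\<bar>h (nx i) - h i - (frechet_derivative H (at (t, u i t)) (0, v) + frechet_derivative H (at (t, u (nx i) t)) (0, v)) / 2\<bar> \<le> C * (norm v)\<^sup>2"
        proof -
          have "norm ((t, u (nx i) t) - (t, u i t)) \<le> e" unfolding w nv using v ds(2) by linarith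
          from Ce(3)[OF uK[OF t, of i] uK[OF t, of "nx i"] this] show ?thesis unfolding w nv h_def .
        qed
        also have "\<dots> \<le> C * \<delta>\<^sup>2" using v Ce(1) by (intro mult_left_mono power_mono) simp_all
        finally have 2: "\<bar>h (nx i) - h i - ((g1 i t \<bullet> fst v + g2 i t \<bullet> snd v) + (g1 (nx i) t \<bullet> fst v + g2 (nx i) t \<bullet> snd v)) / 2\<bar> \<le> C * \<delta>\<^sup>2"
          unfolding DH[OF uU[OF t]] g1_def g2_def .
        have "X' i + Y' i = ((g1 i t \<bullet> fst v + g2 i t \<bullet> snd v) + (g1 (nx i) t \<bullet> fst v + g2 (nx i) t \<bullet> snd v)) / 4 + (\<tau> i - \<tau> (nx i))"
          unfolding X'_def Y'_def \<tau>_def v_def by (simp add: inner_add_left inner_diff_right field_simps)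
        moreover have "C * \<delta>\<^sup>2 \<ge> 0" using Ce(1) by simp
        ultimately show ?thesis unfolding distrib_right by (rule combine_edge_estimates[OF _ _ 1 2])
      qed
      have "(\<Sum>i<N. (h (nx i) - h i) / 2 + (\<tau> i - \<tau> (nx i))) = ((\<Sum>i<N. h (nx i)) - (\<Sum>i<N. h i)) / 2 + ((\<Sum>i<N. \<tau> i) - (\<Sum>i<N. \<tau> (nx i)))"
        by (simp only: sum.distrib sum_subtractf sum_divide_distrib[symmetric])
      also have "\<dots> = 0" unfolding nx_def by (simp add: sum_cyclic_shift[OF N(1)])
      finally have "c1 * D1 t + c2 * D2 t = (\<Sum>i<N. X i t + Y i t - ((h (nx i) - h i) / 2 + (\<tau> i - \<tau> (nx i))))"
        unfolding cD1 cD2 by (simp only: sum.distrib sum_subtractf)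
      also have "\<bar>\<dots>\<bar> \<le> (\<Sum>i<N. (M1 + M2 + C) * \<delta>\<^sup>2)"
        by (rule order_trans[OF sum_abs sum_mono]) (use edge in simp)
      also have "\<dots> = (M1 + M2 + C) * (real N * \<delta>\<^sup>2)" by simp
      finally show ?thesis unfolding Nd2 by simp
    qed
    define x y where "x = integral {0..1} D1" and "y = integral {0..1} D2"
    have bx: "\<bar>x\<bar> \<le> M1 * A / c1" "\<bar>y\<bar> \<le> M2 * A / c2"
      unfolding x_def y_def using integral_bound[of 0 1 D1 "M1 * A / c1"] integral_bound[of 0 1 D2 "M2 * A / c2"] T1(1) T2(1) bD by simp_all
    have "c1 * x + c2 * y = integral {0..1} (\<lambda>t. c1 * D1 t + c2 * D2 t)"
      unfolding x_def y_def using T1(1) T2(1)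
      by (subst Henstock_Kurzweil_Integration.integral_add) (auto intro!: integrable_continuous_interval continuous_intros)
    also have "\<bar>\<dots>\<bar> \<le> (M1 + M2 + C) * A\<^sup>2 / real N"
      using integral_bound[of 0 1 "\<lambda>t. c1 * D1 t + c2 * D2 t" "(M1 + M2 + C) * A\<^sup>2 / real N"] T1(1) T2(1) bS
      by (simp add: continuous_intros)
    finally have S: "\<bar>c1 * x + c2 * y\<bar> \<le> (M1 + M2 + C) * A\<^sup>2 / real N" .
    have u0: "u i 0 = (\<gamma> i, q0)" for i unfolding u_def by (rule hamiltonian_flowD(2)[OF fl x0])
    \<comment> \<open>The initial polygon is a regular N-gon, going once around the parallel in the
      first factor; in the second factor it is a single point, with phase 1.\<close>
    have I1: "norm (polygon_phase N (\<lambda>i. fst (u i 0)) - exp (\<i> * of_real (pi * (1 - z1) * 1))) \<le> 2 * real N * \<theta>\<^sup>2"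
    proof (rule latitude_polygon_phase_angles[OF N(1) z(1), where D = "\<lambda>_. \<theta>"])
      fix i assume i: "i < N"
      show "Complex (fst (u (Suc i mod N) 0) $ 1) (fst (u (Suc i mod N) 0) $ 2) = Complex (fst (u i 0) $ 1) (fst (u i 0) $ 2) * exp (\<i> * of_real \<theta>)"
        unfolding u0 fst_conv \<gamma>nx[OF i, unfolded nx_def]
        by (simp add: \<gamma>_def complex_eq_iff cis_conv_exp[symmetric] distrib_left distrib_right cos_add sin_add algebra_simps)
    qed (use \<gamma>S u0 N in \<open>simp_all add: \<theta>_def\<close>)
    have I1': "2 * real N * \<theta>\<^sup>2 = 8 * pi\<^sup>2 / real N" using N by (simp add: \<theta>_def power2_eq_square)
    have I2: "polygon_phase N (\<lambda>i. snd (u i 0)) = 1" unfolding u0 by (simp add: polygon_phase_constant[OF q0(1)])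
    have endp: "u i 1 \<in> round_torus z1' z2'" for i
    proof -
      have "(\<gamma> i, q0) \<in> round_torus z1 z2" using \<gamma>S q0 by (simp add: round_torus_def)
      then show ?thesis unfolding u_def using img by blast
    qed
    have e3: "fst (u i 1) \<in> S2" "fst (u i 1) $ 3 = z1'" "snd (u i 1) \<in> S2" "snd (u i 1) $ 3 = z2'" for i
      using endp[of i] by (auto simp: round_torus_def)
    obtain m :: int where m: "norm (polygon_phase N (\<lambda>i. fst (u i 1)) - exp (\<i> * of_real (pi * (1 - z1') * of_int m))) \<le> 8 * real N * \<delta>\<^sup>2 / (1 - z1'\<^sup>2)"
      "\<bar>real_of_int m\<bar> \<le> real N * \<delta> / sqrt (1 - z1'\<^sup>2)"
      by (rule latitude_polygon_phase[OF N(1) z(3), of "\<lambda>i. fst (u i 1)" \<delta>]) (use e3 pd[of 1, unfolded nx_def] ds r1_def in auto)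
    obtain n :: int where n: "norm (polygon_phase N (\<lambda>i. snd (u i 1)) - exp (\<i> * of_real (pi * (1 - z2') * of_int n))) \<le> 8 * real N * \<delta>\<^sup>2 / (1 - z2'\<^sup>2)"
      "\<bar>real_of_int n\<bar> \<le> real N * \<delta> / sqrt (1 - z2'\<^sup>2)"
      by (rule latitude_polygon_phase[OF N(1) z(4), of "\<lambda>i. snd (u i 1)" \<delta>]) (use e3 pd[of 1, unfolded nx_def] ds r2_def in auto)
    have e8: "8 * real N * \<delta>\<^sup>2 / (1 - w) = 8 * A\<^sup>2 / (1 - w) / real N" for w
    proof -
      have "8 * real N * \<delta>\<^sup>2 / (1 - w) = 8 * (real N * \<delta>\<^sup>2) / (1 - w)" by simp
      then show ?thesis unfolding Nd2 by simp
    qed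
    have F1: "norm (exp (\<i> * of_real x) * exp (\<i> * of_real (pi * (1 - z1))) - exp (\<i> * of_real (pi * (1 - z1') * of_int m))) \<le> 8 * pi\<^sup>2 / real N + 8 * A\<^sup>2 / (1 - z1'\<^sup>2) / real N"
    proof -
      have "exp (\<i> * of_real x) * exp (\<i> * of_real (pi * (1 - z1))) - exp (\<i> * of_real (pi * (1 - z1') * of_int m)) =
        - (exp (\<i> * of_real x) * (polygon_phase N (\<lambda>i. fst (u i 0)) - exp (\<i> * of_real (pi * (1 - z1) * 1)))) +
        (polygon_phase N (\<lambda>i. fst (u i 1)) - exp (\<i> * of_real (pi * (1 - z1') * of_int m)))"
        unfolding T1(2) x_def by (simp add: algebra_simps)
      also have "norm \<dots> \<le> norm (exp (\<i> * of_real x) * (polygon_phase N (\<lambda>i. fst (u i 0)) - exp (\<i> * of_real (pi * (1 - z1) * 1)))) +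
         norm (polygon_phase N (\<lambda>i. fst (u i 1)) - exp (\<i> * of_real (pi * (1 - z1') * of_int m)))"
        by (rule norm_triangle_le) simp
      also have "\<dots> \<le> 8 * pi\<^sup>2 / real N + 8 * A\<^sup>2 / (1 - z1'\<^sup>2) / real N"
        using I1 m(1) unfolding I1' e8 by (intro add_mono) (simp_all add: norm_mult)
      finally show ?thesis .
    qed
    have F2: "norm (exp (\<i> * of_real y) - exp (\<i> * of_real (pi * (1 - z2') * of_int n))) \<le> 8 * A\<^sup>2 / (1 - z2'\<^sup>2) / real N"
      using n(1) unfolding T2(2) I2 e8 y_def by simp
    have pos: "(M1 + M2 + C) * A\<^sup>2 / real N \<ge> 0" "8 * pi\<^sup>2 / real N \<ge> 0" "8 * A\<^sup>2 / (1 - z1'\<^sup>2) / real N \<ge> 0" "8 * A\<^sup>2 / (1 - z2'\<^sup>2) / real N \<ge> 0"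
      using M1(1) M2(1) Ce(1) zz by simp_all
    have EN: "E / real N = (M1 + M2 + C) * A\<^sup>2 / real N + 8 * pi\<^sup>2 / real N + 8 * A\<^sup>2 / (1 - z1'\<^sup>2) / real N + 8 * A\<^sup>2 / (1 - z2'\<^sup>2) / real N"
      by (simp add: E_def add_divide_distrib)
    have pB: "M1 * A / c1 \<ge> 0" "M2 * A / c2 \<ge> 0" "A / r1 \<ge> 0" "A / r2 \<ge> 0" using M1(1) M2(1) A0 c r by simp_all
    have mn: "\<bar>real_of_int m\<bar> \<le> A / r1" "\<bar>real_of_int n\<bar> \<le> A / r2" using m(2) n(2) unfolding Nd r1_def r2_def by simp_all
    show ?thesis
    proof (intro exI conjI)
      show "\<bar>c1 * x + c2 * y\<bar> \<le> E / real N" unfolding EN using S pos by linarith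
      show "\<bar>x\<bar> \<le> B" "\<bar>y\<bar> \<le> B" "\<bar>real_of_int m\<bar> \<le> B" "\<bar>real_of_int n\<bar> \<le> B"
        unfolding B_def using bx mn pB by linarith+
      show "norm (exp (\<i> * of_real x) * exp (\<i> * of_real (pi * (1 - z1))) - exp (\<i> * of_real (pi * (1 - z1') * of_int m))) \<le> E / real N"
        unfolding EN using F1 pos by linarith
      show "norm (exp (\<i> * of_real y) - exp (\<i> * of_real (pi * (1 - z2') * of_int n))) \<le> E / real N"
        unfolding EN using F2 pos by linarith
    qed
  qed
  show ?thesis by (rule integer_relation_from_approximations[OF claim])
qed

section \<open>Density and height function of an area form\<close>

lemma bilinear_alternating_cross3:
  fixes B :: "real^3 \<Rightarrow> real^3 \<Rightarrow> real"
  assumes B: "bilinear B" and alt: "\<And>u. B u u = 0"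
  shows "B u v = vector [B (axis 2 1) (axis 3 1), B (axis 3 1) (axis 1 1), B (axis 1 1) (axis 2 1)] \<bullet> (u \<otimes> v)"
proof -
  have l: "\<And>x. linear (B x)" "\<And>y. linear (\<lambda>x. B x y)" using B by (auto simp: bilinear_def)
  have skew: "B a b = - B b a" for a b
  proof -
    have "0 = B (a + b) (a + b)" using alt by simp
    also have "\<dots> = B a a + B a b + (B b a + B b b)" using l by (simp add: linear_add[OF l(1)] linear_add[OF l(2)])
    finally show ?thesis using alt by simp
  qed
  have "B u v = B ((u$1) *\<^sub>R axis 1 1 + (u$2) *\<^sub>R axis 2 1 + (u$3) *\<^sub>R axis 3 1) ((v$1) *\<^sub>R axis 1 1 + (v$2) *\<^sub>R axis 2 1 + (v$3) *\<^sub>R axis 3 1)"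
    using vec3_expand[of u] vec3_expand[of v] by simp
  also have "\<dots> = u$1 * v$1 * B (axis 1 1) (axis 1 1) + u$1 * v$2 * B (axis 1 1) (axis 2 1) + u$1 * v$3 * B (axis 1 1) (axis 3 1) +
      (u$2 * v$1 * B (axis 2 1) (axis 1 1) + u$2 * v$2 * B (axis 2 1) (axis 2 1) + u$2 * v$3 * B (axis 2 1) (axis 3 1)) +
      (u$3 * v$1 * B (axis 3 1) (axis 1 1) + u$3 * v$2 * B (axis 3 1) (axis 2 1) + u$3 * v$3 * B (axis 3 1) (axis 3 1))"
    by (simp add: linear_add[OF l(1)] linear_add[OF l(2)] linear_scale[OF l(1)] linear_scale[OF l(2)] algebra_simps)
  finally show ?thesis
    unfolding alt skew[of "axis 2 1" "axis 1 1"] skew[of "axis 1 1" "axis 3 1"] skew[of "axis 3 1" "axis 2 1"]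
    by (simp add: inner_real3 cross3_nth algebra_simps)
qed

text \<open>The cross product of two tangent vectors is normal, so only the normal component of w
  counts. This reduces an alternating form to a scalar density.\<close>

lemma tangent_cross3_parallel:
  assumes p: "p \<in> S2" and u: "p \<bullet> u = 0" "p \<bullet> v = 0"
  shows "w \<bullet> (u \<otimes> v) = (w \<bullet> p) * (p \<bullet> (u \<otimes> v))"
proof -
  have "w \<bullet> (u \<otimes> v) * (p \<bullet> p) = (w \<bullet> p) * (p \<bullet> (u \<otimes> v)) + (p \<bullet> u) * (w \<bullet> (p \<otimes> v)) + (p \<bullet> v) * (w \<bullet> (u \<otimes> p))"
    by (simp add: inner_real3 cross3_nth algebra_simps)
  then show ?thesis using u S2_inner[OF p] by simp
qed

lemma smooth_on_open_norm: "smooth_on_open (- {0}) (norm :: 'a::euclidean_space \<Rightarrow> real)"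
proof -
  have o: "open (- {0::'a})" by (simp add: open_Compl)
  have "smooth_on_open (- {0}) (\<lambda>x::'a. sqrt (x \<bullet> x))"
    by (intro smooth_intros o) simp_all
  then show ?thesis by (simp add: norm_eq_sqrt_inner[symmetric])
qed

lemma open_nonzero: "open (- {0::real^3})"
  by (simp add: open_Compl)

text \<open>Functions on the sphere are extended constantly along rays. Smoothness then concerns the
  open set of nonzero vectors, and no charts of the sphere are needed.\<close>

definition radial :: "(real^3 \<Rightarrow> real) \<Rightarrow> bool" where
  "radial f \<longleftrightarrow> (\<forall>x t. t > 0 \<longrightarrow> f (t *\<^sub>R x) = f x)"

text \<open>Projection along rays turns the extensions supplied by
  \<open>smooth_on_submanifold\<close> into smooth functions on all nonzero vectors. Nondegeneracy
  only gives a density without zeros; its sign will follow from the total area.\<close>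

lemma area_form_density:
  assumes "area_form \<omega>"
  obtains \<rho> :: "real^3 \<Rightarrow> real" where "smooth_on_open (- {0}) \<rho>" "radial \<rho>"
    "\<And>p u v. p \<in> S2 \<Longrightarrow> p \<bullet> u = 0 \<Longrightarrow> p \<bullet> v = 0 \<Longrightarrow> \<omega> p u v = \<rho> p * (p \<bullet> (u \<otimes> v))"
    "\<And>x. x \<noteq> 0 \<Longrightarrow> \<rho> x \<noteq> 0"
proof -
  have bil: "\<And>p. p \<in> S2 \<Longrightarrow> bilinear (\<omega> p)" "\<And>p u. p \<in> S2 \<Longrightarrow> \<omega> p u u = 0"
    and sm: "\<And>u v. smooth_on_submanifold S2 (\<lambda>p. \<omega> p u v)"
    and nd: "\<And>p u. p \<in> S2 \<Longrightarrow> u \<in> tangent_S2 p \<Longrightarrow> u \<noteq> 0 \<Longrightarrow> \<exists>v\<in>tangent_S2 p. \<omega> p u v \<noteq> 0"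
    using assms unfolding area_form_def by blast+
  have "\<exists>f. smooth_on_open (- {0}) f \<and> (\<forall>x. x \<noteq> 0 \<longrightarrow> f x = \<omega> (inverse (norm x) *\<^sub>R x) u v)" for u v
  proof -
    from sm[of u v] obtain U g where g: "open U" "S2 \<subseteq> U" "smooth_on_open U g" "\<And>x. x \<in> S2 \<Longrightarrow> g x = \<omega> x u v"
      unfolding smooth_on_submanifold_def by blast
    have n: "inverse (norm x) *\<^sub>R x \<in> S2" if "x \<noteq> 0" for x :: "real^3" using that by simp
    have "smooth_on_open (- {0}) (\<lambda>x. g (inverse (norm x) *\<^sub>R x))"
    proof (rule smooth_on_open_compose[OF open_nonzero g(1) _ g(3)])
      show "smooth_on_open (- {0}) (\<lambda>x::real^3. inverse (norm x) *\<^sub>R x)"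
        by (intro smooth_intros open_nonzero smooth_on_open_norm) simp
      show "(\<lambda>x. inverse (norm x) *\<^sub>R x) ` (- {0}) \<subseteq> U"
      proof (rule image_subsetI)
        fix x :: "real^3" assume "x \<in> - {0}"
        then show "inverse (norm x) *\<^sub>R x \<in> U" using subsetD[OF g(2) n] by blast
      qed
    qed
    then show ?thesis using g(4)[OF n] by (intro exI[of _ "\<lambda>x. g (inverse (norm x) *\<^sub>R x)"]) auto
  qed
  then obtain f where f: "\<And>u v. smooth_on_open (- {0}) (f u v)" "\<And>u v x. x \<noteq> 0 \<Longrightarrow> f u v x = \<omega> (inverse (norm x) *\<^sub>R x) u v"
    by metis
  define W :: "real^3 \<Rightarrow> real^3" where "W x = vector [f (axis 2 1) (axis 3 1) x, f (axis 3 1) (axis 1 1) x, f (axis 1 1) (axis 2 1) x]" for x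
  define \<rho> where "\<rho> x = (if x = 0 then 0 else W x \<bullet> (inverse (norm x) *\<^sub>R x))" for x
  have sW: "smooth_on_open (- {0}) W"
    by (rule smooth_on_open_vec3[OF open_nonzero]) (simp_all add: W_def f(1))
  have s: "smooth_on_open (- {0}) \<rho>"
  proof (rule smooth_on_open_cong[OF open_nonzero])
    show "smooth_on_open (- {0}) (\<lambda>x. W x \<bullet> (inverse (norm x) *\<^sub>R x))"
      by (intro smooth_intros open_nonzero smooth_on_open_norm sW) simp
  qed (simp add: \<rho>_def)
  have r: "radial \<rho>"
    unfolding radial_def
  proof (intro allI impI)
    fix x :: "real^3" and t :: real assume t: "t > 0"
    show "\<rho> (t *\<^sub>R x) = \<rho> x"
    proof (cases "x = 0")
      case False
      then have n: "t *\<^sub>R x \<noteq> 0" using t by simp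
      have e: "inverse (norm (t *\<^sub>R x)) *\<^sub>R (t *\<^sub>R x) = inverse (norm x) *\<^sub>R x" using t by simp
      have "W (t *\<^sub>R x) = W x" unfolding W_def f(2)[OF n] f(2)[OF False] e ..
      then show ?thesis unfolding \<rho>_def using n False e by (simp only: if_False)
    qed simp
  qed
  have om: "\<omega> p u v = \<rho> p * (p \<bullet> (u \<otimes> v))" if p: "p \<in> S2" and uv: "p \<bullet> u = 0" "p \<bullet> v = 0" for p u v
  proof -
    have pn: "norm p = 1" "p \<noteq> 0" using p by auto
    have "\<omega> p u v = W p \<bullet> (u \<otimes> v)"
      unfolding W_def using pn bilinear_alternating_cross3[OF bil(1)[OF p] bil(2)[OF p], of u v] by (simp add: f(2))
    also have "\<dots> = (W p \<bullet> p) * (p \<bullet> (u \<otimes> v))" by (rule tangent_cross3_parallel[OF p uv])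
    finally show ?thesis using pn by (simp add: \<rho>_def)
  qed
  have nz: "\<rho> x \<noteq> 0" if "x \<noteq> 0" for x
  proof -
    define p where "p = inverse (norm x) *\<^sub>R x"
    have p: "p \<in> S2" using that by (simp add: p_def)
    have "\<rho> p = \<rho> x" unfolding p_def using r that by (simp add: radial_def)
    have "\<exists>u. u \<noteq> 0 \<and> p \<bullet> u = 0"
    proof (cases "p $ 1 = 0 \<and> p $ 2 = 0")
      case True
      then show ?thesis by (intro exI[of _ "vector [1, 0, 0]"]) (auto simp: inner_real3 vec3_eq_iff)
    next
      case False
      then show ?thesis by (intro exI[of _ "vector [- p $ 2, p $ 1, 0]"]) (auto simp: inner_real3 vec3_eq_iff)
    qed
    then obtain u where u: "u \<noteq> 0" "p \<bullet> u = 0" by blast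
    then obtain v where v: "p \<bullet> v = 0" "\<omega> p u v \<noteq> 0" using nd[OF p, of u] by (auto simp: tangent_S2_def)
    then show ?thesis using om[OF p u(2) v(1)] \<open>\<rho> p = \<rho> x\<close> by auto
  qed
  show thesis by (rule that[OF s r om nz])
qed

section \<open>Rotations about the polar axis and areas of zones\<close>

definition rotz :: "real \<Rightarrow> real^3 \<Rightarrow> real^3" where
  "rotz t x = vector [x$1 * cos t - x$2 * sin t, x$1 * sin t + x$2 * cos t, x$3]"

lemma rotz_nth [simp]: "rotz t x $ 1 = x$1 * cos t - x$2 * sin t" "rotz t x $ 2 = x$1 * sin t + x$2 * cos t"
  "rotz t x $ 3 = x$3"
  by (simp_all add: rotz_def)

lemma norm_rotz [simp]: "norm (rotz t x) = norm x"
proof -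
  have "(x$1 * cos t - x$2 * sin t)\<^sup>2 + (x$1 * sin t + x$2 * cos t)\<^sup>2 = (x$1)\<^sup>2 + (x$2)\<^sup>2"
    using rot_sq[of "x$1" t "x$2"] by (simp add: add.commute)
  then have "rotz t x \<bullet> rotz t x = x \<bullet> x" by (simp add: inner_real3 power2_eq_square[symmetric])
  then show ?thesis by (simp add: norm_eq_sqrt_inner)
qed

lemma rotz_eq_0_iff [simp]: "rotz t x = 0 \<longleftrightarrow> x = 0"
  by (metis norm_eq_zero norm_rotz)

lemma geographic_nth: "geographic a b $ 1 = cos a * cos b" "geographic a b $ 2 = cos a * sin b" "geographic a b $ 3 = sin a"
  by (simp_all add: geographic_def)

lemma geographic_S2: "geographic a b \<in> S2"
proof -
  have "(cos a * cos b)\<^sup>2 + (cos a * sin b)\<^sup>2 + (sin a)\<^sup>2 = (cos a)\<^sup>2 * ((cos b)\<^sup>2 + (sin b)\<^sup>2) + (sin a)\<^sup>2" by algebra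
  then show ?thesis unfolding S2_iff geographic_nth by simp
qed

lemma rotz_geographic: "rotz t (geographic a 0) = geographic a t"
  by (simp add: vec3_eq_iff geographic_nth)

lemma smooth_on_open_rotz:
  "smooth_on_open UNIV (\<lambda>y::real \<times> (real^3). rotz (fst y) (snd y))"
  by (rule smooth_on_open_vec3[OF open_UNIV]; simp; intro smooth_intros open_UNIV)

text \<open>The integral over a full turn, not divided by 2 pi: applied to the density it is the
  derivative of the zone area with respect to the height.\<close>

definition rot_mean :: "(real^3 \<Rightarrow> real) \<Rightarrow> real^3 \<Rightarrow> real" where
  "rot_mean f x = integral {0..2 * pi} (\<lambda>t. f (rotz t x))"

lemma smooth_on_open_rotz_compose:
  assumes "smooth_on_open (- {0}) f"
  shows "smooth_on_open (UNIV \<times> - {0}) (\<lambda>y::real \<times> (real^3). f (rotz (fst y) (snd y)))"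
  by (rule smooth_on_open_compose[OF open_Times[OF open_UNIV open_nonzero] open_nonzero
      smooth_on_open_subset[OF smooth_on_open_rotz] assms]) auto

lemma smooth_on_open_rot_mean:
  assumes "smooth_on_open (- {0}) f" shows "smooth_on_open (- {0}) (rot_mean f)"
  using smooth_on_open_integral_parameter[OF open_nonzero open_Times[OF open_UNIV open_nonzero] _ smooth_on_open_rotz_compose[OF assms], of 0 "2 * pi"]
  unfolding rot_mean_def[abs_def] by auto

text \<open>The longitude and latitude vectors have triple product \<open>cos lat\<close> with the
  base point, and motion in longitude is rotation, so the inner integral is a rotation mean.\<close>

lemma zone_area_density:
  assumes \<omega>: "\<And>p u v. p \<in> S2 \<Longrightarrow> p \<bullet> u = 0 \<Longrightarrow> p \<bullet> v = 0 \<Longrightarrow> \<omega> p u v = \<rho> p * (p \<bullet> (u \<otimes> v))"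
    and s: "smooth_on_open (- {0}) \<rho>"
  shows "zone_area \<omega> a b = (LBINT t=ereal a..ereal b. cos t * rot_mean \<rho> (geographic t 0))"
proof -
  have g0: "geographic a b \<noteq> 0" for a b using geographic_S2[of a b] by auto
  have d1: "vector_derivative (\<lambda>s. geographic lat s) (at lon) = vector [- cos lat * sin lon, cos lat * cos lon, 0]" for lat lon
    by (rule vector_derivative_at, rule has_vector_derivative_real3)
      (auto simp: geographic_nth intro!: derivative_eq_intros)
  have d2: "vector_derivative (\<lambda>s. geographic s lon) (at lat) = vector [- sin lat * cos lon, - sin lat * sin lon, cos lat]" for lat lon
    by (rule vector_derivative_at, rule has_vector_derivative_real3)
      (auto simp: geographic_nth intro!: derivative_eq_intros)
  have i: "\<omega> (geographic lat lon) (vector [- cos lat * sin lon, cos lat * cos lon, 0]) (vector [- sin lat * cos lon, - sin lat * sin lon, cos lat])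
      = cos lat * \<rho> (rotz lon (geographic lat 0))" for lat lon
  proof -
    have "\<omega> (geographic lat lon) (vector [- cos lat * sin lon, cos lat * cos lon, 0]) (vector [- sin lat * cos lon, - sin lat * sin lon, cos lat])
      = \<rho> (geographic lat lon) * (geographic lat lon \<bullet> (vector [- cos lat * sin lon, cos lat * cos lon, 0] \<otimes> vector [- sin lat * cos lon, - sin lat * sin lon, cos lat]))"
    proof (rule \<omega>[OF geographic_S2])
      show "geographic lat lon \<bullet> vector [- cos lat * sin lon, cos lat * cos lon, 0] = 0" by (simp add: inner_real3 geographic_nth)
      have "cos lat * cos lon * (- sin lat * cos lon) + cos lat * sin lon * (- sin lat * sin lon) + sin lat * cos lat
         = cos lat * sin lat * (1 - ((cos lon)\<^sup>2 + (sin lon)\<^sup>2))" by algebra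
      then show "geographic lat lon \<bullet> vector [- sin lat * cos lon, - sin lat * sin lon, cos lat] = 0" by (simp add: inner_real3 geographic_nth)
    qed
    also have "geographic lat lon \<bullet> (vector [- cos lat * sin lon, cos lat * cos lon, 0] \<otimes> vector [- sin lat * cos lon, - sin lat * sin lon, cos lat]) = cos lat"
    proof -
      have c: "(cos lon)\<^sup>2 + (sin lon)\<^sup>2 = 1" "(cos lat)\<^sup>2 + (sin lat)\<^sup>2 = 1" by simp_all
      have "geographic lat lon \<bullet> (vector [- cos lat * sin lon, cos lat * cos lon, 0] \<otimes> vector [- sin lat * cos lon, - sin lat * sin lon, cos lat])
        = cos lat * cos lon * (cos lat * cos lon * cos lat) + cos lat * sin lon * (cos lat * sin lon * cos lat)
          + sin lat * (cos lat * sin lon * (sin lat * sin lon) + cos lat * cos lon * (sin lat * cos lon))"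
        by (simp add: inner_real3 geographic_nth cross3_nth)
      also have "\<dots> = cos lat" using c by algebra
      finally show ?thesis .
    qed
    finally show ?thesis by (simp add: rotz_geographic)
  qed
  have inner: "(LBINT lon=ereal 0..ereal (2 * pi). cos lat * \<rho> (rotz lon (geographic lat 0))) = cos lat * rot_mean \<rho> (geographic lat 0)" for lat
  proof -
    have c: "continuous_on {0..2 * pi} (\<lambda>lon. cos lat * \<rho> (rotz lon (geographic lat 0)))"
      by (intro continuous_on_mult continuous_on_const
          continuous_on_compose2[OF smooth_on_open_imp_continuous_on[OF smooth_on_open_rotz_compose[OF s]], where f = "\<lambda>lon. (lon, geographic lat 0)", simplified]
          continuous_on_Pair continuous_on_id) (auto simp: g0)
    have "(LBINT lon=ereal 0..ereal (2 * pi). cos lat * \<rho> (rotz lon (geographic lat 0))) = integral {0..2 * pi} (\<lambda>lon. cos lat * \<rho> (rotz lon (geographic lat 0)))"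
      by (rule interval_integral_eq_integral) (use c in \<open>auto intro: borel_integrable_atLeastAtMost'\<close>)
    then show ?thesis by (simp add: rot_mean_def)
  qed
  show ?thesis unfolding zone_area_def d1 d2 i inner ..
qed

text \<open>The derivative of \<open>arcsin\<close> cancels the factor \<open>cos t\<close>, and the
  factor 2 lets h run from -1 to 1. The density has no zeros and the space of nonzero vectors is
  connected, so its sign is constant; positivity of the total area decides it.\<close>

lemma height_function:
  assumes \<omega>: "\<And>p u v. p \<in> S2 \<Longrightarrow> p \<bullet> u = 0 \<Longrightarrow> p \<bullet> v = 0 \<Longrightarrow> \<omega> p u v = \<rho> p * (p \<bullet> (u \<otimes> v))"
    and s: "smooth_on_open (- {0}) \<rho>" and r: "radial \<rho>" and nz: "\<And>x. x \<noteq> 0 \<Longrightarrow> \<rho> x \<noteq> 0"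
    and area: "total_area \<omega> = 1" "northern_area \<omega> = 1 / 2"
  defines "h \<equiv> \<lambda>z. 2 * zone_area \<omega> 0 (arcsin z)"
  shows "continuous_on {-1..1} h" and "h 1 = 1" and "h (-1) = -1"
    and "\<And>z. \<bar>z\<bar> < 1 \<Longrightarrow> (h has_real_derivative 2 * rot_mean \<rho> (vector [sqrt (1 - z\<^sup>2), 0, z])) (at z)"
    and "\<And>x. x \<noteq> 0 \<Longrightarrow> \<rho> x > 0"
proof -
  define k where "k t = cos t * rot_mean \<rho> (geographic t 0)" for t
  have g0: "geographic a b \<noteq> 0" for a b using geographic_S2[of a b] by auto
  have cgeo: "continuous_on A (\<lambda>t. geographic t 0)" for A
  proof -
    have "((\<lambda>s. geographic s 0) has_vector_derivative vector [- sin t, 0, cos t]) (at t)" for t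
      by (rule has_vector_derivative_real3) (auto simp: geographic_nth intro!: derivative_eq_intros)
    then show ?thesis by (meson continuous_at_imp_continuous_on has_vector_derivative_continuous)
  qed
  have ck: "continuous_on A k" for A unfolding k_def
    by (intro continuous_on_mult continuous_intros
        continuous_on_compose2[OF smooth_on_open_imp_continuous_on[OF smooth_on_open_rot_mean[OF s]] cgeo]) (auto simp: g0)
  have za: "zone_area \<omega> a b = (LBINT t=ereal a..ereal b. k t)" for a b
    unfolding k_def by (rule zone_area_density[OF \<omega> s])
  define Q where "Q b = (LBINT t=ereal 0..ereal b. k t)" for b
  \<comment> \<open>The interval from -2 to 2 contains all latitudes in its interior, so the
    derivatives of Q are two-sided where they are used.\<close>
  have dQ: "(Q has_vector_derivative k x) (at x within {-2..2})" if "x \<in> {-2..2}" for x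
    unfolding Q_def by (rule interval_integral_FTC2[of "-2" 0 2]) (use that ck in auto)
  have cQ: "continuous_on {-2..2} Q"
    unfolding continuous_on_eq_continuous_within using has_vector_derivative_continuous[OF dQ] by blast
  have hQ: "h = (\<lambda>z. 2 * Q (arcsin z))" by (simp add: h_def za Q_def)
  have rng: "arcsin z \<in> {-2..2}" if "z \<in> {-1..1}" for z
  proof -
    have "- (pi / 2) \<le> arcsin z" "arcsin z \<le> pi / 2" using arcsin_bounded[of z] that by auto
    then show ?thesis using pi_less_4 by auto
  qed
  show c: "continuous_on {-1..1} h" unfolding hQ
    by (intro continuous_intros continuous_on_compose2[OF cQ continuous_on_arcsin']) (use rng in auto)
  have Qp: "Q (pi / 2) = 1 / 2" using area(2) by (simp add: northern_area_def za Q_def)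
  then show h1: "h 1 = 1" by (simp add: hQ)
  have "(LBINT t=ereal (- (pi / 2))..ereal 0. k t) + (LBINT t=ereal 0..ereal (pi / 2). k t) = (LBINT t=ereal (- (pi / 2))..ereal (pi / 2). k t)"
  proof (rule interval_integral_sum)
    show "interval_lebesgue_integrable lborel (min (ereal (- (pi / 2))) (min (ereal 0) (ereal (pi / 2)))) (max (ereal (- (pi / 2))) (max (ereal 0) (ereal (pi / 2)))) k"
      unfolding ereal_min[symmetric] ereal_max[symmetric]
      by (rule interval_integrable_continuous_on) (use ck in auto)
  qed
  moreover have "(LBINT t=ereal (- (pi / 2))..ereal (pi / 2). k t) = 1" using area(1) by (simp add: total_area_def za)
  ultimately have "(LBINT t=ereal (- (pi / 2))..ereal 0. k t) = 1 / 2" using Qp by (simp add: Q_def)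
  then have "Q (- (pi / 2)) = - (1 / 2)"
    unfolding Q_def using interval_integral_endpoints_reverse[of "ereal 0" "ereal (- (pi / 2))" k] by simp
  then show hm: "h (-1) = -1" by (simp add: hQ arcsin_minus)
  show d: "(h has_real_derivative 2 * rot_mean \<rho> (vector [sqrt (1 - z\<^sup>2), 0, z])) (at z)" if z: "\<bar>z\<bar> < 1" for z
  proof -
    have b: "- 1 < z" "z < 1" using z by auto
    have "- (pi / 2) < arcsin z" "arcsin z < pi / 2" using arcsin_lt_bounded[OF b] by auto
    then have i: "arcsin z \<in> interior {-2..2}" using pi_less_4 by auto
    then have "(Q has_real_derivative k (arcsin z)) (at (arcsin z))"
      using dQ[of "arcsin z"] at_within_interior[OF i] interior_subset[of "{-2..2::real}"]
      by (auto simp: has_real_derivative_iff_has_vector_derivative)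
    from DERIV_chain2[OF this DERIV_arcsin[OF b]]
    have D: "((\<lambda>z. Q (arcsin z)) has_real_derivative k (arcsin z) * inverse (sqrt (1 - z\<^sup>2))) (at z)" .
    have sq: "sqrt (1 - z\<^sup>2) > 0" using z by (simp add: abs_square_less_1)
    have g: "geographic (arcsin z) 0 = vector [sqrt (1 - z\<^sup>2), 0, z]"
      using b by (simp add: vec3_eq_iff geographic_nth cos_arcsin)
    have "k (arcsin z) * inverse (sqrt (1 - z\<^sup>2)) = rot_mean \<rho> (vector [sqrt (1 - z\<^sup>2), 0, z])"
      unfolding k_def g using b sq by (simp add: cos_arcsin)
    then show ?thesis unfolding hQ using DERIV_cmult[OF D, of 2] by simp
  qed
  \<comment> \<open>The mean value theorem over the whole range, on which h grows by 2, yields a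
    parallel with positive mean density.\<close>
  have "\<exists>z. -1 < z \<and> z < 1 \<and> h 1 - h (-1) = (\<lambda>v. 2 * rot_mean \<rho> (vector [sqrt (1 - z\<^sup>2), 0, z]) * v) (1 - (-1))"
    by (rule mvt[of "-1" 1 h "\<lambda>z v. 2 * rot_mean \<rho> (vector [sqrt (1 - z\<^sup>2), 0, z]) * v"])
      (use c d in \<open>auto simp: has_field_derivative_def abs_less_iff\<close>)
  then obtain z where "h 1 - h (-1) = 2 * rot_mean \<rho> (vector [sqrt (1 - z\<^sup>2), 0, z]) * (1 - (-1))" by blast
  then have z: "rot_mean \<rho> (vector [sqrt (1 - z\<^sup>2), 0, z]) = 1 / 2" unfolding h1 hm by simp
  have ex: "\<exists>x. x \<noteq> 0 \<and> \<rho> x > 0"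
  proof (rule ccontr)
    assume "\<not> ?thesis"
    then have n: "\<rho> x \<le> 0" if "x \<noteq> 0" for x using that by force
    have x0: "vector [sqrt (1 - z\<^sup>2), 0, z] \<noteq> (0 :: real^3)"
      by (auto simp: vec3_eq_iff)
    have "rot_mean \<rho> (vector [sqrt (1 - z\<^sup>2), 0, z]) \<le> integral {0..2 * pi} (\<lambda>t. 0)"
      unfolding rot_mean_def
    proof (rule integral_le)
      have "continuous_on {0..2 * pi} (\<lambda>t. \<rho> (rotz t (vector [sqrt (1 - z\<^sup>2), 0, z])))"
        by (rule continuous_on_compose2[OF smooth_on_open_imp_continuous_on[OF smooth_on_open_rotz_compose[OF s]], where f = "\<lambda>t. (t, vector [sqrt (1 - z\<^sup>2), 0, z])", simplified])
          (use x0 in \<open>auto intro!: continuous_intros\<close>)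
      then show "(\<lambda>t. \<rho> (rotz t (vector [sqrt (1 - z\<^sup>2), 0, z]))) integrable_on {0..2 * pi}"
        by (rule integrable_continuous_interval)
    qed (use n x0 in auto)
    then show False using z by simp
  qed
  show "\<rho> x > 0" if x: "x \<noteq> 0" for x
  proof (rule ccontr)
    assume "\<not> \<rho> x > 0"
    then have neg: "\<rho> x < 0" using nz[OF x] by simp
    obtain y where y: "y \<noteq> 0" "\<rho> y > 0" using ex by blast
    have "connected (- {0::real^3})" by (rule connected_punctured_universe) simp
    then have "connected (\<rho> ` (- {0}))"
      by (rule connected_continuous_image[rotated]) (rule smooth_on_open_imp_continuous_on[OF s])
    moreover have "\<rho> x \<in> \<rho> ` (- {0})" "\<rho> y \<in> \<rho> ` (- {0})" using x y by auto
    ultimately have "0 \<in> \<rho> ` (- {0})" using neg y(2) by (meson connected_iff_interval less_imp_le)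
    then obtain w where "w \<in> - {0}" "0 = \<rho> w" by (rule imageE)
    then have "w \<noteq> 0" "\<rho> w = 0" by simp_all
    then show False using nz by blast
  qed
qed

section \<open>Periodic functions and polar caps\<close>

lemma primitive_exists:
  fixes f :: "real \<Rightarrow> real"
  assumes "continuous_on UNIV f"
  obtains P where "\<And>x. (P has_real_derivative f x) (at x)"
proof -
  have "isCont f x" for x using assms by (simp add: continuous_on_eq_continuous_at)
  then have "\<exists>F. \<forall>x. -\<infinity> < ereal x \<longrightarrow> ereal x < \<infinity> \<longrightarrow> (F has_vector_derivative f x) (at x)"
    by (intro einterval_antiderivative) auto
  then show thesis using that by (auto simp: has_real_derivative_iff_has_vector_derivative)
qed

lemma constant_if_derivative_0:
  fixes f :: "real \<Rightarrow> real"
  assumes "\<And>x. (f has_real_derivative 0) (at x)"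
  shows "f x = f y"
  using has_derivative_zero_unique[of UNIV f x y] assms
  by (metis DERIV_const_average assms DERIV_isconst_all)

lemma integral_eq_primitive:
  fixes P f :: "real \<Rightarrow> real"
  assumes "a \<le> b" and "\<And>x. (P has_real_derivative f x) (at x)"
  shows "integral {a..b} f = P b - P a"
  by (rule integral_unique, rule fundamental_theorem_of_calculus[OF assms(1)])
    (use assms(2) in \<open>auto simp: has_real_derivative_iff_has_vector_derivative[symmetric] intro: has_field_derivative_at_within\<close>)

lemma periodic_integral_shift:
  fixes f :: "real \<Rightarrow> real"
  assumes f: "continuous_on UNIV f" and per: "\<And>t. f (t + p) = f t" and p: "0 \<le> p"
  shows "integral {0..p} (\<lambda>t. f (t + s)) = integral {0..p} f"
proof -
  obtain P where P: "\<And>x. (P has_real_derivative f x) (at x)" using primitive_exists[OF f] by blast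
  have D: "((\<lambda>x. P (x + c)) has_real_derivative f (x + c)) (at x)" for x c
    using DERIV_shift[of P "f (x + c)" x c] P[of "x + c"] by simp
  have "((\<lambda>s. P (s + p) - P s) has_real_derivative f (s + p) - f s) (at s)" for s
    by (intro derivative_intros D P)
  then have "((\<lambda>s. P (s + p) - P s) has_real_derivative 0) (at s)" for s using per by simp
  from constant_if_derivative_0[OF this, of s 0]
  have "P (p + s) - P s = P p - P 0" by (simp add: add.commute)
  moreover have "integral {0..p} (\<lambda>t. f (t + s)) = P (p + s) - P (0 + s)"
    by (rule integral_eq_primitive[OF p D])
  moreover have "integral {0..p} f = P p - P 0" by (rule integral_eq_primitive[OF p P])
  ultimately show ?thesis by simp
qed

text \<open>Integration by parts gives p times a primitive P of f minus a constant, where P is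
  periodic because f has mean 0. The integral is thus p times a primitive obtained without choosing
  a base point.\<close>

lemma periodic_primitive_mean_zero:
  fixes f :: "real \<Rightarrow> real"
  assumes f: "continuous_on UNIV f" and per: "\<And>t. f (t + p) = f t" and p: "0 \<le> p"
    and mean: "integral {0..p} f = 0"
  shows "((\<lambda>s. integral {0..p} (\<lambda>t. t * f (t + s))) has_real_derivative p * f s) (at s)"
proof -
  obtain P where P: "\<And>x. (P has_real_derivative f x) (at x)" using primitive_exists[OF f] by blast
  have D: "((\<lambda>x. P (x + c)) has_real_derivative f (x + c)) (at x)" for x c
    using DERIV_shift[of P "f (x + c)" x c] P[of "x + c"] by simp
  have per': "P (t + p) = P t" for t
  proof -
    have "((\<lambda>s. P (s + p) - P s) has_real_derivative f (s + p) - f s) (at s)" for s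
      by (intro derivative_intros D P)
    then have "((\<lambda>s. P (s + p) - P s) has_real_derivative 0) (at s)" for s using per by simp
    from constant_if_derivative_0[OF this, of t 0]
    have "P (t + p) - P t = P p - P 0" by simp
    moreover have "integral {0..p} f = P p - P 0" by (rule integral_eq_primitive[OF p P])
    ultimately show ?thesis using mean by simp
  qed
  have cP: "continuous_on A P" for A using P by (meson DERIV_isCont continuous_at_imp_continuous_on)
  have e: "integral {0..p} (\<lambda>t. t * f (t + s)) = p * P s - integral {0..p} P" for s
  proof -
    have "((\<lambda>t. t * P (t + s)) has_real_derivative (P (t + s) + t * f (t + s))) (at t)" for t
      by (auto intro!: derivative_eq_intros D)
    from integral_eq_primitive[OF p this]
    have "integral {0..p} (\<lambda>t. P (t + s) + t * f (t + s)) = p * P s"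
      using per'[of s] by (simp add: add.commute)
    moreover have "integral {0..p} (\<lambda>t. P (t + s) + t * f (t + s)) = integral {0..p} (\<lambda>t. P (t + s)) + integral {0..p} (\<lambda>t. t * f (t + s))"
      by (intro integral_add integrable_continuous_interval continuous_intros
          continuous_on_compose2[OF cP] continuous_on_compose2[OF f]) auto
    moreover have "integral {0..p} (\<lambda>t. P (t + s)) = integral {0..p} P"
      by (rule periodic_integral_shift[OF cP per' p])
    ultimately show ?thesis by simp
  qed
  show ?thesis unfolding e by (auto intro!: derivative_eq_intros P)
qed

text \<open>
  Since \<open>h\<close> is only continuous at the pole, the quotient \<open>(1 - h) / (1 - z\<^sup>2)\<close> is written as an
  integral over the segment from the pole to the point, which visibly depends smoothly on the point.
\<close>

lemma polar_cap:
  fixes R :: "real^3 \<Rightarrow> real" and h :: "real \<Rightarrow> real"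
  assumes R: "smooth_on_open (- {0}) R" "\<And>x. x \<noteq> 0 \<Longrightarrow> R x > 0"
    and hc: "continuous_on {-1..1} h" and h1: "h 1 = 1" and hlt: "\<And>z. -1 \<le> z \<Longrightarrow> z < 1 \<Longrightarrow> h z < 1"
    and hd: "\<And>x. \<bar>x $ 3\<bar> < norm x \<Longrightarrow> (h has_real_derivative 2 * R x) (at (x $ 3 / norm x))"
  obtains \<kappa> :: "real^3 \<Rightarrow> real" where "smooth_on_open {x. - norm x < x $ 3} \<kappa>"
    "\<And>x. - norm x < x $ 3 \<Longrightarrow> \<kappa> x > 0"
    "\<And>x. - norm x < x $ 3 \<Longrightarrow> ((x$1)\<^sup>2 + (x$2)\<^sup>2) * \<kappa> x = (norm x)\<^sup>2 * (1 - h (x $ 3 / norm x))"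
proof -
  \<comment> \<open>The point with parameter w on the segment from the pole, scaled to the norm of
    x, to x. The integrand f is the derivative of h along this segment with the factor
    \<open>- ((x$1)\<^sup>2 + (x$2)\<^sup>2) / (norm x)\<^sup>2\<close> taken out, which vanishes on
    the axis.\<close>
  define cc :: "real \<times> (real^3) \<Rightarrow> real^3" where
    "cc y = ((1 - fst y) * norm (snd y)) *\<^sub>R axis 3 1 + fst y *\<^sub>R snd y" for y
  define V where "V = {y. snd y \<noteq> 0 \<and> cc y \<noteq> 0}"
  define f where "f y = 2 * R (cc y) * (fst y * norm (snd y) ^ 3 / norm (cc y) ^ 3)" for y
  define U where "U = {x::real^3. - norm x < x $ 3}"
  define \<kappa> where "\<kappa> x = integral {0..1} (\<lambda>w. f (w, x))" for x
  have cn: "cc (w, x) $ 1 = w * x$1" "cc (w, x) $ 2 = w * x$2" "cc (w, x) $ 3 = (1 - w) * norm x + w * x$3" for w x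
    by (simp_all add: cc_def axis_def)
  have U: "open U" unfolding U_def by (intro open_Collect_less continuous_intros)
  have oV: "open V"
  proof -
    have "V = {y. snd y \<noteq> 0} \<inter> {y. cc y \<noteq> 0}" by (auto simp: V_def)
    then show ?thesis unfolding cc_def by (auto intro!: open_Int open_Collect_neq continuous_intros)
  qed
  have sn: "smooth_on_open V (\<lambda>y. norm (snd y))"
    by (rule smooth_on_open_compose[OF oV open_nonzero _ smooth_on_open_norm])
      (auto simp: V_def oV[unfolded V_def] intro!: smooth_intros)
  have sc: "smooth_on_open V cc"
    unfolding cc_def[abs_def] by (intro smooth_intros oV sn)
  have sf: "smooth_on_open V f"
  proof -
    have im: "cc ` V \<subseteq> - {0}" by (auto simp: V_def)
    have 1: "smooth_on_open V (\<lambda>y. norm (cc y))" "smooth_on_open V (\<lambda>y. R (cc y))"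
      using smooth_on_open_compose[OF oV open_nonzero sc smooth_on_open_norm im]
        smooth_on_open_compose[OF oV open_nonzero sc R(1) im] by simp_all
    show ?thesis unfolding f_def[abs_def]
      by (intro smooth_intros oV sn 1) (simp add: V_def)
  qed
  have nz: "cc (w, x) \<noteq> 0" if w: "0 \<le> w" "w \<le> 1" and x: "x \<in> U" for w x
  proof
    assume 0: "cc (w, x) = 0"
    have "w \<noteq> 0" using 0 x cn(3)[of w x] by (auto simp: U_def)
    then have x12: "x$1 = 0" "x$2 = 0" using 0 cn(1,2)[of w x] by auto
    have "norm x = \<bar>x $ 3\<bar>" unfolding norm_eq_sqrt_inner inner_real3 x12 by simp
    then have "x $ 3 > 0" using x by (auto simp: U_def)
    then have "w * x $ 3 > 0" "(1 - w) * norm x \<ge> 0" using w \<open>w \<noteq> 0\<close> by auto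
    then show False using 0 cn(3)[of w x] by simp
  qed
  have sub: "{0..1} \<times> U \<subseteq> V"
    using nz by (auto simp: V_def U_def)
  have s: "smooth_on_open U \<kappa>"
    unfolding \<kappa>_def[abs_def] by (rule smooth_on_open_integral_parameter[OF U oV sub sf])
  have eq: "((x$1)\<^sup>2 + (x$2)\<^sup>2) * \<kappa> x = (norm x)\<^sup>2 * (1 - h (x $ 3 / norm x))"
    if x: "x \<in> U" "(x$1)\<^sup>2 + (x$2)\<^sup>2 > 0" for x
  proof -
    define N where "N = norm x"
    define r where "r = (x$1)\<^sup>2 + (x$2)\<^sup>2"
    have r: "r > 0" using x by (simp add: r_def)
    have N: "N > 0" using x by (auto simp: N_def U_def)
    define c3 where "c3 w = (1 - w) * N + w * x$3" for w
    define q where "q w = w\<^sup>2 * r + (c3 w)\<^sup>2" for w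
    have ncc: "norm (cc (w, x)) = sqrt (q w)" for w
      unfolding norm_eq_sqrt_inner inner_real3 cn q_def r_def c3_def N_def
      by (simp add: power2_eq_square algebra_simps)
    have qp: "q w > 0" if "0 \<le> w" "w \<le> 1" for w
      using nz[OF that x(1)] ncc[of w] by (metis real_sqrt_gt_0_iff zero_less_norm_iff)
    define \<zeta> where "\<zeta> w = c3 w / sqrt (q w)" for w
    have dz: "(\<zeta> has_real_derivative - N * w * r / sqrt (q w) ^ 3) (at w)" if w: "0 < w" "w < 1" for w
    proof -
      have q: "q w > 0" using qp w by simp
      have dc: "(c3 has_real_derivative x$3 - N) (at w)" unfolding c3_def by (auto intro!: derivative_eq_intros)
      have dq: "(q has_real_derivative 2 * w * r + 2 * c3 w * (x$3 - N)) (at w)" unfolding q_def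
        by (auto intro!: derivative_eq_intros dc)
      have ds: "((\<lambda>w. sqrt (q w)) has_real_derivative (2 * w * r + 2 * c3 w * (x$3 - N)) * (inverse (sqrt (q w)) / 2)) (at w)"
        using DERIV_chain2[OF DERIV_real_sqrt[OF q] dq] by (simp add: mult.commute)
      define n where "n = sqrt (q w)"
      have n: "n > 0" "n\<^sup>2 = w\<^sup>2 * r + (c3 w)\<^sup>2" using q by (simp_all add: n_def) (simp add: q_def)
      have "(\<zeta> has_real_derivative ((x$3 - N) * n - c3 w * ((2 * w * r + 2 * c3 w * (x$3 - N)) * (inverse n / 2))) / (n * n)) (at w)"
        unfolding \<zeta>_def n_def by (rule DERIV_divide[OF dc ds]) (use q in simp)
      moreover have "((x$3 - N) * n - c3 w * ((2 * w * r + 2 * c3 w * (x$3 - N)) * (inverse n / 2))) / (n * n)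
          = ((x$3 - N) * n\<^sup>2 - c3 w * (w * r + c3 w * (x$3 - N))) / n ^ 3"
        using n(1) by (simp add: field_simps power2_eq_square power3_eq_cube)
      moreover have "(x$3 - N) * n\<^sup>2 - c3 w * (w * r + c3 w * (x$3 - N)) = - N * w * r"
        unfolding n(2) c3_def by algebra
      ultimately show ?thesis by (simp add: n_def)
    qed
    have cz: "continuous_on {0..1} \<zeta>" unfolding \<zeta>_def q_def c3_def
      by (intro continuous_intros) (use qp in \<open>force simp: q_def c3_def\<close>)
    have zr: "\<bar>\<zeta> w\<bar> \<le> 1" if "0 \<le> w" "w \<le> 1" for w
    proof -
      have "\<bar>cc (w, x) $ 3\<bar> \<le> norm (cc (w, x))" by (rule component_le_norm_cart)
      then show ?thesis using qp[OF that] ncc[of w] by (simp add: \<zeta>_def cn c3_def N_def)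
    qed
    have "((\<lambda>w. - (r / N\<^sup>2) * f (w, x)) has_integral h (\<zeta> 1) - h (\<zeta> 0)) {0..1}"
    proof (rule fundamental_theorem_of_calculus_interior)
      show "continuous_on {0..1} (\<lambda>w. h (\<zeta> w))"
        by (rule continuous_on_compose2[OF hc cz]) (use zr in \<open>force simp: abs_le_iff\<close>)
      fix w :: real assume "w \<in> {0<..<1}"
      then have w: "0 < w" "w < 1" by auto
      have q: "sqrt (q w) > 0" using qp w by simp
      have "\<bar>c3 w\<bar> < sqrt (q w)"
        by (rule real_less_rsqrt) (use r w in \<open>simp add: q_def\<close>)
      then have "\<bar>cc (w, x) $ 3\<bar> < norm (cc (w, x))" by (simp add: ncc cn c3_def N_def)
      from hd[OF this] have "(h has_real_derivative 2 * R (cc (w, x))) (at (\<zeta> w))"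
        by (simp add: ncc cn \<zeta>_def c3_def N_def)
      from DERIV_chain2[OF this dz[OF w]]
      have "((\<lambda>w. h (\<zeta> w)) has_real_derivative 2 * R (cc (w, x)) * (- N * w * r / sqrt (q w) ^ 3)) (at w)" .
      moreover have "2 * R (cc (w, x)) * (- N * w * r / sqrt (q w) ^ 3) = - (r / N\<^sup>2) * f (w, x)"
        unfolding f_def fst_conv snd_conv ncc N_def[symmetric] using N q
        by (simp add: field_simps power2_eq_square power3_eq_cube)
      ultimately show "((\<lambda>w. h (\<zeta> w)) has_vector_derivative - (r / N\<^sup>2) * f (w, x)) (at w)"
        by (simp add: has_real_derivative_iff_has_vector_derivative)
    qed simp
    from integral_unique[OF this] have "- (r / N\<^sup>2) * \<kappa> x = h (\<zeta> 1) - h (\<zeta> 0)"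
      by (simp add: \<kappa>_def)
    moreover have "\<zeta> 0 = 1" using N by (simp add: \<zeta>_def q_def c3_def)
    moreover have "\<zeta> 1 = x $ 3 / norm x"
      using ncc[of 1] by (simp add: \<zeta>_def cc_def c3_def)
    ultimately have "- (r / N\<^sup>2) * \<kappa> x = h (x $ 3 / N) - 1" using h1 by (simp add: N_def)
    then have "r * \<kappa> x = N\<^sup>2 * (1 - h (x $ 3 / N))" using N by (simp add: field_simps)
    then show ?thesis by (simp add: r_def N_def)
  qed
  \<comment> \<open>On the axis the identity for \<kappa> reads 0 = 0 and does not show positivity.
    There the segment is a single point, and the integral can be evaluated.\<close>
  have ax: "\<kappa> x = R x \<and> x $ 3 = norm x" if x: "x \<in> U" "x$1 = 0" "x$2 = 0" for x
  proof -
    have "norm x = \<bar>x $ 3\<bar>" unfolding norm_eq_sqrt_inner inner_real3 x by simp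
    then have 3: "x $ 3 = norm x" "norm x > 0" using x by (auto simp: U_def)
    have "cc (w, x) = x" for w
      unfolding vec3_eq_iff cn using x 3(1) by (simp add: algebra_simps)
    then have "f (w, x) = (2 * R x) * w" for w using 3 by (simp add: f_def)
    moreover have "integral {0..1} (\<lambda>w. (2 * R x) * w) = R x * 1\<^sup>2 - R x * 0\<^sup>2"
      by (rule integral_eq_primitive) (auto intro!: derivative_eq_intros)
    ultimately show ?thesis using 3 by (simp add: \<kappa>_def)
  qed
  have eq': "((x$1)\<^sup>2 + (x$2)\<^sup>2) * \<kappa> x = (norm x)\<^sup>2 * (1 - h (x $ 3 / norm x))" if x: "x \<in> U" for x
  proof (cases "(x$1)\<^sup>2 + (x$2)\<^sup>2 > 0")
    case False
    then have "x$1 = 0" "x$2 = 0" by (auto simp: sum_power2_gt_zero_iff)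
    then show ?thesis using ax[OF x] h1 x by (auto simp: U_def)
  qed (rule eq[OF x])
  have pos: "\<kappa> x > 0" if x: "x \<in> U" for x
  proof (cases "(x$1)\<^sup>2 + (x$2)\<^sup>2 > 0")
    case False
    then have "x$1 = 0" "x$2 = 0" by (auto simp: sum_power2_gt_zero_iff)
    then show ?thesis using ax[OF x] R(2)[of x] x by (auto simp: U_def)
  next
    case True
    have N: "norm x > 0" using x by (auto simp: U_def)
    have "(x $ 3)\<^sup>2 < (norm x)\<^sup>2"
      using True unfolding power2_norm_eq_inner inner_real3 by (simp add: power2_eq_square)
    then have "\<bar>x $ 3\<bar> < norm x" using N abs_le_square_iff[of "norm x" "x $ 3"] by (simp add: not_less[symmetric] del: not_less)
    then have "h (x $ 3 / norm x) < 1" using N by (intro hlt) (auto simp: field_simps abs_less_iff)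
    then have "((x$1)\<^sup>2 + (x$2)\<^sup>2) * \<kappa> x > 0" unfolding eq'[OF x] using N by simp
    then show ?thesis using True by (simp add: zero_less_mult_iff)
  qed
  show thesis
    by (rule that[of \<kappa>]) (use s pos eq' in \<open>simp_all add: U_def\<close>)
qed

text \<open>In the product of 1 - h and 1 + h, near each pole one factor is divisible by the squared
  distance from the axis, by \<open>polar_cap\<close> for h and for its reflection
  \<open>- h (- z)\<close>, and the other is positive. The two square roots agree on the overlap,
  since off the axis the equation and the sign determine the root.\<close>

lemma height_profile:
  fixes R :: "real^3 \<Rightarrow> real" and h :: "real \<Rightarrow> real"
  assumes R: "smooth_on_open (- {0}) R" "\<And>x. x \<noteq> 0 \<Longrightarrow> R x > 0"
    and hc: "continuous_on {-1..1} h" and h1: "h 1 = 1" "h (-1) = -1"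
    and hm: "\<And>z w. -1 \<le> z \<Longrightarrow> z < w \<Longrightarrow> w \<le> 1 \<Longrightarrow> h z < h w"
    and hd: "\<And>x. \<bar>x $ 3\<bar> < norm x \<Longrightarrow> (h has_real_derivative 2 * R x) (at (x $ 3 / norm x))"
  obtains m :: "real^3 \<Rightarrow> real" where "smooth_on_open (- {0}) (\<lambda>x::real^3. h (x $ 3 / norm x))"
    "smooth_on_open (- {0}) m" "\<And>x. x \<noteq> 0 \<Longrightarrow> m x \<ge> 0"
    "\<And>x. x \<noteq> 0 \<Longrightarrow> (m x)\<^sup>2 * ((x$1)\<^sup>2 + (x$2)\<^sup>2) = (norm x)\<^sup>2 * (1 - (h (x $ 3 / norm x))\<^sup>2)"
proof -
  have hlt: "h z < 1" if "-1 \<le> z" "z < 1" for z using hm[OF that] h1 by simp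
  obtain k :: "real^3 \<Rightarrow> real" where k: "smooth_on_open {x. - norm x < x $ 3} k" "\<And>x. - norm x < x $ 3 \<Longrightarrow> k x > 0"
    "\<And>x. - norm x < x $ 3 \<Longrightarrow> ((x$1)\<^sup>2 + (x$2)\<^sup>2) * k x = (norm x)\<^sup>2 * (1 - h (x $ 3 / norm x))"
    by (rule polar_cap[OF R hc h1(1) hlt hd], assumption+, rule that)
  define \<sigma> :: "real^3 \<Rightarrow> real^3" where "\<sigma> x = vector [x$1, x$2, - x$3]" for x
  have sn: "\<sigma> x $ 1 = x$1" "\<sigma> x $ 2 = x$2" "\<sigma> x $ 3 = - x$3" "norm (\<sigma> x) = norm x" for x
    by (simp_all add: \<sigma>_def norm_eq_sqrt_inner inner_real3)
  have s0: "\<sigma> x \<noteq> 0" if "x \<noteq> 0" for x using that sn(4)[of x] by (metis norm_eq_zero)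
  have ss: "smooth_on_open A \<sigma>" if "open A" for A
    by (rule smooth_on_open_vec3[OF that]; unfold sn; intro smooth_intros that)
  have R': "smooth_on_open (- {0}) (\<lambda>x. R (\<sigma> x))"
  proof (rule smooth_on_open_compose[OF open_nonzero open_nonzero ss[OF open_nonzero] R(1)])
    show "\<sigma> ` (- {0}) \<subseteq> - {0}"
      by (rule image_subsetI) (simp only: Compl_iff singleton_iff s0 not_False_eq_True)
  qed
  have Rp': "R (\<sigma> x) > 0" if "x \<noteq> 0" for x by (rule R(2)[OF s0[OF that]])
  have hc': "continuous_on {-1..1} (\<lambda>z. - h (- z))"
    by (intro continuous_intros continuous_on_compose2[OF hc]) auto
  have hlt': "- h (- z) < 1" if "-1 \<le> z" "z < 1" for z using hm[of "-1" "-z"] that h1 by simp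
  have hd': "((\<lambda>z. - h (- z)) has_real_derivative 2 * R (\<sigma> x)) (at (x $ 3 / norm x))" if "\<bar>x $ 3\<bar> < norm x" for x
  proof -
    have "(h has_real_derivative 2 * R (\<sigma> x)) (at (- (x $ 3 / norm x)))" using hd[of "\<sigma> x"] that by (simp add: sn)
    then have "((\<lambda>z. h (- z)) has_real_derivative 2 * R (\<sigma> x) * (-1)) (at (x $ 3 / norm x))"
      by (rule DERIV_chain2) (auto intro!: derivative_eq_intros)
    from DERIV_minus[OF this] show ?thesis by simp
  qed
  have h1': "- h (- 1) = 1" using h1 by simp
  obtain l :: "real^3 \<Rightarrow> real" where l: "smooth_on_open {x. - norm x < x $ 3} l" "\<And>x. - norm x < x $ 3 \<Longrightarrow> l x > 0"
    "\<And>x. - norm x < x $ 3 \<Longrightarrow> ((x$1)\<^sup>2 + (x$2)\<^sup>2) * l x = (norm x)\<^sup>2 * (1 - - h (- (x $ 3 / norm x)))"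
    by (rule polar_cap[OF R' Rp' hc' h1' hlt' hd'], assumption+, rule that)
  define N where "N = {x::real^3. - norm x < x $ 3}"
  define S where "S = {x::real^3. x $ 3 < norm x}"
  have oN: "open N" "open S" unfolding N_def S_def by (intro open_Collect_less continuous_intros)+
  have NS: "N \<union> S = - {0}"
  proof -
    have "x \<in> N \<union> S \<longleftrightarrow> x \<noteq> 0" for x
      by (cases "x = 0") (use zero_less_norm_iff[of x] in \<open>auto simp: N_def S_def simp del: zero_less_norm_iff\<close>)
    then show ?thesis by blast
  qed
  define l' where "l' x = l (\<sigma> x)" for x
  have l': "smooth_on_open S l'" "\<And>x. x \<in> S \<Longrightarrow> l' x > 0"
    "\<And>x. x \<in> S \<Longrightarrow> ((x$1)\<^sup>2 + (x$2)\<^sup>2) * l' x = (norm x)\<^sup>2 * (1 + h (x $ 3 / norm x))"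
  proof -
    show "smooth_on_open S l'" unfolding l'_def[abs_def]
      by (rule smooth_on_open_compose[OF oN(2) oN(1) ss[OF oN(2)] l(1)[folded N_def]]) (auto simp: S_def N_def sn)
    show "l' x > 0" if "x \<in> S" for x using l(2)[of "\<sigma> x"] that by (simp add: l'_def S_def sn)
    show "((x$1)\<^sup>2 + (x$2)\<^sup>2) * l' x = (norm x)\<^sup>2 * (1 + h (x $ 3 / norm x))" if "x \<in> S" for x
      using l(3)[of "\<sigma> x"] that by (simp add: l'_def S_def sn)
  qed
  have k2: "k x > 0" "((x$1)\<^sup>2 + (x$2)\<^sup>2) * k x = (norm x)\<^sup>2 * (1 - h (x $ 3 / norm x))" if "x \<in> N" for x
    using k(2,3)[of x] that by (auto simp: N_def)
  have n0: "x \<noteq> 0" if "x \<in> N \<or> x \<in> S" for x using NS that by blast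
  have nN: "smooth_on_open A (\<lambda>x::real^3. norm x)" if "A \<subseteq> - {0}" for A
    by (rule smooth_on_open_subset[OF smooth_on_open_norm that])
  have zN: "smooth_on_open N (\<lambda>x. h (x $ 3 / norm x))"
  proof (rule smooth_on_open_cong[OF oN(1)])
    show "smooth_on_open N (\<lambda>x. 1 - ((x$1)\<^sup>2 + (x$2)\<^sup>2) * k x / (norm x)\<^sup>2)"
      by (intro smooth_intros oN(1) nN k(1)[folded N_def]) (use n0 in auto)
    show "1 - ((x$1)\<^sup>2 + (x$2)\<^sup>2) * k x / (norm x)\<^sup>2 = h (x $ 3 / norm x)" if "x \<in> N" for x
      unfolding k2(2)[OF that] using n0[of x] that by simp
  qed
  have zS: "smooth_on_open S (\<lambda>x. h (x $ 3 / norm x))"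
  proof (rule smooth_on_open_cong[OF oN(2)])
    show "smooth_on_open S (\<lambda>x. ((x$1)\<^sup>2 + (x$2)\<^sup>2) * l' x / (norm x)\<^sup>2 - 1)"
      by (intro smooth_intros oN(2) nN l'(1)) (use n0 in auto)
    show "((x$1)\<^sup>2 + (x$2)\<^sup>2) * l' x / (norm x)\<^sup>2 - 1 = h (x $ 3 / norm x)" if "x \<in> S" for x
      unfolding l'(3)[OF that] using n0[of x] that by simp
  qed
  have sZ: "smooth_on_open (- {0}) (\<lambda>x::real^3. h (x $ 3 / norm x))"
    using smooth_on_open_Un[OF zN zS] by (simp add: NS)
  define a where "a x = k x * (1 + h (x $ 3 / norm x))" for x
  define b where "b x = l' x * (1 - h (x $ 3 / norm x))" for x
  have rz: "-1 \<le> x $ 3 / norm x" "x $ 3 / norm x \<le> 1" for x :: "real^3"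
    using component_le_norm_cart[of x 3] by (cases "x = 0"; simp add: pos_le_divide_eq pos_divide_le_eq abs_le_iff)+
  have ap: "a x > 0" if "x \<in> N" for x
  proof -
    have "- 1 < x $ 3 / norm x" using that n0[of x] by (simp add: N_def pos_less_divide_eq)
    then have "h (x $ 3 / norm x) > -1" using hm[OF order_refl _ rz(2)] h1 by simp
    then show ?thesis using k2(1)[OF that] by (simp add: a_def)
  qed
  have bp: "b x > 0" if "x \<in> S" for x
  proof -
    have "x $ 3 / norm x < 1" using that n0[of x] by (simp add: S_def)
    then have "h (x $ 3 / norm x) < 1" using hm[OF rz(1) _ order_refl] h1 by simp
    then show ?thesis using l'(2)[OF that] by (simp add: b_def)
  qed
  have ea: "a x * ((x$1)\<^sup>2 + (x$2)\<^sup>2) = (norm x)\<^sup>2 * (1 - (h (x $ 3 / norm x))\<^sup>2)" if "x \<in> N" for x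
    using k2(2)[OF that] unfolding a_def by algebra
  have eb: "b x * ((x$1)\<^sup>2 + (x$2)\<^sup>2) = (norm x)\<^sup>2 * (1 - (h (x $ 3 / norm x))\<^sup>2)" if "x \<in> S" for x
    using l'(3)[OF that] unfolding b_def by algebra
  define m where "m x = (if x \<in> N then sqrt (a x) else sqrt (b x))" for x
  have mS: "m x = sqrt (b x)" if x: "x \<in> S" for x
  proof (cases "x \<in> N")
    case True
    have "(x$1)\<^sup>2 + (x$2)\<^sup>2 \<noteq> 0"
    proof
      assume 0: "(x$1)\<^sup>2 + (x$2)\<^sup>2 = 0"
      then have "x $ 1 = 0" "x $ 2 = 0" by (auto simp: sum_power2_eq_zero_iff)
      then have "norm x = \<bar>x $ 3\<bar>" unfolding norm_eq_sqrt_inner inner_real3 by simp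
      then show False using True x by (auto simp: N_def S_def)
    qed
    then have "a x = b x" using ea[OF True] eb[OF x] by (metis mult_right_cancel)
    then show ?thesis by (simp add: m_def)
  qed (simp add: m_def)
  have sm: "smooth_on_open (- {0}) m"
  proof -
    have "smooth_on_open N m"
    proof (rule smooth_on_open_cong[OF oN(1)])
      show "smooth_on_open N (\<lambda>x. sqrt (a x))" unfolding a_def[abs_def]
        by (intro smooth_intros oN(1) k(1)[folded N_def] zN) (use ap in \<open>auto simp: a_def\<close>)
    qed (simp add: m_def)
    moreover have "smooth_on_open S m"
    proof (rule smooth_on_open_cong[OF oN(2)])
      show "smooth_on_open S (\<lambda>x. sqrt (b x))" unfolding b_def[abs_def]
        by (intro smooth_intros oN(2) l'(1) zS) (use bp in \<open>auto simp: b_def\<close>)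
    qed (simp add: mS)
    ultimately show ?thesis using smooth_on_open_Un[of N m S] by (simp add: NS)
  qed
  show thesis
  proof (rule that[OF sZ sm])
    fix x :: "real^3" assume "x \<noteq> 0"
    then consider "x \<in> N" | "x \<in> S" using NS by blast
    then show "(m x)\<^sup>2 * ((x$1)\<^sup>2 + (x$2)\<^sup>2) = (norm x)\<^sup>2 * (1 - (h (x $ 3 / norm x))\<^sup>2)"
      by cases (use ap ea bp eb mS in \<open>force simp: m_def less_imp_le\<close>)+
    show "m x \<ge> 0" using \<open>x \<noteq> 0\<close> ap bp NS by (cases "x \<in> N") (auto simp: m_def less_imp_le)
  qed
qed

section \<open>Normal form of an area form\<close>

lemma rotz_add: "rotz s (rotz t x) = rotz (s + t) x"
  by (simp add: vec3_eq_iff cos_add sin_add algebra_simps)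

lemma rotz_zero [simp]: "rotz 0 x = x"
  by (simp add: vec3_eq_iff)

lemma rotz_scaleR: "rotz s (c *\<^sub>R x) = c *\<^sub>R rotz s x"
  by (simp add: vec3_eq_iff algebra_simps)

lemma rotz_periodic: "rotz (s + 2 * pi * of_int k) x = rotz s x"
  using sin_cos_eq_iff[of "s + 2 * pi * of_int k" s] by (auto simp: vec3_eq_iff)

lemma has_vector_derivative_rotz:
  "((\<lambda>s. rotz s x) has_vector_derivative axis 3 1 \<otimes> rotz t x) (at t)"
  by (rule has_vector_derivative_real3) (auto intro!: derivative_eq_intros simp: cross3_nth axis_def)

lemma rotz_normalize: "\<exists>s. x = rotz s (vector [sqrt ((x$1)\<^sup>2 + (x$2)\<^sup>2), 0, x$3])"
proof -
  define r where "r = sqrt ((x$1)\<^sup>2 + (x$2)\<^sup>2)"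
  have "\<exists>s. x$1 = r * cos s \<and> x$2 = r * sin s"
  proof (cases "r = 0")
    case True
    then show ?thesis by (simp add: r_def sum_power2_eq_zero_iff)
  next
    case False
    have r2: "(x$1)\<^sup>2 + (x$2)\<^sup>2 = r\<^sup>2" by (simp add: r_def)
    have "(x$1 / r)\<^sup>2 + (x$2 / r)\<^sup>2 = 1"
      unfolding power_divide add_divide_distrib[symmetric] r2 using False by simp
    then obtain s where "x$1 / r = cos s" "x$2 / r = sin s" using sincos_total_2pi_le by blast
    then show ?thesis using False by (intro exI[of _ s]) (simp add: field_simps)
  qed
  then obtain s where "x$1 = r * cos s" "x$2 = r * sin s" by blast
  then have "x = rotz s (vector [r, 0, x$3])" by (simp add: vec3_eq_iff)
  then show ?thesis unfolding r_def by blast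
qed

lemma continuous_on_rotz_orbit:
  assumes "smooth_on_open (- {0}) f" "x \<noteq> 0"
  shows "continuous_on A (\<lambda>t. f (rotz t x))"
proof -
  have "continuous_on A (\<lambda>t. (t, x))" by (intro continuous_intros)
  moreover have "(\<lambda>t. (t, x)) ` A \<subseteq> UNIV \<times> - {0}" using assms(2) by auto
  ultimately show ?thesis
    using continuous_on_compose2[OF smooth_on_open_imp_continuous_on[OF smooth_on_open_rotz_compose[OF assms(1)]], of A "\<lambda>t. (t, x)"]
    by (simp only: fst_conv snd_conv)
qed

lemma rot_mean_rotz:
  assumes "smooth_on_open (- {0}) f" "x \<noteq> 0"
  shows "rot_mean f (rotz s x) = rot_mean f x"
  unfolding rot_mean_def rotz_add
  by (rule periodic_integral_shift[OF continuous_on_rotz_orbit[OF assms]])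
    (use rotz_periodic[of _ 1] in simp_all)

lemma rot_mean_radial: "radial f \<Longrightarrow> radial (rot_mean f)"
  unfolding radial_def rot_mean_def rotz_scaleR by simp

lemma rot_mean_pos:
  assumes "smooth_on_open (- {0}) f" "x \<noteq> 0" and "\<And>x. x \<noteq> 0 \<Longrightarrow> f x > 0"
  shows "rot_mean f x > 0"
proof -
  obtain P where P: "\<And>t. (P has_real_derivative f (rotz t x)) (at t)"
    using primitive_exists[OF continuous_on_rotz_orbit[OF assms(1,2)]] by blast
  have p: "f (rotz t x) > 0" for t using assms(2) by (intro assms(3)) simp
  have "P 0 < P (2 * pi)"
    by (rule DERIV_pos_imp_increasing) (use P p in \<open>auto intro!: exI\<close>)
  then show ?thesis unfolding rot_mean_def
    by (subst integral_eq_primitive[OF _ P]) auto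
qed

text \<open>The factor on the right is the determinant of T; it can therefore be computed on any
  frame adapted to the rotations.\<close>

lemma linear_triple_product:
  fixes T :: "real^3 \<Rightarrow> real^3"
  assumes "linear T"
  shows "T a \<bullet> (T b \<otimes> T c) = (T (axis 1 1) \<bullet> (T (axis 2 1) \<otimes> T (axis 3 1))) * (a \<bullet> (b \<otimes> c))"
proof -
  have T: "T v = (v$1) *\<^sub>R T (axis 1 1) + (v$2) *\<^sub>R T (axis 2 1) + (v$3) *\<^sub>R T (axis 3 1)" for v
    using arg_cong[OF vec3_expand[of v], of T] by (simp only: linear_add[OF assms] linear_scale[OF assms])
  show ?thesis unfolding T[of a] T[of b] T[of c]
    by (simp add: inner_real3 cross3_nth algebra_simps)
qed

text \<open>Models an area form of total area 1 halved by the equator: \<open>h z\<close> is twice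
  the signed area between the equator and height z. The aim is a norm-preserving map that takes the
  form with density \<rho> on the unit sphere to the round form of total area 1 and height z to
  height \<open>h z\<close>.\<close>

locale normalizable_density =
  fixes \<rho> :: "real^3 \<Rightarrow> real" and h :: "real \<Rightarrow> real"
  assumes smooth_density: "smooth_on_open (- {0}) \<rho>" and radial_density: "radial \<rho>"
    and density_pos: "\<And>x. x \<noteq> 0 \<Longrightarrow> \<rho> x > 0"
    and h_continuous: "continuous_on {-1..1} h" and h_1: "h 1 = 1" "h (-1) = -1"
    and h_derivative: "\<And>z. \<bar>z\<bar> < 1 \<Longrightarrow>
      (h has_real_derivative 2 * rot_mean \<rho> (vector [sqrt (1 - z\<^sup>2), 0, z])) (at z)"
begin

abbreviation R :: "real^3 \<Rightarrow> real" where "R \<equiv> rot_mean \<rho>"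

lemma smooth_R: "smooth_on_open (- {0}) R"
  by (rule smooth_on_open_rot_mean[OF smooth_density])

lemma R_pos: "x \<noteq> 0 \<Longrightarrow> R x > 0"
  by (rule rot_mean_pos[OF smooth_density _ density_pos])

lemma vec3_nz: "\<bar>z\<bar> < 1 \<Longrightarrow> vector [sqrt (1 - z\<^sup>2), 0, z] \<noteq> (0 :: real^3)"
  by (auto simp: vec3_eq_iff)

lemma h_less: "-1 \<le> z \<Longrightarrow> z < w \<Longrightarrow> w \<le> 1 \<Longrightarrow> h z < h w"
proof (rule DERIV_pos_imp_increasing_open[of z w h])
  assume zw: "-1 \<le> z" "z < w" "w \<le> 1"
  show "continuous_on {z..w} h" by (rule continuous_on_subset[OF h_continuous]) (use zw in auto)
  show "\<exists>y. (h has_real_derivative y) (at x) \<and> y > 0" if "z < x" "x < w" for x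
  proof (intro exI conjI)
    have x: "\<bar>x\<bar> < 1" using that zw by auto
    show "(h has_real_derivative 2 * R (vector [sqrt (1 - x\<^sup>2), 0, x])) (at x)" by (rule h_derivative[OF x])
    show "2 * R (vector [sqrt (1 - x\<^sup>2), 0, x]) > 0" using R_pos[OF vec3_nz[OF x]] by simp
  qed
qed

lemma norm_sq3: "(norm (x::real^3))\<^sup>2 = (x$1)\<^sup>2 + (x$2)\<^sup>2 + (x$3)\<^sup>2"
  unfolding power2_norm_eq_inner inner_real3 by (simp add: power2_eq_square)

lemma h_derivative_ratio:
  assumes "\<bar>x $ 3\<bar> < norm x"
  shows "(h has_real_derivative 2 * R x) (at (x $ 3 / norm x))"
proof -
  define z where "z = x $ 3 / norm x"
  have n: "norm x > 0" using assms by linarith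
  have z: "\<bar>z\<bar> < 1" using assms n by (simp add: z_def)
  obtain s where s: "x = rotz s (vector [sqrt ((x$1)\<^sup>2 + (x$2)\<^sup>2), 0, x$3])" using rotz_normalize by blast
  have "(x$1)\<^sup>2 + (x$2)\<^sup>2 = (norm x)\<^sup>2 * (1 - z\<^sup>2)"
  proof -
    have "z\<^sup>2 * (norm x)\<^sup>2 = (x$3)\<^sup>2" using n by (simp add: z_def power_divide)
    then show ?thesis using norm_sq3[of x] by algebra
  qed
  then have "sqrt ((x$1)\<^sup>2 + (x$2)\<^sup>2) = norm x * sqrt (1 - z\<^sup>2)" using n by (simp add: real_sqrt_mult)
  then have e: "vector [sqrt ((x$1)\<^sup>2 + (x$2)\<^sup>2), 0, x$3] = norm x *\<^sub>R (vector [sqrt (1 - z\<^sup>2), 0, z] :: real^3)"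
    using n by (simp add: vec3_eq_iff z_def)
  have "R x = R (norm x *\<^sub>R vector [sqrt (1 - z\<^sup>2), 0, z])"
    by (subst s, unfold e, rule rot_mean_rotz[OF smooth_density]) (use vec3_nz[OF z] n in auto)
  also have "\<dots> = R (vector [sqrt (1 - z\<^sup>2), 0, z])"
    using rot_mean_radial[OF radial_density] n unfolding radial_def by blast
  finally show ?thesis using h_derivative[OF z] by (simp add: z_def)
qed

section \<open>Correction of the height\<close>

abbreviation Z :: "real^3 \<Rightarrow> real" where "Z x \<equiv> h (x $ 3 / norm x)"

definition m :: "real^3 \<Rightarrow> real" where
  "m = (SOME m. smooth_on_open (- {0}) m \<and> (\<forall>x. x \<noteq> 0 \<longrightarrow> m x \<ge> 0 \<and>
     (m x)\<^sup>2 * ((x$1)\<^sup>2 + (x$2)\<^sup>2) = (norm x)\<^sup>2 * (1 - (Z x)\<^sup>2)))"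

lemma smooth_Z: "smooth_on_open (- {0}) Z"
  and smooth_m: "smooth_on_open (- {0}) m"
  and m_nonneg: "x \<noteq> 0 \<Longrightarrow> m x \<ge> 0"
  and m_sq: "x \<noteq> 0 \<Longrightarrow> (m x)\<^sup>2 * ((x$1)\<^sup>2 + (x$2)\<^sup>2) = (norm x)\<^sup>2 * (1 - (Z x)\<^sup>2)"
proof -
  obtain n :: "real^3 \<Rightarrow> real" where n: "smooth_on_open (- {0}) (\<lambda>x::real^3. h (x $ 3 / norm x))"
    "smooth_on_open (- {0}) n" "\<And>x. x \<noteq> 0 \<Longrightarrow> n x \<ge> 0"
    "\<And>x. x \<noteq> 0 \<Longrightarrow> (n x)\<^sup>2 * ((x$1)\<^sup>2 + (x$2)\<^sup>2) = (norm x)\<^sup>2 * (1 - (h (x $ 3 / norm x))\<^sup>2)"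
    by (rule height_profile[OF smooth_R R_pos h_continuous h_1 h_less h_derivative_ratio], assumption+, rule that)
  show "smooth_on_open (- {0}) Z" by (rule n(1))
  have "\<exists>m. smooth_on_open (- {0}) m \<and> (\<forall>x. x \<noteq> 0 \<longrightarrow> m x \<ge> 0 \<and>
     (m x)\<^sup>2 * ((x$1)\<^sup>2 + (x$2)\<^sup>2) = (norm x)\<^sup>2 * (1 - (Z x)\<^sup>2))"
    by (intro exI[of _ n] conjI allI impI n)
  from someI_ex[OF this, folded m_def]
  show "smooth_on_open (- {0}) m" "x \<noteq> 0 \<Longrightarrow> m x \<ge> 0"
    "x \<noteq> 0 \<Longrightarrow> (m x)\<^sup>2 * ((x$1)\<^sup>2 + (x$2)\<^sup>2) = (norm x)\<^sup>2 * (1 - (Z x)\<^sup>2)" by blast+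
qed

text \<open>Slides a point along its meridian, on the sphere of the same norm, to the relative
  height Z; m is the factor by which the horizontal part is stretched.\<close>

definition M :: "real^3 \<Rightarrow> real^3" where "M x = vector [m x * x$1, m x * x$2, norm x * Z x]"

lemma M_nth: "M x $ 1 = m x * x$1" "M x $ 2 = m x * x$2" "M x $ 3 = norm x * Z x"
  by (simp_all add: M_def)

lemma smooth_M: "smooth_on_open (- {0}) M"
  by (rule smooth_on_open_vec3[OF open_nonzero]; unfold M_nth;
      intro smooth_intros open_nonzero smooth_m smooth_Z smooth_on_open_norm)

lemma norm_M: "x \<noteq> 0 \<Longrightarrow> norm (M x) = norm x"
proof -
  assume x: "x \<noteq> 0"
  have "(norm (M x))\<^sup>2 = (m x)\<^sup>2 * ((x$1)\<^sup>2 + (x$2)\<^sup>2) + (norm x)\<^sup>2 * (Z x)\<^sup>2"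
    unfolding norm_sq3[of "M x"] M_nth by algebra
  also have "\<dots> = (norm x)\<^sup>2" unfolding m_sq[OF x] by algebra
  finally show ?thesis by simp
qed

text \<open>On the axis the equation does not determine m, but there the horizontal part is 0; hence
  uniqueness concerns the products. It gives homogeneity and rotation equivariance of M although m
  was merely chosen.\<close>

lemma m_unique:
  assumes x: "x \<noteq> 0" and n: "n \<ge> 0" "n\<^sup>2 * ((x$1)\<^sup>2 + (x$2)\<^sup>2) = (norm x)\<^sup>2 * (1 - (Z x)\<^sup>2)"
  shows "m x * x$1 = n * x$1" "m x * x$2 = n * x$2"
proof -
  have "m x = n \<or> x$1 = 0 \<and> x$2 = 0"
  proof (rule disjCI)
    assume "\<not> (x$1 = 0 \<and> x$2 = 0)"
    then have "(x$1)\<^sup>2 + (x$2)\<^sup>2 \<noteq> 0" by (simp add: sum_power2_eq_zero_iff)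
    then have "(m x)\<^sup>2 = n\<^sup>2" using m_sq[OF x] n(2) by (metis mult_right_cancel)
    then show "m x = n" using m_nonneg[OF x] n(1) by simp
  qed
  then show "m x * x$1 = n * x$1" "m x * x$2 = n * x$2" by auto
qed

lemma M_scaleR: "x \<noteq> 0 \<Longrightarrow> t > 0 \<Longrightarrow> M (t *\<^sub>R x) = t *\<^sub>R M x"
proof -
  assume x: "x \<noteq> 0" and t: "t > 0"
  have tx: "t *\<^sub>R x \<noteq> 0" using x t by simp
  have "(m x)\<^sup>2 * (((t *\<^sub>R x)$1)\<^sup>2 + ((t *\<^sub>R x)$2)\<^sup>2) = t\<^sup>2 * ((m x)\<^sup>2 * ((x$1)\<^sup>2 + (x$2)\<^sup>2))"
    by (simp add: algebra_simps)
  also have "\<dots> = (norm (t *\<^sub>R x))\<^sup>2 * (1 - (Z (t *\<^sub>R x))\<^sup>2)"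
    unfolding m_sq[OF x] using t by (simp add: power_mult_distrib)
  finally show ?thesis
    using m_unique[OF tx m_nonneg[OF x]] t by (simp add: vec3_eq_iff M_nth)
qed

lemma M_rotz: "x \<noteq> 0 \<Longrightarrow> M (rotz s x) = rotz s (M x)"
proof -
  assume x: "x \<noteq> 0"
  have tx: "rotz s x \<noteq> 0" using x by simp
  have "((rotz s x)$1)\<^sup>2 + ((rotz s x)$2)\<^sup>2 = (x$1)\<^sup>2 + (x$2)\<^sup>2"
    using norm_sq3[of "rotz s x"] norm_sq3[of x] by simp
  then have "(m x)\<^sup>2 * (((rotz s x)$1)\<^sup>2 + ((rotz s x)$2)\<^sup>2) = (norm (rotz s x))\<^sup>2 * (1 - (Z (rotz s x))\<^sup>2)"
    using m_sq[OF x] by simp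
  from m_unique[OF tx m_nonneg[OF x] this] show ?thesis
    by (simp add: vec3_eq_iff M_nth algebra_simps)
qed

text \<open>1 + g is the density relative to its mean over the circle of latitude. So g has mean 0
  on each circle, which makes a periodic correction of the longitude possible.\<close>

definition g :: "real^3 \<Rightarrow> real" where "g x = 2 * pi * \<rho> x / R x - 1"

text \<open>
  \<open>E\<close> is the correction of the longitude: its derivative along circles of latitude is \<open>g\<close>.
  Averaging, instead of integrating from a fixed meridian, makes \<open>E\<close> smooth at the poles.
\<close>

definition E :: "real^3 \<Rightarrow> real" where
  "E x = (1 / (2 * pi)) * integral {0..2 * pi} (\<lambda>\<tau>. \<tau> * g (rotz \<tau> x))"

lemma smooth_g: "smooth_on_open (- {0}) g"
  unfolding g_def[abs_def]
  by (intro smooth_intros open_nonzero smooth_density smooth_R) (use R_pos in force)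

lemma smooth_E: "smooth_on_open (- {0}) E"
proof -
  have o: "open (UNIV \<times> - {0::real^3} :: (real \<times> (real^3)) set)" by (intro open_Times open_UNIV open_nonzero)
  have "smooth_on_open (UNIV \<times> - {0}) (\<lambda>y::real \<times> (real^3). fst y * g (rotz (fst y) (snd y)))"
    by (intro smooth_intros o smooth_on_open_rotz_compose[OF smooth_g])
  from smooth_on_open_integral_parameter[OF open_nonzero o _ this, of 0 "2 * pi"]
  have "smooth_on_open (- {0}) (\<lambda>x::real^3. integral {0..2 * pi} (\<lambda>\<tau>. \<tau> * g (rotz \<tau> x)))" by auto
  then show ?thesis unfolding E_def[abs_def] by (intro smooth_intros open_nonzero)
qed

lemma g_radial: "t > 0 \<Longrightarrow> g (t *\<^sub>R x) = g x"
  using radial_density rot_mean_radial[OF radial_density] unfolding radial_def g_def by simp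

lemma E_radial: "t > 0 \<Longrightarrow> E (t *\<^sub>R x) = E x"
  unfolding E_def rotz_scaleR by (simp add: g_radial)

lemma has_derivative_E:
  assumes x: "x \<noteq> 0"
  shows "((\<lambda>s. E (rotz s x)) has_real_derivative g (rotz s x)) (at s)"
proof -
  define c where "c = 2 * pi / R x"
  have "(\<lambda>t. \<rho> (rotz t x)) integrable_on {0..2 * pi}"
    by (intro integrable_continuous_interval continuous_on_rotz_orbit[OF smooth_density x])
  then have "((\<lambda>t. \<rho> (rotz t x)) has_integral R x) {0..2 * pi}" unfolding rot_mean_def by (rule integrable_integral)
  then have "((\<lambda>t. c * \<rho> (rotz t x) - 1) has_integral c * R x - 2 * pi) {0..2 * pi}"
    using has_integral_diff[OF has_integral_mult_right[of _ "R x" "{0..2 * pi}" c] has_integral_const_real[of "1::real" 0 "2 * pi"]] by simp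
  moreover have "c * R x - 2 * pi = 0" using R_pos[OF x] by (simp add: c_def)
  moreover have "g (rotz t x) = c * \<rho> (rotz t x) - 1" for t
    by (simp add: g_def c_def rot_mean_rotz[OF smooth_density x])
  ultimately have mean: "integral {0..2 * pi} (\<lambda>t. g (rotz t x)) = 0" by (simp add: integral_unique)
  have "((\<lambda>s. integral {0..2 * pi} (\<lambda>t. t * g (rotz (t + s) x))) has_real_derivative 2 * pi * g (rotz s x)) (at s)"
    by (rule periodic_primitive_mean_zero[OF continuous_on_rotz_orbit[OF smooth_g x] _ _ mean])
      (use rotz_periodic[of _ 1] in simp_all)
  from DERIV_cmult[OF this, of "1 / (2 * pi)"] show ?thesis
    unfolding E_def rotz_add by simp
qed

text \<open>M gives every zone the right area, and the rotation by E spreads the area evenly along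
  each parallel.\<close>

definition \<Psi> :: "real^3 \<Rightarrow> real^3" where "\<Psi> x = rotz (E x) (M x)"

lemma smooth_Psi: "smooth_on_open (- {0}) \<Psi>"
  unfolding \<Psi>_def[abs_def] rotz_def
  by (rule smooth_on_open_vec3[OF open_nonzero]; simp;
      intro smooth_intros open_nonzero smooth_E smooth_M)

lemma norm_Psi: "x \<noteq> 0 \<Longrightarrow> norm (\<Psi> x) = norm x"
  by (simp add: \<Psi>_def norm_M)

lemma Psi_nth3: "\<Psi> x $ 3 = norm x * Z x"
  by (simp add: \<Psi>_def M_nth)

lemma Psi_rotz: "x \<noteq> 0 \<Longrightarrow> \<Psi> (rotz s x) = rotz (s + E (rotz s x)) (M x)"
  by (simp add: \<Psi>_def M_rotz rotz_add add.commute)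

lemma Psi_scaleR: "x \<noteq> 0 \<Longrightarrow> t > 0 \<Longrightarrow> \<Psi> (t *\<^sub>R x) = t *\<^sub>R \<Psi> x"
  by (simp add: \<Psi>_def M_scaleR E_radial rotz_scaleR)

section \<open>Bijectivity of the corrected map\<close>

definition turn_angle :: "real^3 \<Rightarrow> real \<Rightarrow> real" where "turn_angle x s = s + E (rotz s x)"

lemma turn_angle_derivative:
  "x \<noteq> 0 \<Longrightarrow> (turn_angle x has_real_derivative 1 + g (rotz s x)) (at s)"
  unfolding turn_angle_def[abs_def] by (intro derivative_intros has_derivative_E)

lemma turn_angle_less: "x \<noteq> 0 \<Longrightarrow> s < t \<Longrightarrow> turn_angle x s < turn_angle x t"
proof (rule DERIV_pos_imp_increasing[of s t "turn_angle x"])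
  fix u assume x: "x \<noteq> 0"
  have "rotz u x \<noteq> 0" using x by simp
  then have "1 + g (rotz u x) > 0" using R_pos density_pos by (simp add: g_def)
  then show "\<exists>y. (turn_angle x has_real_derivative y) (at u) \<and> y > 0"
    using turn_angle_derivative[OF x] by blast
qed

text \<open>Together with monotonicity this makes the longitude correction a bijection of each
  circle of latitude.\<close>

lemma turn_angle_shift: "turn_angle x (s + 2 * pi * of_int k) = turn_angle x s + 2 * pi * of_int k"
  by (simp add: turn_angle_def rotz_periodic)

lemma turn_angle_surj: "x \<noteq> 0 \<Longrightarrow> \<exists>s. turn_angle x s = \<beta>"
proof -
  assume x: "x \<noteq> 0"
  define k where "k = \<lfloor>(\<beta> - turn_angle x 0) / (2 * pi)\<rfloor>"
  have "of_int k \<le> (\<beta> - turn_angle x 0) / (2 * pi)" "(\<beta> - turn_angle x 0) / (2 * pi) \<le> of_int (k + 1)"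
    unfolding k_def by linarith+
  then have k: "2 * pi * of_int k \<le> \<beta> - turn_angle x 0" "\<beta> - turn_angle x 0 \<le> 2 * pi * of_int (k + 1)"
    by (simp_all add: pos_le_divide_eq pos_divide_le_eq mult.commute)
  have "\<exists>s\<ge>2 * pi * of_int k. s \<le> 2 * pi * of_int (k + 1) \<and> turn_angle x s = \<beta>"
  proof (rule IVT')
    show "turn_angle x (2 * pi * of_int k) \<le> \<beta>" "\<beta> \<le> turn_angle x (2 * pi * of_int (k + 1))"
      using k turn_angle_shift[of x 0 k] turn_angle_shift[of x 0 "k + 1"] by simp_all
    show "continuous_on {2 * pi * of_int k..2 * pi * of_int (k + 1)} (turn_angle x)"
      by (meson DERIV_isCont continuous_at_imp_continuous_on turn_angle_derivative[OF x])
  qed simp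
  then show ?thesis by blast
qed

lemma ratio_bounds: "-1 \<le> x $ 3 / norm x" "x $ 3 / norm x \<le> 1" for x :: "real^3"
  using component_le_norm_cart[of x 3] by (cases "x = 0"; simp add: pos_le_divide_eq pos_divide_le_eq abs_le_iff)+

lemma h_surj: "-1 \<le> c \<Longrightarrow> c \<le> 1 \<Longrightarrow> \<exists>z. -1 \<le> z \<and> z \<le> 1 \<and> h z = c"
  using IVT'[of h "-1" c 1] h_1 h_continuous by auto

lemma h_inj: "inj_on h {-1..1}"
proof (rule inj_onI)
  fix z w assume "z \<in> {-1..1}" "w \<in> {-1..1}" "h z = h w"
  then show "z = w" using h_less[of z w] h_less[of w z] by (cases z w rule: linorder_cases) auto
qed

lemma Psi_surj: "y \<noteq> 0 \<Longrightarrow> \<exists>x. x \<noteq> 0 \<and> \<Psi> x = y"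
proof -
  assume y: "y \<noteq> 0"
  define N where "N = norm y"
  have N: "N > 0" using y by (simp add: N_def)
  obtain z where z: "-1 \<le> z" "z \<le> 1" "h z = y $ 3 / norm y"
    using h_surj[OF ratio_bounds] by blast
  \<comment> \<open>The preimage up to rotation: the point of the required height on the meridian of
    longitude 0. The longitude is then adjusted through \<open>turn_angle\<close>.\<close>
  define x0 :: "real^3" where "x0 = vector [N * sqrt (1 - z\<^sup>2), 0, N * z]"
  have z2: "z\<^sup>2 \<le> 1" using z by (simp add: abs_square_le_1 abs_le_iff)
  have "(norm x0)\<^sup>2 = N\<^sup>2" unfolding norm_sq3 x0_def using z2 by (simp add: power_mult_distrib algebra_simps)
  then have n0: "norm x0 = N" using N by simp
  have x0: "x0 \<noteq> 0" using n0 N by auto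
  have M3: "M x0 $ 3 = y $ 3" using N z(3) by (simp add: M_nth n0) (simp add: x0_def N_def)
  have M2: "M x0 $ 2 = 0" by (simp add: M_nth x0_def)
  have M1: "M x0 $ 1 \<ge> 0" using m_nonneg[OF x0] N z2 by (simp add: M_nth) (simp add: x0_def)
  have "(M x0 $ 1)\<^sup>2 = (y$1)\<^sup>2 + (y$2)\<^sup>2"
    using norm_sq3[of "M x0"] norm_sq3[of y] norm_M[OF x0] M3 M2 n0 by (simp add: N_def)
  then have "M x0 $ 1 = sqrt ((y$1)\<^sup>2 + (y$2)\<^sup>2)" using M1 by (metis real_sqrt_unique)
  then have "M x0 = vector [sqrt ((y$1)\<^sup>2 + (y$2)\<^sup>2), 0, y$3]" using M2 M3 by (simp add: vec3_eq_iff)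
  then obtain \<beta> where "y = rotz \<beta> (M x0)" using rotz_normalize[of y] by metis
  moreover obtain s where "turn_angle x0 s = \<beta>" using turn_angle_surj[OF x0] by blast
  ultimately have "\<Psi> (rotz s x0) = y" using Psi_rotz[OF x0] by (simp add: turn_angle_def)
  then show ?thesis using x0 by (intro exI[of _ "rotz s x0"]) simp
qed

lemma Psi_inj: "inj_on \<Psi> (- {0})"
proof (rule inj_onI)
  fix x y assume "x \<in> - {0}" "y \<in> - {0}" and e: "\<Psi> x = \<Psi> y"
  then have x: "x \<noteq> 0" and y: "y \<noteq> 0" by auto
  have n: "norm x = norm y" using e norm_Psi[OF x] norm_Psi[OF y] by simp
  have "Z x = Z y" using e Psi_nth3[of x] Psi_nth3[of y] n y by simp
  then have "x $ 3 / norm x = y $ 3 / norm y"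
    using inj_onD[OF h_inj] ratio_bounds[of x] ratio_bounds[of y] by auto
  then have x3: "x $ 3 = y $ 3" using n y by simp
  then have r: "(x$1)\<^sup>2 + (x$2)\<^sup>2 = (y$1)\<^sup>2 + (y$2)\<^sup>2" using norm_sq3[of x] norm_sq3[of y] n by simp
  define x0 :: "real^3" where "x0 = vector [sqrt ((x$1)\<^sup>2 + (x$2)\<^sup>2), 0, x$3]"
  obtain s where s: "x = rotz s x0" using rotz_normalize[of x] unfolding x0_def by blast
  obtain t where t: "y = rotz t x0" using rotz_normalize[of y] unfolding x0_def r x3 by blast
  have x0: "x0 \<noteq> 0" using x s by auto
  have e': "rotz (turn_angle x0 s) (M x0) = rotz (turn_angle x0 t) (M x0)"
    using e Psi_rotz[OF x0] unfolding s t turn_angle_def by simp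
  show "x = y"
  \<comment> \<open>On the axis rotations act trivially. Off the axis the image has a nonzero
    horizontal part, so equal images force the values of \<open>turn_angle\<close> to agree modulo
    full turns.\<close>
  proof (cases "(x$1)\<^sup>2 + (x$2)\<^sup>2 = 0")
    case True
    then have "x0 $ 1 = 0" "x0 $ 2 = 0" by (simp_all add: x0_def)
    then show ?thesis unfolding s t by (simp add: vec3_eq_iff)
  next
    case False
    then have p: "(x$1)\<^sup>2 + (x$2)\<^sup>2 > 0" using sum_power2_ge_zero[of "x$1" "x$2"] by linarith
    have n0: "norm x0 = norm x" unfolding s by simp
    have "(x$3)\<^sup>2 < (norm x)\<^sup>2" using norm_sq3[of x] p by simp
    then have "\<bar>x$3\<bar> < norm x" using abs_square_less_1[of "x$3 / norm x"] x by (simp add: power_divide)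
    then have "-1 < x$3 / norm x" "x$3 / norm x < 1" using x by (auto simp: pos_less_divide_eq pos_divide_less_eq abs_less_iff)
    then have "-1 < Z x" "Z x < 1" using h_less[of "-1" "x$3 / norm x"] h_less[of "x$3 / norm x" 1] h_1 by auto
    then have "(Z x)\<^sup>2 < 1" by (simp add: abs_square_less_1 abs_less_iff)
    moreover have "Z x0 = Z x" unfolding n0 by (simp add: x0_def)
    ultimately have "(norm x0)\<^sup>2 * (1 - (Z x0)\<^sup>2) \<noteq> 0" using x n0 by simp
    then have "m x0 \<noteq> 0" using m_sq[OF x0] by auto
    moreover have x01: "x0 $ 1 \<noteq> 0" "x0 $ 2 = 0" using False by (simp_all add: x0_def)
    ultimately have M1: "M x0 $ 1 \<noteq> 0" "M x0 $ 2 = 0" using x01 by (simp_all add: M_nth)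
    have "cos (turn_angle x0 s) = cos (turn_angle x0 t)" "sin (turn_angle x0 s) = sin (turn_angle x0 t)"
      using arg_cong[OF e', of "\<lambda>v. v $ 1"] arg_cong[OF e', of "\<lambda>v. v $ 2"] M1 by simp_all
    then obtain k :: int where "turn_angle x0 s = turn_angle x0 t + 2 * pi * k"
      using sin_cos_eq_iff[of "turn_angle x0 s" "turn_angle x0 t"] by blast
    then have "turn_angle x0 s = turn_angle x0 (t + 2 * pi * k)" by (simp add: turn_angle_shift)
    then have "s = t + 2 * pi * k" using turn_angle_less[OF x0, of s "t + 2 * pi * k"] turn_angle_less[OF x0, of "t + 2 * pi * k" s]
      by (cases s "t + 2 * pi * k" rule: linorder_cases) auto
    then show ?thesis unfolding s t by (simp add: rotz_periodic)
  qed
qed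

section \<open>The Jacobian determinant of the corrected map\<close>

abbreviation D :: "real^3 \<Rightarrow> real^3 \<Rightarrow> real^3" where "D x \<equiv> frechet_derivative \<Psi> (at x)"

lemma Psi_derivative: "x \<noteq> 0 \<Longrightarrow> (\<Psi> has_derivative D x) (at x)"
  by (rule smooth_on_open_has_derivative[OF smooth_Psi]) simp

lemma linear_D: "x \<noteq> 0 \<Longrightarrow> linear (D x)"
  using Psi_derivative has_derivative_linear by blast

lemma Psi_curve:
  assumes "(c has_vector_derivative v) (at t)" "c t \<noteq> 0"
  shows "((\<lambda>s. \<Psi> (c s)) has_vector_derivative D (c t) v) (at t)"
  using vector_derivative_diff_chain_within[OF assms(1) has_derivative_at_withinI[OF Psi_derivative[OF assms(2)]]]
  by (simp add: o_def)

lemma D_rotation: "x \<noteq> 0 \<Longrightarrow> D x (axis 3 1 \<otimes> x) = (1 + g x) *\<^sub>R (axis 3 1 \<otimes> \<Psi> x)"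
proof -
  assume x: "x \<noteq> 0"
  have "((\<lambda>s. \<Psi> (rotz s x)) has_vector_derivative D x (axis 3 1 \<otimes> x)) (at 0)"
    using Psi_curve[OF has_vector_derivative_rotz, of 0 x] x by simp
  moreover have "((\<lambda>s. rotz (turn_angle x s) (M x)) has_vector_derivative (1 + g x) *\<^sub>R (axis 3 1 \<otimes> rotz (turn_angle x 0) (M x))) (at 0)"
    using vector_diff_chain_at[OF _ has_vector_derivative_rotz, of "turn_angle x" "1 + g x" 0 "M x"] turn_angle_derivative[OF x, of 0]
    by (simp add: o_def has_real_derivative_iff_has_vector_derivative)
  moreover have "rotz (turn_angle x 0) (M x) = \<Psi> x" by (simp add: turn_angle_def \<Psi>_def)
  moreover have "(\<lambda>s. \<Psi> (rotz s x)) = (\<lambda>s. rotz (turn_angle x s) (M x))" by (simp add: Psi_rotz[OF x] turn_angle_def)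
  ultimately show ?thesis using vector_derivative_unique_at by metis
qed

lemma D_radial: "x \<noteq> 0 \<Longrightarrow> D x x = \<Psi> x"
proof -
  assume x: "x \<noteq> 0"
  have e: "((\<lambda>t. exp t *\<^sub>R y) has_vector_derivative y) (at 0)" for y :: "real^3"
    by (auto intro!: derivative_eq_intros)
  have "((\<lambda>t. \<Psi> (exp t *\<^sub>R x)) has_vector_derivative D x x) (at 0)"
    using Psi_curve[OF e, of x] x by simp
  moreover have "(\<lambda>t. \<Psi> (exp t *\<^sub>R x)) = (\<lambda>t. exp t *\<^sub>R \<Psi> x)" using Psi_scaleR[OF x] by simp
  ultimately show ?thesis using vector_derivative_unique_at e by metis
qed

text \<open>Preservation of the norm, differentiated. In particular the tangent planes of spheres go
  to tangent planes.\<close>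

lemma D_inner: "x \<noteq> 0 \<Longrightarrow> \<Psi> x \<bullet> D x v = x \<bullet> v"
proof -
  assume x: "x \<noteq> 0"
  have "((\<lambda>y. \<Psi> y \<bullet> \<Psi> y) has_derivative (\<lambda>v. \<Psi> x \<bullet> D x v + D x v \<bullet> \<Psi> x)) (at x)"
    by (intro has_derivative_inner Psi_derivative x)
  moreover have "((\<lambda>y. \<Psi> y \<bullet> \<Psi> y) has_derivative (\<lambda>v. x \<bullet> v + v \<bullet> x)) (at x)"
  proof (rule has_derivative_transform_within_open)
    show "((\<lambda>y. y \<bullet> y) has_derivative (\<lambda>v. x \<bullet> v + v \<bullet> x)) (at x)"
      by (intro has_derivative_inner has_derivative_ident)
    show "y \<bullet> y = \<Psi> y \<bullet> \<Psi> y" if "y \<in> - {0}" for y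
      using norm_Psi[of y] that by (simp add: power2_norm_eq_inner[symmetric])
  qed (use x open_nonzero in auto)
  ultimately have "(\<lambda>v. \<Psi> x \<bullet> D x v + D x v \<bullet> \<Psi> x) = (\<lambda>v. x \<bullet> v + v \<bullet> x)"
    by (rule has_derivative_unique)
  from fun_cong[OF this, of v] show ?thesis by (simp add: inner_commute)
qed

text \<open>The direction is \<open>(norm x)\<^sup>2\<close> times the projection of the polar axis
  to the plane orthogonal to x. Along the straight line in this direction the norm is stationary at
  x, so only h contributes to the derivative of the third coordinate.\<close>

lemma D_meridian:
  assumes x: "\<bar>x $ 3\<bar> < norm x"
  shows "D x ((norm x)\<^sup>2 *\<^sub>R axis 3 1 - (x$3) *\<^sub>R x) $ 3 = 2 * R x * ((norm x)\<^sup>2 - (x$3)\<^sup>2)"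
proof -
  define N where "N = norm x"
  define v where "v = N\<^sup>2 *\<^sub>R axis 3 1 - (x$3) *\<^sub>R x"
  have N: "N > 0" using x by (auto simp: N_def)
  then have x0: "x \<noteq> 0" by (auto simp: N_def)
  have xv: "x \<bullet> v = 0" using norm_sq3[of x] by (simp add: v_def N_def inner_diff_right inner_axis power2_norm_eq_inner)
  define c where "c t = x + t *\<^sub>R v" for t
  have cn: "norm (c t) = sqrt (N\<^sup>2 + t\<^sup>2 * (v \<bullet> v))" for t
    unfolding norm_eq_sqrt_inner c_def using xv
    by (simp add: inner_add_left inner_add_right inner_commute power2_eq_square N_def norm_eq_sqrt_inner)
  have v3: "v $ 3 = N\<^sup>2 - (x$3)\<^sup>2" by (simp add: v_def axis_def power2_eq_square)
  have dc: "(c has_vector_derivative v) (at 0)" unfolding c_def by (auto intro!: derivative_eq_intros)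
  have c0: "c 0 = x" by (simp add: c_def)
  have "((\<lambda>t. \<Psi> (c t)) has_vector_derivative D x v) (at 0)"
    using Psi_curve[OF dc] x0 c0 by simp
  then have 1: "((\<lambda>t. \<Psi> (c t) $ 3) has_real_derivative D x v $ 3) (at 0)"
    unfolding has_real_derivative_iff_has_vector_derivative
    by (rule bounded_linear.has_vector_derivative[OF bounded_linear_vec_nth])
  define n where "n t = sqrt (N\<^sup>2 + t\<^sup>2 * (v \<bullet> v))" for t
  have dn: "(n has_real_derivative 0) (at 0)"
    unfolding n_def using N by (auto intro!: derivative_eq_intros)
  have n0: "n 0 = N" using N by (simp add: n_def)
  have d3: "((\<lambda>t. x$3 + t * v$3) has_real_derivative v$3) (at 0)" by (auto intro!: derivative_eq_intros)
  have q: "((\<lambda>t. (x$3 + t * v$3) / n t) has_real_derivative v$3 / N) (at 0)"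
    using DERIV_divide[OF d3 dn] N n0 by simp
  have "(h has_real_derivative 2 * R x) (at ((x$3 + 0 * v$3) / n 0))"
    using h_derivative_ratio[OF x] n0 by (simp add: N_def)
  from DERIV_mult[OF dn DERIV_chain2[OF this q]]
  have 2: "((\<lambda>t. n t * h ((x$3 + t * v$3) / n t)) has_real_derivative N * (2 * R x * (v$3 / N))) (at 0)"
    by (simp add: n0 mult.commute)
  have "\<Psi> (c t) $ 3 = n t * h ((x$3 + t * v$3) / n t)" for t
    unfolding Psi_nth3 cn n_def[symmetric] by (simp add: c_def)
  then have "D x v $ 3 = N * (2 * R x * (v$3 / N))" using DERIV_unique[OF 1] 2 by simp
  then show ?thesis using N by (simp add: v3) (simp add: v_def N_def)
qed

text \<open>Evaluated on the frame of x, the rotation direction and the meridian direction. By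
  \<open>tri\<close> only the third coordinate of the image of the meridian direction enters, so its
  horizontal part, which would involve derivatives of E and m, is never computed. The factors R
  cancel and leave \<rho>.\<close>

lemma det_D_off_axis:
  assumes x: "\<bar>x $ 3\<bar> < norm x"
  shows "D x (axis 1 1) \<bullet> (D x (axis 2 1) \<otimes> D x (axis 3 1)) = 4 * pi * \<rho> x"
proof -
  define u where "u = axis 3 1 \<otimes> x"
  define v where "v = (norm x)\<^sup>2 *\<^sub>R axis 3 1 - (x$3) *\<^sub>R x"
  have n: "norm x > 0" using x by linarith
  then have x0: "x \<noteq> 0" by auto
  define r where "r = (norm x)\<^sup>2 - (x$3)\<^sup>2"
  have r: "r > 0" unfolding r_def using x by (simp add: power2_strict_mono)
  have xv: "x \<bullet> v = 0" using norm_sq3[of x] by (simp add: v_def inner_diff_right inner_axis power2_norm_eq_inner)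
  have v3: "v $ 3 = r" by (simp add: v_def axis_def r_def power2_eq_square)
  have tri: "a \<bullet> ((axis 3 1 \<otimes> a) \<otimes> b) = (norm a)\<^sup>2 * b$3 - a$3 * (a \<bullet> b)" for a b :: "real^3"
    unfolding power2_norm_eq_inner by (simp add: inner_real3 cross3_nth axis_def algebra_simps)
  have "(D x (axis 1 1) \<bullet> (D x (axis 2 1) \<otimes> D x (axis 3 1))) * (x \<bullet> (u \<otimes> v)) = D x x \<bullet> (D x u \<otimes> D x v)"
    by (rule linear_triple_product[OF linear_D[OF x0], symmetric])
  also have "\<dots> = (1 + g x) * (\<Psi> x \<bullet> ((axis 3 1 \<otimes> \<Psi> x) \<otimes> D x v))"
    unfolding D_radial[OF x0] u_def D_rotation[OF x0] by (simp add: cross_mult_left)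
  also have "\<dots> = (1 + g x) * ((norm x)\<^sup>2 * (2 * R x * r))"
    unfolding tri D_inner[OF x0] norm_Psi[OF x0] xv using D_meridian[OF x] by (simp add: v_def r_def)
  also have "\<dots> = 4 * pi * \<rho> x * ((norm x)\<^sup>2 * r)" using R_pos[OF x0] by (simp add: g_def)
  finally have "(D x (axis 1 1) \<bullet> (D x (axis 2 1) \<otimes> D x (axis 3 1))) * (x \<bullet> (u \<otimes> v)) = 4 * pi * \<rho> x * ((norm x)\<^sup>2 * r)" .
  moreover have "x \<bullet> (u \<otimes> v) = (norm x)\<^sup>2 * r" unfolding u_def tri xv v3 by simp
  moreover have "(norm x)\<^sup>2 * r \<noteq> 0" using n r by simp
  ultimately show ?thesis by (metis mult_right_cancel)
qed

text \<open>The frame degenerates on the axis; there the formula follows by continuity, approaching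
  along the first coordinate direction.\<close>

lemma det_D:
  assumes x: "x \<noteq> 0"
  shows "D x (axis 1 1) \<bullet> (D x (axis 2 1) \<otimes> D x (axis 3 1)) = 4 * pi * \<rho> x"
proof (cases "\<bar>x $ 3\<bar> < norm x")
  case False
  define F where "F x = D x (axis 1 1) \<bullet> (D x (axis 2 1) \<otimes> D x (axis 3 1)) - 4 * pi * \<rho> x" for x
  have "smooth_on_open (- {0}) F"
    unfolding F_def[abs_def]
    by (intro smooth_intros open_nonzero smooth_on_open_cross3 smooth_on_open_derivative[OF smooth_Psi] smooth_density)
      (simp_all add: Basis_real3)
  then have "isCont F x"
    using smooth_on_open_imp_continuous_on continuous_on_eq_continuous_at[OF open_nonzero] x by blast
  moreover have "(\<lambda>t. x + t *\<^sub>R axis 1 1) \<midarrow>0\<rightarrow> x"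
    by (rule tendsto_eq_intros refl)+ simp
  ultimately have lim: "(\<lambda>t. F (x + t *\<^sub>R axis 1 1)) \<midarrow>0\<rightarrow> F x"
    using isCont_tendsto_compose by blast
  have 3: "\<bar>x $ 3\<bar> = norm x" using False component_le_norm_cart[of x 3] by simp
  have "(norm x)\<^sup>2 = (x$3)\<^sup>2" unfolding 3[symmetric] by simp
  then have "(x$1)\<^sup>2 + (x$2)\<^sup>2 = 0" using norm_sq3[of x] by simp
  then have 12: "x$1 = 0" "x$2 = 0" by (simp_all add: sum_power2_eq_zero_iff)
  have "F (x + t *\<^sub>R axis 1 1) = 0" if t: "t \<noteq> 0" for t
  proof -
    have "(norm (x + t *\<^sub>R axis 1 1))\<^sup>2 = t\<^sup>2 + (x$3)\<^sup>2" unfolding norm_sq3 using 12 by (simp add: axis_def)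
    then have "\<bar>(x + t *\<^sub>R axis 1 1) $ 3\<bar>\<^sup>2 < (norm (x + t *\<^sub>R axis 1 1))\<^sup>2" using t by (simp add: axis_def)
    then have "\<bar>(x + t *\<^sub>R axis 1 1) $ 3\<bar> < norm (x + t *\<^sub>R axis 1 1)" by (rule power2_less_imp_less) simp
    from det_D_off_axis[OF this] show ?thesis by (simp add: F_def)
  qed
  then have "(\<lambda>t. F (x + t *\<^sub>R axis 1 1)) \<midarrow>0\<rightarrow> 0" by (intro LIM_I) auto
  then have "F x = 0" using lim LIM_unique by blast
  then show ?thesis by (simp add: F_def)
qed (rule det_D_off_axis)

lemma D_triple: "x \<noteq> 0 \<Longrightarrow> D x a \<bullet> (D x b \<otimes> D x c) = 4 * pi * \<rho> x * (a \<bullet> (b \<otimes> c))"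
  by (subst linear_triple_product[OF linear_D], assumption, subst det_D, assumption, rule refl)

lemma inj_D: "x \<noteq> 0 \<Longrightarrow> inj (D x)"
proof -
  assume x: "x \<noteq> 0"
  have "v = 0" if v: "D x v = 0" for v
  proof -
    have "v \<bullet> (b \<otimes> c) = 0" for b c
      using D_triple[OF x, of v b c] density_pos[OF x] v by simp
    from this[of "axis 2 1" "axis 3 1"] this[of "axis 3 1" "axis 1 1"] this[of "axis 1 1" "axis 2 1"]
    show ?thesis by (simp add: vec3_eq_iff inner_real3 cross3_nth axis_def)
  qed
  then show ?thesis using linear_inj_iff_eq_0[OF linear_D[OF x]] by blast
qed

end

section \<open>Conjugation of Hamiltonian flows\<close>

text \<open>An area-preserving diffeomorphism of spheres, extended to nonzero vectors with the norm
  preserved, so that its derivatives are ordinary ones on an open set. The inner product condition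
  guarantees that tangent planes go to tangent planes.\<close>

locale sphere_conjugation =
  fixes G G' :: "real^3 \<Rightarrow> real^3" and \<sigma> \<tau> :: "(real^3) two_form"
  assumes smooth: "smooth_on_open (- {0}) G" "smooth_on_open (- {0}) G'"
    and norms: "\<And>x. x \<noteq> 0 \<Longrightarrow> norm (G x) = norm x" "\<And>x. x \<noteq> 0 \<Longrightarrow> norm (G' x) = norm x"
    and inverse: "\<And>x. x \<noteq> 0 \<Longrightarrow> G' (G x) = x" "\<And>x. x \<noteq> 0 \<Longrightarrow> G (G' x) = x"
    and inner: "\<And>x v. x \<noteq> 0 \<Longrightarrow> G x \<bullet> frechet_derivative G (at x) v = x \<bullet> v"
    and pullback: "\<And>p u v. p \<in> S2 \<Longrightarrow> p \<bullet> u = 0 \<Longrightarrow> p \<bullet> v = 0 \<Longrightarrow>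
      \<tau> (G p) (frechet_derivative G (at p) u) (frechet_derivative G (at p) v) = \<sigma> p u v"
begin

lemma nonzero: "x \<noteq> 0 \<Longrightarrow> G x \<noteq> 0" "x \<noteq> 0 \<Longrightarrow> G' x \<noteq> 0"
  using norms[of x] by (metis norm_eq_zero)+

lemma S2_nonzero: "p \<in> S2 \<Longrightarrow> p \<noteq> (0::real^3)"
  by auto

lemma S2_maps: "p \<in> S2 \<Longrightarrow> G p \<in> S2" "p \<in> S2 \<Longrightarrow> G' p \<in> S2"
  using norms(1)[OF S2_nonzero] norms(2)[OF S2_nonzero] by simp_all

lemma derivatives: "x \<noteq> 0 \<Longrightarrow> (G has_derivative frechet_derivative G (at x)) (at x)"
  "x \<noteq> 0 \<Longrightarrow> (G' has_derivative frechet_derivative G' (at x)) (at x)"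
  by (rule smooth_on_open_has_derivative[OF smooth(1)], simp)
    (rule smooth_on_open_has_derivative[OF smooth(2)], simp)

lemma derivative_inverse:
  assumes y: "y \<noteq> 0"
  shows "frechet_derivative G (at (G' y)) (frechet_derivative G' (at y) v) = v"
proof -
  have "((\<lambda>z. G (G' z)) has_derivative (\<lambda>v. frechet_derivative G (at (G' y)) (frechet_derivative G' (at y) v))) (at y)"
    by (rule has_derivative_compose[OF derivatives(2)[OF y] derivatives(1)[OF nonzero(2)[OF y]]])
  moreover have "((\<lambda>z. G (G' z)) has_derivative (\<lambda>v. v)) (at y)"
    by (rule has_derivative_transform_within_open[OF has_derivative_ident open_nonzero]) (use y inverse(2) in auto)
  ultimately have "(\<lambda>v. frechet_derivative G (at (G' y)) (frechet_derivative G' (at y) v)) = (\<lambda>v. v)"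
    by (rule has_derivative_unique)
  then show ?thesis by (rule fun_cong)
qed

text \<open>The derivative of the inverse inverts the derivative of G, so all conditions pass over
  with the two forms exchanged. Equivalences can then be transferred in both directions.\<close>

lemma swap: "sphere_conjugation G' G \<tau> \<sigma>"
proof
  have i: "G' x \<bullet> frechet_derivative G' (at x) v = x \<bullet> v" if x: "x \<noteq> 0" for x v
    using inner[OF nonzero(2)[OF x], of "frechet_derivative G' (at x) v"]
    unfolding derivative_inverse[OF x] inverse(2)[OF x] by simp
  then show "\<And>x v. x \<noteq> 0 \<Longrightarrow> G' x \<bullet> frechet_derivative G' (at x) v = x \<bullet> v" .
  fix p u v assume p: "p \<in> S2" and uv: "p \<bullet> u = 0" "p \<bullet> v = 0"
  have p0: "p \<noteq> 0" by (rule S2_nonzero[OF p])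
  show "\<sigma> (G' p) (frechet_derivative G' (at p) u) (frechet_derivative G' (at p) v) = \<tau> p u v"
    using pullback[OF S2_maps(2)[OF p], of "frechet_derivative G' (at p) u" "frechet_derivative G' (at p) v"]
    unfolding derivative_inverse[OF p0] inverse(2)[OF p0] i[OF p0] using uv by simp
qed (fact smooth norms inverse)+

abbreviation GG :: "point \<Rightarrow> point" where "GG \<equiv> map_prod G G"
abbreviation GG' :: "point \<Rightarrow> point" where "GG' \<equiv> map_prod G' G'"

text \<open>Naturality: pulling back the form and the Hamiltonian by the same map conjugates the
  flow. Since G acts on both factors alike, the weights a and b are kept.\<close>

lemma hamiltonian_flow_conjugate:
  assumes flow: "hamiltonian_flow (sum_form (scale_form a \<tau>) (scale_form b \<tau>)) H \<Phi>"
  shows "hamiltonian_flow (sum_form (scale_form a \<sigma>) (scale_form b \<sigma>)) (\<lambda>y. H (fst y, GG (snd y))) (\<lambda>t x. GG' (\<Phi> t (GG x)))"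
proof -
  obtain U where U: "open U" "{0..1} \<times> S2xS2 \<subseteq> U" "smooth_on_open U H" using hamiltonian_flowD(1)[OF flow] by blast
  define V :: "(real \<times> point) set" where "V = UNIV \<times> (- {0}) \<times> (- {0})"
  define T where "T y = (fst y, GG (snd y))" for y :: "real \<times> point"
  have oV: "open V" unfolding V_def by (intro open_Times open_UNIV open_nonzero)
  have sT: "smooth_on_open V T"
  proof -
    have "smooth_on_open V (\<lambda>y. G (fst (snd y)))"
    proof (rule smooth_on_open_compose[OF oV open_nonzero _ smooth(1)])
      show "smooth_on_open V (\<lambda>y. fst (snd y))" by (intro smooth_intros oV)
    qed (auto simp: V_def)
    moreover have "smooth_on_open V (\<lambda>y. G (snd (snd y)))"
    proof (rule smooth_on_open_compose[OF oV open_nonzero _ smooth(1)])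
      show "smooth_on_open V (\<lambda>y. snd (snd y))" by (intro smooth_intros oV)
    qed (auto simp: V_def)
    moreover have "T = (\<lambda>y. (fst y, G (fst (snd y)), G (snd (snd y))))" by (simp add: T_def map_prod_def case_prod_unfold fun_eq_iff)
    ultimately show ?thesis by (simp only:) (intro smooth_intros oV; assumption)
  qed
  \<comment> \<open>The domain of the new Hamiltonian: both points are nonzero, and the transformed
    point lies in the domain U of the old one.\<close>
  define W where "W = V \<inter> T -` U"
  have W: "open W" unfolding W_def
    by (rule continuous_open_preimage[OF smooth_on_open_imp_continuous_on[OF sT] oV U(1)])
  have sH: "smooth_on_open W (\<lambda>y. H (T y))"
    by (rule smooth_on_open_compose[OF W U(1) smooth_on_open_subset[OF sT] U(3)]) (auto simp: W_def)
  have GS: "GG x \<in> S2xS2" if "x \<in> S2xS2" for x using that S2_maps(1) by (cases x) simp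
  have GS': "GG' x \<in> S2xS2" if "x \<in> S2xS2" for x using that S2_maps(2) by (cases x) simp
  have inv: "GG' (GG x) = x" "GG (GG' x) = x" if "x \<in> S2xS2" for x
    using that inverse[of "fst x"] inverse[of "snd x"] S2_nonzero[of "fst x"] S2_nonzero[of "snd x"] by (cases x; simp)+
  have sub: "{0..1} \<times> S2xS2 \<subseteq> W"
  proof
    fix y :: "real \<times> point" assume y: "y \<in> {0..1} \<times> S2xS2"
    then have "T y \<in> {0..1} \<times> S2xS2" using GS[of "snd y"] by (auto simp: T_def mem_Times_iff)
    moreover have "y \<in> V" using y by (auto simp: V_def)
    ultimately show "y \<in> W" using U(2) by (auto simp: W_def)
  qed
  have vec: "\<exists>X. hamiltonian_vector (sum_form (scale_form a \<sigma>) (scale_form b \<sigma>)) (\<lambda>z. H (t, GG z)) (GG' (\<Phi> t (GG x))) X \<and>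
      ((\<lambda>s. GG' (\<Phi> s (GG x))) has_vector_derivative X) (at t within {0..1})"
    if t: "t \<in> {0..1}" and x: "x \<in> S2xS2" for t x
  proof -
    define y where "y = \<Phi> t (GG x)"
    have y: "y \<in> S2xS2" unfolding y_def by (rule hamiltonian_flowD(3)[OF flow t GS[OF x]])
    then have yS: "fst y \<in> S2" "snd y \<in> S2" by (simp_all add: mem_Times_iff)
    have y0: "fst y \<noteq> 0" "snd y \<noteq> 0" using yS S2_nonzero by blast+
    obtain X where X: "hamiltonian_vector (sum_form (scale_form a \<tau>) (scale_form b \<tau>)) (\<lambda>z. H (t, z)) y X"
      "((\<lambda>s. \<Phi> s (GG x)) has_vector_derivative X) (at t within {0..1})"
      using hamiltonian_flowD(4)[OF flow t GS[OF x]] unfolding y_def by blast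
    define L where "L v = (frechet_derivative G' (at (fst y)) (fst v), frechet_derivative G' (at (snd y)) (snd v))" for v :: point
    define K where "K v = (frechet_derivative G (at (fst (GG' y))) (fst v), frechet_derivative G (at (snd (GG' y))) (snd v))" for v :: point
    have dL: "(GG' has_derivative L) (at y)"
    proof -
      have "((\<lambda>z. (G' (fst z), G' (snd z))) has_derivative L) (at y)" unfolding L_def
        by (intro has_derivative_Pair has_derivative_compose[OF has_derivative_fst[OF has_derivative_ident] derivatives(2)]
            has_derivative_compose[OF has_derivative_snd[OF has_derivative_ident] derivatives(2)] y0)
      then show ?thesis by (simp only: map_prod_def case_prod_unfold)
    qed
    have gy: "GG' y \<in> S2xS2" by (rule GS'[OF y])
    then have gyS: "fst (GG' y) \<in> S2" "snd (GG' y) \<in> S2" by (simp_all only: mem_Times_iff)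
    then have gy0: "fst (GG' y) \<noteq> 0" "snd (GG' y) \<noteq> 0" using S2_nonzero by blast+
    have dK: "(GG has_derivative K) (at (GG' y))"
    proof -
      have "((\<lambda>z. (G (fst z), G (snd z))) has_derivative K) (at (GG' y))" unfolding K_def
        by (intro has_derivative_Pair has_derivative_compose[OF has_derivative_fst[OF has_derivative_ident] derivatives(1)]
            has_derivative_compose[OF has_derivative_snd[OF has_derivative_ident] derivatives(1)] gy0)
      then show ?thesis by (simp only: map_prod_def case_prod_unfold)
    qed
    have KL: "K (L v) = v" for v
      unfolding K_def L_def using derivative_inverse[OF y0(1)] derivative_inverse[OF y0(2)] by simp
    interpret sw: sphere_conjugation G' G \<tau> \<sigma> by (rule swap)
    have "X \<in> tangent_S2xS2 y" using X(1) by (simp add: hamiltonian_vector_def)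
    then have tX: "fst y \<bullet> fst X = 0" "snd y \<bullet> snd X = 0" by (auto simp: tangent_S2xS2_def tangent_S2_def)
    have tL: "fst (GG' y) \<bullet> fst (L X) = 0" "snd (GG' y) \<bullet> snd (L X) = 0"
      using sw.inner[OF y0(1), of "fst X"] sw.inner[OF y0(2), of "snd X"] tX by (simp_all add: L_def)
    have "(t, y) \<in> U" using U(2) t y by blast
    from smooth_on_open_has_derivative[OF U(3) this]
    have "((\<lambda>z. H (t, z)) has_derivative (\<lambda>v. frechet_derivative H (at (t, y)) (0, v))) (at y)"
      by (rule has_derivative_compose[rotated]) (auto intro!: derivative_eq_intros)
    then have dH: "((\<lambda>z. H (t, z)) has_derivative frechet_derivative (\<lambda>z. H (t, z)) (at (GG (GG' y)))) (at (GG (GG' y)))"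
      unfolding inv(2)[OF y] using frechet_derivative_at by metis
    have dHK: "frechet_derivative (\<lambda>z. H (t, GG z)) (at (GG' y)) = (\<lambda>v. frechet_derivative (\<lambda>z. H (t, z)) (at y) (K v))"
      using has_derivative_compose[OF dK dH] frechet_derivative_at unfolding inv(2)[OF y] by metis
    have "hamiltonian_vector (sum_form (scale_form a \<sigma>) (scale_form b \<sigma>)) (\<lambda>z. H (t, GG z)) (GG' y) (L X)"
      unfolding hamiltonian_vector_def
    proof (intro conjI ballI)
      show "L X \<in> tangent_S2xS2 (GG' y)" using tL by (simp add: tangent_S2xS2_def tangent_S2_def mem_Times_iff)
      fix v assume "v \<in> tangent_S2xS2 (GG' y)"
      then have tv: "fst (GG' y) \<bullet> fst v = 0" "snd (GG' y) \<bullet> snd v = 0"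
        by (simp_all add: tangent_S2xS2_def tangent_S2_def mem_Times_iff)
      have tK: "fst y \<bullet> fst (K v) = 0" "snd y \<bullet> snd (K v) = 0"
        using inner[OF gy0(1), of "fst v"] inner[OF gy0(2), of "snd v"] tv inverse(2)[OF y0(1)] inverse(2)[OF y0(2)]
        by (simp_all add: K_def)
      then have Kt: "K v \<in> tangent_S2xS2 y" by (simp add: tangent_S2xS2_def tangent_S2_def mem_Times_iff)
      have "sum_form (scale_form a \<sigma>) (scale_form b \<sigma>) (GG' y) (L X) v = sum_form (scale_form a \<tau>) (scale_form b \<tau>) (GG (GG' y)) (K (L X)) (K v)"
        using pullback[OF gyS(1) tL(1) tv(1)] pullback[OF gyS(2) tL(2) tv(2)]
        by (simp add: sum_form_def scale_form_def K_def)
      also have "\<dots> = frechet_derivative (\<lambda>z. H (t, z)) (at y) (K v)"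
        unfolding KL inv(2)[OF y] using X(1) Kt by (simp add: hamiltonian_vector_def)
      finally show "sum_form (scale_form a \<sigma>) (scale_form b \<sigma>) (GG' y) (L X) v = frechet_derivative (\<lambda>z. H (t, GG z)) (at (GG' y)) v"
        unfolding dHK .
    qed
    moreover have "((\<lambda>s. GG' (\<Phi> s (GG x))) has_vector_derivative L X) (at t within {0..1})"
      using vector_derivative_diff_chain_within[OF X(2) has_derivative_at_withinI[OF dL[unfolded y_def]]]
      by (simp only: o_def y_def)
    ultimately show ?thesis unfolding y_def by blast
  qed
  show ?thesis
    unfolding hamiltonian_flow_def
  proof (intro conjI ballI exI[of _ W] W sub)
    show "smooth_on_open W (\<lambda>y. H (fst y, GG (snd y)))" using sH by (simp add: T_def)
    show "GG' (\<Phi> 0 (GG x)) = x" if "x \<in> S2xS2" for x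
      unfolding hamiltonian_flowD(2)[OF flow GS[OF that]] by (rule inv(1)[OF that])
    show "GG' (\<Phi> t (GG x)) \<in> S2xS2" if "t \<in> {0..1}" "x \<in> S2xS2" for t x
      by (rule GS'[OF hamiltonian_flowD(3)[OF flow that(1) GS[OF that(2)]]])
    show "\<exists>X. hamiltonian_vector (sum_form (scale_form a \<sigma>) (scale_form b \<sigma>)) (\<lambda>z. H (fst (t, z), GG (snd (t, z)))) (GG' (\<Phi> t (GG x))) X \<and>
      ((\<lambda>s. GG' (\<Phi> s (GG x))) has_vector_derivative X) (at t within {0..1})" if "t \<in> {0..1}" "x \<in> S2xS2" for t x
      unfolding fst_conv snd_conv by (rule vec[OF that])
  qed
qed

lemma ham_equivalent_conjugate:
  assumes e: "ham_equivalent (sum_form (scale_form a \<tau>) (scale_form b \<tau>)) L L'" and L: "L \<subseteq> S2xS2"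
  shows "ham_equivalent (sum_form (scale_form a \<sigma>) (scale_form b \<sigma>)) (GG' ` L) (GG' ` L')"
proof -
  obtain H \<Phi> where flow: "hamiltonian_flow (sum_form (scale_form a \<tau>) (scale_form b \<tau>)) H \<Phi>" "\<Phi> 1 ` L = L'"
    using ham_equivalentE[OF e L] by blast
  have "GG (GG' x) = x" if "x \<in> L" for x
  proof -
    have "fst x \<noteq> 0" "snd x \<noteq> 0" using subsetD[OF L that] S2_nonzero by (auto simp: mem_Times_iff)
    then show ?thesis using inverse(2) by (cases x) simp
  qed
  then have "(\<lambda>x. GG' (\<Phi> 1 (GG x))) ` GG' ` L = GG' ` \<Phi> 1 ` L"
    unfolding image_image by (intro image_cong) simp_all
  then show ?thesis
    unfolding flow(2)[symmetric] by (rule ham_equivalentI[OF hamiltonian_flow_conjugate[OF flow(1)]])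
qed

end

lemma zone_area_scale_form: "zone_area (scale_form a \<omega>) s t = a * zone_area \<omega> s t"
  by (simp add: zone_area_def scale_form_def)

text \<open>The function k inverts the height function: it locates the parallel on which the
  normalized area takes the value c. Its continuity turns convergence of areas into convergence of
  latitudes.\<close>

lemma area_normal_form:
  assumes "area_form \<omega>" "total_area \<omega> = 1" "northern_area \<omega> = 1 / 2"
  obtains \<Psi> \<Psi>' k where "sphere_conjugation \<Psi> \<Psi>' \<omega> (\<lambda>p u v. 1 / (4 * pi) * (p \<bullet> (u \<otimes> v)))"
    "\<And>p. p \<in> S2 \<Longrightarrow> \<Psi> p $ 3 = 2 * zone_area \<omega> 0 (arcsin (p $ 3))"
    "continuous_on {-1..1} k" "\<And>c. \<bar>c\<bar> < 1 \<Longrightarrow> \<bar>k c\<bar> < 1"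
    "\<And>z c. \<bar>z\<bar> \<le> 1 \<Longrightarrow> \<bar>c\<bar> < 1 \<Longrightarrow> 2 * zone_area \<omega> 0 (arcsin z) = c \<longleftrightarrow> z = k c"
proof -
  obtain \<rho> where \<rho>: "smooth_on_open (- {0}) \<rho>" "radial \<rho>"
    "\<And>p u v. p \<in> S2 \<Longrightarrow> p \<bullet> u = 0 \<Longrightarrow> p \<bullet> v = 0 \<Longrightarrow> \<omega> p u v = \<rho> p * (p \<bullet> (u \<otimes> v))"
    "\<And>x. x \<noteq> 0 \<Longrightarrow> \<rho> x \<noteq> 0"
    by (rule area_form_density[OF assms(1)], rule that)
  define h where "h z = 2 * zone_area \<omega> 0 (arcsin z)" for z
  note hf = height_function[OF \<rho>(3,1,2,4) assms(2,3), folded h_def]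
  interpret nd: normalizable_density \<rho> h
    by (intro normalizable_density.intro \<rho>(1,2) hf)
  define \<Psi> where "\<Psi> = nd.\<Psi>"
  define \<Psi>' where "\<Psi>' = inv_into (- {0}) \<Psi>"
  have inv: "\<Psi>' (\<Psi> x) = x" if "x \<noteq> 0" for x
    unfolding \<Psi>'_def by (rule inv_into_f_f) (use nd.Psi_inj that in \<open>simp_all add: \<Psi>_def\<close>)
  have inv': "\<Psi> (\<Psi>' y) = y" "\<Psi>' y \<noteq> 0" if y: "y \<noteq> 0" for y
  proof -
    obtain x where x: "x \<noteq> 0" "\<Psi> x = y" using nd.Psi_surj[OF y] unfolding \<Psi>_def by blast
    then show "\<Psi> (\<Psi>' y) = y" "\<Psi>' y \<noteq> 0" using inv by auto
  qed
  have nrm: "norm (\<Psi> x) = norm x" if "x \<noteq> 0" for x unfolding \<Psi>_def by (rule nd.norm_Psi[OF that])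
  have smooth': "smooth_on_open (- {0}) \<Psi>'"
  proof (rule smooth_on_open_inverse_map3[OF open_nonzero open_nonzero])
    show "smooth_on_open (- {0}) \<Psi>" unfolding \<Psi>_def by (rule nd.smooth_Psi)
    show "\<Psi>' y \<in> - {0}" "\<Psi> (\<Psi>' y) = y" if "y \<in> - {0}" for y using inv'[of y] that by simp_all
    show "\<Psi>' (\<Psi> x) = x" "inj (frechet_derivative \<Psi> (at x))" if "x \<in> - {0}" for x
      using inv[of x] nd.inj_D[of x] that by (simp_all add: \<Psi>_def)
  qed
  have conj: "sphere_conjugation \<Psi> \<Psi>' \<omega> (\<lambda>p u v. 1 / (4 * pi) * (p \<bullet> (u \<otimes> v)))"
  proof
    show "smooth_on_open (- {0}) \<Psi>" unfolding \<Psi>_def by (rule nd.smooth_Psi)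
    show "smooth_on_open (- {0}) \<Psi>'" by (rule smooth')
    show "norm (\<Psi> x) = norm x" "\<Psi>' (\<Psi> x) = x" "\<Psi> (\<Psi>' x) = x" if "x \<noteq> 0" for x by (fact nrm[OF that] inv[OF that] inv'(1)[OF that])+
    show "norm (\<Psi>' x) = norm x" if "x \<noteq> 0" for x using nrm[OF inv'(2)[OF that]] inv'(1)[OF that] by simp
    show "\<Psi> x \<bullet> frechet_derivative \<Psi> (at x) v = x \<bullet> v" if "x \<noteq> 0" for x v
      unfolding \<Psi>_def by (rule nd.D_inner[OF that])
    fix p u v assume p: "p \<in> S2" and uv: "p \<bullet> u = 0" "p \<bullet> v = 0"
    have p0: "p \<noteq> 0" using p by auto
    have "\<Psi> p \<bullet> (frechet_derivative \<Psi> (at p) u \<otimes> frechet_derivative \<Psi> (at p) v) = 4 * pi * \<rho> p * (p \<bullet> (u \<otimes> v))"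
      using nd.D_triple[OF p0, of p u v] unfolding nd.D_radial[OF p0] by (simp add: \<Psi>_def)
    then show "1 / (4 * pi) * (\<Psi> p \<bullet> (frechet_derivative \<Psi> (at p) u \<otimes> frechet_derivative \<Psi> (at p) v)) = \<omega> p u v"
      unfolding \<rho>(3)[OF p uv] by simp
  qed
  define k where "k = inv_into {-1..1} h"
  have im: "h ` {-1..1} = {-1..1}"
  proof
    show "h ` {-1..1} \<subseteq> {-1..1}"
    proof (rule image_subsetI)
      fix z :: real assume "z \<in> {-1..1}"
      then show "h z \<in> {-1..1}" using nd.h_less[of "-1" z] nd.h_less[of z 1] nd.h_1 by (cases "z = 1"; cases "z = -1") auto
    qed
    show "{-1..1} \<subseteq> h ` {-1..1}" using nd.h_surj by force
  qed
  have kh: "k (h z) = z" if "\<bar>z\<bar> \<le> 1" for z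
    unfolding k_def by (rule inv_into_f_f[OF nd.h_inj]) (use that in auto)
  have hk: "h (k c) = c" "k c \<in> {-1..1}" if "\<bar>c\<bar> \<le> 1" for c
    using f_inv_into_f[of c h "{-1..1}"] inv_into_into[of c h "{-1..1}"] that unfolding k_def im by (auto simp: abs_le_iff)
  show thesis
  proof (rule that[OF conj])
    show "\<Psi> p $ 3 = 2 * zone_area \<omega> 0 (arcsin (p $ 3))" if "p \<in> S2" for p
      using nd.Psi_nth3[of p] that by (simp add: \<Psi>_def h_def)
    have "continuous_on (h ` {-1..1}) k"
      by (rule continuous_on_inv[OF nd.h_continuous compact_Icc]) (use kh in auto)
    then show "continuous_on {-1..1} k" unfolding im .
    show "\<bar>k c\<bar> < 1" if c: "\<bar>c\<bar> < 1" for c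
    proof -
      have "k c \<noteq> 1" "k c \<noteq> -1" using hk[of c] c nd.h_1 by auto
      then show ?thesis using hk(2)[of c] c by auto
    qed
    show "2 * zone_area \<omega> 0 (arcsin z) = c \<longleftrightarrow> z = k c" if "\<bar>z\<bar> \<le> 1" "\<bar>c\<bar> < 1" for z c
      using kh[OF that(1)] hk(1)[of c] that(2) unfolding h_def by auto
  qed
qed

section \<open>Convergence of tori of latitude\<close>

text \<open>The phase \<theta> makes the family closed under differentiation: a derivative
  multiplies the radius by 2 pi, sets the height to 0 and advances the phase by a quarter
  turn.\<close>

definition circ :: "real \<Rightarrow> real \<Rightarrow> real \<Rightarrow> real \<Rightarrow> real^3" where
  "circ r z \<theta> s = vector [r * cos (2 * pi * s + \<theta>), r * sin (2 * pi * s + \<theta>), z]"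

lemma circ_nth: "circ r z \<theta> s $ 1 = r * cos (2 * pi * s + \<theta>)" "circ r z \<theta> s $ 2 = r * sin (2 * pi * s + \<theta>)" "circ r z \<theta> s $ 3 = z"
  by (simp_all add: circ_def)

lemma has_vector_derivative_circ:
  "(circ r z \<theta> has_vector_derivative circ (2 * pi * r) 0 (\<theta> + pi / 2) s) (at s)"
proof -
  have e: "cos (2 * pi * s + (\<theta> + pi / 2)) = - sin (2 * pi * s + \<theta>)" "sin (2 * pi * s + (\<theta> + pi / 2)) = cos (2 * pi * s + \<theta>)"
    by (simp_all add: add.assoc[symmetric] cos_add sin_add)
  show ?thesis
    by (rule has_vector_derivative_real3; unfold circ_nth e; auto intro!: derivative_eq_intros)
qed

lemma smooth_on_open_circ:
  "open U \<Longrightarrow> smooth_on_open U u \<Longrightarrow> smooth_on_open U (\<lambda>x. circ r z \<theta> (u x))"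
  by (rule smooth_on_open_vec3, assumption; unfold circ_nth; intro smooth_intros; assumption)

lemma has_derivative_circ:
  assumes "(u has_derivative u') (at x)"
  shows "((\<lambda>x. circ r z \<theta> (u x)) has_derivative (\<lambda>v. u' v *\<^sub>R circ (2 * pi * r) 0 (\<theta> + pi / 2) (u x))) (at x)"
  using has_derivative_compose[OF assms] has_vector_derivative_circ[of r z \<theta> "u x"]
  unfolding has_vector_derivative_def by blast

lemma norm_circ_diff: "norm (circ r z \<theta> s - circ r' z' \<theta> s) \<le> \<bar>r - r'\<bar> + \<bar>z - z'\<bar>"
proof -
  have e: "((r - r') * cos (2 * pi * s + \<theta>))\<^sup>2 + ((r - r') * sin (2 * pi * s + \<theta>))\<^sup>2 = (r - r')\<^sup>2"
    unfolding power_mult_distrib distrib_left[symmetric] by simp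
  have "(norm (circ r z \<theta> s - circ r' z' \<theta> s))\<^sup>2 = ((r - r') * cos (2 * pi * s + \<theta>))\<^sup>2 + ((r - r') * sin (2 * pi * s + \<theta>))\<^sup>2 + (z - z')\<^sup>2"
    unfolding power2_norm_eq_inner inner_real3 by (simp add: circ_nth power2_eq_square left_diff_distrib)
  also have "\<dots> \<le> (\<bar>r - r'\<bar> + \<bar>z - z'\<bar>)\<^sup>2" unfolding e by (simp add: power2_sum)
  finally show ?thesis by (rule power2_le_imp_le) simp
qed

text \<open>Radii, heights, phase and second component are arbitrary because all of them change in
  the induction. The second component is common to both maps and cancels, and a derivative in its
  direction replaces the radius of the first by 0.\<close>

lemma iterated_derivative_circ_diff:
  fixes \<psi> :: "real \<times> real \<Rightarrow> real^3"
  assumes "set vs \<subseteq> Basis" "smooth_on_open UNIV \<psi>"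
  shows "norm (iterated_derivative vs (\<lambda>x. (circ r z \<theta> (fst x), \<psi> x)) x - iterated_derivative vs (\<lambda>x. (circ r' z' \<theta> (fst x), \<psi> x)) x)
    \<le> prod_list (map (\<lambda>v. 2 * pi * \<bar>fst v\<bar>) vs) * \<bar>r - r'\<bar> + \<bar>z - z'\<bar>"
  using assms
proof (induction vs arbitrary: r r' z z' \<theta> \<psi>)
  case Nil
  then show ?case using norm_circ_diff[of r z \<theta> "fst x" r' z'] by (simp add: norm_Pair)
next
  case (Cons v vs)
  have d: "frechet_derivative (\<lambda>x. (circ r z \<theta> (fst x), \<psi> x)) (at x) v =
      (circ (2 * pi * fst v * r) 0 (\<theta> + pi / 2) (fst x), frechet_derivative \<psi> (at x) v)" for r z x
  proof -
    have "((\<lambda>x. (circ r z \<theta> (fst x), \<psi> x)) has_derivative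
        (\<lambda>v. (fst v *\<^sub>R circ (2 * pi * r) 0 (\<theta> + pi / 2) (fst x), frechet_derivative \<psi> (at x) v))) (at x)"
      by (intro has_derivative_Pair has_derivative_circ has_derivative_fst has_derivative_ident
          smooth_on_open_has_derivative[OF Cons.prems(2)]) simp
    from frechet_derivative_at[OF this, symmetric]
    show ?thesis by (simp add: vec3_eq_iff circ_nth algebra_simps)
  qed
  have b: "v \<in> Basis" "set vs \<subseteq> Basis" using Cons.prems(1) by auto
  from Cons.IH[OF b(2) smooth_on_open_derivative[OF Cons.prems(2) b(1)], of "2 * pi * fst v * r" 0 "\<theta> + pi / 2" "2 * pi * fst v * r'" 0]
  have "norm (iterated_derivative (v # vs) (\<lambda>x. (circ r z \<theta> (fst x), \<psi> x)) x - iterated_derivative (v # vs) (\<lambda>x. (circ r' z' \<theta> (fst x), \<psi> x)) x)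
     \<le> prod_list (map (\<lambda>v. 2 * pi * \<bar>fst v\<bar>) vs) * \<bar>2 * pi * fst v * r - 2 * pi * fst v * r'\<bar>"
    by (simp add: d)
  also have "\<bar>2 * pi * fst v * r - 2 * pi * fst v * r'\<bar> = 2 * pi * \<bar>fst v\<bar> * \<bar>r - r'\<bar>"
    unfolding right_diff_distrib[symmetric] abs_mult by simp
  finally show ?case by (simp add: mult.assoc mult.left_commute)
qed

definition latitude_torus :: "real \<Rightarrow> real \<Rightarrow> real \<times> real \<Rightarrow> point" where
  "latitude_torus z w x = (circ (sqrt (1 - z\<^sup>2)) z 0 (fst x), circ (sqrt (1 - w\<^sup>2)) w 0 (snd x))"

lemma circ_eq_iff: "r > 0 \<Longrightarrow> circ r z 0 s = circ r z 0 t \<longleftrightarrow> s - t \<in> \<int>"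
proof -
  assume r: "r > 0"
  have "circ r z 0 s = circ r z 0 t \<longleftrightarrow> (\<exists>n::int. 2 * pi * s = 2 * pi * t + 2 * pi * n)"
    using r sin_cos_eq_iff[of "2 * pi * s" "2 * pi * t"] by (auto simp: vec3_eq_iff circ_nth)
  also have "\<dots> \<longleftrightarrow> (\<exists>n::int. s - t = n)"
  proof (rule ex_cong1)
    fix n :: int
    have "2 * pi * s = 2 * pi * t + 2 * pi * n \<longleftrightarrow> 2 * pi * (s - t) = 2 * pi * n" by (simp add: algebra_simps)
    then show "2 * pi * s = 2 * pi * t + 2 * pi * n \<longleftrightarrow> s - t = n" by simp
  qed
  finally show ?thesis by (auto simp: Ints_def)
qed

lemma circ_range:
  assumes "\<bar>z\<bar> < 1"
  shows "range (circ (sqrt (1 - z\<^sup>2)) z 0) = {p \<in> S2. p $ 3 = z}"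
proof (intro equalityI subsetI)
  have z2: "z\<^sup>2 < 1" using assms by (simp add: abs_square_less_1)
  fix p
  show "p \<in> range (circ (sqrt (1 - z\<^sup>2)) z 0) \<Longrightarrow> p \<in> {p \<in> S2. p $ 3 = z}"
  proof -
    assume "p \<in> range (circ (sqrt (1 - z\<^sup>2)) z 0)"
    then obtain s where s: "p = circ (sqrt (1 - z\<^sup>2)) z 0 s" by blast
    have "(sqrt (1 - z\<^sup>2) * cos (2 * pi * s))\<^sup>2 + (sqrt (1 - z\<^sup>2) * sin (2 * pi * s))\<^sup>2 = 1 - z\<^sup>2"
      unfolding power_mult_distrib distrib_left[symmetric] using z2 by simp
    then show ?thesis unfolding s mem_Collect_eq S2_iff by (simp add: circ_nth)
  qed
  assume "p \<in> {p \<in> S2. p $ 3 = z}"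
  then have p: "p \<in> S2" "p $ 3 = z" by auto
  obtain s where s: "p = rotz s (vector [sqrt ((p$1)\<^sup>2 + (p$2)\<^sup>2), 0, p$3])" using rotz_normalize by blast
  have "(p$1)\<^sup>2 + (p$2)\<^sup>2 = 1 - z\<^sup>2" using p S2_iff[of p] by simp
  then have "p = rotz s (vector [sqrt (1 - z\<^sup>2), 0, z])" using s p(2) by metis
  also have "\<dots> = circ (sqrt (1 - z\<^sup>2)) z 0 (s / (2 * pi))" by (simp add: vec3_eq_iff circ_nth)
  finally show "p \<in> range (circ (sqrt (1 - z\<^sup>2)) z 0)" by blast
qed

lemma torus_embedding_latitude:
  assumes z: "\<bar>z\<bar> < 1" and w: "\<bar>w\<bar> < 1"
  shows "torus_embedding (latitude_torus z w) (round_torus z w)"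
  unfolding torus_embedding_def
proof (intro conjI allI)
  have r: "sqrt (1 - z\<^sup>2) > 0" "sqrt (1 - w\<^sup>2) > 0" using z w by (simp_all add: abs_square_less_1)
  show "smooth_on_open UNIV (latitude_torus z w)" unfolding latitude_torus_def[abs_def]
    by (intro smooth_intros smooth_on_open_circ open_UNIV)
  show "latitude_torus z w (s, t) = latitude_torus z w (s', t') \<longleftrightarrow> s - s' \<in> \<int> \<and> t - t' \<in> \<int>" for s t s' t'
    using circ_eq_iff[OF r(1)] circ_eq_iff[OF r(2)] by (simp add: latitude_torus_def)
  show "inj (frechet_derivative (latitude_torus z w) (at x))" for x
  proof -
    have c: "circ (2 * pi * r) 0 \<theta> s \<noteq> 0" if "r > 0" for r \<theta> s
    proof
      assume "circ (2 * pi * r) 0 \<theta> s = 0"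
      then have "cos (2 * pi * s + \<theta>) = 0" "sin (2 * pi * s + \<theta>) = 0" using that by (auto simp: vec3_eq_iff circ_nth)
      then show False using sin_cos_squared_add[of "2 * pi * s + \<theta>"] by simp
    qed
    have D: "(latitude_torus z w has_derivative (\<lambda>v. (fst v *\<^sub>R circ (2 * pi * sqrt (1 - z\<^sup>2)) 0 (0 + pi / 2) (fst x),
        snd v *\<^sub>R circ (2 * pi * sqrt (1 - w\<^sup>2)) 0 (0 + pi / 2) (snd x)))) (at x)"
      unfolding latitude_torus_def[abs_def]
      by (intro has_derivative_Pair has_derivative_circ has_derivative_fst has_derivative_snd has_derivative_ident)
    show ?thesis unfolding frechet_derivative_at[OF D, symmetric]
      using c[OF r(1)] c[OF r(2)] by (intro injI) (auto simp: prod_eq_iff)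
  qed
  have "range (latitude_torus z w) = range (circ (sqrt (1 - z\<^sup>2)) z 0) \<times> range (circ (sqrt (1 - w\<^sup>2)) w 0)"
  proof (intro equalityI subsetI)
    fix x assume "x \<in> range (circ (sqrt (1 - z\<^sup>2)) z 0) \<times> range (circ (sqrt (1 - w\<^sup>2)) w 0)"
    then obtain s t where "x = (circ (sqrt (1 - z\<^sup>2)) z 0 s, circ (sqrt (1 - w\<^sup>2)) w 0 t)" by blast
    then have "x = latitude_torus z w (s, t)" by (simp add: latitude_torus_def)
    then show "x \<in> range (latitude_torus z w)" by blast
  qed (auto simp: latitude_torus_def)
  then show "range (latitude_torus z w) = round_torus z w"
    unfolding circ_range[OF z] circ_range[OF w] round_torus_def .
qed

lemma tori_converge_latitude:
  assumes z: "\<And>i. \<bar>z i\<bar> < 1" "z \<longlonglongrightarrow> z0" "\<bar>z0\<bar> < 1" and w: "\<bar>w\<bar> < 1"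
  shows "tori_converge_smoothly (\<lambda>i. round_torus (z i) w) (round_torus z0 w)"
  unfolding tori_converge_smoothly_def
proof (intro exI[of _ "\<lambda>i. latitude_torus (z i) w"] exI[of _ "latitude_torus z0 w"] conjI allI impI
    torus_embedding_latitude z w)
  fix vs :: "(real \<times> real) list" assume vs: "set vs \<subseteq> Basis"
  \<comment> \<open>The resulting bound B i is uniform in the point and depends on i only through
    the differences of radii and heights.\<close>
  define C where "C = prod_list (map (\<lambda>v. 2 * pi * \<bar>fst v\<bar>) vs)"
  define B where "B i = C * \<bar>sqrt (1 - (z i)\<^sup>2) - sqrt (1 - z0\<^sup>2)\<bar> + \<bar>z i - z0\<bar>" for i
  have s: "smooth_on_open UNIV (\<lambda>x::real \<times> real. circ (sqrt (1 - w\<^sup>2)) w 0 (snd x))"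
    by (intro smooth_on_open_circ smooth_intros open_UNIV)
  have b: "dist (iterated_derivative vs (latitude_torus (z i) w) x) (iterated_derivative vs (latitude_torus z0 w) x) \<le> B i" for i x
    using iterated_derivative_circ_diff[OF vs s] unfolding latitude_torus_def[abs_def] dist_norm B_def C_def by blast
  have "B \<longlonglongrightarrow> C * \<bar>sqrt (1 - z0\<^sup>2) - sqrt (1 - z0\<^sup>2)\<bar> + \<bar>z0 - z0\<bar>"
    unfolding B_def by (intro tendsto_intros z(2))
  then have B0: "B \<longlonglongrightarrow> 0" by simp
  show "uniform_limit UNIV (\<lambda>i. iterated_derivative vs (latitude_torus (z i) w)) (iterated_derivative vs (latitude_torus z0 w)) sequentially"
  proof (rule uniform_limitI)
    fix e :: real assume "e > 0"
    then have "\<forall>\<^sub>F i in sequentially. B i < e" using B0 by (rule order_tendstoD(2)[rotated])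
    then show "\<forall>\<^sub>F i in sequentially. \<forall>x\<in>UNIV. dist (iterated_derivative vs (latitude_torus (z i) w) x) (iterated_derivative vs (latitude_torus z0 w) x) < e"
      by eventually_elim (use b le_less_trans in blast)
  qed
qed

theorem corollary1p11:
  fixes \<omega> :: "(real^3) two_form" and \<alpha> :: real
  assumes "area_form \<omega>" and "total_area \<omega> = 1" and "northern_area \<omega> = 1 / 2"
    and "\<alpha> > 0"
  shows "\<exists>(Ls :: nat \<Rightarrow> point set) L.
           (\<forall>i. is_split_torus \<omega> \<alpha> (Ls i)) \<and>
           (\<forall>i j. ham_equivalent (symplectic_form \<omega> \<alpha>) (Ls i) (Ls j)) \<and>
           is_split_torus \<omega> \<alpha> L \<and>
           tori_converge_smoothly Ls L \<and>
           (\<forall>i. \<not> ham_equivalent (symplectic_form \<omega> \<alpha>) L (Ls i))"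
proof -
  have \<alpha>: "\<alpha> > 0" by (rule assms(4))
  obtain y where y: "y \<in> {0<..<\<alpha>}" "y \<notin> \<rat>"
    using real_interval_avoid_countable_set[OF \<alpha> countable_rat] by blast
  then have y: "0 < y" "y < \<alpha>" "y \<notin> \<rat>" by simp_all
  \<comment> \<open>All heights for which the area invariant could allow an equivalence with a torus
    of the family. As the image of the triples of integers the set is countable, so the interval
    around 1 contains an x outside it.\<close>
  define B where "B = (\<lambda>(a::int, b::int, c::int). of_int a + of_int b * \<alpha> + of_int c * y :: real) ` UNIV"
  have "countable B" unfolding B_def by simp
  moreover have "1 - y < 1 + y" using y by simp
  ultimately obtain x where "x \<in> {1 - y<..<1 + y}" and xB: "x \<notin> B"
    using real_interval_avoid_countable_set by blast
  then have x: "\<bar>x - 1\<bar> < y" by auto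
  obtain X where X: "\<And>i::nat. \<bar>X i - 1\<bar> < y" "X \<longlonglongrightarrow> x"
    "\<And>i. \<exists>a b::int. X i = of_int a + of_int b * y" "\<And>i j. split_equiv \<alpha> y (X i) (X j)"
    by (rule equivalent_tori_sequence[OF \<alpha> y(1,2,3) x], rule that)
  define \<tau> :: "(real^3) two_form" where "\<tau> = (\<lambda>p u v. 1 / (4 * pi) * (p \<bullet> (u \<otimes> v)))"
  obtain \<Psi> \<Psi>' k where conj: "sphere_conjugation \<Psi> \<Psi>' \<omega> \<tau>"
    and height: "\<And>p. p \<in> S2 \<Longrightarrow> \<Psi> p $ 3 = 2 * zone_area \<omega> 0 (arcsin (p $ 3))"
    and k: "continuous_on {-1..1} k" "\<And>c. \<bar>c\<bar> < 1 \<Longrightarrow> \<bar>k c\<bar> < 1"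
      "\<And>z c. \<bar>z\<bar> \<le> 1 \<Longrightarrow> \<bar>c\<bar> < 1 \<Longrightarrow> 2 * zone_area \<omega> 0 (arcsin z) = c \<longleftrightarrow> z = k c"
    by (rule area_normal_form[OF assms(1-3), folded \<tau>_def], rule that)
  interpret conj: sphere_conjugation \<Psi> \<Psi>' \<omega> \<tau> by (rule conj)
  interpret swap: sphere_conjugation \<Psi>' \<Psi> \<tau> \<omega> by (rule conj.swap)
  have form: "sum_form (scale_form (2 * (\<alpha> + 1)) \<tau>) (scale_form (2 * \<alpha>) \<tau>) = split_form \<alpha>"
    by (simp add: split_form_def round_form_def sum_form_def scale_form_def \<tau>_def fun_eq_iff field_simps)
  \<comment> \<open>A circle of constant height is a parallel in the given coordinates, at the
    height found by k, and also the image under \<open>\<Psi>'\<close> of the parallel at height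
    \<open>u / a\<close> of the round sphere.\<close>
  have circle: "height_circle (scale_form (2 * a) \<omega>) u = {p \<in> S2. p $ 3 = k (u / a)}"
    "height_circle (scale_form (2 * a) \<omega>) u = \<Psi>' ` {q \<in> S2. q $ 3 = u / a}" if a: "a > 0" "\<bar>u\<bar> < a" for a u
  proof -
    have c: "\<bar>u / a\<bar> < 1" using a by simp
    have z: "zone_area (scale_form (2 * a) \<omega>) 0 t = u \<longleftrightarrow> 2 * zone_area \<omega> 0 t = u / a" for t
      unfolding zone_area_scale_form using a by (simp add: eq_divide_eq mult.commute mult.left_commute)
    show "height_circle (scale_form (2 * a) \<omega>) u = {p \<in> S2. p $ 3 = k (u / a)}"
      unfolding height_circle_def z
    proof (rule Collect_cong, rule conj_cong[OF refl])
      fix p :: "real^3" assume "p \<in> S2"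
      then have "\<bar>p $ 3\<bar> \<le> 1" using component_le_norm_cart[of p 3] by simp
      then show "2 * zone_area \<omega> 0 (arcsin (p $ 3)) = u / a \<longleftrightarrow> p $ 3 = k (u / a)" by (rule k(3)[OF _ c])
    qed
    show "height_circle (scale_form (2 * a) \<omega>) u = \<Psi>' ` {q \<in> S2. q $ 3 = u / a}"
      unfolding height_circle_def z
    proof (intro equalityI subsetI)
      fix p assume "p \<in> {p \<in> S2. 2 * zone_area \<omega> 0 (arcsin (p $ 3)) = u / a}"
      then have p: "p \<in> S2" "\<Psi> p $ 3 = u / a" using height by auto
      have "p = \<Psi>' (\<Psi> p)" by (rule conj.inverse(1)[OF conj.S2_nonzero[OF p(1)], symmetric])
      then show "p \<in> \<Psi>' ` {q \<in> S2. q $ 3 = u / a}" using p(2) conj.S2_maps(1)[OF p(1)] by blast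
    next
      fix p assume "p \<in> \<Psi>' ` {q \<in> S2. q $ 3 = u / a}"
      then obtain q where q: "q \<in> S2" "q $ 3 = u / a" "p = \<Psi>' q" by blast
      have "\<Psi> p = q" unfolding q(3) by (rule conj.inverse(2)[OF conj.S2_nonzero[OF q(1)]])
      moreover have "p \<in> S2" unfolding q(3) by (rule conj.S2_maps(2)[OF q(1)])
      ultimately show "p \<in> {p \<in> S2. 2 * zone_area \<omega> 0 (arcsin (p $ 3)) = u / a}" using height[of p] q(2) by simp
    qed
  qed
  have \<alpha>1: "\<alpha> + 1 > 0" using \<alpha> by simp
  have y1: "\<bar>y\<bar> < \<alpha>" using y by simp
  \<comment> \<open>The first description yields explicit parametrizations and thus smooth
    convergence, regardless of how \<open>\<Psi>'\<close> moves points along the circles; the second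
    transfers Hamiltonian equivalence to and from the round form.\<close>
  have split: "split_torus \<omega> \<alpha> u y = round_torus (k (u / (1 + \<alpha>))) (k (y / \<alpha>))"
    "split_torus \<omega> \<alpha> u y = conj.GG' ` round_split \<alpha> u y" if u: "\<bar>u\<bar> < \<alpha> + 1" for u
  proof -
    show "split_torus \<omega> \<alpha> u y = round_torus (k (u / (1 + \<alpha>))) (k (y / \<alpha>))"
      unfolding split_torus_def circle(1)[OF \<alpha>1 u] circle(1)[OF \<alpha> y1] round_torus_def
      unfolding add.commute[of \<alpha> 1] ..
    show "split_torus \<omega> \<alpha> u y = conj.GG' ` round_split \<alpha> u y"
      unfolding split_torus_def circle(2)[OF \<alpha>1 u] circle(2)[OF \<alpha> y1] round_split_def round_torus_def
      unfolding add.commute[of \<alpha> 1]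
      by (rule map_prod_image[symmetric])
  qed
  have X1: "\<bar>X i\<bar> < \<alpha> + 1" for i using X(1)[of i] y by auto
  have x1: "\<bar>x\<bar> < \<alpha> + 1" using x y by auto
  have ratio: "\<bar>u / (1 + \<alpha>)\<bar> < 1" if "\<bar>u\<bar> < \<alpha> + 1" for u
    using that \<alpha> by (simp add: add.commute)
  have yr: "\<bar>y / \<alpha>\<bar> < 1" using y by simp
  have sub: "round_split \<alpha> u y \<subseteq> S2xS2" for u
    unfolding round_split_def by (rule round_torus_subset)
  have is_split: "is_split_torus \<omega> \<alpha> (split_torus \<omega> \<alpha> u y)" if "\<bar>u\<bar> < \<alpha> + 1" for u
    unfolding is_split_torus_def using that y by (intro bexI[of _ u] bexI[of _ y]) auto
  have equiv: "ham_equivalent (symplectic_form \<omega> \<alpha>) (split_torus \<omega> \<alpha> (X i) y) (split_torus \<omega> \<alpha> (X j) y)" for i j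
    unfolding symplectic_form_def split(2)[OF X1]
    by (rule conj.ham_equivalent_conjugate[OF X(4)[of i j, unfolded split_equiv_def, folded form] sub])
  have conv: "tori_converge_smoothly (\<lambda>i. split_torus \<omega> \<alpha> (X i) y) (split_torus \<omega> \<alpha> x y)"
    unfolding split(1)[OF X1] split(1)[OF x1]
  proof (rule tori_converge_latitude)
    have "(\<lambda>i. X i / (1 + \<alpha>)) \<longlonglongrightarrow> x / (1 + \<alpha>)"
      by (intro tendsto_divide X(2) tendsto_const) (use \<alpha> in simp)
    then show "(\<lambda>i. k (X i / (1 + \<alpha>))) \<longlonglongrightarrow> k (x / (1 + \<alpha>))"
    proof (rule continuous_on_tendsto_compose[OF k(1)])
      have I: "u / (1 + \<alpha>) \<in> {-1..1}" if "\<bar>u\<bar> < \<alpha> + 1" for u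
        using ratio[OF that] unfolding abs_less_iff by simp
      show "x / (1 + \<alpha>) \<in> {-1..1}" by (rule I[OF x1])
      show "\<forall>\<^sub>F i in sequentially. X i / (1 + \<alpha>) \<in> {-1..1}" by (intro always_eventually allI I X1)
    qed
  qed (intro k(2) ratio X1 x1 yr)+
  have "\<not> ham_equivalent (symplectic_form \<omega> \<alpha>) (split_torus \<omega> \<alpha> x y) (split_torus \<omega> \<alpha> (X i) y)" for i
  proof
    assume e: "ham_equivalent (symplectic_form \<omega> \<alpha>) (split_torus \<omega> \<alpha> x y) (split_torus \<omega> \<alpha> (X i) y)"
    have GG: "conj.GG ` conj.GG' ` round_split \<alpha> u y = round_split \<alpha> u y" for u
    proof -
      have "conj.GG (conj.GG' q) = q" if "q \<in> round_split \<alpha> u y" for q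
      proof -
        have "fst q \<in> S2" "snd q \<in> S2" using sub[of u] that by auto
        then show ?thesis using conj.inverse(2)[OF conj.S2_nonzero] by (cases q) simp
      qed
      then show ?thesis unfolding image_image by simp
    qed
    have "conj.GG' ` round_split \<alpha> x y \<subseteq> S2xS2"
    proof (rule image_subsetI)
      fix q assume "q \<in> round_split \<alpha> x y"
      then have "fst q \<in> S2" "snd q \<in> S2" using sub[of x] by auto
      then show "conj.GG' q \<in> S2xS2" using conj.S2_maps(2) by (cases q) simp
    qed
    from swap.ham_equivalent_conjugate[OF e[unfolded symplectic_form_def split(2)[OF x1] split(2)[OF X1]] this]
    have "ham_equivalent (split_form \<alpha>) (round_split \<alpha> x y) (round_split \<alpha> (X i) y)"
      unfolding GG form .
    then have eq: "ham_equivalent (round_form ((1 + \<alpha>) / (2 * pi)) (\<alpha> / (2 * pi)))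
        (round_torus (x / (1 + \<alpha>)) (y / \<alpha>)) (round_torus (X i / (1 + \<alpha>)) (y / \<alpha>))"
      unfolding split_form_def round_split_def .
    have c: "(1 + \<alpha>) / (2 * pi) > 0" "\<alpha> / (2 * pi) > 0" using \<alpha> by simp_all
    obtain m n p q :: int where rel:
      "(1 + \<alpha>) / (2 * pi) * (1 - x / (1 + \<alpha>)) =
        of_int m * ((1 + \<alpha>) / (2 * pi) * (1 - X i / (1 + \<alpha>))) + of_int n * (2 * ((1 + \<alpha>) / (2 * pi)))
        + of_int p * (\<alpha> / (2 * pi) * (1 - y / \<alpha>)) + of_int q * (2 * (\<alpha> / (2 * pi)))"
      using ham_equivalent_round_torus_areas[OF c ratio[OF x1] yr ratio[OF X1] yr eq] by (elim exE) (rule that)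
    have scale: "2 * pi * (b / (2 * pi) * (1 - u / b)) = b - u" "2 * pi * (2 * (b / (2 * pi))) = 2 * b" if "b > 0" for b u :: real
      using that by (simp_all add: field_simps)
    have lin: "2 * pi * c = i1 * (2 * pi * c1) + i2 * (2 * pi * c2) + i3 * (2 * pi * c3) + i4 * (2 * pi * c4)"
      if "c = i1 * c1 + i2 * c2 + i3 * c3 + i4 * c4" for c i1 c1 i2 c2 i3 c3 i4 c4 :: real
      unfolding that by (simp add: algebra_simps)
    have "1 + \<alpha> > 0" using \<alpha> by simp
    from lin[OF rel, unfolded scale[OF \<alpha>] scale[OF this]]
    have "1 + \<alpha> - x = of_int m * (1 + \<alpha> - X i) + of_int n * (2 * (1 + \<alpha>)) + of_int p * (\<alpha> - y) + of_int q * (2 * \<alpha>)" .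
    moreover obtain a b :: int where "X i = of_int a + of_int b * y" using X(3) by blast
    \<comment> \<open>The height x enters the area relation with coefficient -1, so solving for it
      requires no division and the coefficients remain integers; this places x in B.\<close>
    ultimately have "x = of_int (1 - m + m * a - 2 * n) + of_int (1 - m - 2 * n - p - 2 * q) * \<alpha> + of_int (m * b + p) * y"
      by (simp add: algebra_simps)
    then have "x \<in> B" unfolding B_def by (intro image_eqI[where x = "(1 - m + m * a - 2 * n, 1 - m - 2 * n - p - 2 * q, m * b + p)"]) simp_all
    then show False using xB by contradiction
  qed
  then show ?thesis
    by (intro exI[of _ "\<lambda>i. split_torus \<omega> \<alpha> (X i) y"] exI[of _ "split_torus \<omega> \<alpha> x y"] conjI allI
        is_split equiv conv X1 x1)
qed

end
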